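(* Let $d \ge 2$, let $U \subset \mathbb{R}^d$ be a bounded, open, simply connected domain, and let $\Gamma$ be a log-correlated Gaussian field on $U$ with covariance kernel of the form $$C(x,y) = \log\frac{1}{|x-y|} + g(x,y), \qquad x,y \in U,$$ where $g \in C^2(U\times U)\cap L^1(U \times U)$ is bounded from above. Let $\beta \in (0,\sqrt d)$ and let $\mu = \mu_\beta$ be the imaginary chaos associated with $\Gamma$. Then $\nabla \Gamma$ (understood as a vector of random distributions) is locally recoverable from $\mu_\beta$, i.e.: for every $f \in C_c^\infty(U)$, every $k \in \{1,\dots,d\}$ and every open set $V\subset U$ with $\operatorname{supp} f \subset V$, the random variable $\langle \frac{\partial}{\partial x_k}\Gamma, f\rangle$ is measurable with respect to the restriction of the random distribution $\mu_\beta$ to $V$.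
   Context: Test functions $f\in C_c^\infty(U)$ are real-valued. A log-correlated Gaussian field $\Gamma$ on $U$ with covariance kernel $C$ is a centered Gaussian random distribution with $\mathbb{E}\langle \Gamma, f\rangle\langle \Gamma, h\rangle = \int f(x)h(y)C(x,y)\,dx\,dy$, where $C$ is extended by $0$ outside $U\times U$. It exists as a random element of $H^{-\varepsilon}(\mathbb{R}^d)$ for every $\varepsilon>0$. Its distributional derivatives are given by $\langle \frac{\partial}{\partial x_k}\Gamma, f\rangle = -\langle \Gamma, \frac{\partial f}{\partial x_k}\rangle$. Let $\varphi$ be a smooth non-negative mollifier ($\int\varphi=1$) supported in the annulus $B(0,1)\setminus B(0,1/2)\subset\mathbb{R}^d$, and let $\varphi_\delta(x)=\delta^{-d}\varphi(x/\delta)$. For $\beta\in(0,\sqrt d)$ the imaginary chaos $\mu=\mu_\beta$ is the random complex-valued distribution $$\mu(x)=\lim_{\delta\to0} e^{i\beta(\Gamma*\varphi_\delta)(x)+\frac{\beta^2}{2}\mathbb{E}(\Gamma*\varphi_\delta)(x)^2},$$ where the approximating functions of $x \in U$ are understood as zero outside $U$, and the convergence takes place (in probability) in $H^s(\mathbb{R}^d)$ for $s<-d/2$; the existence of this limit is known. The restriction of $\mu$ to an open set $V\subset U$ is the collection of random variables $\langle \mu,h\rangle$, $h\in C_c^\infty(V)$. Measurability with respect to it means measurability with respect to the $\sigma$-algebra these variables generate, completed by the null sets of the underlying probability space. *)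

theory Defs
  imports "HOL-Probability.Probability"
begin

text \<open>Iterated partial derivatives; the directions of differentiation are listed from the
  last one taken to the first one.\<close>

primrec partials :: "'a::euclidean_space list \<Rightarrow> ('a \<Rightarrow> real) \<Rightarrow> 'a \<Rightarrow> real" where
  "partials [] f = f"
| "partials (b # bs) f = (\<lambda>x. frechet_derivative (partials bs f) (at x) b)"

text \<open>Meant for open \<open>S\<close>.\<close>

definition Ck_on :: "nat \<Rightarrow> 'a::euclidean_space set \<Rightarrow> ('a \<Rightarrow> real) \<Rightarrow> bool" where
  "Ck_on k S f \<longleftrightarrow> (\<forall>bs. set bs \<subseteq> Basis \<longrightarrow>
     (length bs < k \<longrightarrow> (\<forall>x\<in>S. partials bs f differentiable (at x))) \<and>
     (length bs \<le> k \<longrightarrow> continuous_on S (partials bs f)))"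

definition supp :: "('a::topological_space \<Rightarrow> 'b::zero) \<Rightarrow> 'a set" where
  "supp f = closure {x. f x \<noteq> 0}"

definition test_functions :: "'a::euclidean_space set \<Rightarrow> ('a \<Rightarrow> real) set" where
  "test_functions S = {f. (\<forall>k. Ck_on k UNIV f) \<and> compact (supp f) \<and> supp f \<subseteq> S}"

text \<open>A distribution on the whole space is represented by a function on all real-valued
  functions, of which only the values on test functions are meaningful.\<close>

definition distribution :: "(('a::euclidean_space \<Rightarrow> real) \<Rightarrow> 'b::real_normed_vector) \<Rightarrow> bool" where
  "distribution u \<longleftrightarrow>
     (\<forall>f\<in>test_functions UNIV. \<forall>h\<in>test_functions UNIV. \<forall>a b.
        u (\<lambda>x. a * f x + b * h x) = a *\<^sub>R u f + b *\<^sub>R u h) \<and>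
     (\<forall>K. compact K \<longrightarrow> (\<exists>N A. \<forall>f\<in>test_functions K. \<forall>B.
        (\<forall>bs x. set bs \<subseteq> Basis \<and> length bs \<le> N \<longrightarrow> \<bar>partials bs f x\<bar> \<le> B) \<longrightarrow>
        norm (u f) \<le> A * B))"

definition distr_deriv ::
    "'a::euclidean_space \<Rightarrow> (('a \<Rightarrow> real) \<Rightarrow> real) \<Rightarrow> ('a \<Rightarrow> real) \<Rightarrow> real" where
  "distr_deriv b u f = - u (\<lambda>x. frechet_derivative f (at x) b)"

definition inverse_fourier :: "('a::euclidean_space \<Rightarrow> real) \<Rightarrow> 'a \<Rightarrow> complex" where
  "inverse_fourier f \<xi> = (LINT x|lborel. cis (2 * pi * (x \<bullet> \<xi>)) * complex_of_real (f x))"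

text \<open>\<open>v\<close> is the Fourier transform of \<open>u\<close> and lies in the weighted \<open>L\<^sup>2\<close> space. The Fourier
  transform of a tempered distribution pairs with \<open>\<psi>\<close> as \<open>u\<close> pairs with the Fourier transform of
  \<open>\<psi>\<close>; here this is written with \<open>\<psi> = inverse_fourier f\<close>. Since test functions are dense in the
  Schwartz space it is enough to let \<open>f\<close> range over them. Such a \<open>v\<close> is unique up to null sets.\<close>

definition sobolev_fourier ::
    "real \<Rightarrow> (('a::euclidean_space \<Rightarrow> real) \<Rightarrow> complex) \<Rightarrow> ('a \<Rightarrow> complex) \<Rightarrow> bool" where
  "sobolev_fourier s u v \<longleftrightarrow>
     v \<in> borel_measurable lborel \<and>
     integrable lborel (\<lambda>\<xi>. (1 + (norm \<xi>)\<^sup>2) powr s * (norm (v \<xi>))\<^sup>2) \<and>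
     (\<forall>f\<in>test_functions UNIV. u f = (LINT \<xi>|lborel. v \<xi> * inverse_fourier f \<xi>))"

definition sobolev :: "real \<Rightarrow> (('a::euclidean_space \<Rightarrow> real) \<Rightarrow> complex) set" where
  "sobolev s = {u. distribution u \<and> (\<exists>v. sobolev_fourier s u v)}"

definition sobolev_norm :: "real \<Rightarrow> (('a::euclidean_space \<Rightarrow> real) \<Rightarrow> complex) \<Rightarrow> real" where
  "sobolev_norm s u =
     (let v = (SOME v. sobolev_fourier s u v)
      in sqrt (LINT \<xi>|lborel. (1 + (norm \<xi>)\<^sup>2) powr s * (norm (v \<xi>))\<^sup>2))"

text \<open>Test functions are dense in the dual of the separable Hilbert space \<open>sobolev s\<close>, so
  measurability of the pairings is Borel measurability.\<close>

definition random_sobolev ::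
    "'w measure \<Rightarrow> real \<Rightarrow> ('w \<Rightarrow> ('a::euclidean_space \<Rightarrow> real) \<Rightarrow> complex) \<Rightarrow> bool" where
  "random_sobolev M s X \<longleftrightarrow>
     (\<forall>w\<in>space M. X w \<in> sobolev s) \<and>
     (\<forall>f\<in>test_functions UNIV. (\<lambda>w. X w f) \<in> borel_measurable M)"

definition restriction_algebra ::
    "'w measure \<Rightarrow> 'a::euclidean_space set \<Rightarrow> ('w \<Rightarrow> ('a \<Rightarrow> real) \<Rightarrow> complex) \<Rightarrow> 'w measure" where
  "restriction_algebra M V X = sigma (space M)
     ({(\<lambda>w. X w h) -` B \<inter> space M | h B. h \<in> test_functions V \<and> B \<in> sets borel} \<union> null_sets M)"

definition tendsto_0_in_probability ::
    "'w measure \<Rightarrow> ('i \<Rightarrow> 'w \<Rightarrow> real) \<Rightarrow> 'i filter \<Rightarrow> bool" where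
  "tendsto_0_in_probability M Z F \<longleftrightarrow>
     (\<forall>\<^sub>F i in F. Z i \<in> borel_measurable M) \<and>
     (\<forall>\<epsilon>>0. ((\<lambda>i. measure M {w \<in> space M. \<bar>Z i w\<bar> > \<epsilon>}) \<longlongrightarrow> 0) F)"

definition centered_gaussian :: "'w measure \<Rightarrow> ('w \<Rightarrow> real) \<Rightarrow> bool" where
  "centered_gaussian M X \<longleftrightarrow> X \<in> borel_measurable M \<and>
     ((AE w in M. X w = 0) \<or> (\<exists>\<sigma>>0. distributed M lborel X (normal_density 0 \<sigma>)))"

text \<open>The kernel \<open>C\<close> on \<open>U \<times> U\<close> is extended by zero, and the field is tested against test functions
  on the whole space. The pairings are jointly Gaussian because each of them is Gaussian and
  realisations are linear.\<close>

definition gaussian_field ::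
    "'w measure \<Rightarrow> 'a::euclidean_space set \<Rightarrow> ('a \<Rightarrow> 'a \<Rightarrow> real) \<Rightarrow>
     ('w \<Rightarrow> ('a \<Rightarrow> real) \<Rightarrow> real) \<Rightarrow> bool" where
  "gaussian_field M U C \<Gamma> \<longleftrightarrow>
     (\<forall>\<epsilon>>0. random_sobolev M (- \<epsilon>) (\<lambda>w f. complex_of_real (\<Gamma> w f))) \<and>
     (\<forall>f\<in>test_functions UNIV. centered_gaussian M (\<lambda>w. \<Gamma> w f)) \<and>
     (\<forall>f\<in>test_functions UNIV. \<forall>h\<in>test_functions UNIV.
        (LINT w|M. \<Gamma> w f * \<Gamma> w h) =
        (LINT z|lborel. f (fst z) * h (snd z) *
           (if fst z \<in> U \<and> snd z \<in> U then C (fst z) (snd z) else 0)))"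

definition annular_mollifier :: "('a::euclidean_space \<Rightarrow> real) \<Rightarrow> bool" where
  "annular_mollifier \<phi> \<longleftrightarrow>
     \<phi> \<in> test_functions (ball 0 1 - ball 0 (1/2)) \<and> (\<forall>x. 0 \<le> \<phi> x) \<and> (LINT x|lborel. \<phi> x) = 1"

definition rescale :: "('a::euclidean_space \<Rightarrow> real) \<Rightarrow> real \<Rightarrow> 'a \<Rightarrow> real" where
  "rescale \<phi> \<delta> x = \<phi> (x /\<^sub>R \<delta>) / \<delta> ^ DIM('a)"

definition convolve ::
    "(('a::euclidean_space \<Rightarrow> real) \<Rightarrow> real) \<Rightarrow> ('a \<Rightarrow> real) \<Rightarrow> 'a \<Rightarrow> real" where
  "convolve u \<psi> x = u (\<lambda>y. \<psi> (x - y))"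

definition chaos_approx ::
    "'w measure \<Rightarrow> 'a::euclidean_space set \<Rightarrow> ('a \<Rightarrow> real) \<Rightarrow> real \<Rightarrow>
     ('w \<Rightarrow> ('a \<Rightarrow> real) \<Rightarrow> real) \<Rightarrow> real \<Rightarrow> 'w \<Rightarrow> 'a \<Rightarrow> complex" where
  "chaos_approx M U \<phi> \<beta> \<Gamma> \<delta> w x =
     (if x \<in> U then
        exp (\<i> * complex_of_real (\<beta> * convolve (\<Gamma> w) (rescale \<phi> \<delta>) x) +
             complex_of_real (\<beta>\<^sup>2 / 2 * (LINT w'|M. (convolve (\<Gamma> w') (rescale \<phi> \<delta>) x)\<^sup>2)))
      else 0)"

definition imaginary_chaos ::
    "'w measure \<Rightarrow> 'a::euclidean_space set \<Rightarrow> ('a \<Rightarrow> real) \<Rightarrow> real \<Rightarrow>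
     ('w \<Rightarrow> ('a \<Rightarrow> real) \<Rightarrow> real) \<Rightarrow> ('w \<Rightarrow> ('a \<Rightarrow> real) \<Rightarrow> complex) \<Rightarrow> bool" where
  "imaginary_chaos M U \<phi> \<beta> \<Gamma> \<mu> \<longleftrightarrow>
     (\<forall>s < - real DIM('a) / 2.
        random_sobolev M s \<mu> \<and>
        tendsto_0_in_probability M
          (\<lambda>\<delta> w. sobolev_norm s
             (\<lambda>f. (LINT x|lborel. chaos_approx M U \<phi> \<beta> \<Gamma> \<delta> w x * complex_of_real (f x)) - \<mu> w f))
          (at_right 0))"

end

theory Submission imports Defs begin

text \<open>
  The idea is to recover the derivative from products of the chaos with its conjugate at two nearby
  points. Put \<open>b = \<beta>\<^sup>2\<close>. For a kernel \<open>K\<close> supported off the diagonal, the functional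
  \<open>\<integral>\<integral> K(x,y) \<mu>(x) cnj (\<mu>(y)) dx dy\<close> is measurable with respect to the restriction of \<open>\<mu>\<close> as soon as
  \<open>K\<close> is a finite sum of products of test functions, and Gaussian calculus (with Fatou's lemma along
  the mollification) bounds the mean square distance between its centering and \<open>\<i> \<beta> \<Gamma>(\<rho>)\<close> by an
  explicit quadratic expression \<open>Q K \<rho>\<close>. With \<open>k(x,y) = K(x,y) exp (b C(x,y))\<close> one has
  \<open>Q K \<rho> = \<integral>\<integral> k(z) k(z') expr2 (b D(z,z')) dz dz' + b E(\<Gamma>(p - \<rho>)\<^sup>2)\<close>, where \<open>expr2 u = exp u - 1 - u\<close>,
  \<open>D\<close> is the mixed second difference of \<open>C\<close> and \<open>p\<close> is the difference of the marginals of \<open>k\<close>.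
  Taking \<open>k(x,y) = r powr (-1-d) f(x) \<psi>((x-y)/r)\<close> with \<open>\<psi>\<close> of mass one and mean a basis vector \<open>e\<close> makes
  \<open>p\<close> converge to minus the derivative of \<open>f\<close> along \<open>e\<close>. The first term stays bounded for a single
  scale \<open>r\<close>, and for two scales \<open>r \<le> s\<close> it is at most a multiple of \<open>sqrt (r/s)\<close>; averaging over
  many well separated scales therefore sends it to zero as well.
\<close>

lemmas LINT_cong = Bochner_Integration.integral_cong[OF refl]
lemmas LINT_bound = Bochner_Integration.integrable_bound

section \<open>Test functions\<close>

definition smooth :: "('a::euclidean_space => real) => bool" where
 "smooth f \<longleftrightarrow> (\<forall>bs x. set bs \<subseteq> Basis \<longrightarrow> partials bs f differentiable (at x))"

lemma smoothD: "smooth f ==> set bs \<subseteq> Basis ==> partials bs f differentiable (at x)"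
 by (auto simp: smooth_def)

lemma continuous_on_partials:
 "smooth f ==> set bs \<subseteq> Basis ==> continuous_on A (partials bs f)"
 by (meson smoothD continuous_at_imp_continuous_on differentiable_imp_continuous_within)

lemma smooth_iff_Ck_on: "smooth f \<longleftrightarrow> (\<forall>k. Ck_on k UNIV f)"
proof
 assume "smooth f" then show "\<forall>k. Ck_on k UNIV f"
  by (auto simp: Ck_on_def smoothD continuous_on_partials)
next
 assume *: "\<forall>k. Ck_on k UNIV f"
 show "smooth f" unfolding smooth_def
 proof (intro allI impI)
  fix bs :: "'a list" and x assume "set bs \<subseteq> Basis"
  then show "partials bs f differentiable (at x)"
   using *[rule_format, of "Suc (length bs)"] by (auto simp: Ck_on_def)
 qed
qed

lemma test_functions_iff:
 "f \<in> test_functions S \<longleftrightarrow> smooth f \<and> compact (supp f) \<and> supp f \<subseteq> S"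
 by (auto simp: test_functions_def smooth_iff_Ck_on)

lemma partials_append: "partials bs (partials cs f) = partials (bs @ cs) f"
 by (induction bs) auto

lemma smooth_partials: "smooth f ==> set bs \<subseteq> Basis ==> smooth (partials bs f)"
 by (auto simp: smooth_def partials_append)

lemma partials_lincomb:
 assumes "smooth f" "smooth h" "set bs \<subseteq> Basis"
 shows "partials bs (\<lambda>x. a * f x + c * h x) = (\<lambda>x. a * partials bs f x + c * partials bs h x)"
 using assms(3)
proof (induction bs)
 case (Cons b bs)
 have "frechet_derivative (\<lambda>x. a * partials bs f x + c * partials bs h x) (at x) b =
  a * frechet_derivative (partials bs f) (at x) b + c * frechet_derivative (partials bs h) (at x) b" for x
 proof -
  have 1: "(partials bs f has_derivative frechet_derivative (partials bs f) (at x)) (at x)"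
   "(partials bs h has_derivative frechet_derivative (partials bs h) (at x)) (at x)"
   using Cons.prems assms(1,2) by (auto simp: frechet_derivative_works[symmetric] smoothD)
  have "((\<lambda>x. a * partials bs f x + c * partials bs h x) has_derivative
   (\<lambda>v. a * frechet_derivative (partials bs f) (at x) v + c * frechet_derivative (partials bs h) (at x) v)) (at x)"
   by (intro derivative_intros 1)
  from frechet_derivative_at[OF this] show ?thesis by metis
 qed
 with Cons show ?case by auto
qed auto

lemma smooth_lincomb:
 assumes "smooth f" "smooth h" shows "smooth (\<lambda>x. a * f x + c * h x)"
 unfolding smooth_def using assms
 by (auto simp: partials_lincomb intro!: derivative_intros smoothD)

lemma partials_affine:
 fixes f :: "'a::euclidean_space => real"
 assumes "smooth f" "set bs \<subseteq> Basis"
 shows "partials bs (\<lambda>y. f (p + s *\<^sub>R y)) = (\<lambda>y. s ^ length bs * partials bs f (p + s *\<^sub>R y))"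
 using assms(2)
proof (induction bs)
 case (Cons b bs)
 have "frechet_derivative (\<lambda>y. s ^ length bs * partials bs f (p + s *\<^sub>R y)) (at x) b =
  s ^ Suc (length bs) * frechet_derivative (partials bs f) (at (p + s *\<^sub>R x)) b" for x
 proof -
  let ?D = "frechet_derivative (partials bs f) (at (p + s *\<^sub>R x))"
  have 1: "(partials bs f has_derivative ?D) (at (p + s *\<^sub>R x))"
   using Cons.prems assms(1) by (auto simp: frechet_derivative_works[symmetric] smoothD)
  have 2: "((\<lambda>y. p + s *\<^sub>R y) has_derivative (\<lambda>v. s *\<^sub>R v)) (at x)"
   by (auto intro!: derivative_eq_intros)
  have "((\<lambda>y. partials bs f (p + s *\<^sub>R y)) has_derivative (\<lambda>v. ?D (s *\<^sub>R v))) (at x)"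
   using has_derivative_compose[OF 2 1] .
  then have "((\<lambda>y. s ^ length bs * partials bs f (p + s *\<^sub>R y)) has_derivative (\<lambda>v. s ^ length bs * ?D (s *\<^sub>R v))) (at x)"
   by (intro derivative_intros)
  from frechet_derivative_at[OF this] have "frechet_derivative (\<lambda>y. s ^ length bs * partials bs f (p + s *\<^sub>R y)) (at x) b = s ^ length bs * ?D (s *\<^sub>R b)"
   by metis
  also have "?D (s *\<^sub>R b) = s *\<^sub>R ?D b"
   using 1 by (simp add: has_derivative_def linear_simps)
  finally show ?thesis by simp
 qed
 with Cons show ?case by auto
qed auto

lemma smooth_affine:
 fixes f :: "'a::euclidean_space => real"
 assumes "smooth f" shows "smooth (\<lambda>y. f (p + s *\<^sub>R y))"
 unfolding smooth_def
proof (intro allI impI)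
 fix bs :: "'a list" and x assume bs: "set bs \<subseteq> Basis"
 have "(\<lambda>y. p + s *\<^sub>R y) differentiable (at x)"
  by (intro derivative_intros)
 then have "(\<lambda>y. partials bs f (p + s *\<^sub>R y)) differentiable (at x)"
  using differentiable_chain_at[of "\<lambda>y. p + s *\<^sub>R y" x "partials bs f"] smoothD[OF assms bs]
  by (simp add: o_def)
 then show "partials bs (\<lambda>y. f (p + s *\<^sub>R y)) differentiable (at x)"
  unfolding partials_affine[OF assms bs] by (intro derivative_intros)
qed

lemma supp_superset: "x \<notin> supp f ==> f x = 0"
 using closure_subset[of "{x. f x \<noteq> 0}"] by (auto simp: supp_def)

lemma supp_subsetI:
 assumes "closed S" "\<And>x. x \<notin> S ==> f x = 0" shows "supp f \<subseteq> S"
 unfolding supp_def by (rule closure_minimal) (use assms in auto)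

lemma closed_supp: "closed (supp f)" by (simp add: supp_def)

lemma partials_eq_0_outside:
 fixes f :: "'a::euclidean_space => real"
 assumes "closed S" "\<And>x. x \<notin> S ==> f x = 0" "x \<notin> S"
 shows "partials bs f x = 0"
 using assms(3)
proof (induction bs arbitrary: x)
 case (Cons b bs)
 have "((\<lambda>_. 0) has_derivative (\<lambda>_. 0)) (at x)" by simp
 then have "(partials bs f has_derivative (\<lambda>_. 0)) (at x)"
  by (rule has_derivative_transform_within_open[where s = "- S"])
   (use Cons assms(1) in \<open>auto simp: open_Compl\<close>)
 from frechet_derivative_at[OF this] show ?case by (simp add: fun_eq_iff)
qed (use assms in auto)

lemma compact_supp_subset:
 "compact S ==> (\<And>x. x \<notin> S ==> f x = 0) ==> compact (supp f) \<and> supp f \<subseteq> S"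
 for f :: "'a::t2_space => 'b::zero"
 by (metis closed_supp compact_Int_closed compact_imp_closed inf.absorb_iff2 supp_subsetI)

lemma test_functionsI:
 assumes "smooth f" "compact S" "\<And>x. x \<notin> S ==> f x = 0" "S \<subseteq> V"
 shows "f \<in> test_functions V"
proof -
 have "compact (supp f) \<and> supp f \<subseteq> S" by (rule compact_supp_subset) (use assms in auto)
 then show ?thesis using assms by (auto simp: test_functions_iff)
qed

lemma test_functions_smooth: "f \<in> test_functions V ==> smooth f"
 by (simp add: test_functions_iff)

lemma test_functions_mono: "V \<subseteq> W ==> f \<in> test_functions V ==> f \<in> test_functions W"
 by (auto simp: test_functions_iff)

lemma test_functions_partials:
 "f \<in> test_functions V ==> set bs \<subseteq> Basis ==> partials bs f \<in> test_functions V"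
 by (rule test_functionsI[where S = "supp f"])
  (auto simp: test_functions_iff smooth_partials intro: partials_eq_0_outside[OF closed_supp supp_superset])

lemma test_functions_lincomb:
 fixes f :: "'a::euclidean_space => real"
 assumes "f \<in> test_functions V" "h \<in> test_functions V"
 shows "(\<lambda>x. a * f x + c * h x) \<in> test_functions V"
 using assms by (intro test_functionsI[where S = "supp f \<union> supp h"] smooth_lincomb)
  (auto simp: test_functions_iff supp_superset)

lemma test_functions_affine:
 fixes f :: "'a::euclidean_space => real"
 assumes f: "f \<in> test_functions UNIV" and "s \<noteq> 0"
 shows "(\<lambda>y. f (p + s *\<^sub>R y)) \<in> test_functions UNIV"
proof -
 let ?S = "(\<lambda>z. (1/s) *\<^sub>R (z - p)) ` supp f"
 have S: "compact ?S"
  using f by (intro compact_continuous_image continuous_intros) (auto simp: test_functions_iff)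
 have 0: "f (p + s *\<^sub>R y) = 0" if y: "y \<notin> ?S" for y
 proof (rule supp_superset[of _ f])
  show "p + s *\<^sub>R y \<notin> supp f"
  proof
   assume "p + s *\<^sub>R y \<in> supp f"
   then have "(1/s) *\<^sub>R ((p + s *\<^sub>R y) - p) \<in> ?S" by (rule imageI)
   then show False using y \<open>s \<noteq> 0\<close> by simp
  qed
 qed
 have "smooth (\<lambda>y. f (p + s *\<^sub>R y))" using f by (intro smooth_affine) (simp add: test_functions_iff)
 then show ?thesis by (rule test_functionsI[OF _ S 0]) simp_all
qed

lemma test_functions_cmult:
 fixes f :: "'a::euclidean_space => real"
 shows "f \<in> test_functions V ==> (\<lambda>x. a * f x) \<in> test_functions V"
 using test_functions_lincomb[of f V f a 0] by simp

lemma test_functions_continuous: "f \<in> test_functions V ==> continuous_on A f"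
 using continuous_on_partials[of f "[]" A] by (simp add: test_functions_iff)

lemma test_functions_borel [measurable_dest]: "f \<in> test_functions V ==> f \<in> borel_measurable borel"
 by (intro borel_measurable_continuous_onI test_functions_continuous)

lemma continuous_compact_support_bounded:
 fixes f :: "'a::topological_space => 'b::real_normed_vector"
 assumes "continuous_on UNIV f" "compact S" "\<And>x. x \<notin> S ==> f x = 0"
 obtains B where "B > 0" "\<And>x. norm (f x) \<le> B"
proof -
 have "compact (f ` S)" using assms by (meson compact_continuous_image continuous_on_subset subset_UNIV)
 then obtain B where B: "B > 0" "\<And>y. y \<in> f ` S ==> norm y \<le> B"
  using compact_imp_bounded bounded_pos by metis
 have "norm (f x) \<le> B" for x using B assms(3)[of x] by (cases "x \<in> S") auto
 with B(1) that show ?thesis by blast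
qed

lemma test_functions_bounded:
 assumes "f \<in> test_functions V"
 obtains B where "B > 0" "\<And>x. \<bar>f x\<bar> \<le> B"
 using continuous_compact_support_bounded[OF test_functions_continuous[OF assms], of "supp f"] assms
 by (metis real_norm_def supp_superset test_functions_iff)

lemma integrable_continuous_compact_support:
 fixes f :: "'a::euclidean_space => 'b::{banach, second_countable_topology}"
 assumes "continuous_on UNIV f" "compact S" "\<And>x. x \<notin> S ==> f x = 0"
 shows "integrable lborel f"
proof -
 have "integrable lborel (\<lambda>x. indicator S x *\<^sub>R f x)"
  using borel_integrable_compact[OF assms(2), of f] assms(1) by (meson continuous_on_subset subset_UNIV)
 moreover have "(\<lambda>x. indicator S x *\<^sub>R f x) = f" using assms(3) by (auto simp: indicator_def fun_eq_iff)
 ultimately show ?thesis by simp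
qed

lemma test_functions_integrable: "f \<in> test_functions V ==> integrable lborel f"
 by (rule integrable_continuous_compact_support[where S = "supp f"])
  (auto simp: test_functions_iff test_functions_continuous supp_superset)

lemma continuous_compact_support_uniform:
 fixes f :: "'a::euclidean_space => 'b::real_normed_vector"
 assumes c: "continuous_on UNIV f" and S: "compact S" "\<And>x. x \<notin> S ==> f x = 0" and e: "e > 0"
 shows "\<exists>d>0. \<forall>x y. dist x y < d \<longrightarrow> dist (f x) (f y) < e"
proof -
 obtain R where R: "R > 0" "\<And>x. x \<in> S ==> norm x \<le> R" using S(1) compact_imp_bounded bounded_pos by metis
 have "uniformly_continuous_on (cball 0 (R + 2)) f"
  by (intro compact_uniformly_continuous) (auto intro: continuous_on_subset[OF c])
 then obtain d where d: "d > 0" "\<And>x y. x \<in> cball 0 (R+2) ==> y \<in> cball 0 (R+2) ==> dist x y < d ==> dist (f x) (f y) < e"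
  using e unfolding uniformly_continuous_on_def by (metis dist_commute)
 have "dist (f x) (f y) < e" if "dist x y < min d 1" for x y
 proof (cases "norm x \<le> R + 1")
  case True
  have "norm y \<le> norm x + dist x y" by (metis dist_commute dist_norm norm_triangle_sub add.commute norm_minus_commute)
  then show ?thesis using True that by (intro d) auto
 next
  case False
  have "norm x \<le> norm y + dist x y" by (metis dist_norm norm_triangle_sub)
  then have "norm y > R" using False that by auto
  then have "y \<notin> S" "x \<notin> S" using R False by force+
  then show ?thesis using S e by simp
 qed
 then show ?thesis using d by (intro exI[of _ "min d 1"]) auto
qed

lemma differentiable_has_derivative:
 fixes f :: "'a::euclidean_space => real"
 assumes "f differentiable (at x)"
 shows "(f has_derivative (\<lambda>v. \<Sum>b\<in>Basis. (v \<bullet> b) * partials [b] f x)) (at x)"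
proof -
 have 1: "(f has_derivative frechet_derivative f (at x)) (at x)"
  using assms by (simp add: frechet_derivative_works[symmetric])
 have lin: "bounded_linear (frechet_derivative f (at x))" using 1 by (simp add: has_derivative_def)
 have "frechet_derivative f (at x) v = (\<Sum>b\<in>Basis. (v \<bullet> b) * partials [b] f x)" for v
 proof -
  have "frechet_derivative f (at x) v = frechet_derivative f (at x) (\<Sum>b\<in>Basis. (v \<bullet> b) *\<^sub>R b)"
   by (simp add: euclidean_representation)
  also have "\<dots> = (\<Sum>b\<in>Basis. (v \<bullet> b) * frechet_derivative f (at x) b)"
   by (simp add: linear_sum[OF bounded_linear.linear[OF lin]] linear_simps[OF lin])
  finally show ?thesis by simp
 qed
 then have "frechet_derivative f (at x) = (\<lambda>v. \<Sum>b\<in>Basis. (v \<bullet> b) * partials [b] f x)" by (rule ext)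
 with 1 show ?thesis by metis
qed

lemma smooth_has_derivative:
 fixes f :: "'a::euclidean_space => real"
 assumes "smooth f"
 shows "(f has_derivative (\<lambda>v. \<Sum>b\<in>Basis. (v \<bullet> b) * partials [b] f x)) (at x)"
 using smoothD[OF assms, of "[]"] by (intro differentiable_has_derivative) simp

lemma finite_lists_Basis: "finite {bs. set bs \<subseteq> (Basis :: 'a::euclidean_space set) \<and> length bs \<le> N}"
 by (rule finite_lists_length_le) simp

lemma distribution_lincomb:
 assumes "distribution u" "f \<in> test_functions UNIV" "h \<in> test_functions UNIV"
 shows "u (\<lambda>x. a * f x + b * h x) = a *\<^sub>R u f + b *\<^sub>R u h"
 using conjunct1[OF assms(1)[unfolded distribution_def], rule_format, OF assms(2,3)] .

lemma distribution_convolve_continuous: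
 fixes u :: "('a::euclidean_space => real) => real"
 assumes u: "distribution u" and f: "f \<in> test_functions UNIV"
 shows "continuous_on UNIV (\<lambda>x. convolve u f x)"
proof -
 have aff: "(\<lambda>y. f (x - y)) \<in> test_functions UNIV" for x
  using test_functions_affine[OF f, of "-1" x] by simp
 have sm: "smooth f" using f by (rule test_functions_smooth)
 have "isCont (\<lambda>x. convolve u f x) x0" for x0
 proof -
  define K where "K = (\<lambda>(x,z). x - z) ` (cball x0 1 \<times> supp f)"
  have K: "compact K" unfolding K_def using f
   by (intro compact_continuous_image compact_Times) (auto intro!: continuous_intros simp: test_functions_iff split_beta)
  obtain N A where NA: "\<And>h B. h \<in> test_functions K ==>
    (\<forall>bs x. set bs \<subseteq> Basis \<and> length bs \<le> N \<longrightarrow> \<bar>partials bs h x\<bar> \<le> B) ==> norm (u h) \<le> A * B"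
   using u K unfolding distribution_def by metis
  show ?thesis unfolding continuous_at_eps_delta
  proof (intro allI impI)
   fix e :: real assume e: "e > 0"
   define e1 where "e1 = e / (2 * (\<bar>A\<bar> + 1))"
   have e1: "e1 > 0" "A * e1 < e"
   proof -
    show "e1 > 0" using e by (simp add: e1_def)
    then have "A * e1 \<le> \<bar>A\<bar> * e1" by (intro mult_right_mono) auto
    also have "\<dots> < (\<bar>A\<bar> + 1) * 2 * e1" using \<open>e1 > 0\<close> by (intro mult_strict_right_mono) auto
    also have "\<dots> = e" unfolding e1_def by (subst mult.assoc) (simp add: field_simps)
    finally show "A * e1 < e" .
   qed
   have "\<exists>d>0. \<forall>x y. dist x y < d \<longrightarrow> dist (partials bs f x) (partials bs f y) < e1"
    if bs: "set bs \<subseteq> Basis" for bs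
   proof -
    have 1: "compact (supp f)" using f by (simp add: test_functions_iff)
    have 2: "partials bs f x = 0" if "x \<notin> supp f" for x
     by (rule partials_eq_0_outside[OF closed_supp _ that]) (rule supp_superset)
    show ?thesis by (rule continuous_compact_support_uniform[OF continuous_on_partials[OF sm bs] 1 2 e1(1)])
   qed
   then obtain d where d: "\<And>bs. set bs \<subseteq> Basis ==> d bs > (0::real)"
    "\<And>bs x y. set bs \<subseteq> Basis ==> dist x y < d bs ==> dist (partials bs f x) (partials bs f y) < e1"
    by metis
   define L where "L = {bs. set bs \<subseteq> (Basis :: 'a set) \<and> length bs \<le> N}"
   define d0 where "d0 = Min (insert 1 (d ` L))"
   have fin: "finite L" unfolding L_def by (rule finite_lists_Basis)
   have d0: "d0 > 0" "d0 \<le> 1" "\<And>bs. bs \<in> L ==> d0 \<le> d bs"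
    unfolding d0_def using fin d by (auto simp: L_def)
   have "dist (convolve u f x) (convolve u f x0) < e" if x: "dist x x0 < d0" for x
   proof -
    define h where "h = (\<lambda>y. 1 * f (x - y) + (-1) * f (x0 - y))"
    have hK: "h \<in> test_functions K"
    proof (rule test_functionsI[OF _ K])
     show "smooth h" unfolding h_def using aff by (intro smooth_lincomb) (auto intro: test_functions_smooth)
     fix y assume "y \<notin> K"
     have *: "z - y \<notin> supp f" if "z \<in> cball x0 1" for z
     proof
      assume "z - y \<in> supp f"
      then have "(case (z, z - y) of (x, z) => x - z) \<in> K" unfolding K_def using that by blast
      then show False using \<open>y \<notin> K\<close> by simp
     qed
     have "x - y \<notin> supp f" "x0 - y \<notin> supp f"
      using x d0(2) by (auto intro!: * simp: dist_commute)
     then show "h y = 0" by (simp add: h_def supp_superset)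
    qed auto
    have pb: "\<bar>partials bs h y\<bar> \<le> e1" if "set bs \<subseteq> Basis" "length bs \<le> N" for bs y
    proof -
     have "partials bs h y = (-1) ^ length bs * (partials bs f (x - y) - partials bs f (x0 - y))"
      unfolding h_def using aff that(1) partials_affine[OF sm that(1), of x "-1"] partials_affine[OF sm that(1), of x0 "-1"]
      by (subst partials_lincomb) (auto intro: test_functions_smooth simp: algebra_simps)
     also have "\<bar>\<dots>\<bar> = dist (partials bs f (x - y)) (partials bs f (x0 - y))"
      by (simp add: abs_mult power_abs dist_real_def)
     also have "\<dots> < e1" using that x d0(3)[of bs] by (intro d) (auto simp: L_def dist_norm)
     finally show ?thesis by simp
    qed
    have "u h = 1 *\<^sub>R u (\<lambda>y. f (x - y)) + (-1) *\<^sub>R u (\<lambda>y. f (x0 - y))"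
     unfolding h_def by (rule distribution_lincomb[OF u aff aff])
    then have "dist (convolve u f x) (convolve u f x0) = norm (u h)"
     by (simp add: convolve_def dist_norm)
    also have "\<dots> \<le> A * e1" by (rule NA[OF hK]) (use pb in auto)
    also have "\<dots> < e" by (rule e1)
    finally show ?thesis .
   qed
   then show "\<exists>d>0. \<forall>x. dist x x0 < d \<longrightarrow> dist (convolve u f x) (convolve u f x0) < e"
    using d0 by blast
  qed
 qed
 then show ?thesis by (simp add: continuous_on_eq_continuous_at)
qed

lemma test_functions_rescale:
 fixes \<phi> :: "'a::euclidean_space => real"
 assumes "\<phi> \<in> test_functions UNIV" "dl > 0"
 shows "rescale \<phi> dl \<in> test_functions UNIV"
 using test_functions_cmult[OF test_functions_affine[OF assms(1), of "1/dl" 0], of "1 / dl ^ DIM('a)"] assms(2)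
 by (simp add: rescale_def[abs_def] field_simps)

section \<open>Riesz kernels\<close>

lemma balls_sets_borel [measurable]:
 fixes w :: "'a::metric_space" shows "cball w r \<in> sets borel" "ball w r \<in> sets borel"
 by auto

definition riesz :: "real => 'a::euclidean_space => ennreal" where
 "riesz gm x = ennreal (norm x powr (- gm))"

lemma riesz_measurable [measurable]: "riesz gm \<in> borel_measurable borel"
 unfolding riesz_def by measurable

lemma riesz_minus: "riesz gm (x - y) = riesz gm (y - x)"
 by (simp add: riesz_def norm_minus_commute)

lemma emeasure_cball_scale:
 fixes w :: "'a::euclidean_space"
 assumes "r \<ge> 0"
 shows "emeasure lborel (cball w r) = ennreal (unit_ball_vol (DIM('a)) * r ^ DIM('a))"
 using emeasure_cball[OF assms, of w] by simp

lemma dyadic_below: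
 fixes t s :: real assumes "0 < t" "t \<le> s"
 obtains j :: nat where "s / 2 ^ Suc j < t" "t \<le> s / 2 ^ j"
proof -
 have "\<exists>j. s / 2 ^ Suc j < t"
 proof -
  obtain n where "(1/2) ^ n < t / s" using real_arch_pow_inv[of "t / s" "1/2"] assms by auto
  then have "s / 2 ^ n < t" using assms by (simp add: field_simps power_one_over)
  moreover have "s / 2 ^ Suc n \<le> s / 2 ^ n" using assms by (simp add: field_simps)
  ultimately show ?thesis by (intro exI[of _ n]) linarith
 qed
 then have 1: "s / 2 ^ Suc (LEAST j. s / 2 ^ Suc j < t) < t" by (rule LeastI_ex)
 define j where "j = (LEAST j. s / 2 ^ Suc j < t)"
 have "t \<le> s / 2 ^ j"
 proof (cases j)
  case 0 then show ?thesis using assms by simp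
 next
  case (Suc i)
  then have "\<not> s / 2 ^ Suc i < t" using not_less_Least[of i "\<lambda>j. s / 2 ^ Suc j < t"] by (simp add: j_def)
  then show ?thesis using Suc by simp
 qed
 with 1 that show ?thesis by (auto simp: j_def)
qed

lemma dyadic_above:
 fixes t s :: real assumes "0 < s" "s \<le> t"
 obtains j :: nat where "s * 2 ^ j \<le> t" "t < s * 2 ^ Suc j"
proof -
 have "\<exists>j. t < s * 2 ^ Suc j"
 proof -
  obtain n where "t / s < 2 ^ n" using real_arch_pow[of 2 "t / s"] by auto
  then have "t < s * 2 ^ n" using assms by (simp add: field_simps)
  moreover have "s * 2 ^ n \<le> s * 2 ^ Suc n" using assms by (simp add: field_simps)
  ultimately show ?thesis by (intro exI[of _ n]) linarith
 qed
 then have 1: "t < s * 2 ^ Suc (LEAST j. t < s * 2 ^ Suc j)" by (rule LeastI_ex)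
 define j where "j = (LEAST j. t < s * 2 ^ Suc j)"
 have "s * 2 ^ j \<le> t"
 proof (cases j)
  case 0 then show ?thesis using assms by simp
 next
  case (Suc i)
  then have "\<not> t < s * 2 ^ Suc i" using not_less_Least[of i "\<lambda>j. t < s * 2 ^ Suc j"] by (simp add: j_def)
  then show ?thesis using Suc by simp
 qed
 with 1 that show ?thesis by (auto simp: j_def)
qed

lemma ennreal_term_le_suminf: "f j \<le> suminf f" for f :: "nat => ennreal"
 using sum_le_suminf[of f "{j}"] by simp

lemma nn_integral_dyadic_bound:
 fixes w :: "'a::euclidean_space"
 assumes [measurable]: "f \<in> borel_measurable borel"
  and f: "\<And>y. f y \<le> (\<Sum>j. ennreal (h j) * indicator (cball w (\<rho> j)) y)"
  and h: "\<And>j. h j \<ge> 0" "\<And>j. \<rho> j \<ge> 0"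
  and hq: "\<And>j. h j * \<rho> j ^ DIM('a) = B * q ^ j" and B: "B \<ge> 0" "0 \<le> q" "q < 1"
 shows "(\<integral>\<^sup>+ y. f y \<partial>lborel) \<le> ennreal (unit_ball_vol (DIM('a)) * B / (1 - q))"
proof -
 have "(\<integral>\<^sup>+ y. f y \<partial>lborel) \<le> (\<integral>\<^sup>+ y. (\<Sum>j. ennreal (h j) * indicator (cball w (\<rho> j)) y) \<partial>lborel)"
  by (intro nn_integral_mono f)
 also have "\<dots> = (\<Sum>j. \<integral>\<^sup>+ y. ennreal (h j) * indicator (cball w (\<rho> j)) y \<partial>lborel)"
  by (intro nn_integral_suminf) measurable
 also have "\<dots> = (\<Sum>j. ennreal (unit_ball_vol (DIM('a)) * B * q ^ j))"
 proof (intro suminf_cong)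
  fix j
  have "(\<integral>\<^sup>+ y. ennreal (h j) * indicator (cball w (\<rho> j)) y \<partial>lborel) = ennreal (h j) * emeasure lborel (cball w (\<rho> j))"
   by (subst nn_integral_cmult) auto
  also have "\<dots> = ennreal (h j * (unit_ball_vol (DIM('a)) * \<rho> j ^ DIM('a)))"
   using h by (simp add: emeasure_cball_scale ennreal_mult)
  also have "h j * (unit_ball_vol (DIM('a)) * \<rho> j ^ DIM('a)) = unit_ball_vol (DIM('a)) * B * q ^ j"
   using hq[of j] by (simp add: algebra_simps)
  finally show "(\<integral>\<^sup>+ y. ennreal (h j) * indicator (cball w (\<rho> j)) y \<partial>lborel) = ennreal (unit_ball_vol (DIM('a)) * B * q ^ j)" .
 qed
 also have "\<dots> = ennreal (unit_ball_vol (DIM('a)) * B * (1 / (1 - q)))"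
  using B by (intro suminf_ennreal_eq sums_mult geometric_sums) auto
 finally show ?thesis by simp
qed

lemma powr_half_power: "s > 0 ==> (s / 2 ^ j) powr a = s powr a * (2 powr (- a)) ^ j" for s :: real
 by (simp add: powr_divide powr_realpow[symmetric] powr_powr powr_minus_divide mult.commute)

lemma powr_double_power: "s > 0 ==> (s * 2 ^ j) powr a = s powr a * (2 powr a) ^ j" for s :: real
 by (simp add: powr_mult powr_realpow[symmetric] powr_powr mult.commute)

lemma riesz_near:
 fixes gm :: real
 assumes "0 < gm" "gm < DIM('a::euclidean_space)"
 obtains A where "A > 0" "\<And>s (w::'a). s > 0 ==>
  (\<integral>\<^sup>+ y. riesz gm (y - w) * indicator (cball w s) y \<partial>lborel) \<le> ennreal (A * s powr (DIM('a) - gm))"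
proof -
 define q where "q = 2 powr (gm - DIM('a))"
 have q: "0 \<le> q" "q < 1" using assms powr_less_mono[of "gm - DIM('a)" 0 2] by (auto simp: q_def)
 define A where "A = unit_ball_vol (DIM('a)) * 2 powr gm / (1 - q)"
 show ?thesis
 proof (rule that)
  show "A > 0" using q by (auto simp: A_def)
  fix s :: real and w :: 'a assume s: "s > 0"
  have "(\<integral>\<^sup>+ y. riesz gm (y - w) * indicator (cball w s) y \<partial>lborel)
   \<le> ennreal (unit_ball_vol (DIM('a)) * (2 powr gm * s powr (DIM('a) - gm)) / (1 - q))"
  proof (rule nn_integral_dyadic_bound[where h="\<lambda>j. (s / 2 ^ Suc j) powr (-gm)" and \<rho>="\<lambda>j. s / 2 ^ j" and w=w])
   fix y :: 'a
   show "riesz gm (y - w) * indicator (cball w s) y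
    \<le> (\<Sum>j. ennreal ((s / 2 ^ Suc j) powr (-gm)) * indicator (cball w (s / 2 ^ j)) y)" (is "_ \<le> suminf ?g")
   proof (cases "y \<noteq> w \<and> dist w y \<le> s")
    case True
    then have "0 < norm (y - w)" "norm (y - w) \<le> s" by (auto simp: dist_norm norm_minus_commute)
    then obtain j where j: "s / 2 ^ Suc j < norm (y - w)" "norm (y - w) \<le> s / 2 ^ j"
     by (rule dyadic_below)
    have "riesz gm (y - w) * indicator (cball w s) y \<le> ?g j"
     using j s True assms unfolding riesz_def
     by (auto intro!: ennreal_leI powr_mono2' simp: indicator_def dist_norm norm_minus_commute)
    also have "\<dots> \<le> suminf ?g" by (rule ennreal_term_le_suminf)
    finally show ?thesis .
   next
    case False
    then show ?thesis using assms by (auto simp: riesz_def)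
   qed
  next
   fix j
   have "(s / 2 ^ Suc j) powr (-gm) * (s / 2 ^ j) ^ DIM('a) = (s / 2 ^ j / 2) powr (-gm) * (s / 2 ^ j) powr (DIM('a))"
    using s by (simp add: powr_realpow mult.commute)
   also have "\<dots> = 2 powr gm * (s / 2 ^ j) powr (DIM('a) - gm)"
   proof -
    have "(t / 2) powr (-gm) * t powr (DIM('a)) = 2 powr gm * t powr (DIM('a) - gm)" if "t > 0" for t :: real
     using that by (simp add: powr_divide powr_diff powr_minus_divide)
    from this[of "s / 2 ^ j"] s show ?thesis by simp
   qed
   also have "\<dots> = 2 powr gm * s powr (DIM('a) - gm) * q ^ j"
    using s by (subst powr_half_power) (auto simp: q_def)
   finally show "(s / 2 ^ Suc j) powr (-gm) * (s / 2 ^ j) ^ DIM('a) = 2 powr gm * s powr (DIM('a) - gm) * q ^ j" .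
  qed (use s q in auto)
  then show "(\<integral>\<^sup>+ y. riesz gm (y - w) * indicator (cball w s) y \<partial>lborel) \<le> ennreal (A * s powr (DIM('a) - gm))"
   by (simp add: A_def mult.assoc)
 qed
qed

lemma riesz_far:
 fixes a :: real
 assumes "a > DIM('a::euclidean_space)"
 obtains A where "A > 0" "\<And>s (w::'a). s > 0 ==>
  (\<integral>\<^sup>+ y. riesz a (y - w) * indicator (- ball w s) y \<partial>lborel) \<le> ennreal (A * s powr (DIM('a) - a))"
proof -
 define q where "q = 2 powr (DIM('a) - a)"
 have q: "0 \<le> q" "q < 1" using assms powr_less_mono[of "DIM('a) - a" 0 2] by (auto simp: q_def)
 have a0: "a > 0" using assms by (meson of_nat_0_le_iff order_le_less_trans)
 define A where "A = unit_ball_vol (DIM('a)) * 2 ^ DIM('a) / (1 - q)"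
 show ?thesis
 proof (rule that)
  show "A > 0" using q by (auto simp: A_def)
  fix s :: real and w :: 'a assume s: "s > 0"
  have "(\<integral>\<^sup>+ y. riesz a (y - w) * indicator (- ball w s) y \<partial>lborel)
   \<le> ennreal (unit_ball_vol (DIM('a)) * (2 ^ DIM('a) * s powr (DIM('a) - a)) / (1 - q))"
  proof (rule nn_integral_dyadic_bound[where h="\<lambda>j. (s * 2 ^ j) powr (-a)" and \<rho>="\<lambda>j. s * 2 ^ Suc j" and w=w])
   fix y :: 'a
   show "riesz a (y - w) * indicator (- ball w s) y
    \<le> (\<Sum>j. ennreal ((s * 2 ^ j) powr (-a)) * indicator (cball w (s * 2 ^ Suc j)) y)" (is "_ \<le> suminf ?g")
   proof (cases "s \<le> dist w y")
    case True
    then have "s \<le> norm (y - w)" by (auto simp: dist_norm norm_minus_commute)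
    with s obtain j where j: "s * 2 ^ j \<le> norm (y - w)" "norm (y - w) < s * 2 ^ Suc j"
     by (rule dyadic_above)
    have "riesz a (y - w) * indicator (- ball w s) y \<le> ?g j"
     using j s True a0 unfolding riesz_def
     by (auto intro!: ennreal_leI powr_mono2' simp: indicator_def dist_norm norm_minus_commute)
    also have "\<dots> \<le> suminf ?g" by (rule ennreal_term_le_suminf)
    finally show ?thesis .
   qed auto
  next
   fix j
   have "(s * 2 ^ j) powr (-a) * (s * 2 ^ Suc j) ^ DIM('a) = 2 ^ DIM('a) * ((s * 2 ^ j) powr (-a) * (s * 2 ^ j) powr (DIM('a)))"
    using s by (simp add: powr_realpow power_mult_distrib)
   also have "\<dots> = 2 ^ DIM('a) * (s * 2 ^ j) powr (DIM('a) - a)"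
    by (simp add: powr_add[symmetric])
   also have "\<dots> = 2 ^ DIM('a) * s powr (DIM('a) - a) * q ^ j"
    using s by (subst powr_double_power) (auto simp: q_def)
   finally show "(s * 2 ^ j) powr (-a) * (s * 2 ^ Suc j) ^ DIM('a) = 2 ^ DIM('a) * s powr (DIM('a) - a) * q ^ j" .
  qed (use s q in auto)
  then show "(\<integral>\<^sup>+ y. riesz a (y - w) * indicator (- ball w s) y \<partial>lborel) \<le> ennreal (A * s powr (DIM('a) - a))"
   by (simp add: A_def mult.assoc)
 qed
qed

lemma riesz_average:
 fixes gm :: real
 assumes "0 < gm" "gm < DIM('a::euclidean_space)"
 obtains A where "A > 0" "\<And>r (x::'a) w. r > 0 ==>
  (\<integral>\<^sup>+ y. riesz gm (y - w) * indicator (cball x (2 * r)) y \<partial>lborel)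
   \<le> ennreal (A * r ^ DIM('a) * (max r (norm (x - w))) powr (- gm))"
proof -
 obtain A where A: "A > 0" "\<And>s (w::'a). s > 0 ==>
  (\<integral>\<^sup>+ y. riesz gm (y - w) * indicator (cball w s) y \<partial>lborel) \<le> ennreal (A * s powr (DIM('a) - gm))"
  by (rule riesz_near[OF assms]) blast
 define v where "v = unit_ball_vol (real (DIM('a)))"
 have v: "v > 0" by (simp add: v_def)
 define A1 where "A1 = v * 2 ^ DIM('a) * 2 powr gm"
 define A2 where "A2 = A * 6 powr (DIM('a) - gm) * 4 powr gm"
 show ?thesis
 proof (rule that)
  show "A1 + A2 > 0" using A v by (auto simp: A1_def A2_def intro!: add_pos_pos)
  fix r :: real and x w :: 'a assume r: "r > 0"
  define m where "m = max r (norm (x - w))"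
  have m: "m > 0" "r \<le> m" using r by (auto simp: m_def)
  show "(\<integral>\<^sup>+ y. riesz gm (y - w) * indicator (cball x (2 * r)) y \<partial>lborel)
   \<le> ennreal ((A1 + A2) * r ^ DIM('a) * m powr (- gm))"
  proof (cases "norm (x - w) \<ge> 4 * r")
   case True
   have "(\<integral>\<^sup>+ y. riesz gm (y - w) * indicator (cball x (2 * r)) y \<partial>lborel)
    \<le> (\<integral>\<^sup>+ y. ennreal ((m/2) powr (-gm)) * indicator (cball x (2 * r)) y \<partial>lborel)"
   proof (intro nn_integral_mono)
    fix y
    have "m / 2 \<le> norm (y - w)" if "dist x y \<le> 2 * r"
    proof -
     have "norm (x - w) \<le> norm (y - w) + norm (x - y)" using norm_triangle_ineq[of "x - y" "y - w"] by simp
     then show ?thesis using that True r by (simp add: m_def dist_norm)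
    qed
    then show "riesz gm (y - w) * indicator (cball x (2 * r)) y \<le> ennreal ((m/2) powr (-gm)) * indicator (cball x (2 * r)) y"
     using assms m unfolding riesz_def by (auto intro!: ennreal_leI powr_mono2' simp: indicator_def)
   qed
   also have "\<dots> = ennreal ((m/2) powr (-gm) * (v * (2 * r) ^ DIM('a)))"
    using r by (subst nn_integral_cmult, measurable) (auto simp: emeasure_cball_scale ennreal_mult v_def)
   also have "(m/2) powr (-gm) * (v * (2 * r) ^ DIM('a)) = A1 * r ^ DIM('a) * m powr (- gm)"
    using m by (simp add: A1_def powr_divide powr_minus_divide power_mult_distrib field_simps)
   also have "ennreal \<dots> \<le> ennreal ((A1 + A2) * r ^ DIM('a) * m powr (- gm))"
    using A r by (intro ennreal_leI mult_right_mono) (auto simp: A2_def)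
   finally show ?thesis .
  next
   case False
   have m4: "m \<le> 4 * r" using False r by (auto simp: m_def)
   have "(\<integral>\<^sup>+ y. riesz gm (y - w) * indicator (cball x (2 * r)) y \<partial>lborel)
    \<le> (\<integral>\<^sup>+ y. riesz gm (y - w) * indicator (cball w (6 * r)) y \<partial>lborel)"
   proof (intro nn_integral_mono mult_left_mono)
    fix y
    have "dist w y \<le> 6 * r" if "dist x y \<le> 2 * r"
     using that False dist_triangle[of w y x] by (simp add: dist_norm norm_minus_commute)
    then show "(indicator (cball x (2 * r)) y::ennreal) \<le> indicator (cball w (6 * r)) y"
     by (auto simp: indicator_def)
   qed auto
   also have "\<dots> \<le> ennreal (A * (6 * r) powr (DIM('a) - gm))" using r by (intro A) auto
   also have "\<dots> \<le> ennreal ((A1 + A2) * r ^ DIM('a) * m powr (- gm))"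
   proof (intro ennreal_leI)
    have "A * (6 * r) powr (DIM('a) - gm) = A * 6 powr (DIM('a) - gm) * (r ^ DIM('a) * r powr (-gm))"
     using r by (simp add: powr_mult powr_diff powr_realpow powr_minus_divide)
    also have "r powr (-gm) \<le> 4 powr gm * m powr (- gm)"
    proof -
     have "r powr (-gm) \<le> (m / 4) powr (-gm)" using m m4 assms by (intro powr_mono2') auto
     also have "\<dots> = 4 powr gm * m powr (-gm)" using m by (simp add: powr_divide powr_minus_divide)
     finally show ?thesis .
    qed
    also have "A * 6 powr (DIM('a) - gm) * (r ^ DIM('a) * (4 powr gm * m powr (- gm))) = A2 * r ^ DIM('a) * m powr (- gm)"
     by (simp add: A2_def)
    also have "\<dots> \<le> (A1 + A2) * r ^ DIM('a) * m powr (- gm)"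
     using v r by (intro mult_right_mono) (auto simp: A1_def)
    finally show "A * (6 * r) powr (DIM('a) - gm) \<le> (A1 + A2) * r ^ DIM('a) * m powr (- gm)"
     using A r by (simp add: mult_left_mono)
   qed
   finally show ?thesis .
  qed
 qed
qed

lemma riesz_double:
 fixes gm R :: real
 assumes "1 < gm" "gm < DIM('a::euclidean_space)" "R > 0" "DIM('a) \<ge> 2"
 obtains A where "A > 0" "\<And>r (w::'a). 0 < r ==> r \<le> R ==>
  (\<integral>\<^sup>+ x. riesz gm (x - w) * ennreal ((max r (norm (x - w))) powr (- gm)) * indicator (cball w R) x \<partial>lborel)
   \<le> ennreal (A * r powr (2 - 2 * gm))"
proof -
 obtain A1 where A1: "A1 > 0" "\<And>s (w::'a). s > 0 ==>
  (\<integral>\<^sup>+ y. riesz gm (y - w) * indicator (cball w s) y \<partial>lborel) \<le> ennreal (A1 * s powr (DIM('a) - gm))"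
  by (rule riesz_near[where ?'a = 'a and gm = gm]) (use assms in auto)
 have far: "\<exists>A2>0. \<forall>r (w::'a). 0 < r \<longrightarrow> r \<le> R \<longrightarrow>
   (\<integral>\<^sup>+ x. riesz (2 * gm) (x - w) * indicator (cball w R - ball w r) x \<partial>lborel) \<le> ennreal (A2 * r powr (2 - 2 * gm))"
 proof (cases "DIM('a) = 2")
  case True
  obtain A2 where A2: "A2 > 0" "\<And>s (w::'a). s > 0 ==>
   (\<integral>\<^sup>+ y. riesz (2 * gm) (y - w) * indicator (- ball w s) y \<partial>lborel) \<le> ennreal (A2 * s powr (DIM('a) - 2 * gm))"
   by (rule riesz_far[where ?'a = 'a and a = "2 * gm"]) (use assms True in auto)
  show ?thesis
  proof (intro exI[of _ A2] conjI allI impI A2(1))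
   fix r :: real and w :: 'a assume r: "0 < r" "r \<le> R"
   have "(\<integral>\<^sup>+ x. riesz (2 * gm) (x - w) * indicator (cball w R - ball w r) x \<partial>lborel)
    \<le> (\<integral>\<^sup>+ y. riesz (2 * gm) (y - w) * indicator (- ball w r) y \<partial>lborel)"
    by (intro nn_integral_mono mult_left_mono) (auto simp: indicator_def)
   also have "\<dots> \<le> ennreal (A2 * r powr (2 - 2 * gm))" using A2(2)[OF r(1)] True by simp
   finally show "(\<integral>\<^sup>+ x. riesz (2 * gm) (x - w) * indicator (cball w R - ball w r) x \<partial>lborel) \<le> \<dots>" .
  qed
 next
  case False
  obtain A2 where A2: "A2 > 0" "\<And>s (w::'a). s > 0 ==>
   (\<integral>\<^sup>+ y. riesz 2 (y - w) * indicator (cball w s) y \<partial>lborel) \<le> ennreal (A2 * s powr (DIM('a) - 2))"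
   by (rule riesz_near[where ?'a = 'a and gm = 2]) (use assms False in auto)
  show ?thesis
  proof (intro exI[of _ "A2 * R powr (DIM('a) - 2)"] conjI allI impI)
   show "A2 * R powr (DIM('a) - 2) > 0" using A2 assms by simp
   fix r :: real and w :: 'a assume r: "0 < r" "r \<le> R"
   have "(\<integral>\<^sup>+ x. riesz (2 * gm) (x - w) * indicator (cball w R - ball w r) x \<partial>lborel)
    \<le> (\<integral>\<^sup>+ y. ennreal (r powr (2 - 2 * gm)) * (riesz 2 (y - w) * indicator (cball w R) y) \<partial>lborel)"
   proof (intro nn_integral_mono)
    fix x
    have "norm (x - w) powr (-(2*gm)) \<le> r powr (2 - 2 * gm) * norm (x - w) powr (-2)" if "r \<le> norm (x - w)"
    proof -
     have "norm (x - w) powr (-(2*gm)) = norm (x - w) powr (2 - 2 * gm) * norm (x - w) powr (-2)"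
      using that r by (simp add: powr_add[symmetric])
     also have "\<dots> \<le> r powr (2 - 2 * gm) * norm (x - w) powr (-2)"
      using that r assms by (intro mult_right_mono powr_mono2') auto
     finally show ?thesis .
    qed
    then show "riesz (2 * gm) (x - w) * indicator (cball w R - ball w r) x \<le> ennreal (r powr (2 - 2 * gm)) * (riesz 2 (x - w) * indicator (cball w R) x)"
     by (auto simp: riesz_def indicator_def ennreal_mult[symmetric] dist_norm norm_minus_commute intro!: ennreal_leI)
   qed
   also have "\<dots> = ennreal (r powr (2 - 2 * gm)) * (\<integral>\<^sup>+ y. riesz 2 (y - w) * indicator (cball w R) y \<partial>lborel)"
    by (intro nn_integral_cmult) measurable
   also have "\<dots> \<le> ennreal (r powr (2 - 2 * gm)) * ennreal (A2 * R powr (DIM('a) - 2))"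
    by (intro mult_left_mono A2 assms) auto
   finally show "(\<integral>\<^sup>+ x. riesz (2 * gm) (x - w) * indicator (cball w R - ball w r) x \<partial>lborel) \<le> ennreal (A2 * R powr (DIM('a) - 2) * r powr (2 - 2 * gm))"
    using A2 by (simp add: ennreal_mult[symmetric] mult.commute)
  qed
 qed
 then obtain A2 where A2: "A2 > 0" "\<And>r (w::'a). 0 < r ==> r \<le> R ==>
   (\<integral>\<^sup>+ x. riesz (2 * gm) (x - w) * indicator (cball w R - ball w r) x \<partial>lborel) \<le> ennreal (A2 * r powr (2 - 2 * gm))"
  by blast
 show ?thesis
 proof (rule that)
  show "A1 * R powr (DIM('a) - 2) + A2 > 0" using A1 A2 assms by (auto intro!: add_nonneg_pos)
  fix r :: real and w :: 'a assume r: "0 < r" "r \<le> R"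
  have "(\<integral>\<^sup>+ x. riesz gm (x - w) * ennreal ((max r (norm (x - w))) powr (- gm)) * indicator (cball w R) x \<partial>lborel)
   \<le> (\<integral>\<^sup>+ x. ennreal (r powr (-gm)) * (riesz gm (x - w) * indicator (cball w r) x) + riesz (2 * gm) (x - w) * indicator (cball w R - ball w r) x \<partial>lborel)"
  proof (intro nn_integral_mono)
   fix x
   show "riesz gm (x - w) * ennreal ((max r (norm (x - w))) powr (- gm)) * indicator (cball w R) x
    \<le> ennreal (r powr (-gm)) * (riesz gm (x - w) * indicator (cball w r) x) + riesz (2 * gm) (x - w) * indicator (cball w R - ball w r) x"
   proof (cases "norm (x - w) \<ge> r")
    case True
    have "riesz gm (x - w) * ennreal ((max r (norm (x - w))) powr (- gm)) = riesz (2 * gm) (x - w)"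
     using True by (simp add: riesz_def max_def ennreal_mult[symmetric] powr_add[symmetric])
    then show ?thesis using True by (auto simp: indicator_def dist_norm norm_minus_commute intro: add_increasing)
   next
    case False
    then have "riesz gm (x - w) * ennreal ((max r (norm (x - w))) powr (- gm)) = ennreal (r powr (-gm)) * riesz gm (x - w)"
     by (simp add: max_def mult.commute)
    then show ?thesis using False r by (auto simp: indicator_def dist_norm norm_minus_commute)
   qed
  qed
  also have "\<dots> = ennreal (r powr (-gm)) * (\<integral>\<^sup>+ x. riesz gm (x - w) * indicator (cball w r) x \<partial>lborel)
    + (\<integral>\<^sup>+ x. riesz (2 * gm) (x - w) * indicator (cball w R - ball w r) x \<partial>lborel)"
   by (subst nn_integral_add, measurable) (subst nn_integral_cmult, auto)
  also have "\<dots> \<le> ennreal (r powr (-gm)) * ennreal (A1 * r powr (DIM('a) - gm)) + ennreal (A2 * r powr (2 - 2 * gm))"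
   by (intro add_mono mult_left_mono A1 A2 r) auto
  also have "\<dots> = ennreal (A1 * (r powr (-gm) * r powr (DIM('a) - gm)) + A2 * r powr (2 - 2 * gm))"
   using A1 A2 by (simp add: ennreal_mult[symmetric] ennreal_plus[symmetric] mult_ac del: ennreal_plus)
  also have "\<dots> \<le> ennreal ((A1 * R powr (DIM('a) - 2) + A2) * r powr (2 - 2 * gm))"
  proof (intro ennreal_leI)
   have "r powr (-gm) * r powr (DIM('a) - gm) = r powr (DIM('a) - 2) * r powr (2 - 2 * gm)"
    using assms by (simp add: powr_add[symmetric] of_nat_diff algebra_simps)
   also have "\<dots> \<le> R powr (DIM('a) - 2) * r powr (2 - 2 * gm)"
    using r assms by (intro mult_right_mono powr_mono2) auto
   finally have "A1 * (r powr (-gm) * r powr (DIM('a) - gm)) \<le> A1 * (R powr (DIM('a) - 2) * r powr (2 - 2 * gm))"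
    using A1 by (intro mult_left_mono) auto
   then show "A1 * (r powr (-gm) * r powr (DIM('a) - gm)) + A2 * r powr (2 - 2 * gm) \<le> (A1 * R powr (DIM('a) - 2) + A2) * r powr (2 - 2 * gm)"
    by (simp add: algebra_simps)
  qed
  finally show "(\<integral>\<^sup>+ x. riesz gm (x - w) * ennreal ((max r (norm (x - w))) powr (- gm)) * indicator (cball w R) x \<partial>lborel)
   \<le> ennreal ((A1 * R powr (DIM('a) - 2) + A2) * r powr (2 - 2 * gm))" .
 qed
qed

lemma ptolemy_zero:
 fixes x y z :: "'a::real_inner"
 shows "norm (x - z) * norm y \<le> norm (x - y) * norm z + norm (y - z) * norm x"
proof (cases "x = 0 \<or> y = 0 \<or> z = 0")
 case True then show ?thesis by (auto simp: mult.commute)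
next
 case False
 define i where "i = (\<lambda>x::'a. (1 / (norm x)\<^sup>2) *\<^sub>R x)"
 have inv: "norm (i x - i y) = norm (x - y) / (norm x * norm y)" if "x \<noteq> 0" "y \<noteq> 0" for x y :: 'a
 proof -
  define X where "X = x \<bullet> x"
  define Y where "Y = y \<bullet> y"
  have XY: "X > 0" "Y > 0" using that by (auto simp: X_def Y_def)
  have i: "i x = (1 / X) *\<^sub>R x" "i y = (1 / Y) *\<^sub>R y"
   by (simp_all add: i_def X_def Y_def power2_norm_eq_inner)
  have "(norm (i x - i y))\<^sup>2 = (1 / X) * (1 / X) * X - 2 * ((1 / X) * (1 / Y) * (x \<bullet> y)) + (1 / Y) * (1 / Y) * Y"
   unfolding power2_norm_eq_inner i by (simp add: inner_diff_left inner_diff_right inner_commute X_def Y_def)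
  also have "\<dots> = (X - 2 * (x \<bullet> y) + Y) / (X * Y)"
   using XY by (simp add: field_simps)
  also have "X - 2 * (x \<bullet> y) + Y = (norm (x - y))\<^sup>2"
   unfolding power2_norm_eq_inner by (simp add: inner_diff_left inner_diff_right inner_commute X_def Y_def)
  also have "X * Y = (norm x * norm y)\<^sup>2" by (simp add: power_mult_distrib power2_norm_eq_inner X_def Y_def)
  finally have "(norm (i x - i y))\<^sup>2 = ((norm (x - y)) / (norm x * norm y))\<^sup>2"
   by (simp add: power_divide)
  then show ?thesis using power2_eq_imp_eq[of "norm (i x - i y)" "norm (x - y) / (norm x * norm y)"] by simp
 qed
 have "norm (i x - i z) \<le> norm (i x - i y) + norm (i y - i z)"
  using norm_triangle_ineq[of "i x - i y" "i y - i z"] by simp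
 then have "norm (x - z) / (norm x * norm z) \<le> norm (x - y) / (norm x * norm y) + norm (y - z) / (norm y * norm z)"
  using False by (simp add: inv)
 then have "norm (x - z) / (norm x * norm z) * (norm x * norm y * norm z) \<le> (norm (x - y) / (norm x * norm y) + norm (y - z) / (norm y * norm z)) * (norm x * norm y * norm z)"
  by (rule mult_right_mono) auto
 then show ?thesis using False by (simp add: field_simps)
qed

lemma ptolemy:
 fixes x y z w :: "'a::real_inner"
 shows "norm (x - z) * norm (y - w) \<le> norm (x - y) * norm (z - w) + norm (y - z) * norm (x - w)"
 using ptolemy_zero[of "x - w" "z - w" "y - w"] by simp

definition expr2 :: "real => real" where "expr2 u = exp u - 1 - u"

lemma expr2_nonneg: "expr2 u \<ge> 0"
 using exp_ge_add_one_self[of u] unfolding expr2_def by linarith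

lemma expr2_abs: "expr2 u \<le> expr2 \<bar>u\<bar>"
proof (cases "u \<ge> 0")
 case False
 have "exp u - 1 - u \<le> exp (- u) - 1 + u"
 proof -
  define v where "v = - u"
  have v: "v \<ge> 0" using False by (simp add: v_def)
  have "\<exists>y. (\<lambda>x. exp x - exp (- x) - 2 * x) 0 \<le> (\<lambda>x. exp x - exp (- x) - 2 * x) v"
  proof (intro exI)
   show "(\<lambda>x. exp x - exp (- x) - 2 * x) 0 \<le> (\<lambda>x. exp x - exp (- x) - 2 * x) v"
   proof (rule DERIV_nonneg_imp_nondecreasing[OF v])
    fix x :: real
    have "((\<lambda>x. exp x - exp (- x) - 2 * x) has_real_derivative exp x + exp (- x) - 2) (at x)"
     by (auto intro!: derivative_eq_intros)
    moreover have "exp x + exp (- x) - 2 \<ge> 0"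
     using exp_ge_add_one_self[of x] exp_ge_add_one_self[of "- x"] by linarith
    ultimately show "\<exists>y. ((\<lambda>x. exp x - exp (- x) - 2 * x) has_real_derivative y) (at x) \<and> 0 \<le> y" by blast
   qed
  qed
  then show ?thesis by (simp add: v_def)
 qed
 then show ?thesis using False by (simp add: expr2_def)
qed auto

lemma expr2_mono: assumes "0 \<le> u" "u \<le> v" shows "expr2 u \<le> expr2 v"
proof (rule DERIV_nonneg_imp_nondecreasing[OF assms(2)])
 fix x assume "u \<le> x"
 have "(expr2 has_real_derivative exp x - 1) (at x)"
  unfolding expr2_def[abs_def] by (auto intro!: derivative_eq_intros)
 moreover have "exp x - 1 \<ge> 0" using assms(1) \<open>u \<le> x\<close> by simp
 ultimately show "\<exists>y. (expr2 has_real_derivative y) (at x) \<and> 0 \<le> y" by blast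
qed

lemma exp_minus_one_le: "\<bar>exp u - 1\<bar> \<le> \<bar>u\<bar> * exp \<bar>u\<bar>" for u :: real
proof (cases "u \<ge> 0")
 case True
 have "(1 - u) * exp u \<le> exp (- u) * exp u"
  using exp_ge_add_one_self[of "- u"] by (intro mult_right_mono) auto
 then have "exp u - 1 \<le> u * exp u" by (simp add: algebra_simps exp_minus_inverse mult.commute)
 then show ?thesis using True by simp
next
 case False
 have "1 - exp u \<le> - u" using exp_ge_add_one_self[of u] by linarith
 also have "\<dots> \<le> - u * exp (- u)" using False by (simp add: mult_le_cancel_left1)
 finally show ?thesis using False by simp
qed

lemma expr2_le_square: "expr2 u \<le> u\<^sup>2 * exp \<bar>u\<bar>"
proof -
 define v where "v = \<bar>u\<bar>"
 have v: "v \<ge> 0" by (simp add: v_def)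
 have 1: "exp v - 1 \<le> v * exp v" using exp_minus_one_le[of v] v by simp
 have "exp v - 1 - v \<le> v * (exp v - 1)" using 1 by (simp add: algebra_simps)
 also have "\<dots> \<le> v * (v * exp v)" using 1 v by (intro mult_left_mono) auto
 finally have "expr2 v \<le> u\<^sup>2 * exp \<bar>u\<bar>" by (simp add: expr2_def v_def power2_eq_square mult.assoc[symmetric])
 then show ?thesis using expr2_abs[of u] by (simp add: v_def)
qed

lemma square_le_expr2: "u\<^sup>2 \<le> 2 * expr2 \<bar>u\<bar>"
proof -
 define v where "v = \<bar>u\<bar>"
 have v: "v \<ge> 0" by (simp add: v_def)
 have "1 + v + v\<^sup>2 / 2 \<le> exp v" using exp_lower_Taylor_quadratic[OF v] by (simp add: numeral_2_eq_2)
 then show ?thesis by (simp add: expr2_def v_def)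
qed

lemma expr2_add: "expr2 (a + c) \<le> (exp \<bar>c\<bar> + 1) * expr2 \<bar>a\<bar> + c\<^sup>2 * exp (2 * \<bar>c\<bar>) * 2"
proof -
 have "expr2 (a + c) = exp c * expr2 a + expr2 c + a * (exp c - 1)"
  by (simp add: expr2_def exp_add algebra_simps)
 also have "a * (exp c - 1) \<le> a\<^sup>2 / 2 + (exp c - 1)\<^sup>2 / 2"
  using sum_squares_bound[of a "exp c - 1"] by (simp add: power2_eq_square)
 also have "a\<^sup>2 / 2 \<le> expr2 \<bar>a\<bar>" using square_le_expr2[of a] by simp
 also have "exp c * expr2 a \<le> exp \<bar>c\<bar> * expr2 \<bar>a\<bar>"
  by (intro mult_mono expr2_abs expr2_nonneg) auto
 also have "(exp c - 1)\<^sup>2 \<le> (\<bar>c\<bar> * exp \<bar>c\<bar>)\<^sup>2"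
  using power_mono[OF exp_minus_one_le[of c], of 2] by simp
 also have "(\<bar>c\<bar> * exp \<bar>c\<bar>)\<^sup>2 = c\<^sup>2 * exp (2 * \<bar>c\<bar>)" by (simp add: power_mult_distrib exp_double)
 also have "expr2 c \<le> c\<^sup>2 * exp (2 * \<bar>c\<bar>)"
  by (rule order_trans[OF expr2_le_square]) (intro mult_left_mono, auto)
 finally have "expr2 (a + c) \<le> exp \<bar>c\<bar> * expr2 \<bar>a\<bar> + c\<^sup>2 * exp (2 * \<bar>c\<bar>) + (expr2 \<bar>a\<bar> + c\<^sup>2 * exp (2 * \<bar>c\<bar>) / 2)"
  by simp
 moreover have "c\<^sup>2 * exp (2 * \<bar>c\<bar>) \<ge> 0" by simp
 ultimately show ?thesis unfolding distrib_right by linarith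
qed

lemma expr2_ln:
 fixes b gm z :: real
 assumes "b > 0" "b \<le> gm" "z \<ge> 0"
 shows "expr2 (b * ln (1 + z)) \<le> (b\<^sup>2 * exp b + 2 powr b) * (z powr (3/2) + z powr gm)"
proof (cases "z \<le> 1")
 case True
 have l: "0 \<le> b * ln (1 + z)" "b * ln (1 + z) \<le> b * z" "b * ln (1 + z) \<le> b"
 proof -
  have l: "0 \<le> ln (1 + z)" "ln (1 + z) \<le> z" "ln (1 + z) \<le> 1"
   using assms ln_add_one_self_le_self[of z] True by auto
  show "0 \<le> b * ln (1 + z)" "b * ln (1 + z) \<le> b * z" "b * ln (1 + z) \<le> b"
   using l assms mult_left_mono[OF l(3), of b] by auto
 qed
 have "expr2 (b * ln (1 + z)) \<le> (b * ln (1 + z))\<^sup>2 * exp \<bar>b * ln (1 + z)\<bar>" by (rule expr2_le_square)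
 also have "\<dots> \<le> (b * z)\<^sup>2 * exp b" 
  by (rule mult_mono[OF power_mono[OF l(2,1)]]) (use l in auto)
 also have "\<dots> = b\<^sup>2 * exp b * z powr 2" using assms by (cases "z = 0") (auto simp: power_mult_distrib powr_numeral)
 also have "\<dots> \<le> b\<^sup>2 * exp b * z powr (3/2)"
  by (rule mult_left_mono[OF powr_mono']) (use True assms in simp_all)
 also have "\<dots> \<le> (b\<^sup>2 * exp b + 2 powr b) * (z powr (3/2) + z powr gm)"
  by (intro mult_mono) auto
 finally show ?thesis .
next
 case False
 have "0 \<le> b * ln (1 + z)" using assms by simp
 then have "expr2 (b * ln (1 + z)) \<le> exp (b * ln (1 + z))" by (simp add: expr2_def)
 also have "\<dots> = (1 + z) powr b" using assms by (simp add: powr_def)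
 also have "\<dots> \<le> (2 * z) powr b" using assms False by (intro powr_mono2) auto
 also have "\<dots> = 2 powr b * z powr b" using assms by (simp add: powr_mult)
 also have "\<dots> \<le> 2 powr b * z powr gm" using assms False by (intro mult_left_mono powr_mono) auto
 also have "\<dots> \<le> (b\<^sup>2 * exp b + 2 powr b) * (z powr (3/2) + z powr gm)"
  by (intro mult_mono) auto
 finally show ?thesis .
qed

lemma expr2_kernel:
 fixes b gm q q' kp h H :: real
 assumes "b > 0" "b \<le> gm" "q > 0" "q' > 0" "\<bar>q' - q\<bar> \<le> kp" "\<bar>h\<bar> \<le> H"
 shows "expr2 (b * (ln (q' / q) + h)) \<le> (exp (b * H) + 1) * (b\<^sup>2 * exp b + 2 powr b) *
   ((kp / q) powr (3/2) + (kp / q) powr gm + (kp / q') powr (3/2) + (kp / q') powr gm)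
   + 2 * b\<^sup>2 * exp (2 * b * H) * h\<^sup>2"
proof -
 define A where "A = b\<^sup>2 * exp b + 2 powr b"
 have A: "A \<ge> 0" by (simp add: A_def)
 define S where "S = (kp / q) powr (3/2) + (kp / q) powr gm + (kp / q') powr (3/2) + (kp / q') powr gm"
 have k: "kp \<ge> 0" using assms by linarith
 have 1: "expr2 \<bar>b * ln (q' / q)\<bar> \<le> A * S"
 proof (cases "q \<le> q'")
  case True
  have "q' / q \<le> 1 + kp / q" using assms by (simp add: field_simps)
  then have "ln (q' / q) \<le> ln (1 + kp / q)" using assms k by (subst ln_le_cancel_iff) (auto intro: add_pos_nonneg)
  moreover have "ln (q' / q) \<ge> 0" using True assms by (intro ln_ge_zero) simp
  ultimately have "expr2 \<bar>b * ln (q' / q)\<bar> \<le> expr2 (b * ln (1 + kp / q))"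
   using assms by (intro expr2_mono) (auto simp: abs_mult)
  also have "\<dots> \<le> A * ((kp / q) powr (3/2) + (kp / q) powr gm)" unfolding A_def
   using assms k by (intro expr2_ln) auto
  also have "\<dots> \<le> A * S" unfolding S_def using A by (intro mult_left_mono) auto
  finally show ?thesis .
 next
  case False
  have "q / q' \<le> 1 + kp / q'" using assms by (simp add: field_simps)
  then have "ln (q / q') \<le> ln (1 + kp / q')" using assms k by (subst ln_le_cancel_iff) (auto intro: add_pos_nonneg)
  moreover have "ln (q / q') \<ge> 0" using False assms by (intro ln_ge_zero) simp
  moreover have "ln (q' / q) = - ln (q / q')" using assms by (simp add: ln_div)
  ultimately have "expr2 \<bar>b * ln (q' / q)\<bar> \<le> expr2 (b * ln (1 + kp / q'))"
   using assms by (intro expr2_mono) (auto simp: abs_mult)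
  also have "\<dots> \<le> A * ((kp / q') powr (3/2) + (kp / q') powr gm)" unfolding A_def
   using assms k by (intro expr2_ln) auto
  also have "\<dots> \<le> A * S" unfolding S_def using A by (intro mult_left_mono) auto
  finally show ?thesis .
 qed
 have S: "S \<ge> 0" by (simp add: S_def)
 have bh: "\<bar>b * h\<bar> \<le> b * H" using assms by (simp add: abs_mult)
 have "expr2 (b * (ln (q' / q) + h)) \<le> (exp \<bar>b * h\<bar> + 1) * expr2 \<bar>b * ln (q' / q)\<bar> + (b * h)\<^sup>2 * exp (2 * \<bar>b * h\<bar>) * 2"
  using expr2_add[of "b * ln (q' / q)" "b * h"] by (simp add: distrib_left)
 also have "\<dots> \<le> (exp (b * H) + 1) * (A * S) + (b * h)\<^sup>2 * exp (2 * (b * H)) * 2"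
  using bh 1 A S by (intro add_mono mult_mono mult_left_mono) (auto simp: expr2_nonneg)
 finally show ?thesis by (simp add: A_def S_def power_mult_distrib mult_ac)
qed

section \<open>Interaction of kernels at different scales\<close>

definition near :: "real => 'a::euclidean_space => 'a => ennreal" where
 "near r x y = indicator {..2 * r} (norm (x - y))"

lemma near_measurable [measurable (raw)]:
 assumes [measurable]: "f \<in> borel_measurable M" "g \<in> borel_measurable M"
 shows "(\<lambda>x. near r (f x) (g x)) \<in> borel_measurable M"
 unfolding near_def by measurable

lemma near_eq: "near r x y = indicator (cball x (2 * r)) y"
 by (auto simp: near_def indicator_def dist_norm)

lemma nn_integral_lborel_pair:
 fixes f :: "'a::euclidean_space \<times> 'b::euclidean_space => ennreal"
 assumes "f \<in> borel_measurable borel"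
 shows "(\<integral>\<^sup>+ z. f z \<partial>lborel) = (\<integral>\<^sup>+ x. \<integral>\<^sup>+ y. f (x, y) \<partial>lborel \<partial>lborel)"
proof -
 have "f \<in> borel_measurable (lborel \<Otimes>\<^sub>M lborel)" using assms by (simp add: lborel_prod)
 from lborel.nn_integral_fst[OF this] show ?thesis by (simp add: lborel_prod)
qed

lemma borel_quad: "(borel :: (('a::euclidean_space \<times> 'a) \<times> ('a \<times> 'a)) measure) = (borel \<Otimes>\<^sub>M borel) \<Otimes>\<^sub>M (borel \<Otimes>\<^sub>M borel)"
 by (simp add: borel_prod)

lemma nn_integral_quad:
 fixes f :: "('a::euclidean_space \<times> 'a) \<times> ('a \<times> 'a) => ennreal"
 assumes f: "f \<in> borel_measurable borel"
 shows "(\<integral>\<^sup>+ zz. f zz \<partial>lborel) = (\<integral>\<^sup>+ x. \<integral>\<^sup>+ x'. \<integral>\<^sup>+ y. \<integral>\<^sup>+ y'. f ((x, y), (x', y')) \<partial>lborel \<partial>lborel \<partial>lborel \<partial>lborel)"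
proof -
 have [measurable]: "f \<in> borel_measurable ((borel \<Otimes>\<^sub>M borel) \<Otimes>\<^sub>M (borel \<Otimes>\<^sub>M borel))"
  using f by (simp add: borel_quad)
 have "sets ((borel::('a \<times> 'a) measure) \<Otimes>\<^sub>M (lborel::('a \<times> 'a) measure)) = sets (borel \<Otimes>\<^sub>M (borel::('a \<times> 'a) measure))"
  by (rule sets_pair_measure_cong) auto
 then have "sets ((borel::('a \<times> 'a) measure) \<Otimes>\<^sub>M (lborel::('a \<times> 'a) measure)) = sets (borel :: (('a \<times> 'a) \<times> ('a \<times> 'a)) measure)"
  unfolding borel_prod .
 then have "(\<lambda>(z, z'). f (z, z')) \<in> borel_measurable ((borel::('a \<times> 'a) measure) \<Otimes>\<^sub>M (lborel::('a \<times> 'a) measure))"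
  using f by (simp cong: measurable_cong_sets)
 then have 1: "(\<lambda>z. \<integral>\<^sup>+ z'. f (z, z') \<partial>lborel) \<in> borel_measurable borel"
  by (rule lborel.borel_measurable_nn_integral)
 have 2: "(\<lambda>z'. f (z, z')) \<in> borel_measurable borel" for z
  by (rule measurable_compose[OF _ f]) (intro borel_measurable_continuous_onI continuous_intros)
 have "(\<integral>\<^sup>+ zz. f zz \<partial>lborel) = (\<integral>\<^sup>+ z. \<integral>\<^sup>+ z'. f (z, z') \<partial>lborel \<partial>lborel)"
  by (rule nn_integral_lborel_pair[OF f])
 also have "\<dots> = (\<integral>\<^sup>+ x. \<integral>\<^sup>+ y. \<integral>\<^sup>+ z'. f ((x, y), z') \<partial>lborel \<partial>lborel \<partial>lborel)"
  by (rule nn_integral_lborel_pair[OF 1])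
 also have "\<dots> = (\<integral>\<^sup>+ x. \<integral>\<^sup>+ y. \<integral>\<^sup>+ x'. \<integral>\<^sup>+ y'. f ((x, y), (x', y')) \<partial>lborel \<partial>lborel \<partial>lborel \<partial>lborel)"
  by (intro nn_integral_cong nn_integral_lborel_pair 2)
 also have "\<dots> = (\<integral>\<^sup>+ x. \<integral>\<^sup>+ x'. \<integral>\<^sup>+ y. \<integral>\<^sup>+ y'. f ((x, y), (x', y')) \<partial>lborel \<partial>lborel \<partial>lborel \<partial>lborel)"
  by (intro nn_integral_cong lborel_pair.Fubini') measurable
 finally show ?thesis .
qed

lemma AE_lborel_neq: "AE y in lborel. y \<noteq> (w::'a::euclidean_space)"
 by (rule AE_lborel_singleton)

lemma riesz_quad:
 fixes gm R :: real and F :: "'a::euclidean_space set"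
 assumes gm: "1 < gm" "gm < DIM('a)" and R: "R > 0" and d: "DIM('a) \<ge> 2"
  and F: "compact F" "\<And>x x'. x \<in> F ==> x' \<in> F ==> dist x x' \<le> R"
 shows "\<exists>A\<ge>0. \<forall>r s. 0 < r \<longrightarrow> 0 < s \<longrightarrow> s \<le> R \<longrightarrow>
  (\<integral>\<^sup>+ zz. (case zz of ((x, y), (x', y')) => indicator F x * indicator F x' * near r x y * near s x' y' *
    (riesz gm (x - x') * riesz gm (y - y'))) \<partial>lborel) \<le> ennreal (A * (r * s) ^ DIM('a) * s powr (2 - 2 * gm)) \<and>
  (\<integral>\<^sup>+ zz. (case zz of ((x, y), (x', y')) => indicator F x * indicator F x' * near r x y * near s x' y' *
    (riesz gm (x - y') * riesz gm (y - x'))) \<partial>lborel) \<le> ennreal (A * (r * s) ^ DIM('a) * s powr (2 - 2 * gm))"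
proof -
 have [measurable]: "F \<in> sets borel" using F by (simp add: compact_imp_closed borel_closed)
 obtain A1 where A1: "A1 > 0" "\<And>r (x::'a) w. r > 0 ==>
  (\<integral>\<^sup>+ y. riesz gm (y - w) * indicator (cball x (2 * r)) y \<partial>lborel)
   \<le> ennreal (A1 * r ^ DIM('a) * (max r (norm (x - w))) powr (- gm))"
  by (rule riesz_average[where ?'a = 'a and gm = gm]) (use gm in auto)
 have avg: "(\<integral>\<^sup>+ y. near r x y * riesz gm (y - w) \<partial>lborel) \<le> ennreal (A1 * r ^ DIM('a)) * ennreal ((max r (norm (x - w))) powr (- gm))"
  if "r > 0" for r and x w :: 'a
  using A1(2)[OF that, of w x] A1(1) that by (simp add: near_eq mult.commute ennreal_mult[symmetric])
 have avg': "(\<integral>\<^sup>+ y. near r x y * riesz gm (y - w) \<partial>lborel) \<le> ennreal (A1 * r ^ DIM('a)) * riesz gm (x - w)"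
  if "r > 0" "x \<noteq> w" for r and x w :: 'a
 proof -
  have "ennreal ((max r (norm (x - w))) powr (- gm)) \<le> riesz gm (x - w)"
   unfolding riesz_def using that gm by (intro ennreal_leI powr_mono2') auto
  then show ?thesis using avg[OF that(1), of x w] by (meson mult_left_mono order_trans zero_le)
 qed
 obtain A3 where A3: "A3 > 0" "\<And>r (w::'a). 0 < r ==> r \<le> R ==>
  (\<integral>\<^sup>+ x. riesz gm (x - w) * ennreal ((max r (norm (x - w))) powr (- gm)) * indicator (cball w R) x \<partial>lborel)
   \<le> ennreal (A3 * r powr (2 - 2 * gm))"
  by (rule riesz_double[where ?'a = 'a and gm = gm and R = R]) (use gm R d in auto)
 obtain vF where vF: "vF \<ge> 0" "emeasure lborel F = ennreal vF"
  using emeasure_compact_finite[OF F(1)] by (metis ennreal_cases infinity_ennreal_def less_irrefl)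
 define A where "A = A1 * A1 * A3 * vF"
 define c where "c = (\<lambda>r s::real. ennreal (A1 * r ^ DIM('a)) * ennreal (A1 * s ^ DIM('a)))"
 have main: "(\<integral>\<^sup>+ zz. f zz \<partial>lborel) \<le> ennreal (A * (r * s) ^ DIM('a) * s powr (2 - 2 * gm))"
  if r: "0 < r" "0 < s" "s \<le> R" and [measurable]: "f \<in> borel_measurable borel"
  and J: "\<And>x x'. x \<noteq> x' ==> (\<integral>\<^sup>+ y. \<integral>\<^sup>+ y'. f ((x, y), (x', y')) \<partial>lborel \<partial>lborel)
   \<le> indicator F x * indicator F x' * (c r s * riesz gm (x' - x) * ennreal ((max s (norm (x' - x))) powr (- gm)))"
  for r s and f :: "('a \<times> 'a) \<times> ('a \<times> 'a) => ennreal"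
 proof -
  have "(\<integral>\<^sup>+ zz. f zz \<partial>lborel) = (\<integral>\<^sup>+ x. \<integral>\<^sup>+ x'. \<integral>\<^sup>+ y. \<integral>\<^sup>+ y'. f ((x, y), (x', y')) \<partial>lborel \<partial>lborel \<partial>lborel \<partial>lborel)"
   by (rule nn_integral_quad) fact
  also have "\<dots> \<le> (\<integral>\<^sup>+ x. indicator F x * (c r s * ennreal (A3 * s powr (2 - 2 * gm))) \<partial>lborel)"
  proof (intro nn_integral_mono)
   fix x :: 'a
   have "(\<integral>\<^sup>+ x'. \<integral>\<^sup>+ y. \<integral>\<^sup>+ y'. f ((x, y), (x', y')) \<partial>lborel \<partial>lborel \<partial>lborel)
    \<le> (\<integral>\<^sup>+ x'. (indicator F x * c r s) * (riesz gm (x' - x) * ennreal ((max s (norm (x' - x))) powr (- gm)) * indicator (cball x R) x') \<partial>lborel)"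
   proof (intro nn_integral_mono_AE, use AE_lborel_neq[of x] in eventually_elim)
    fix x' assume "x' \<noteq> x"
    then have "(\<integral>\<^sup>+ y. \<integral>\<^sup>+ y'. f ((x, y), (x', y')) \<partial>lborel \<partial>lborel)
     \<le> indicator F x * indicator F x' * (c r s * riesz gm (x' - x) * ennreal ((max s (norm (x' - x))) powr (- gm)))"
     by (intro J) auto
    also have "\<dots> \<le> indicator F x * indicator (cball x R) x' * (c r s * riesz gm (x' - x) * ennreal ((max s (norm (x' - x))) powr (- gm)))"
     using F(2)[of x x'] by (intro mult_right_mono) (auto simp: indicator_def)
    finally show "(\<integral>\<^sup>+ y. \<integral>\<^sup>+ y'. f ((x, y), (x', y')) \<partial>lborel \<partial>lborel) \<le>
     (indicator F x * c r s) * (riesz gm (x' - x) * ennreal ((max s (norm (x' - x))) powr (- gm)) * indicator (cball x R) x')"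
     by (simp add: mult_ac)
   qed
   also have "\<dots> = indicator F x * c r s * (\<integral>\<^sup>+ x'. riesz gm (x' - x) * ennreal ((max s (norm (x' - x))) powr (- gm)) * indicator (cball x R) x' \<partial>lborel)"
    by (intro nn_integral_cmult) measurable
   also have "\<dots> \<le> indicator F x * c r s * ennreal (A3 * s powr (2 - 2 * gm))"
    by (intro mult_left_mono A3 r) auto
   finally show "(\<integral>\<^sup>+ x'. \<integral>\<^sup>+ y. \<integral>\<^sup>+ y'. f ((x, y), (x', y')) \<partial>lborel \<partial>lborel \<partial>lborel) \<le> indicator F x * (c r s * ennreal (A3 * s powr (2 - 2 * gm)))"
    by (simp add: mult.assoc)
  qed
  also have "\<dots> = ennreal vF * (c r s * ennreal (A3 * s powr (2 - 2 * gm)))"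
   by (subst nn_integral_multc) (auto simp: vF)
  also have "\<dots> = ennreal (A * (r * s) ^ DIM('a) * s powr (2 - 2 * gm))"
   using A1(1) A3(1) r vF(1) by (simp add: c_def A_def ennreal_mult[symmetric] power_mult_distrib mult_ac)
  finally show ?thesis .
 qed
 show ?thesis
 proof (intro exI[of _ A] conjI allI impI)
  show "A \<ge> 0" using A1 A3 vF by (simp add: A_def)
  fix r s :: real assume r: "0 < r" "0 < s" "s \<le> R"
  show "(\<integral>\<^sup>+ zz. (case zz of ((x, y), (x', y')) => indicator F x * indicator F x' * near r x y * near s x' y' *
    (riesz gm (x - x') * riesz gm (y - y'))) \<partial>lborel) \<le> ennreal (A * (r * s) ^ DIM('a) * s powr (2 - 2 * gm))"
  proof (rule main[OF r])
   fix x x' :: 'a assume "x \<noteq> x'"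
   define k where "k = indicator F x * indicator F x' * riesz gm (x' - x)"
   have "(\<integral>\<^sup>+ y. \<integral>\<^sup>+ y'. (case ((x, y), (x', y')) of ((x, y), (x', y')) => indicator F x * indicator F x' * near r x y * near s x' y' *
    (riesz gm (x - x') * riesz gm (y - y'))) \<partial>lborel \<partial>lborel)
    = (\<integral>\<^sup>+ y'. \<integral>\<^sup>+ y. (k * near s x' y') * (near r x y * riesz gm (y - y')) \<partial>lborel \<partial>lborel)"
    by (subst lborel_pair.Fubini') (auto simp: k_def mult_ac riesz_minus[of gm x x'])
   also have "\<dots> = (\<integral>\<^sup>+ y'. (k * near s x' y') * (\<integral>\<^sup>+ y. near r x y * riesz gm (y - y') \<partial>lborel) \<partial>lborel)"
    by (intro nn_integral_cong nn_integral_cmult) measurable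
   also have "\<dots> \<le> (\<integral>\<^sup>+ y'. (k * ennreal (A1 * r ^ DIM('a))) * (near s x' y' * riesz gm (y' - x)) \<partial>lborel)"
   proof (intro nn_integral_mono_AE, use AE_lborel_neq[of x] in eventually_elim)
    fix y' assume "y' \<noteq> x"
    then have "(k * near s x' y') * (\<integral>\<^sup>+ y. near r x y * riesz gm (y - y') \<partial>lborel) \<le> (k * near s x' y') * (ennreal (A1 * r ^ DIM('a)) * riesz gm (x - y'))"
     by (intro mult_left_mono avg' r) auto
    then show "(k * near s x' y') * (\<integral>\<^sup>+ y. near r x y * riesz gm (y - y') \<partial>lborel) \<le> (k * ennreal (A1 * r ^ DIM('a))) * (near s x' y' * riesz gm (y' - x))"
     by (simp add: mult_ac riesz_minus[of gm x y'])
   qed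
   also have "\<dots> = (k * ennreal (A1 * r ^ DIM('a))) * (\<integral>\<^sup>+ y'. near s x' y' * riesz gm (y' - x) \<partial>lborel)"
    by (intro nn_integral_cmult) measurable
   also have "\<dots> \<le> (k * ennreal (A1 * r ^ DIM('a))) * (ennreal (A1 * s ^ DIM('a)) * ennreal ((max s (norm (x' - x))) powr (- gm)))"
    by (intro mult_left_mono avg r) auto
   finally show "(\<integral>\<^sup>+ y. \<integral>\<^sup>+ y'. (case ((x, y), (x', y')) of ((x, y), (x', y')) => indicator F x * indicator F x' * near r x y * near s x' y' *
    (riesz gm (x - x') * riesz gm (y - y'))) \<partial>lborel \<partial>lborel) \<le> indicator F x * indicator F x' * (c r s * riesz gm (x' - x) * ennreal ((max s (norm (x' - x))) powr (- gm)))"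
    by (simp add: k_def c_def mult_ac)
  qed (unfold borel_quad, measurable)
  show "(\<integral>\<^sup>+ zz. (case zz of ((x, y), (x', y')) => indicator F x * indicator F x' * near r x y * near s x' y' *
    (riesz gm (x - y') * riesz gm (y - x'))) \<partial>lborel) \<le> ennreal (A * (r * s) ^ DIM('a) * s powr (2 - 2 * gm))"
  proof (rule main[OF r])
   fix x x' :: 'a assume ne: "x \<noteq> x'"
   define k :: ennreal where "k = indicator F x * indicator F x'"
   have "(\<integral>\<^sup>+ y. \<integral>\<^sup>+ y'. (case ((x, y), (x', y')) of ((x, y), (x', y')) => indicator F x * indicator F x' * near r x y * near s x' y' *
    (riesz gm (x - y') * riesz gm (y - x'))) \<partial>lborel \<partial>lborel)
    = (\<integral>\<^sup>+ y. \<integral>\<^sup>+ y'. (k * (near r x y * riesz gm (y - x'))) * (near s x' y' * riesz gm (y' - x)) \<partial>lborel \<partial>lborel)"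
    by (auto simp: k_def mult_ac riesz_minus[of gm x] intro!: nn_integral_cong)
   also have "\<dots> = (\<integral>\<^sup>+ y. (k * (near r x y * riesz gm (y - x'))) * (\<integral>\<^sup>+ y'. near s x' y' * riesz gm (y' - x) \<partial>lborel) \<partial>lborel)"
    by (intro nn_integral_cong nn_integral_cmult) measurable
   also have "\<dots> = k * (\<integral>\<^sup>+ y. near r x y * riesz gm (y - x') \<partial>lborel) * (\<integral>\<^sup>+ y'. near s x' y' * riesz gm (y' - x) \<partial>lborel)"
    by (subst nn_integral_multc, measurable, subst nn_integral_cmult, measurable)
   also have "\<dots> \<le> k * (ennreal (A1 * r ^ DIM('a)) * riesz gm (x - x')) * (ennreal (A1 * s ^ DIM('a)) * ennreal ((max s (norm (x' - x))) powr (- gm)))"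
    by (intro mult_mono mult_left_mono avg avg' r ne) auto
   finally show "(\<integral>\<^sup>+ y. \<integral>\<^sup>+ y'. (case ((x, y), (x', y')) of ((x, y), (x', y')) => indicator F x * indicator F x' * near r x y * near s x' y' *
    (riesz gm (x - y') * riesz gm (y - x'))) \<partial>lborel \<partial>lborel) \<le> indicator F x * indicator F x' * (c r s * riesz gm (x' - x) * ennreal ((max s (norm (x' - x))) powr (- gm)))"
    by (simp add: k_def c_def mult_ac riesz_minus[of gm x x'])
  qed (unfold borel_quad, measurable)
 qed
qed

lemma measurable_near_quad [measurable]:
 assumes [measurable]: "F \<in> sets borel"
 shows "(\<lambda>zz. (case zz of ((x, y), (x', y')) => indicator F x * indicator F x' * near r x y * near s x' y')) \<in> borel_measurable ((borel \<Otimes>\<^sub>M borel) \<Otimes>\<^sub>M (borel \<Otimes>\<^sub>M borel))"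
 by measurable

lemma near_quad:
 fixes F :: "'a::euclidean_space set"
 assumes F: "compact F"
 obtains A where "A \<ge> 0" "\<And>r s. 0 < r ==> 0 < s ==>
  (\<integral>\<^sup>+ zz. (case zz of ((x, y), (x', y')) => indicator F x * indicator F x' * near r x y * near s x' y') \<partial>lborel) \<le> ennreal (A * (r * s) ^ DIM('a))"
proof -
 have [measurable]: "F \<in> sets borel" using F by (simp add: compact_imp_closed borel_closed)
 obtain vF where vF: "vF \<ge> 0" "emeasure lborel F = ennreal vF"
  using emeasure_compact_finite[OF F(1)] by (metis ennreal_cases infinity_ennreal_def less_irrefl)
 define v where "v = unit_ball_vol (DIM('a)) * 2 ^ DIM('a)"
 have v: "v \<ge> 0" by (simp add: v_def)
 have nr: "(\<integral>\<^sup>+ y. near r x y \<partial>lborel) = ennreal (v * r ^ DIM('a))" if "r > 0" for r and x :: 'a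
  using that by (simp add: near_eq emeasure_cball_scale v_def power_mult_distrib mult.assoc)
 show ?thesis
 proof (rule that)
  show "vF * vF * v * v \<ge> 0" using vF v by simp
  fix r s :: real assume r: "0 < r" "0 < s"
  have m: "(\<lambda>zz. (case zz of ((x, y), (x', y')) => indicator F x * indicator F x' * near r x y * near s x' y')) \<in> borel_measurable (borel::(('a \<times> 'a) \<times> ('a \<times> 'a)) measure)"
   unfolding borel_quad by measurable
  have "(\<integral>\<^sup>+ zz. (case zz of ((x, y), (x', y')) => indicator F x * indicator F x' * near r x y * near s x' y') \<partial>(lborel::(('a \<times> 'a) \<times> ('a \<times> 'a)) measure))
   = (\<integral>\<^sup>+ x. \<integral>\<^sup>+ x'. \<integral>\<^sup>+ y. \<integral>\<^sup>+ y'. indicator F x * indicator F x' * near r x y * near s x' y' \<partial>lborel \<partial>lborel \<partial>lborel \<partial>lborel)"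
   by (subst nn_integral_quad[OF m]) simp
  also have "\<dots> = (\<integral>\<^sup>+ x. \<integral>\<^sup>+ x'. indicator F x * indicator F x' * ennreal (v * r ^ DIM('a)) * ennreal (v * s ^ DIM('a)) \<partial>lborel \<partial>(lborel::'a measure))"
   using r by (simp add: nn_integral_cmult nn_integral_multc nr)
  also have "\<dots> = ennreal vF * ennreal vF * ennreal (v * r ^ DIM('a)) * ennreal (v * s ^ DIM('a))"
   by (simp add: nn_integral_cmult nn_integral_multc vF)
  also have "\<dots> = ennreal (vF * vF * v * v * (r * s) ^ DIM('a))"
   using vF v r by (simp add: ennreal_mult[symmetric] power_mult_distrib mult_ac)
  finally show "(\<integral>\<^sup>+ zz. (case zz of ((x, y), (x', y')) => indicator F x * indicator F x' * near r x y * near s x' y') \<partial>(lborel::(('a \<times> 'a) \<times> ('a \<times> 'a)) measure))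
   \<le> ennreal (vF * vF * v * v * (r * s) ^ DIM('a))" by simp
 qed
qed

lemma AE_lborel_inner_neq:
 fixes a :: "'a::euclidean_space"
 assumes "a \<noteq> 0" shows "AE z in lborel. a \<bullet> z \<noteq> 0"
proof -
 have "negligible {z. a \<bullet> z = 0}" using assms by (intro negligible_hyperplane) auto
 then have "AE z in lebesgue. z \<notin> {z. a \<bullet> z = 0}" by (intro AE_not_in) (simp add: negligible_iff_null_sets)
 then show ?thesis by (subst (asm) AE_completion_iff) auto
qed

lemma AE_quad_neq:
 "AE zz in (lborel :: (('a::euclidean_space \<times> 'a) \<times> ('a \<times> 'a)) measure).
  fst (fst zz) \<noteq> fst (snd zz) \<and> snd (fst zz) \<noteq> snd (snd zz) \<and> fst (fst zz) \<noteq> snd (snd zz) \<and> snd (fst zz) \<noteq> fst (snd zz)"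
proof -
 obtain b :: 'a where b: "b \<in> Basis" using nonempty_Basis by blast
 then have "b \<noteq> 0" by auto
 have "AE zz in (lborel :: (('a \<times> 'a) \<times> ('a \<times> 'a)) measure). ((b, 0), (- b, 0)) \<bullet> zz \<noteq> 0"
  "AE zz in (lborel :: (('a \<times> 'a) \<times> ('a \<times> 'a)) measure). ((0, b), (0, - b)) \<bullet> zz \<noteq> 0"
  "AE zz in (lborel :: (('a \<times> 'a) \<times> ('a \<times> 'a)) measure). ((b, 0), (0, - b)) \<bullet> zz \<noteq> 0"
  "AE zz in (lborel :: (('a \<times> 'a) \<times> ('a \<times> 'a)) measure). ((0, b), (- b, 0)) \<bullet> zz \<noteq> 0"
  using \<open>b \<noteq> 0\<close> by (auto intro!: AE_lborel_inner_neq simp: zero_prod_def)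
 then show ?thesis by eventually_elim (auto simp: inner_prod_def)
qed

lemma kernel_pair_bound:
 fixes F :: "'a::euclidean_space set" and b M L R0 :: real
 assumes b: "0 < b" "b < DIM('a)" and d: "DIM('a) \<ge> 2" and F: "compact F" and L: "L \<ge> 0" and R0: "R0 > 0"
 obtains A where "A \<ge> 0" "\<And>r s (k :: 'a \<times> 'a => real) k' \<Phi>. 0 < r ==> r \<le> s ==> s \<le> R0 ==>
  (\<And>x y. \<bar>k (x, y)\<bar> \<le> (if x \<in> F \<and> norm (x - y) \<le> 2 * r then M / r ^ Suc (DIM('a)) else 0)) ==>
  (\<And>x y. \<bar>k' (x, y)\<bar> \<le> (if x \<in> F \<and> norm (x - y) \<le> 2 * s then M / s ^ Suc (DIM('a)) else 0)) ==>
  (\<And>x y x' y'. x \<in> F ==> x' \<in> F ==> norm (x - y) \<le> 2 * r ==> norm (x' - y') \<le> 2 * s ==>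
    x \<noteq> x' ==> y \<noteq> y' ==> x \<noteq> y' ==> y \<noteq> x' ==>
    \<exists>h. \<bar>h\<bar> \<le> L * r \<and> \<Phi> ((x, y), (x', y')) =
     expr2 (b * (ln ((norm (x - y') * norm (y - x')) / (norm (x - x') * norm (y - y'))) + h))) ==>
  (\<integral>\<^sup>+ zz. ennreal (\<bar>k (fst zz)\<bar> * \<bar>k' (snd zz)\<bar> * \<Phi> zz) \<partial>lborel) \<le> ennreal (A * sqrt (r / s))"
proof -
 have [measurable]: "F \<in> sets borel" using F by (simp add: compact_imp_closed borel_closed)
 let ?d = "DIM('a)"
 define gm where "gm = max b (3/2)"
 have gm: "b \<le> gm" "3/2 \<le> gm" "gm < ?d" using b d by (auto simp: gm_def)
 have d32: "3/2 < real ?d" using d by linarith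
 define R where "R = max R0 (diameter F)"
 have R: "R > 0" "R0 \<le> R" using R0 by (auto simp: R_def)
 have FR: "dist x x' \<le> R" if "x \<in> F" "x' \<in> F" for x x'
  using diameter_bounded_bound[OF compact_imp_bounded[OF F] that] by (simp add: R_def)
 define T0 where "T0 = (\<lambda>r s (zz :: ('a \<times> 'a) \<times> ('a \<times> 'a)). (case zz of ((x, y), (x', y')) => indicator F x * indicator F x' * near r x y * near s x' y'))"
 define T1 where "T1 = (\<lambda>gm r s (zz :: ('a \<times> 'a) \<times> ('a \<times> 'a)). (case zz of ((x, y), (x', y')) => indicator F x * indicator F x' * near r x y * near s x' y' * (riesz gm (x - x') * riesz gm (y - y'))))"
 define T2 where "T2 = (\<lambda>gm r s (zz :: ('a \<times> 'a) \<times> ('a \<times> 'a)). (case zz of ((x, y), (x', y')) => indicator F x * indicator F x' * near r x y * near s x' y' * (riesz gm (x - y') * riesz gm (y - x'))))"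
 have [measurable]: "T0 r s \<in> borel_measurable borel" "T1 gm r s \<in> borel_measurable borel" "T2 gm r s \<in> borel_measurable borel" for r s gm
  unfolding T0_def T1_def T2_def borel_quad by measurable
 obtain A0 where A0: "A0 \<ge> 0" "\<And>r s. 0 < r ==> 0 < s ==> (\<integral>\<^sup>+ zz. T0 r s zz \<partial>lborel) \<le> ennreal (A0 * (r * s) ^ ?d)"
  unfolding T0_def by (rule near_quad[OF F]) blast
 have ex: "\<exists>A\<ge>0. \<forall>r s. 0 < r \<longrightarrow> 0 < s \<longrightarrow> s \<le> R \<longrightarrow>
   (\<integral>\<^sup>+ zz. T1 gm r s zz \<partial>lborel) \<le> ennreal (A * (r * s) ^ ?d * s powr (2 - 2 * gm)) \<and>
   (\<integral>\<^sup>+ zz. T2 gm r s zz \<partial>lborel) \<le> ennreal (A * (r * s) ^ ?d * s powr (2 - 2 * gm))"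
  if gg: "1 < gm" "gm < real ?d" for gm :: real
  using riesz_quad[OF gg R(1) d F FR] unfolding T1_def T2_def .
 obtain A1 where A1: "A1 \<ge> 0" "\<And>r s. 0 < r ==> 0 < s ==> s \<le> R ==> (\<integral>\<^sup>+ zz. T1 (3/2) r s zz \<partial>lborel) \<le> ennreal (A1 * (r * s) ^ ?d * s powr (2 - 2 * (3/2)))"
  "\<And>r s. 0 < r ==> 0 < s ==> s \<le> R ==> (\<integral>\<^sup>+ zz. T2 (3/2) r s zz \<partial>lborel) \<le> ennreal (A1 * (r * s) ^ ?d * s powr (2 - 2 * (3/2)))"
  using ex[of "3/2"] d32 by auto
 obtain A2 where A2: "A2 \<ge> 0" "\<And>r s. 0 < r ==> 0 < s ==> s \<le> R ==> (\<integral>\<^sup>+ zz. T1 gm r s zz \<partial>lborel) \<le> ennreal (A2 * (r * s) ^ ?d * s powr (2 - 2 * gm))"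
  "\<And>r s. 0 < r ==> 0 < s ==> s \<le> R ==> (\<integral>\<^sup>+ zz. T2 gm r s zz \<partial>lborel) \<le> ennreal (A2 * (r * s) ^ ?d * s powr (2 - 2 * gm))"
  using ex[of gm] gm by auto
 define H where "H = L * R0"
 define K1 where "K1 = (exp (b * H) + 1) * (b\<^sup>2 * exp b + 2 powr b)"
 define K2 where "K2 = 2 * b\<^sup>2 * exp (2 * b * H) * L\<^sup>2"
 have K: "K1 \<ge> 0" "K2 \<ge> 0" by (auto simp: K1_def K2_def)
 define A where "A = M\<^sup>2 * (K1 * (2 * 4 powr (3/2) * A1 + 2 * 4 powr gm * A2) + K2 * A0)"
 show ?thesis
 proof (rule that)
  show "A \<ge> 0" using A0 A1 A2 K by (simp add: A_def)
  fix r s :: real and k k' :: "'a \<times> 'a => real" and \<Phi>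
  assume r: "0 < r" "r \<le> s" "s \<le> R0"
   and k: "\<And>x y. \<bar>k (x, y)\<bar> \<le> (if x \<in> F \<and> norm (x - y) \<le> 2 * r then M / r ^ Suc ?d else 0)"
   and k': "\<And>x y. \<bar>k' (x, y)\<bar> \<le> (if x \<in> F \<and> norm (x - y) \<le> 2 * s then M / s ^ Suc ?d else 0)"
   and \<Phi>: "\<And>x y x' y'. x \<in> F ==> x' \<in> F ==> norm (x - y) \<le> 2 * r ==> norm (x' - y') \<le> 2 * s ==>
    x \<noteq> x' ==> y \<noteq> y' ==> x \<noteq> y' ==> y \<noteq> x' ==>
    \<exists>h. \<bar>h\<bar> \<le> L * r \<and> \<Phi> ((x, y), (x', y')) =
     expr2 (b * (ln ((norm (x - y') * norm (y - x')) / (norm (x - x') * norm (y - y'))) + h))"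
  have s: "s > 0" "s \<le> R" using r R by auto
  define kp where "kp = 4 * (r * s)"
  have kp: "kp > 0" using r s by (simp add: kp_def)
  define m where "m = M\<^sup>2 / (r * s) ^ Suc ?d"
  have m: "m \<ge> 0" using r s by (simp add: m_def)
  have "(\<integral>\<^sup>+ zz. ennreal (\<bar>k (fst zz)\<bar> * \<bar>k' (snd zz)\<bar> * \<Phi> zz) \<partial>lborel)
   \<le> (\<integral>\<^sup>+ zz. ennreal (m * K1 * kp powr (3/2)) * (T1 (3/2) r s zz + T2 (3/2) r s zz)
     + ennreal (m * K1 * kp powr gm) * (T1 gm r s zz + T2 gm r s zz) + ennreal (m * K2 * r\<^sup>2) * T0 r s zz \<partial>lborel)"
  proof (intro nn_integral_mono_AE, use AE_quad_neq[where ?'a = 'a] in eventually_elim)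
   fix zz :: "('a \<times> 'a) \<times> ('a \<times> 'a)"
   obtain x y x' y' where zz: "zz = ((x, y), (x', y'))" by (metis surj_pair)
   assume "fst (fst zz) \<noteq> fst (snd zz) \<and> snd (fst zz) \<noteq> snd (snd zz) \<and> fst (fst zz) \<noteq> snd (snd zz) \<and> snd (fst zz) \<noteq> fst (snd zz)"
   then have ne: "x \<noteq> x'" "y \<noteq> y'" "x \<noteq> y'" "y \<noteq> x'" by (auto simp: zz)
   show "ennreal (\<bar>k (fst zz)\<bar> * \<bar>k' (snd zz)\<bar> * \<Phi> zz) \<le> ennreal (m * K1 * kp powr (3/2)) * (T1 (3/2) r s zz + T2 (3/2) r s zz)
     + ennreal (m * K1 * kp powr gm) * (T1 gm r s zz + T2 gm r s zz) + ennreal (m * K2 * r\<^sup>2) * T0 r s zz"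
   proof (cases "x \<in> F \<and> norm (x - y) \<le> 2 * r \<and> x' \<in> F \<and> norm (x' - y') \<le> 2 * s")
    case False
    then have "k (x, y) = 0 \<or> k' (x', y') = 0" using k[of x y] k'[of x' y'] by (auto split: if_splits)
    then show ?thesis by (auto simp: zz)
   next
    case True
    define q where "q = norm (x - x') * norm (y - y')"
    define q' where "q' = norm (x - y') * norm (y - x')"
    have q: "q > 0" "q' > 0" using ne by (auto simp: q_def q'_def)
    obtain h where h: "\<bar>h\<bar> \<le> L * r" "\<Phi> zz = expr2 (b * (ln (q' / q) + h))"
     using \<Phi>[of x x' y y'] True ne unfolding zz q_def q'_def by blast
    have "norm (x - y) * norm (x' - y') \<le> (2 * r) * (2 * s)" using True r by (intro mult_mono) auto
    then have xy: "norm (x - y) * norm (x' - y') \<le> kp" by (simp add: kp_def mult_ac)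
    have "\<bar>q' - q\<bar> \<le> kp"
    proof -
     have "q' \<le> q + norm (x - y) * norm (x' - y')"
      using ptolemy[of x y' y x'] ptolemy[of x y' x' y] unfolding q_def q'_def by (simp add: norm_minus_commute mult.commute)
     moreover have "q \<le> q' + norm (x - y) * norm (x' - y')"
      using ptolemy[of x x' y y'] unfolding q_def q'_def by (simp add: norm_minus_commute mult.commute)
     ultimately show ?thesis using xy by linarith
    qed
    moreover have "L * r \<le> H" unfolding H_def using L r by (intro mult_left_mono) auto
    then have "\<bar>h\<bar> \<le> H" using h by linarith
    ultimately have "\<Phi> zz \<le> K1 * ((kp / q) powr (3/2) + (kp / q) powr gm + (kp / q') powr (3/2) + (kp / q') powr gm)
      + 2 * b\<^sup>2 * exp (2 * b * H) * h\<^sup>2"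
     unfolding h(2) K1_def using b gm q by (intro expr2_kernel) auto
    also have "h\<^sup>2 \<le> (L * r)\<^sup>2" using power_mono[OF h(1), of 2] by simp
    also have "K1 * ((kp / q) powr (3/2) + (kp / q) powr gm + (kp / q') powr (3/2) + (kp / q') powr gm)
      + 2 * b\<^sup>2 * exp (2 * b * H) * (L * r)\<^sup>2 =
      K1 * kp powr (3/2) * (q powr (-(3/2)) + q' powr (-(3/2))) + K1 * kp powr gm * (q powr (-gm) + q' powr (-gm)) + K2 * r\<^sup>2" (is "_ = ?B")
     using q kp by (simp add: K2_def powr_divide powr_minus_divide power_mult_distrib field_simps)
    finally have \<Phi>B: "\<Phi> zz \<le> ?B" by (simp add: mult_left_mono)
    have "\<Phi> zz \<ge> 0" unfolding h by (rule expr2_nonneg)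
    have "M / r ^ Suc ?d \<ge> \<bar>k (x, y)\<bar>" "M / s ^ Suc ?d \<ge> \<bar>k' (x', y')\<bar>" using k[of x y] k'[of x' y'] True by auto
    then have "\<bar>k (x, y)\<bar> * \<bar>k' (x', y')\<bar> \<le> (M / r ^ Suc ?d) * (M / s ^ Suc ?d)"
     by (intro mult_mono) (auto intro: order_trans[OF abs_ge_zero])
    also have "\<dots> = m" by (simp add: m_def power2_eq_square power_mult_distrib)
    finally have "\<bar>k (x, y)\<bar> * \<bar>k' (x', y')\<bar> * \<Phi> zz \<le> m * ?B"
     using \<Phi>B m \<open>\<Phi> zz \<ge> 0\<close> by (intro mult_mono) auto
    then have "ennreal (\<bar>k (fst zz)\<bar> * \<bar>k' (snd zz)\<bar> * \<Phi> zz) \<le> ennreal (m * ?B)"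
     by (intro ennreal_leI) (simp add: zz)
    also have "m * ?B = (m * K1 * kp powr (3/2)) * (q powr (-(3/2)) + q' powr (-(3/2))) + (m * K1 * kp powr gm) * (q powr (-gm) + q' powr (-gm)) + m * K2 * r\<^sup>2"
     by (simp add: algebra_simps)
    also have "ennreal \<dots> = ennreal (m * K1 * kp powr (3/2)) * (ennreal (q powr (-(3/2))) + ennreal (q' powr (-(3/2))))
     + ennreal (m * K1 * kp powr gm) * (ennreal (q powr (-gm)) + ennreal (q' powr (-gm))) + ennreal (m * K2 * r\<^sup>2)"
     using m K by (simp add: ennreal_plus ennreal_mult)
    also have "\<dots> = ennreal (m * K1 * kp powr (3/2)) * (T1 (3/2) r s zz + T2 (3/2) r s zz)
     + ennreal (m * K1 * kp powr gm) * (T1 gm r s zz + T2 gm r s zz) + ennreal (m * K2 * r\<^sup>2) * T0 r s zz"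
     using True by (simp add: zz T0_def T1_def T2_def near_def riesz_def q_def q'_def powr_mult ennreal_mult)
    finally show ?thesis .
   qed
  qed
  also have "\<dots> = ennreal (m * K1 * kp powr (3/2)) * ((\<integral>\<^sup>+ zz. T1 (3/2) r s zz \<partial>lborel) + (\<integral>\<^sup>+ zz. T2 (3/2) r s zz \<partial>lborel))
     + ennreal (m * K1 * kp powr gm) * ((\<integral>\<^sup>+ zz. T1 gm r s zz \<partial>lborel) + (\<integral>\<^sup>+ zz. T2 gm r s zz \<partial>lborel))
     + ennreal (m * K2 * r\<^sup>2) * (\<integral>\<^sup>+ zz. T0 r s zz \<partial>lborel)"
   by (simp add: nn_integral_add nn_integral_cmult)
  also have "\<dots> \<le> ennreal (m * K1 * kp powr (3/2)) * (ennreal (A1 * (r * s) ^ ?d * s powr (2 - 2 * (3/2))) + ennreal (A1 * (r * s) ^ ?d * s powr (2 - 2 * (3/2))))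
     + ennreal (m * K1 * kp powr gm) * (ennreal (A2 * (r * s) ^ ?d * s powr (2 - 2 * gm)) + ennreal (A2 * (r * s) ^ ?d * s powr (2 - 2 * gm)))
     + ennreal (m * K2 * r\<^sup>2) * ennreal (A0 * (r * s) ^ ?d)"
   by (intro add_mono mult_left_mono A0 A1 A2 r s) auto
  also have "\<dots> = ennreal ((m * K1 * kp powr (3/2)) * (2 * (A1 * (r * s) ^ ?d * s powr (2 - 2 * (3/2))))
     + (m * K1 * kp powr gm) * (2 * (A2 * (r * s) ^ ?d * s powr (2 - 2 * gm)))
     + (m * K2 * r\<^sup>2) * (A0 * (r * s) ^ ?d))"
   using m K A0(1) A1(1) A2(1) r s by (simp add: ennreal_mult[symmetric] ennreal_plus[symmetric] del: ennreal_plus)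
  also have "\<dots> \<le> ennreal (A * sqrt (r / s))"
  proof (intro ennreal_leI)
   have md: "m * (r * s) ^ ?d = M\<^sup>2 / (r * s)" using r s by (simp add: m_def)
   have g: "kp powr g * s powr (2 - 2 * g) / (r * s) \<le> 4 powr g * sqrt (r / s)" if "g \<ge> 3/2" for g
   proof -
    have "kp powr g * s powr (2 - 2 * g) / (r * s) = 4 powr g * (r / s) powr (g - 1)"
    proof -
     have "s powr (2 * g) = s powr g * s powr g" by (simp add: powr_add[symmetric])
     then have "s powr (2 - 2 * g) = s * s / (s powr g * s powr g)"
      using s by (simp add: powr_diff power2_eq_square)
     then show ?thesis using r s by (simp add: kp_def powr_mult powr_divide powr_diff field_simps)
    qed
    also have "(r / s) powr (g - 1) \<le> (r / s) powr (1/2)" using that r s by (intro powr_mono') auto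
    finally show ?thesis using r s by (simp add: powr_half_sqrt mult_left_mono)
   qed
   have rs: "r\<^sup>2 / (r * s) \<le> sqrt (r / s)"
   proof -
    have "r / s \<le> sqrt (r / s)" using r s mult_right_mono[of "r / s" 1 "r / s"] by (intro real_le_rsqrt) (simp add: power2_eq_square)
    then show ?thesis using r by (simp add: power2_eq_square)
   qed
   have "(m * K1 * kp powr (3/2)) * (2 * (A1 * (r * s) ^ ?d * s powr (2 - 2 * (3/2))))
     + (m * K1 * kp powr gm) * (2 * (A2 * (r * s) ^ ?d * s powr (2 - 2 * gm)))
     + (m * K2 * r\<^sup>2) * (A0 * (r * s) ^ ?d) =
    (m * (r * s) ^ ?d) * (K1 * (2 * A1 * (kp powr (3/2) * s powr (2 - 2 * (3/2))) + 2 * A2 * (kp powr gm * s powr (2 - 2 * gm))) + K2 * A0 * r\<^sup>2)"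
    by (simp add: algebra_simps)
   also have "\<dots> = M\<^sup>2 * (K1 * (2 * A1 * (kp powr (3/2) * s powr (2 - 2 * (3/2)) / (r * s)) + 2 * A2 * (kp powr gm * s powr (2 - 2 * gm) / (r * s))) + K2 * A0 * (r\<^sup>2 / (r * s)))"
    unfolding md using r s by (simp add: field_simps)
   also have "\<dots> \<le> M\<^sup>2 * (K1 * (2 * A1 * (4 powr (3/2) * sqrt (r / s)) + 2 * A2 * (4 powr gm * sqrt (r / s))) + K2 * A0 * sqrt (r / s))"
    using K A0(1) A1(1) A2(1) gm by (intro mult_left_mono add_mono g rs) auto
   also have "\<dots> = A * sqrt (r / s)" by (simp add: A_def algebra_simps)
   finally show "(m * K1 * kp powr (3/2)) * (2 * (A1 * (r * s) ^ ?d * s powr (2 - 2 * (3/2))))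
     + (m * K1 * kp powr gm) * (2 * (A2 * (r * s) ^ ?d * s powr (2 - 2 * gm)))
     + (m * K2 * r\<^sup>2) * (A0 * (r * s) ^ ?d) \<le> A * sqrt (r / s)" .
  qed
  finally show "(\<integral>\<^sup>+ zz. ennreal (\<bar>k (fst zz)\<bar> * \<bar>k' (snd zz)\<bar> * \<Phi> zz) \<partial>lborel) \<le> ennreal (A * sqrt (r / s))" .
 qed
qed

section \<open>Fourier transform and Sobolev norms\<close>

lemma integral_translate:
 fixes f :: "'a::euclidean_space => 'b::{banach, second_countable_topology}"
 assumes [measurable]: "f \<in> borel_measurable borel"
 shows "(LINT x|lborel. f (c + x)) = (LINT x|lborel. f x)"
 using integral_distr[of "(+) c" lborel borel f] by (simp add: lborel_distr_plus)

lemma integral_affine: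
 fixes f :: "'a::euclidean_space => 'b::{banach, second_countable_topology}"
 assumes [measurable]: "f \<in> borel_measurable borel" and c: "c \<noteq> 0"
 shows "(LINT x|lborel. f (t + c *\<^sub>R x)) = (1 / \<bar>c\<bar> ^ DIM('a)) *\<^sub>R (LINT x|lborel. f x)"
proof -
 have "(LINT x|lborel. f x) = (LINT x|density (distr lborel borel (\<lambda>x. t + c *\<^sub>R x)) (\<lambda>_. ennreal (\<bar>c\<bar> ^ DIM('a))). f x)"
  by (subst lborel_affine[OF c, of t]) (simp add: ennreal_power)
 also have "\<dots> = \<bar>c\<bar> ^ DIM('a) *\<^sub>R (LINT x|distr lborel borel (\<lambda>x. t + c *\<^sub>R x). f x)"
  by (subst integral_density) auto
 also have "(LINT x|distr lborel borel (\<lambda>x. t + c *\<^sub>R x). f x) = (LINT x|lborel. f (t + c *\<^sub>R x))"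
  by (subst integral_distr) auto
 finally show ?thesis using c by simp
qed

lemma integrable_affine:
 fixes f :: "'a::euclidean_space => 'b::{banach, second_countable_topology}"
 assumes f: "integrable lborel f" and c: "c \<noteq> 0"
 shows "integrable lborel (\<lambda>x. f (t + c *\<^sub>R x))"
proof -
 have [measurable]: "f \<in> borel_measurable borel" using f by simp
 have "integrable (density (distr lborel borel (\<lambda>x. t + c *\<^sub>R x)) (\<lambda>_. ennreal (\<bar>c\<bar> ^ DIM('a)))) f"
  using f by (subst (asm) lborel_affine[OF c, of t]) (simp add: ennreal_power)
 then have "integrable (distr lborel borel (\<lambda>x. t + c *\<^sub>R x)) (\<lambda>x. \<bar>c\<bar> ^ DIM('a) *\<^sub>R f x)"
  by (subst (asm) integrable_density) auto
 then have "integrable lborel (\<lambda>x. \<bar>c\<bar> ^ DIM('a) *\<^sub>R f (t + c *\<^sub>R x))"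
  by (subst (asm) integrable_distr_eq) auto
 then have 1: "integrable lborel (\<lambda>x. (1 / \<bar>c\<bar> ^ DIM('a)) *\<^sub>R (\<bar>c\<bar> ^ DIM('a) *\<^sub>R f (t + c *\<^sub>R x)))"
  by - (rule integrable_scaleR_right, assumption)
 have "(\<lambda>x. (1 / \<bar>c\<bar> ^ DIM('a)) *\<^sub>R (\<bar>c\<bar> ^ DIM('a) *\<^sub>R f (t + c *\<^sub>R x))) = (\<lambda>x. f (t + c *\<^sub>R x))"
  using c by simp
 with 1 show ?thesis by metis
qed

lemma (in pair_sigma_finite) integrable_dominated_product:
 fixes f :: "_ => _ => _::{banach, second_countable_topology}" and g h :: "_ => real"
 assumes f: "case_prod f \<in> borel_measurable (M1 \<Otimes>\<^sub>M M2)"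
  and g: "integrable M1 g" and h: "integrable M2 h"
  and le: "\<And>x y. x \<in> space M1 ==> y \<in> space M2 ==> norm (f x y) \<le> g x * h y"
 shows "integrable (M1 \<Otimes>\<^sub>M M2) (case_prod f)"
proof (rule Fubini_integrable[OF f])
 have le': "norm (f x y) \<le> norm (g x * h y)" if "x \<in> space M1" "y \<in> space M2" for x y
  using le[OF that] by simp
 have fx: "integrable M2 (\<lambda>y. f x y)" if "x \<in> space M1" for x
  by (rule LINT_bound[of _ "\<lambda>y. g x * h y"])
   (use that f h le' in \<open>auto intro!: AE_I2 simp: measurable_Pair2\<close>)
 then show "AE x in M1. integrable M2 (\<lambda>y. case_prod f (x, y))" by (intro AE_I2) auto
 have "(\<lambda>(x, y). norm (f x y)) \<in> borel_measurable (M1 \<Otimes>\<^sub>M M2)"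
  using f by (simp add: split_beta')
 then have m: "(\<lambda>x. \<integral>y. norm (f x y) \<partial>M2) \<in> borel_measurable M1"
  by (rule M2.borel_measurable_lebesgue_integral)
 have b: "(\<integral>y. norm (f x y) \<partial>M2) \<le> norm (g x * (\<integral>y. h y \<partial>M2))" if "x \<in> space M1" for x
 proof -
  have "(\<integral>y. norm (f x y) \<partial>M2) \<le> (\<integral>y. g x * h y \<partial>M2)"
   by (intro integral_mono) (use fx[OF that] h le that in auto)
  also have "\<dots> = g x * (\<integral>y. h y \<partial>M2)" by simp
  finally show ?thesis by simp
 qed
 show "integrable M1 (\<lambda>x. \<integral>y. norm (case_prod f (x, y)) \<partial>M2)"
  by (rule LINT_bound[of _ "\<lambda>x. g x * (\<integral>y. h y \<partial>M2)"])
   (use g b m in \<open>auto intro!: AE_I2\<close>)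
qed

lemma Fubini_lborel:
 fixes f :: "'a::euclidean_space => 'b::euclidean_space => 'c::{banach, second_countable_topology}" and g h :: "_ => real"
 assumes "case_prod f \<in> borel_measurable (borel \<Otimes>\<^sub>M borel)" "integrable lborel g" "integrable lborel h"
  and "\<And>x y. norm (f x y) \<le> g x * h y"
 shows "(LINT x|lborel. LINT y|lborel. f x y) = (LINT y|lborel. LINT x|lborel. f x y)"
 using lborel_pair.Fubini_integral[OF lborel_pair.integrable_dominated_product[of f g h]] assms
 by (simp add: measurable_lborel1 cong: measurable_cong_sets sets_pair_measure_cong)

definition wave :: "'a::euclidean_space => 'a => complex" where
 "wave x xi = cis (2 * pi * (x \<bullet> xi))"

lemma wave_simps: "norm (wave x xi) = 1" "wave (x + y) xi = wave x xi * wave y xi" "wave 0 xi = 1" "wave x 0 = 1"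
 "cnj (wave x xi) = wave (- x) xi" "wave (c *\<^sub>R x) xi = wave x (c *\<^sub>R xi)"
 by (simp_all add: wave_def cis_mult inner_add_left distrib_left cis_cnj)

lemma wave_measurable [measurable (raw)]:
 assumes [measurable]: "f \<in> borel_measurable M" "g \<in> borel_measurable M"
 shows "(\<lambda>x. wave (f x) (g x)) \<in> borel_measurable M"
proof -
 have [measurable]: "cis \<in> borel_measurable borel"
  by (intro borel_measurable_continuous_onI continuous_intros)
 show ?thesis unfolding wave_def by measurable
qed

lemma inverse_fourier_wave: "inverse_fourier f xi = (LINT x|lborel. wave x xi * complex_of_real (f x))"
 by (simp add: inverse_fourier_def wave_def)

lemma integrable_wave:
 assumes "integrable lborel f"
 shows "integrable lborel (\<lambda>x. wave x xi * complex_of_real (f x))"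
 by (rule LINT_bound[OF assms]) (use assms in \<open>auto simp: norm_mult wave_simps\<close>)

lemma inverse_fourier_bound:
 assumes "integrable lborel f"
 shows "norm (inverse_fourier f xi) \<le> (LINT x|lborel. \<bar>f x\<bar>)"
proof -
 have "norm (inverse_fourier f xi) \<le> (LINT x|lborel. norm (wave x xi * complex_of_real (f x)))"
  unfolding inverse_fourier_wave by (rule integral_norm_bound)
 then show ?thesis by (simp add: norm_mult wave_simps)
qed

lemma inverse_fourier_lincomb:
 assumes "integrable lborel f" "integrable lborel h"
 shows "inverse_fourier (\<lambda>x. a * f x + c * h x) xi = of_real a * inverse_fourier f xi + of_real c * inverse_fourier h xi"
proof -
 have "inverse_fourier (\<lambda>x. a * f x + c * h x) xi = (LINT x|lborel. of_real a * (wave x xi * of_real (f x)) + of_real c * (wave x xi * of_real (h x)))"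
  unfolding inverse_fourier_wave by (intro Bochner_Integration.integral_cong) (auto simp: algebra_simps)
 also have "\<dots> = of_real a * inverse_fourier f xi + of_real c * inverse_fourier h xi"
  unfolding inverse_fourier_wave using assms by (subst Bochner_Integration.integral_add) (auto intro!: integrable_wave)
 finally show ?thesis .
qed

lemma inverse_fourier_sum:
 assumes "\<And>i. i \<in> I ==> integrable lborel (f i)"
 shows "inverse_fourier (\<lambda>x. \<Sum>i\<in>I. f i x) xi = (\<Sum>i\<in>I. inverse_fourier (f i) xi)"
 unfolding inverse_fourier_wave using assms
 by (simp add: sum_distrib_left integrable_wave Bochner_Integration.integral_sum)

lemma inverse_fourier_measurable [measurable]:
 assumes [measurable]: "f \<in> borel_measurable borel"
 shows "inverse_fourier f \<in> borel_measurable borel"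
 unfolding inverse_fourier_wave[abs_def] by measurable

lemma smooth_line_derivative:
 assumes "smooth f"
 shows "((\<lambda>t. f (x + t *\<^sub>R v)) has_real_derivative (\<Sum>c\<in>Basis. (v \<bullet> c) * partials [c] f (x + t *\<^sub>R v))) (at t)"
proof -
 have 1: "((\<lambda>t. x + t *\<^sub>R v) has_derivative (\<lambda>s. s *\<^sub>R v)) (at t)"
  by (auto intro!: derivative_eq_intros)
 have "((\<lambda>t. f (x + t *\<^sub>R v)) has_derivative (\<lambda>s. \<Sum>c\<in>Basis. ((s *\<^sub>R v) \<bullet> c) * partials [c] f (x + t *\<^sub>R v))) (at t)"
  by (rule has_derivative_compose[OF 1 smooth_has_derivative[OF assms]])
 moreover have "(\<lambda>s. \<Sum>c\<in>Basis. ((s *\<^sub>R v) \<bullet> c) * partials [c] f (x + t *\<^sub>R v)) = (*) (\<Sum>c\<in>Basis. (v \<bullet> c) * partials [c] f (x + t *\<^sub>R v))"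
  by (intro ext) (simp add: sum_distrib_left sum_distrib_right mult_ac del: partials.simps)
 ultimately show ?thesis by (simp add: has_field_derivative_def)
qed

lemma sum_Basis_inner: "b \<in> Basis ==> (\<Sum>c\<in>Basis. (b \<bullet> c) * g c) = (g b :: real)" for b :: "'a::euclidean_space"
proof -
 assume b: "b \<in> Basis"
 have "(\<Sum>c\<in>Basis. (b \<bullet> c) * g c) = (\<Sum>c\<in>Basis. if c = b then g c else 0)"
  using b by (intro sum.cong) (auto simp: inner_Basis)
 also have "\<dots> = g b" using b by simp
 finally show ?thesis .
qed

lemma smooth_difference_bound:
 assumes f: "smooth f" and B: "\<And>y. \<bar>partials [b] f y\<bar> \<le> B" and b: "b \<in> Basis" and t: "t > 0"
 shows "\<bar>f (x + t *\<^sub>R b) - f x\<bar> \<le> B * t"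
proof -
 have "\<exists>z. 0 < z \<and> z < t \<and> f (x + t *\<^sub>R b) - f (x + 0 *\<^sub>R b) = (t - 0) * partials [b] f (x + z *\<^sub>R b)"
  using smooth_line_derivative[OF f, of x b] t
  by (intro MVT2) (auto simp: sum_Basis_inner[OF b])
 then obtain z where "f (x + t *\<^sub>R b) - f x = t * partials [b] f (x + z *\<^sub>R b)" by auto
 then show ?thesis using B[of "x + z *\<^sub>R b"] t by (simp add: abs_mult mult.commute)
qed

lemma partials_singleton_LIMSEQ:
 fixes f :: "'a::euclidean_space => real"
 assumes f: "smooth f" and b: "b \<in> Basis"
 shows "(\<lambda>n. (f (x + (1 / Suc n) *\<^sub>R b) - f x) * Suc n) \<longlonglongrightarrow> partials [b] f x"
proof -
 have "((\<lambda>t. f (x + t *\<^sub>R b)) has_real_derivative partials [b] f x) (at 0)"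
  using smooth_line_derivative[OF f, of x b 0] by (simp add: sum_Basis_inner[OF b])
 then have "((\<lambda>t. (f (x + t *\<^sub>R b) - f x) / t) \<longlongrightarrow> partials [b] f x) (at 0)"
  by (simp add: has_field_derivative_iff)
 moreover have "filterlim (\<lambda>n. 1 / real (Suc n)) (at 0) sequentially"
  using LIMSEQ_Suc[OF lim_1_over_n] by (auto simp: filterlim_at)
 ultimately have "((\<lambda>n. (f (x + (1 / Suc n) *\<^sub>R b) - f x) / (1 / Suc n)) \<longlongrightarrow> partials [b] f x) sequentially"
  by (rule filterlim_compose)
 then show ?thesis by simp
qed

lemma cis_difference_LIMSEQ: "(\<lambda>n. (cis (a / Suc n) - 1) * Suc n) \<longlonglongrightarrow> \<i> * of_real a"
proof -
 have "((\<lambda>t. exp (\<i> * of_real a * t)) has_field_derivative \<i> * of_real a) (at 0)"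
  by (auto intro!: derivative_eq_intros)
 then have "((\<lambda>t. (exp (\<i> * of_real a * t) - 1) / t) \<longlongrightarrow> \<i> * of_real a) (at 0)"
  by (simp add: has_field_derivative_iff)
 moreover have "filterlim (\<lambda>n. complex_of_real (1 / real (Suc n))) (at 0) sequentially"
  using tendsto_of_real[OF LIMSEQ_Suc[OF lim_1_over_n], where ?'a = complex] by (auto simp: filterlim_at simp del: of_nat_Suc)
 ultimately have "((\<lambda>n. (exp (\<i> * of_real a * complex_of_real (1 / Suc n)) - 1) / complex_of_real (1 / Suc n)) \<longlongrightarrow> \<i> * of_real a) sequentially"
  by (rule filterlim_compose)
 moreover have "(\<lambda>n. (exp (\<i> * of_real a * complex_of_real (1 / Suc n)) - 1) / complex_of_real (1 / Suc n)) = (\<lambda>n. (cis (a / Suc n) - 1) * Suc n)"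
  by (intro ext) (simp add: cis_conv_exp del: of_nat_Suc)
 ultimately show ?thesis by metis
qed

lemma inverse_fourier_partial:
 assumes f: "f \<in> test_functions UNIV" and b: "b \<in> Basis"
 shows "inverse_fourier (partials [b] f) xi = - (2 * pi * \<i> * (xi \<bullet> b)) * inverse_fourier f xi"
proof (rule LIMSEQ_unique)
 have sm: "smooth f" using f by (rule test_functions_smooth)
 have [measurable]: "f \<in> borel_measurable borel" using f by (rule test_functions_borel)
 have fi: "integrable lborel f" using f by (rule test_functions_integrable)
 define D where "D = (\<lambda>n x. (f (x + (1 / Suc n) *\<^sub>R b) - f x) * Suc n)"
 have pt: "partials [b] f \<in> test_functions UNIV" using f b by (intro test_functions_partials) auto
 obtain B where B: "B > 0" "\<And>x. \<bar>partials [b] f x\<bar> \<le> B" by (rule test_functions_bounded[OF pt]) blast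
 obtain R where R: "R > 0" "\<And>x. x \<in> supp f ==> norm x \<le> R"
  using f compact_imp_bounded[of "supp f"] by (auto simp: test_functions_iff bounded_pos)
 have nb: "norm b = 1" using b by simp
 have Dbound: "\<bar>D n x\<bar> \<le> B * indicator (cball 0 (R + 1)) x" for n x
 proof (cases "norm x \<le> R + 1")
  case True
  have "\<bar>f (x + (1 / Suc n) *\<^sub>R b) - f x\<bar> \<le> B * (1 / Suc n)"
   by (rule smooth_difference_bound[OF sm B(2) b]) auto
  then have "\<bar>f (x + (1 / Suc n) *\<^sub>R b) - f x\<bar> * Suc n \<le> B * (1 / Suc n) * Suc n"
   by (rule mult_right_mono) simp
  then show ?thesis using True unfolding D_def abs_mult by (simp del: of_nat_Suc)
 next
  case False
  have "norm x \<le> norm (x + (1 / Suc n) *\<^sub>R b) + norm ((1 / Suc n) *\<^sub>R b)"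
   using norm_triangle_ineq4[of "x + (1 / Suc n) *\<^sub>R b" "(1 / Suc n) *\<^sub>R b"] by simp
  also have "norm ((1 / Suc n) *\<^sub>R b) \<le> 1" using nb by simp
  finally have "norm (x + (1 / Suc n) *\<^sub>R b) > R" using False by simp
  then have "x + (1 / Suc n) *\<^sub>R b \<notin> supp f" "x \<notin> supp f" using R False by force+
  then have "f (x + (1 / Suc n) *\<^sub>R b) = 0" "f x = 0" using supp_superset by metis+
  then show ?thesis using B by (simp add: D_def)
 qed
 have "(\<lambda>n. LINT x|lborel. wave x xi * complex_of_real (D n x)) \<longlonglongrightarrow> (LINT x|lborel. wave x xi * complex_of_real (partials [b] f x))"
 proof (rule integral_dominated_convergence[where w = "\<lambda>x. B * indicator (cball 0 (R + 1)) x"])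
  show "integrable lborel (\<lambda>x. B * indicator (cball (0::'a) (R + 1)) x)"
   using emeasure_lborel_cball_finite[of "0::'a" "R + 1"] by (intro integrable_mult_right integrable_real_indicator) auto
  show "AE x in lborel. (\<lambda>n. wave x xi * complex_of_real (D n x)) \<longlonglongrightarrow> wave x xi * complex_of_real (partials [b] f x)"
   unfolding D_def by (intro AE_I2 tendsto_mult tendsto_const tendsto_of_real partials_singleton_LIMSEQ[OF sm b])
  show "AE x in lborel. norm (wave x xi * complex_of_real (D n x)) \<le> B * indicator (cball 0 (R + 1)) x" for n
   using Dbound[of n] by (simp add: norm_mult wave_simps)
  show "(\<lambda>x. wave x xi * complex_of_real (partials [b] f x)) \<in> borel_measurable lborel"
   using test_functions_borel[OF pt] by measurable
  show "(\<lambda>x. wave x xi * complex_of_real (D n x)) \<in> borel_measurable lborel" for n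
   unfolding D_def by measurable
 qed
 moreover have "(LINT x|lborel. wave x xi * complex_of_real (D n x)) = (cis (- (2 * pi * (xi \<bullet> b)) / Suc n) - 1) * Suc n * inverse_fourier f xi" for n
 proof -
  define t where "t = (1 / Suc n) *\<^sub>R b"
  have tr: "(LINT x|lborel. wave x xi * complex_of_real (f (t + x))) = wave (- t) xi * inverse_fourier f xi"
  proof -
   have "inverse_fourier f xi = (LINT x|lborel. wave (t + x) xi * complex_of_real (f (t + x)))"
    unfolding inverse_fourier_wave by (rule integral_translate[symmetric]) measurable
   also have "\<dots> = (LINT x|lborel. wave t xi * (wave x xi * complex_of_real (f (t + x))))"
    by (simp add: wave_simps mult.assoc)
   also have "\<dots> = wave t xi * (LINT x|lborel. wave x xi * complex_of_real (f (t + x)))" by simp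
   finally show ?thesis by (simp add: wave_simps(2)[symmetric] mult.assoc[symmetric] wave_simps(3))
  qed
  have fti: "integrable lborel (\<lambda>x. f (t + x))" using integrable_affine[OF fi, of 1 t] by simp
  have "(LINT x|lborel. wave x xi * complex_of_real (D n x)) = inverse_fourier (\<lambda>x. Suc n * f (t + x) + (- Suc n) * f x) xi"
   unfolding inverse_fourier_wave by (intro Bochner_Integration.integral_cong) (auto simp: D_def t_def algebra_simps)
  also have "\<dots> = Suc n * (wave (- t) xi * inverse_fourier f xi) + (- Suc n) * inverse_fourier f xi"
   using inverse_fourier_lincomb[OF fti fi, of "Suc n" "- Suc n"] by (simp add: tr inverse_fourier_wave[of "\<lambda>x. f (t + x)"])
  also have "wave (- t) xi = cis (- (2 * pi * (xi \<bullet> b)) / Suc n)"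
   by (simp add: wave_def t_def inner_commute)
  finally show ?thesis by (simp add: algebra_simps)
 qed
 ultimately show "(\<lambda>n. (cis (- (2 * pi * (xi \<bullet> b)) / Suc n) - 1) * Suc n * inverse_fourier f xi) \<longlonglongrightarrow> inverse_fourier (partials [b] f) xi"
  by (simp add: inverse_fourier_wave[of "partials [b] f"] del: partials.simps of_nat_Suc)
 have "(\<lambda>n. (cis (- (2 * pi * (xi \<bullet> b)) / Suc n) - 1) * Suc n * inverse_fourier f xi) \<longlonglongrightarrow> \<i> * of_real (- (2 * pi * (xi \<bullet> b))) * inverse_fourier f xi"
  by (intro tendsto_mult_right cis_difference_LIMSEQ)
 then show "(\<lambda>n. (cis (- (2 * pi * (xi \<bullet> b)) / Suc n) - 1) * Suc n * inverse_fourier f xi) \<longlonglongrightarrow> - (2 * pi * \<i> * (xi \<bullet> b)) * inverse_fourier f xi"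
  by (simp add: mult_ac)
qed

lemma test_functions_zero: "(\<lambda>x. 0) \<in> test_functions (V :: 'a::euclidean_space set)"
proof (rule test_functionsI[where S = "{}"])
 have "partials bs (\<lambda>x::'a. 0::real) = (\<lambda>x. 0)" for bs
  by (induction bs) (auto simp: frechet_derivative_at[OF has_derivative_const, symmetric])
 then show "smooth (\<lambda>x::'a. 0)" by (simp add: smooth_def)
qed auto

lemma test_functions_sum:
 fixes f :: "'i => 'a::euclidean_space => real"
 assumes "finite I" "\<And>i. i \<in> I ==> f i \<in> test_functions V"
 shows "(\<lambda>x. \<Sum>i\<in>I. f i x) \<in> test_functions V"
 using assms
proof (induction I rule: finite_induct)
 case (insert i I)
 then show ?case using test_functions_lincomb[of "f i" V "\<lambda>x. \<Sum>i\<in>I. f i x" 1 1] by simp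
qed (simp add: test_functions_zero)

definition bracket :: "'a::euclidean_space => real" where "bracket xi = 1 + (norm xi)\<^sup>2"

lemma bracket_ge_1: "bracket xi \<ge> 1" by (simp add: bracket_def)
lemma bracket_pos: "bracket xi > 0" using bracket_ge_1[of xi] by linarith

lemma bracket_measurable [measurable]: "bracket \<in> borel_measurable borel"
 unfolding bracket_def[abs_def] by measurable

lemma inverse_fourier_laplacian:
 fixes f :: "'a::euclidean_space => real"
 assumes f: "f \<in> test_functions UNIV"
 obtains h where "h \<in> test_functions UNIV" "\<And>xi. inverse_fourier h xi = bracket xi * inverse_fourier f xi"
proof -
 define p where "p = (\<lambda>b. partials [b] (partials [b] f))"
 have p: "p b \<in> test_functions UNIV" if "b \<in> Basis" for b
  unfolding p_def using that by (intro test_functions_partials f) auto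
 have s: "(\<lambda>x. \<Sum>b\<in>Basis. p b x) \<in> test_functions UNIV" by (intro test_functions_sum p) auto
 define h where "h = (\<lambda>x. 1 * f x + (- 1 / (4 * pi\<^sup>2)) * (\<Sum>b\<in>Basis. p b x))"
 show ?thesis
 proof (rule that)
  show "h \<in> test_functions UNIV" unfolding h_def by (intro test_functions_lincomb f s)
  fix xi :: 'a
  have pf: "inverse_fourier (p b) xi = - of_real (4 * pi\<^sup>2) * of_real ((xi \<bullet> b)\<^sup>2) * inverse_fourier f xi" if "b \<in> Basis" for b
  proof -
   have "partials [b] f \<in> test_functions UNIV" using that by (intro test_functions_partials f) auto
   from inverse_fourier_partial[OF this that, of xi] inverse_fourier_partial[OF f that, of xi]
   show ?thesis unfolding p_def by (simp add: power2_eq_square algebra_simps)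
  qed
  have "inverse_fourier h xi = inverse_fourier f xi + of_real (- 1 / (4 * pi\<^sup>2)) * (\<Sum>b\<in>Basis. inverse_fourier (p b) xi)"
   unfolding h_def using test_functions_integrable[OF f] test_functions_integrable[OF s] p
   by (subst inverse_fourier_lincomb, simp, simp, subst inverse_fourier_sum[of Basis p xi]) (auto intro: test_functions_integrable)
  also have "\<dots> = inverse_fourier f xi + of_real (- 1 / (4 * pi\<^sup>2)) * (\<Sum>b\<in>Basis. - of_real (4 * pi\<^sup>2) * of_real ((xi \<bullet> b)\<^sup>2) * inverse_fourier f xi)"
   using pf by simp
  also have "(\<Sum>b\<in>Basis. - of_real (4 * pi\<^sup>2) * of_real ((xi \<bullet> b)\<^sup>2) * inverse_fourier f xi) = - of_real (4 * pi\<^sup>2) * of_real (\<Sum>b\<in>Basis. (xi \<bullet> b)\<^sup>2) * inverse_fourier f xi"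
   by (simp add: sum_distrib_left sum_distrib_right)
  also have "(\<Sum>b\<in>Basis. (xi \<bullet> b)\<^sup>2) = (norm xi)\<^sup>2"
   unfolding power2_norm_eq_inner by (subst euclidean_inner) (simp add: power2_eq_square)
  finally show "inverse_fourier h xi = bracket xi * inverse_fourier f xi"
   by (simp add: bracket_def field_simps)
 qed
qed

lemma inverse_fourier_decay:
 fixes f :: "'a::euclidean_space => real"
 assumes f: "f \<in> test_functions UNIV"
 shows "\<exists>B\<ge>0. \<forall>xi. norm (inverse_fourier f xi) \<le> B * bracket xi powr (- real N)"
 using assms
proof (induction N arbitrary: f)
 case 0
 then show ?case using inverse_fourier_bound[OF test_functions_integrable[OF 0]] bracket_pos
  by (intro exI[of _ "LINT x|lborel. \<bar>f x\<bar>"]) (auto simp: less_imp_neq[OF bracket_pos, symmetric])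
next
 case (Suc N)
 obtain h where h: "h \<in> test_functions UNIV" "\<And>xi. inverse_fourier h xi = bracket xi * inverse_fourier f xi"
  by (rule inverse_fourier_laplacian[OF Suc.prems]) blast
 obtain B where B: "B \<ge> 0" "\<And>xi. norm (inverse_fourier h xi) \<le> B * bracket xi powr (- real N)"
  using Suc.IH[OF h(1)] by blast
 have "norm (inverse_fourier f xi) \<le> B * bracket xi powr (- real (Suc N))" for xi
 proof -
  have "bracket xi * norm (inverse_fourier f xi) \<le> B * bracket xi powr (- real N)"
   using B(2)[of xi] bracket_pos[of xi] by (simp add: h norm_mult)
  moreover have "bracket xi powr (- real (Suc N)) = bracket xi powr (- real N) / bracket xi"
  proof -
   have "- real (Suc N) = - real N - 1" by simp
   then show ?thesis using bracket_pos[of xi] by (simp only: powr_diff) simp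
  qed
  ultimately have "bracket xi * norm (inverse_fourier f xi) \<le> bracket xi * (B * bracket xi powr (- real (Suc N)))"
   using bracket_pos[of xi] by (simp add: field_simps del: of_nat_Suc)
  then show ?thesis using bracket_pos[of xi] by (simp only: mult_le_cancel_left_pos)
 qed
 then show ?case using B(1) by blast
qed

lemma integrable_bracket:
 "integrable lborel (\<lambda>xi::'a::euclidean_space. bracket xi powr (- real (DIM('a))))"
proof -
 let ?d = "DIM('a)"
 obtain A where A: "A > 0" "\<And>s (w::'a). s > 0 ==>
  (\<integral>\<^sup>+ y. riesz (2 * ?d) (y - w) * indicator (- ball w s) y \<partial>lborel) \<le> ennreal (A * s powr (real ?d - real (2 * ?d)))"
  by (rule riesz_far[where ?'a = 'a and a = "2 * ?d"]) auto
 have "(\<integral>\<^sup>+ xi. ennreal (norm (bracket (xi::'a) powr (- real ?d))) \<partial>lborel)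
  \<le> (\<integral>\<^sup>+ xi. indicator (cball 0 1) (xi::'a) + riesz (2 * ?d) (xi - 0) * indicator (- ball 0 1) xi \<partial>lborel)"
 proof (intro nn_integral_mono)
  fix xi :: 'a
  show "ennreal (norm (bracket xi powr (- real ?d))) \<le> indicator (cball 0 1) xi + riesz (2 * ?d) (xi - 0) * indicator (- ball 0 1) xi"
  proof (cases "norm xi \<le> 1")
   case True
   have "bracket xi powr (- real ?d) \<le> 1" using bracket_ge_1[of xi] powr_mono[of "- real ?d" 0 "bracket xi"] by simp
   then have "ennreal (norm (bracket xi powr (- real ?d))) \<le> 1" by simp
   then show ?thesis using True by (simp add: add_increasing2)
  next
   case False
   have "bracket xi powr (- real ?d) \<le> ((norm xi)\<^sup>2) powr (- real ?d)"
    using False by (intro powr_mono2') (auto simp: bracket_def)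
   also have "\<dots> = (norm xi powr 2) powr (- real ?d)" using False by simp
   also have "\<dots> = norm xi powr (- real (2 * ?d))" unfolding powr_powr by simp
   finally have "ennreal (norm (bracket xi powr (- real ?d))) \<le> riesz (2 * ?d) xi"
    by (simp add: riesz_def ennreal_leI)
   then show ?thesis using False by (auto simp: indicator_def)
  qed
 qed
 also have "\<dots> = emeasure lborel (cball (0::'a) 1) + (\<integral>\<^sup>+ xi. riesz (2 * ?d) (xi - (0::'a)) * indicator (- ball 0 1) xi \<partial>lborel)"
  by (subst nn_integral_add) auto
 also have "\<dots> < \<infinity>"
  using emeasure_lborel_cball_finite[of "0::'a" 1] A(2)[of 1 0] by (auto simp: less_top[symmetric] top_unique)
 finally show ?thesis by (intro integrableI_bounded) auto
qed

lemma inverse_fourier_integrable: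
 fixes f :: "'a::euclidean_space => real"
 assumes f: "f \<in> test_functions UNIV"
 shows "integrable lborel (inverse_fourier f)"
proof -
 have [measurable]: "f \<in> borel_measurable borel" using f by (rule test_functions_borel)
 obtain B where B: "B \<ge> 0" "\<And>xi. norm (inverse_fourier f xi) \<le> B * bracket xi powr (- real DIM('a))"
  using inverse_fourier_decay[OF f, of "DIM('a)"] by blast
 show ?thesis
  by (rule LINT_bound[OF integrable_mult_right[OF integrable_bracket, of B]])
   (use B in \<open>auto intro!: AE_I2 order_trans[OF B(2)]\<close>)
qed

lemma inverse_fourier_inversion:
 fixes \<phi> :: "'a::euclidean_space => real"
 assumes \<phi>: "\<phi> \<in> test_functions UNIV" and \<phi>1: "(LINT x|lborel. \<phi> x) = 1"
 obtains kp :: real where "kp \<noteq> 0"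
  "\<And>(f :: 'a => real) x. f \<in> test_functions UNIV ==> (LINT xi|lborel. wave (- x) xi * inverse_fourier f xi) = of_real (kp * f x)"
proof -
 have [measurable]: "\<phi> \<in> borel_measurable borel" using \<phi> by (rule test_functions_borel)
 have \<phi>i: "integrable lborel \<phi>" "integrable lborel (\<lambda>x. \<bar>\<phi> x\<bar>)" using \<phi> by (auto intro: test_functions_integrable)
 obtain B where B: "B > 0" "\<And>x. \<bar>\<phi> x\<bar> \<le> B" by (rule test_functions_bounded[OF \<phi>]) blast
 define I where "I = (LINT x|lborel. \<bar>\<phi> x\<bar>)"
 define gm where "gm = (\<lambda>xi. LINT y|lborel. \<phi> (xi + y) * \<phi> y)"
 have prod_int: "integrable lborel (\<lambda>y. \<phi> (xi + y) * \<phi> y)" for xi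
  by (rule LINT_bound[OF integrable_mult_right[OF \<phi>i(2), of B]])
   (use B in \<open>auto intro!: AE_I2 mult_mono simp: abs_mult\<close>)
 have gm_bound: "\<bar>gm xi\<bar> \<le> B * I" for xi
 proof -
  have "\<bar>gm xi\<bar> \<le> (LINT y|lborel. \<bar>\<phi> (xi + y) * \<phi> y\<bar>)" unfolding gm_def by (rule integral_abs_bound)
  also have "\<dots> \<le> (LINT y|lborel. B * \<bar>\<phi> y\<bar>)"
   by (intro integral_mono) (use integrable_norm[OF prod_int[of xi]] \<phi>i B in \<open>auto simp: abs_mult intro!: mult_right_mono\<close>)
  finally show ?thesis by (simp add: I_def)
 qed
 have gm_lim: "(\<lambda>n. gm (t n)) \<longlonglongrightarrow> gm 0" if "t \<longlonglongrightarrow> 0" for t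
 proof -
  have "(\<lambda>n. LINT y|lborel. \<phi> (t n + y) * \<phi> y) \<longlonglongrightarrow> (LINT y|lborel. \<phi> (0 + y) * \<phi> y)"
  proof (rule integral_dominated_convergence[where w = "\<lambda>y. B * \<bar>\<phi> y\<bar>"])
   have "isCont \<phi> y" for y using test_functions_continuous[OF \<phi>, of UNIV] by (simp add: continuous_on_eq_continuous_at)
   then show "AE y in lborel. (\<lambda>n. \<phi> (t n + y) * \<phi> y) \<longlonglongrightarrow> \<phi> (0 + y) * \<phi> y"
    using that by (intro AE_I2 tendsto_mult_right isCont_tendsto_compose[of _ \<phi>] tendsto_add tendsto_const)
   show "AE y in lborel. norm (\<phi> (t n + y) * \<phi> y) \<le> B * \<bar>\<phi> y\<bar>" for n
    using B by (auto simp: abs_mult intro!: mult_right_mono)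
  qed (use \<phi>i in auto)
  then show ?thesis by (simp add: gm_def)
 qed
 have gmm [measurable]: "gm \<in> borel_measurable borel" unfolding gm_def by measurable
 have aff: "integrable lborel (\<lambda>xi. \<phi> (xi + y))" for y
  using integrable_affine[OF \<phi>i(1), of 1 y] by (simp add: add.commute)
 have affI: "(LINT xi|lborel. \<bar>\<phi> (xi + y)\<bar>) = I" for y
  using integral_translate[of "\<lambda>x. \<bar>\<phi> x\<bar>" y] by (simp add: add.commute I_def)
 have pint: "integrable (lborel \<Otimes>\<^sub>M lborel) (\<lambda>(y, xi). wave et xi * complex_of_real (\<phi> (xi + y) * \<phi> y))" for et
 proof (rule lborel_pair.Fubini_integrable)
  show "(\<lambda>(y, xi). wave et xi * complex_of_real (\<phi> (xi + y) * \<phi> y)) \<in> borel_measurable (lborel \<Otimes>\<^sub>M lborel)"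
   by measurable
  have "integrable lborel (\<lambda>xi. wave et xi * complex_of_real (\<phi> (xi + y) * \<phi> y))" for y
   by (rule LINT_bound[OF integrable_mult_left[where c = "\<phi> y", OF aff[of y]]]) (auto simp: norm_mult wave_simps)
  then show "AE y in lborel. integrable lborel (\<lambda>xi. case (y, xi) of (y, xi) => wave et xi * complex_of_real (\<phi> (xi + y) * \<phi> y))"
   by simp
  have "(LINT xi|lborel. norm (case (y, xi) of (y, xi) => wave et xi * complex_of_real (\<phi> (xi + y) * \<phi> y))) = I * \<bar>\<phi> y\<bar>" for y
   by (simp add: norm_mult wave_simps abs_mult affI)
  then show "integrable lborel (\<lambda>y. LINT xi|lborel. norm (case (y, xi) of (y, xi) => wave et xi * complex_of_real (\<phi> (xi + y) * \<phi> y)))"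
   using \<phi>i by simp
 qed
 have gmw: "(LINT y|lborel. wave et xi * complex_of_real (\<phi> (xi + y) * \<phi> y)) = wave et xi * complex_of_real (gm xi)" for et xi
  unfolding gm_def by (simp only: integral_mult_right_zero integral_complex_of_real)
 have gmi: "integrable lborel gm"
 proof -
  have "integrable lborel (\<lambda>xi. LINT y|lborel. wave 0 xi * complex_of_real (\<phi> (xi + y) * \<phi> y))"
   using lborel_pair.integrable_snd[OF pint[of 0]] .
  then have "integrable lborel (\<lambda>xi. complex_of_real (gm xi))" unfolding gmw by (simp add: wave_simps)
  then show ?thesis by (simp add: complex_of_real_integrable_eq)
 qed
 have gmF: "inverse_fourier gm et = of_real ((norm (inverse_fourier \<phi> et))\<^sup>2)" for et
 proof -
  have "inverse_fourier gm et = (LINT xi|lborel. wave et xi * complex_of_real (gm xi))"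
   unfolding inverse_fourier_wave wave_def by (simp add: inner_commute)
  also have "\<dots> = (LINT xi|lborel. LINT y|lborel. wave et xi * complex_of_real (\<phi> (xi + y) * \<phi> y))"
   unfolding gmw ..
  also have "\<dots> = (LINT y|lborel. LINT xi|lborel. wave et xi * complex_of_real (\<phi> (xi + y) * \<phi> y))"
   by (rule lborel_pair.Fubini_integral[OF pint])
  also have "\<dots> = (LINT y|lborel. cnj (wave y et * complex_of_real (\<phi> y)) * inverse_fourier \<phi> et)"
  proof (intro LINT_cong)
   fix y
   have "(LINT xi|lborel. wave et xi * complex_of_real (\<phi> (xi + y) * \<phi> y))
    = (LINT xi|lborel. cnj (wave y et * complex_of_real (\<phi> y)) * (wave (y + xi) et * complex_of_real (\<phi> (y + xi))))"
   proof (intro LINT_cong)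
    fix xi
    have "wave et xi = cnj (wave y et) * wave (y + xi) et"
     by (simp add: wave_def cis_mult cis_cnj inner_add_left inner_commute algebra_simps)
    then show "wave et xi * complex_of_real (\<phi> (xi + y) * \<phi> y) = cnj (wave y et * complex_of_real (\<phi> y)) * (wave (y + xi) et * complex_of_real (\<phi> (y + xi)))"
     by (simp add: add.commute mult_ac)
   qed
   also have "\<dots> = cnj (wave y et * complex_of_real (\<phi> y)) * (LINT xi|lborel. wave (y + xi) et * complex_of_real (\<phi> (y + xi)))"
    by (rule integral_mult_right_zero)
   also have "(LINT xi|lborel. wave (y + xi) et * complex_of_real (\<phi> (y + xi))) = inverse_fourier \<phi> et"
    unfolding inverse_fourier_wave by (rule integral_translate[of "\<lambda>x. wave x et * complex_of_real (\<phi> x)"]) measurable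
   finally show "(LINT xi|lborel. wave et xi * complex_of_real (\<phi> (xi + y) * \<phi> y)) = cnj (wave y et * complex_of_real (\<phi> y)) * inverse_fourier \<phi> et" .
  qed
  also have "\<dots> = cnj (inverse_fourier \<phi> et) * inverse_fourier \<phi> et"
   unfolding inverse_fourier_wave by (simp only: integral_mult_left_zero Bochner_Integration.integral_cnj)
  finally show ?thesis unfolding complex_norm_square by (simp add: mult.commute)
 qed
 define h where "h = (\<lambda>et. (norm (inverse_fourier \<phi> et))\<^sup>2)"
 have hm [measurable]: "h \<in> borel_measurable borel" unfolding h_def by measurable
 have hi: "integrable lborel h"
 proof (rule LINT_bound[OF integrable_mult_right[OF integrable_norm[OF inverse_fourier_integrable[OF \<phi>]], of I]])
  show "AE x in lborel. norm (h x) \<le> norm (I * norm (inverse_fourier \<phi> x))"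
   using inverse_fourier_bound[OF \<phi>i(1)] by (auto simp: h_def power2_eq_square I_def abs_mult intro!: AE_I2 mult_mono)
 qed simp
 define c where "c = (LINT u|lborel. h u)"
 have g0: "gm 0 \<noteq> 0"
 proof
  assume "gm 0 = 0"
  then have ae: "AE y in lborel. \<phi> y * \<phi> y = 0"
   using integral_nonneg_eq_0_iff_AE[of lborel "\<lambda>y. \<phi> y * \<phi> y"] prod_int[of 0] by (auto simp: gm_def)
  have "(LINT x|lborel. \<phi> x) = (LINT x|(lborel::'a measure). 0)" by (rule integral_cong_AE) (use ae in auto)
  then show False using \<phi>1 by simp
 qed
 have c0: "c \<noteq> 0"
 proof
  assume "c = 0"
  then have ae: "AE y in lborel. h y = 0"
   using integral_nonneg_eq_0_iff_AE[OF hi] by (auto simp: c_def h_def)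
  have "\<exists>xi. xi \<in> ball 0 (1 / Suc n) \<and> inverse_fourier \<phi> xi = 0" for n
  proof (rule ccontr)
   assume na: "\<not> ?thesis"
   have "AE y in lborel. y \<notin> ball (0::'a) (1 / Suc n)"
    using ae by eventually_elim (use na in \<open>auto simp: h_def\<close>)
   then have "emeasure lborel (ball (0::'a) (1 / Suc n)) = 0"
    by (subst (asm) AE_iff_measurable[of "ball (0::'a) (1 / Suc n)"]) (auto simp del: of_nat_Suc)
   moreover have "emeasure lborel (ball (0::'a) (1 / Suc n)) = ennreal (unit_ball_vol (real DIM('a)) * (1 / Suc n) ^ DIM('a))"
    by (rule emeasure_ball) simp
   moreover have "unit_ball_vol (real DIM('a)) * (1 / Suc n) ^ DIM('a) > 0" by (simp del: of_nat_Suc)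
   ultimately show False by (simp del: of_nat_Suc)
  qed
  then obtain t where t: "\<And>n. t n \<in> ball 0 (1 / Suc n)" "\<And>n. inverse_fourier \<phi> (t n) = 0" by metis
  have t0: "t \<longlonglongrightarrow> 0"
  proof (rule tendsto_norm_zero_cancel, rule tendsto_sandwich[of "\<lambda>_. 0" _ _ "\<lambda>n. 1 / real (Suc n)"])
   show "(\<lambda>n. 1 / real (Suc n)) \<longlonglongrightarrow> 0" using LIMSEQ_Suc[OF lim_1_over_n] by simp
   show "\<forall>\<^sub>F n in sequentially. norm (t n) \<le> 1 / real (Suc n)" using t(1) by (intro always_eventually) (auto simp: less_imp_le)
  qed auto
  have "(\<lambda>n. LINT x|lborel. wave x (t n) * complex_of_real (\<phi> x)) \<longlonglongrightarrow> (LINT x|lborel. wave x 0 * complex_of_real (\<phi> x))"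
  proof (rule integral_dominated_convergence[where w = "\<lambda>y. \<bar>\<phi> y\<bar>"])
   have "continuous_on UNIV cis" by (intro continuous_intros)
   then have "isCont cis y" for y by (simp add: continuous_on_eq_continuous_at)
   then show "AE x in lborel. (\<lambda>n. wave x (t n) * complex_of_real (\<phi> x)) \<longlonglongrightarrow> wave x 0 * complex_of_real (\<phi> x)"
    unfolding wave_def using t0 by (intro AE_I2 tendsto_mult_right isCont_tendsto_compose[of _ cis] tendsto_intros) auto
  qed (use \<phi>i in \<open>auto simp: norm_mult wave_simps\<close>)
  then have "(\<lambda>n. inverse_fourier \<phi> (t n)) \<longlonglongrightarrow> of_real 1"
   unfolding inverse_fourier_wave wave_simps(4) by (simp add: \<phi>1)
  then show False using t(2) LIMSEQ_unique[OF _ tendsto_const] by fastforce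
 qed
 show ?thesis
 proof (rule that)
  show "c / gm 0 \<noteq> 0" using c0 g0 by simp
  fix f :: "'a => real" and x assume f: "f \<in> test_functions UNIV"
  have [measurable]: "f \<in> borel_measurable borel" using f by (rule test_functions_borel)
  have fi: "integrable lborel f" using f by (rule test_functions_integrable)
  obtain Bf where Bf: "Bf > 0" "\<And>x. \<bar>f x\<bar> \<le> Bf" by (rule test_functions_bounded[OF f]) blast
  define e where "e = (\<lambda>n::nat. 1 / real (Suc n))"
  have e: "e n > 0" for n by (simp add: e_def)
  have e0: "e \<longlonglongrightarrow> 0" unfolding e_def using LIMSEQ_Suc[OF lim_1_over_n] by simp
  define J where "J = (\<lambda>n. LINT xi|lborel. complex_of_real (gm (e n *\<^sub>R xi)) * (wave (- x) xi * inverse_fourier f xi))"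
  have ifi: "integrable lborel (inverse_fourier f)" by (rule inverse_fourier_integrable[OF f])
  have "J \<longlonglongrightarrow> (LINT xi|lborel. complex_of_real (gm 0) * (wave (- x) xi * inverse_fourier f xi))"
   unfolding J_def
  proof (rule integral_dominated_convergence[where w = "\<lambda>xi. B * I * norm (inverse_fourier f xi)"])
   show "AE xi in lborel. (\<lambda>n. complex_of_real (gm (e n *\<^sub>R xi)) * (wave (- x) xi * inverse_fourier f xi)) \<longlonglongrightarrow> complex_of_real (gm 0) * (wave (- x) xi * inverse_fourier f xi)"
    using tendsto_scaleR[OF e0 tendsto_const] by (intro AE_I2 tendsto_mult_right tendsto_of_real gm_lim) auto
   show "AE xi in lborel. norm (complex_of_real (gm (e n *\<^sub>R xi)) * (wave (- x) xi * inverse_fourier f xi)) \<le> B * I * norm (inverse_fourier f xi)" for n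
    using gm_bound by (auto simp: norm_mult wave_simps intro!: AE_I2 mult_right_mono)
  qed (use ifi in auto)
  then have L1: "J \<longlonglongrightarrow> complex_of_real (gm 0) * (LINT xi|lborel. wave (- x) xi * inverse_fourier f xi)" by simp
  have Jeq: "J n = (LINT u|lborel. complex_of_real (f (x + e n *\<^sub>R u) * h u))" for n
  proof -
   have gmei: "integrable lborel (\<lambda>xi. gm (e n *\<^sub>R xi))" using integrable_affine[OF gmi, of "e n" 0] e[of n] by simp
   have "J n = (LINT xi|lborel. LINT y|lborel. complex_of_real (gm (e n *\<^sub>R xi) * f y) * wave (y - x) xi)"
    unfolding J_def
   proof (intro LINT_cong)
    fix xi
    have "complex_of_real (gm (e n *\<^sub>R xi)) * (wave (- x) xi * inverse_fourier f xi) = (LINT y|lborel. (complex_of_real (gm (e n *\<^sub>R xi)) * wave (- x) xi) * (wave y xi * complex_of_real (f y)))"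
     unfolding inverse_fourier_wave by (simp only: integral_mult_right_zero mult.assoc)
    also have "\<dots> = (LINT y|lborel. complex_of_real (gm (e n *\<^sub>R xi) * f y) * wave (y - x) xi)"
     using wave_simps(2)[of _ "- x" xi] by (intro LINT_cong) (simp add: mult_ac)
    finally show "complex_of_real (gm (e n *\<^sub>R xi)) * (wave (- x) xi * inverse_fourier f xi) = (LINT y|lborel. complex_of_real (gm (e n *\<^sub>R xi) * f y) * wave (y - x) xi)" .
   qed
   also have "\<dots> = (LINT y|lborel. LINT xi|lborel. complex_of_real (gm (e n *\<^sub>R xi) * f y) * wave (y - x) xi)"
    by (rule Fubini_lborel[where g = "\<lambda>xi. \<bar>gm (e n *\<^sub>R xi)\<bar>" and h = "\<lambda>y. \<bar>f y\<bar>"])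
     (use gmei fi in \<open>auto simp: norm_mult wave_simps abs_mult\<close>)
   also have "\<dots> = (LINT y|lborel. complex_of_real (f y * (h ((1 / e n) *\<^sub>R (y - x)) / e n ^ DIM('a))))"
   proof (intro LINT_cong)
    fix y
    have wm: "(\<lambda>xi. wave ((1 / e n) *\<^sub>R (y - x)) xi * complex_of_real (gm xi)) \<in> borel_measurable borel" by measurable
    have "(LINT xi|lborel. wave ((1 / e n) *\<^sub>R (y - x)) (0 + e n *\<^sub>R xi) * complex_of_real (gm (0 + e n *\<^sub>R xi))) =
     (1 / \<bar>e n\<bar> ^ DIM('a)) *\<^sub>R (LINT xi|lborel. wave ((1 / e n) *\<^sub>R (y - x)) xi * complex_of_real (gm xi))"
     by (rule integral_affine[OF wm]) (use e[of n] in simp)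
    also have "(LINT xi|lborel. wave ((1 / e n) *\<^sub>R (y - x)) xi * complex_of_real (gm xi)) = inverse_fourier gm ((1 / e n) *\<^sub>R (y - x))"
     unfolding inverse_fourier_wave wave_def by (simp add: inner_commute)
    also have "\<dots> = of_real (h ((1 / e n) *\<^sub>R (y - x)))" by (simp add: gmF h_def)
    finally have 1: "(LINT xi|lborel. wave (y - x) xi * complex_of_real (gm (e n *\<^sub>R xi))) = of_real (h ((1 / e n) *\<^sub>R (y - x)) / e n ^ DIM('a))"
     using e[of n] by (simp add: wave_simps(6) scaleR_conv_of_real)
    have "(LINT xi|lborel. complex_of_real (gm (e n *\<^sub>R xi) * f y) * wave (y - x) xi) = (LINT xi|lborel. complex_of_real (f y) * (wave (y - x) xi * complex_of_real (gm (e n *\<^sub>R xi))))"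
     by (intro LINT_cong) (simp add: mult_ac)
    then show "(LINT xi|lborel. complex_of_real (gm (e n *\<^sub>R xi) * f y) * wave (y - x) xi) = complex_of_real (f y * (h ((1 / e n) *\<^sub>R (y - x)) / e n ^ DIM('a)))"
     by (simp only: integral_mult_right_zero 1 of_real_mult)
   qed
   also have "\<dots> = (e n ^ DIM('a)) *\<^sub>R (LINT u|lborel. complex_of_real (f (x + e n *\<^sub>R u) * (h ((1 / e n) *\<^sub>R ((x + e n *\<^sub>R u) - x)) / e n ^ DIM('a))))"
   proof -
    have "(\<lambda>y. complex_of_real (f y * (h ((1 / e n) *\<^sub>R (y - x)) / e n ^ DIM('a)))) \<in> borel_measurable borel" by measurable
    from integral_affine[OF this, of "e n" x] show ?thesis using e[of n] by simp
   qed
   also have "\<dots> = (LINT u|lborel. (e n ^ DIM('a)) *\<^sub>R complex_of_real (f (x + e n *\<^sub>R u) * (h ((1 / e n) *\<^sub>R ((x + e n *\<^sub>R u) - x)) / e n ^ DIM('a))))"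
    by simp
   also have "\<dots> = (LINT u|lborel. complex_of_real (f (x + e n *\<^sub>R u) * h u))"
    using e[of n] by (intro LINT_cong) (simp add: scaleR_conv_of_real)
   finally show ?thesis .
  qed
  have "(\<lambda>n. LINT u|lborel. complex_of_real (f (x + e n *\<^sub>R u) * h u)) \<longlonglongrightarrow> (LINT u|lborel. complex_of_real (f x * h u))"
  proof (rule integral_dominated_convergence[where w = "\<lambda>u. Bf * \<bar>h u\<bar>"])
   have ct: "isCont f y" for y using test_functions_continuous[OF f, of UNIV] by (simp add: continuous_on_eq_continuous_at)
   show "AE u in lborel. (\<lambda>n. complex_of_real (f (x + e n *\<^sub>R u) * h u)) \<longlonglongrightarrow> complex_of_real (f x * h u)"
   proof (intro AE_I2 tendsto_of_real tendsto_mult_right)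
    fix u
    have "(\<lambda>n. x + e n *\<^sub>R u) \<longlonglongrightarrow> x + 0 *\<^sub>R u" by (intro tendsto_intros e0)
    then show "(\<lambda>n. f (x + e n *\<^sub>R u)) \<longlonglongrightarrow> f x" using isCont_tendsto_compose[OF ct] by auto
   qed
   show "AE u in lborel. norm (complex_of_real (f (x + e n *\<^sub>R u) * h u)) \<le> Bf * \<bar>h u\<bar>" for n
    using Bf by (auto simp: norm_mult intro!: AE_I2 mult_right_mono)
  qed (use hi in auto)
  then have "J \<longlonglongrightarrow> of_real (f x * c)" using Jeq[abs_def] by (simp add: Jeq c_def)
  from LIMSEQ_unique[OF L1 this]
  show "(LINT xi|lborel. wave (- x) xi * inverse_fourier f xi) = of_real (c / gm 0 * f x)"
   using g0 by (simp add: field_simps)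
 qed
qed

lemma integrable_bounded_support:
 fixes F :: "'a::euclidean_space => 'b::{banach, second_countable_topology}"
 assumes "F \<in> borel_measurable borel" "\<And>x. norm (F x) \<le> B" "bounded U" "\<And>x. x \<notin> U ==> F x = 0"
 shows "integrable lborel F"
proof -
 obtain R where R: "\<And>x. x \<in> U ==> norm x \<le> R" using assms(3) by (auto simp: bounded_iff)
 have "integrable lborel (\<lambda>x. B * indicator (cball (0::'a) R) x)"
  using emeasure_lborel_cball_finite[of "0::'a" R] by (intro integrable_mult_right integrable_real_indicator) auto
 then show ?thesis
 proof (rule LINT_bound)
  show "AE x in lborel. norm (F x) \<le> norm (B * indicator (cball (0::'a) R) x)"
  proof (intro AE_I2)
   fix x
   show "norm (F x) \<le> norm (B * indicator (cball (0::'a) R) x)"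
    using assms(2)[of x] assms(4)[of x] R[of x] by (cases "x \<in> U") auto
  qed
 qed (use assms in simp)
qed

lemma sobolev_fourier_bounded_function:
 fixes \<phi> :: "'a::euclidean_space => real" and F :: "'a => complex"
 assumes \<phi>: "\<phi> \<in> test_functions UNIV" "(LINT x|lborel. \<phi> x) = 1"
  and F: "F \<in> borel_measurable borel" "\<And>x. norm (F x) \<le> B" "bounded U" "\<And>x. x \<notin> U ==> F x = 0"
 shows "\<exists>v. sobolev_fourier (- real DIM('a)) (\<lambda>f. LINT x|lborel. F x * complex_of_real (f x)) v"
proof -
 note F(1) [measurable]
 obtain kp where kp: "kp \<noteq> 0" "\<And>(f :: 'a => real) x. f \<in> test_functions UNIV ==> (LINT xi|lborel. wave (- x) xi * inverse_fourier f xi) = of_real (kp * f x)"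
  by (rule inverse_fourier_inversion[OF \<phi>]) blast
 have Fi: "integrable lborel F" by (rule integrable_bounded_support[OF F])
 define v where "v = (\<lambda>xi. (LINT x|lborel. wave (- x) xi * F x) / of_real kp)"
 define V where "V = (LINT x|lborel. norm (F x)) / \<bar>kp\<bar>"
 have V: "norm (v xi) \<le> V" for xi
 proof -
  have "norm (LINT x|lborel. wave (- x) xi * F x) \<le> (LINT x|lborel. norm (wave (- x) xi * F x))" by (rule integral_norm_bound)
  then show ?thesis unfolding v_def V_def by (simp add: norm_mult wave_simps norm_divide divide_right_mono)
 qed
 have vm [measurable]: "v \<in> borel_measurable borel" unfolding v_def by measurable
 show ?thesis
 proof (intro exI[of _ v], unfold sobolev_fourier_def, intro conjI ballI)
  show "v \<in> borel_measurable lborel" by simp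
  show "integrable lborel (\<lambda>xi. (1 + (norm xi)\<^sup>2) powr (- real DIM('a)) * (norm (v xi))\<^sup>2)"
  proof (rule LINT_bound[OF integrable_mult_right[OF integrable_bracket, of "V\<^sup>2"]])
   have "(norm (v xi))\<^sup>2 \<le> V\<^sup>2" for xi using V[of xi] by (intro power_mono) auto
   then show "AE xi in lborel. norm ((1 + (norm xi)\<^sup>2) powr (- real DIM('a)) * (norm (v xi))\<^sup>2) \<le> norm (V\<^sup>2 * bracket (xi::'a) powr (- real DIM('a)))"
    by (auto simp: bracket_def abs_mult mult.commute intro!: AE_I2 mult_right_mono)
  qed measurable
  fix f :: "'a => real" assume f: "f \<in> test_functions UNIV"
  have [measurable]: "f \<in> borel_measurable borel" using f by (rule test_functions_borel)
  have "(LINT xi|lborel. v xi * inverse_fourier f xi) = (LINT xi|lborel. LINT x|lborel. (wave (- x) xi * F x) * (inverse_fourier f xi / of_real kp))"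
   by (simp only: integral_mult_left_zero v_def) simp
  also have "\<dots> = (LINT x|lborel. LINT xi|lborel. (wave (- x) xi * F x) * (inverse_fourier f xi / of_real kp))"
   by (rule Fubini_lborel[where g = "\<lambda>xi. norm (inverse_fourier f xi) / \<bar>kp\<bar>" and h = "\<lambda>x. norm (F x)"])
    (use Fi inverse_fourier_integrable[OF f] in \<open>auto simp: norm_mult norm_divide wave_simps mult.commute\<close>)
  also have "\<dots> = (LINT x|lborel. (F x / of_real kp) * (LINT xi|lborel. wave (- x) xi * inverse_fourier f xi))"
   by (simp only: integral_mult_right_zero[symmetric]) (simp add: mult_ac)
  also have "\<dots> = (LINT x|lborel. F x * complex_of_real (f x))"
   using kp(1) by (intro LINT_cong) (simp add: kp(2)[OF f])
  finally show "(LINT x|lborel. F x * complex_of_real (f x)) = (LINT xi|lborel. v xi * inverse_fourier f xi)" by simp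
 qed
qed

lemma inverse_fourier_weighted_integrable:
 fixes f :: "'a::euclidean_space => real"
 assumes f: "f \<in> test_functions UNIV"
 shows "integrable lborel (\<lambda>xi. bracket xi powr (real DIM('a)) * (norm (inverse_fourier f xi))\<^sup>2)"
proof -
 have [measurable]: "f \<in> borel_measurable borel" using f by (rule test_functions_borel)
 obtain B where B: "B \<ge> 0" "\<And>xi. norm (inverse_fourier f xi) \<le> B * bracket xi powr (- real DIM('a))"
  using inverse_fourier_decay[OF f, of "DIM('a)"] by blast
 show ?thesis
 proof (rule LINT_bound[OF integrable_mult_right[OF integrable_bracket, of "B\<^sup>2"]])
  have "bracket xi powr (real DIM('a)) * (norm (inverse_fourier f xi))\<^sup>2 \<le> B\<^sup>2 * bracket xi powr (- real DIM('a))" for xi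
  proof -
   have "bracket xi powr (real DIM('a)) * (norm (inverse_fourier f xi))\<^sup>2 \<le> bracket xi powr (real DIM('a)) * (B * bracket xi powr (- real DIM('a)))\<^sup>2"
    using B by (intro mult_left_mono power_mono) auto
   also have "\<dots> = B\<^sup>2 * (bracket xi powr (real DIM('a)) * bracket xi powr (- real DIM('a)) * bracket xi powr (- real DIM('a)))"
    by (simp add: power2_eq_square mult_ac)
   also have "\<dots> = B\<^sup>2 * bracket xi powr (- real DIM('a))"
    using bracket_pos[of xi] by (simp add: powr_add[symmetric])
   finally show ?thesis .
  qed
  then show "AE xi in lborel. norm (bracket xi powr (real DIM('a)) * (norm (inverse_fourier f xi))\<^sup>2) \<le> norm (B\<^sup>2 * bracket (xi::'a) powr (- real DIM('a)))"
   by simp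
 qed measurable
qed

lemma weighted_am_gm:
 fixes a c w t :: real
 assumes "w > 0" "t > 0"
 shows "a * c \<le> (t * (w * a\<^sup>2) + (1 / t) * ((1 / w) * c\<^sup>2)) / 2"
proof -
 have "0 \<le> (t * w * a - c)\<^sup>2 / (t * w)" using assms by simp
 also have "\<dots> = t * (w * a\<^sup>2) + (1 / t) * ((1 / w) * c\<^sup>2) - 2 * (a * c)"
  using assms by (simp add: power2_eq_square field_simps)
 finally show ?thesis by simp
qed

lemma sobolev_fourier_pairing:
 fixes f :: "'a::euclidean_space => real"
 assumes v: "sobolev_fourier (- real DIM('a)) u v" and f: "f \<in> test_functions UNIV" and t: "t > 0"
 shows "integrable lborel (\<lambda>xi. v xi * inverse_fourier f xi)"
  "norm (u f) \<le> (t * (LINT xi|lborel. (1 + (norm xi)\<^sup>2) powr (- real DIM('a)) * (norm (v xi))\<^sup>2)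
   + (1 / t) * (LINT xi|lborel. bracket xi powr (real DIM('a)) * (norm (inverse_fourier f xi))\<^sup>2)) / 2"
proof -
 have [measurable]: "f \<in> borel_measurable borel" using f by (rule test_functions_borel)
 have [measurable]: "v \<in> borel_measurable borel" using v by (simp add: sobolev_fourier_def)
 define p where "p = (\<lambda>xi::'a. (1 + (norm xi)\<^sup>2) powr (- real DIM('a)) * (norm (v xi))\<^sup>2)"
 define q where "q = (\<lambda>xi::'a. bracket xi powr (real DIM('a)) * (norm (inverse_fourier f xi))\<^sup>2)"
 have pi: "integrable lborel p" using v by (simp add: sobolev_fourier_def p_def)
 have qi: "integrable lborel q" unfolding q_def by (rule inverse_fourier_weighted_integrable[OF f])
 have le: "norm (v xi * inverse_fourier f xi) \<le> (t * p xi + (1 / t) * q xi) / 2" for xi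
 proof -
  have "(1 + (norm xi)\<^sup>2) powr (- real DIM('a)) = 1 / bracket xi powr (real DIM('a))"
   by (simp add: bracket_def powr_minus_divide)
  then show ?thesis
   using weighted_am_gm[of "1 / bracket xi powr (real DIM('a))" t "norm (v xi)" "norm (inverse_fourier f xi)"] t bracket_pos[of xi]
   by (simp add: p_def q_def norm_mult)
 qed
 have bi: "integrable lborel (\<lambda>xi. (t * p xi + (1 / t) * q xi) / 2)" using pi qi by auto
 have nn: "p xi \<ge> 0" "q xi \<ge> 0" for xi by (auto simp: p_def q_def)
 show i: "integrable lborel (\<lambda>xi. v xi * inverse_fourier f xi)"
  by (rule LINT_bound[OF bi]) (use le nn t in \<open>auto simp: abs_of_nonneg\<close>)
 have "u f = (LINT xi|lborel. v xi * inverse_fourier f xi)" using v f by (simp add: sobolev_fourier_def)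
 then have "norm (u f) \<le> (LINT xi|lborel. norm (v xi * inverse_fourier f xi))" by (simp add: integral_norm_bound)
 also have "\<dots> \<le> (LINT xi|lborel. (t * p xi + (1 / t) * q xi) / 2)"
  by (intro integral_mono le integrable_norm i bi)
 also have "\<dots> = (t * (LINT xi|lborel. p xi) + (1 / t) * (LINT xi|lborel. q xi)) / 2"
  using pi qi by simp
 finally show "norm (u f) \<le> (t * (LINT xi|lborel. (1 + (norm xi)\<^sup>2) powr (- real DIM('a)) * (norm (v xi))\<^sup>2)
   + (1 / t) * (LINT xi|lborel. bracket xi powr (real DIM('a)) * (norm (inverse_fourier f xi))\<^sup>2)) / 2"
  by (simp add: p_def q_def)
qed

lemma sobolev_fourier_diff:
 fixes u1 :: "('a::euclidean_space => real) => complex"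
 assumes v1: "sobolev_fourier (- real DIM('a)) u1 v1" and v2: "sobolev_fourier (- real DIM('a)) u2 v2"
 shows "sobolev_fourier (- real DIM('a)) (\<lambda>f. u1 f - u2 f) (\<lambda>xi. v1 xi - v2 xi)"
 unfolding sobolev_fourier_def
proof (intro conjI ballI)
 have [measurable]: "v1 \<in> borel_measurable borel" "v2 \<in> borel_measurable borel"
  using v1 v2 by (simp_all add: sobolev_fourier_def)
 show "(\<lambda>xi. v1 xi - v2 xi) \<in> borel_measurable lborel" by simp
 define w where "w = (\<lambda>xi::'a. (1 + (norm xi)\<^sup>2) powr (- real DIM('a)))"
 have [measurable]: "w \<in> borel_measurable borel" unfolding w_def by measurable
 have i: "integrable lborel (\<lambda>xi. 2 * (w xi * (norm (v1 xi))\<^sup>2) + 2 * (w xi * (norm (v2 xi))\<^sup>2))"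
  using v1 v2 by (auto simp: sobolev_fourier_def w_def)
 have le: "w xi * (norm (v1 xi - v2 xi))\<^sup>2 \<le> 2 * (w xi * (norm (v1 xi))\<^sup>2) + 2 * (w xi * (norm (v2 xi))\<^sup>2)" for xi
 proof -
  have "(norm (v1 xi - v2 xi))\<^sup>2 \<le> (norm (v1 xi) + norm (v2 xi))\<^sup>2" by (intro power_mono norm_triangle_ineq4) auto
  also have "\<dots> \<le> 2 * (norm (v1 xi))\<^sup>2 + 2 * (norm (v2 xi))\<^sup>2"
   using sum_squares_bound[of "norm (v1 xi)" "norm (v2 xi)"] by (simp add: power2_sum)
  finally have "w xi * (norm (v1 xi - v2 xi))\<^sup>2 \<le> w xi * (2 * (norm (v1 xi))\<^sup>2 + 2 * (norm (v2 xi))\<^sup>2)"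
   by (intro mult_left_mono) (auto simp: w_def)
  then show ?thesis by (simp add: algebra_simps)
 qed
 have w0: "w xi \<ge> 0" for xi by (simp add: w_def)
 have "integrable lborel (\<lambda>xi. w xi * (norm (v1 xi - v2 xi))\<^sup>2)"
  by (rule LINT_bound[OF i]) (use le w0 in \<open>auto simp: abs_of_nonneg\<close>)
 then show "integrable lborel (\<lambda>xi. (1 + (norm xi)\<^sup>2) powr (- real DIM('a)) * (norm (v1 xi - v2 xi))\<^sup>2)"
  by (simp add: w_def)
 fix f :: "'a => real" assume f: "f \<in> test_functions UNIV"
 show "u1 f - u2 f = (LINT xi|lborel. (v1 xi - v2 xi) * inverse_fourier f xi)"
  using v1 v2 f sobolev_fourier_pairing(1)[OF v1 f zero_less_one] sobolev_fourier_pairing(1)[OF v2 f zero_less_one]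
  by (simp add: sobolev_fourier_def left_diff_distrib)
qed

lemma sobolev_norm_pairing:
 fixes f :: "'a::euclidean_space => real"
 assumes f: "f \<in> test_functions UNIV"
 obtains K where "\<And>u. \<exists>v. sobolev_fourier (- real DIM('a)) u v ==> norm (u f) \<le> K * sobolev_norm (- real DIM('a)) u"
proof -
 define Q where "Q = (LINT xi|lborel. bracket xi powr (real DIM('a)) * (norm (inverse_fourier f xi))\<^sup>2)"
 have Q: "Q \<ge> 0" unfolding Q_def by (rule integral_nonneg_AE) simp
 show ?thesis
 proof (rule that)
  fix u :: "('a => real) => complex" assume "\<exists>v. sobolev_fourier (- real DIM('a)) u v"
  then have v: "sobolev_fourier (- real DIM('a)) u (SOME v. sobolev_fourier (- real DIM('a)) u v)" by (rule someI_ex)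
  define S where "S = (LINT xi|lborel. (1 + (norm xi)\<^sup>2) powr (- real DIM('a)) * (norm ((SOME v. sobolev_fourier (- real DIM('a)) u v) xi))\<^sup>2)"
  define n where "n = sobolev_norm (- real DIM('a)) u"
  have S: "S \<ge> 0" unfolding S_def by (rule integral_nonneg_AE) simp
  have nS: "n = sqrt S" by (simp add: n_def S_def sobolev_norm_def Let_def)
  have b: "norm (u f) \<le> (t * S + (1 / t) * Q) / 2" if "t > 0" for t
   using sobolev_fourier_pairing(2)[OF v f that] by (simp add: S_def Q_def)
  show "norm (u f) \<le> ((1 + Q) / 2) * sobolev_norm (- real DIM('a)) u"
  proof (cases "S = 0")
   case True
   have "norm (u f) \<le> 0 + e" if "e > 0" for e
   proof -
    have "norm (u f) \<le> (1 / ((Q + 1) / e)) * Q / 2" using b[of "(Q + 1) / e"] True that Q by simp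
    also have "\<dots> \<le> 0 + e" using that Q by (simp add: field_simps)
    finally show ?thesis .
   qed
   then have "norm (u f) \<le> 0" by (rule field_le_epsilon)
   then show ?thesis using Q True nS n_def by simp
  next
   case False
   then have n: "n > 0" "S = n * n" using S nS by auto
   show ?thesis using b[of "1 / n"] n by (simp add: n_def[symmetric] field_simps)
  qed
 qed
qed

lemma (in prob_space) tendsto_0_in_probability_AE_subseq:
 fixes Z :: "real => 'a => real"
 assumes "tendsto_0_in_probability M Z (at_right 0)"
 obtains dl :: "nat => real" where "\<And>n. dl n > 0" "dl \<longlonglongrightarrow> 0" "AE w in M. (\<lambda>n. Z (dl n) w) \<longlonglongrightarrow> 0"
proof -
 define e where "e = (\<lambda>n::nat. 1 / real (Suc n))"
 have e0: "e \<longlonglongrightarrow> 0" "\<And>n. e n > 0" unfolding e_def using LIMSEQ_Suc[OF lim_1_over_n] by auto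
 have ef: "filterlim e (at_right 0) sequentially"
  unfolding filterlim_at using e0(1) by (auto simp: e_def intro!: always_eventually)
 have "\<forall>\<^sub>F i in at_right 0. Z i \<in> borel_measurable M"
  using assms by (simp add: tendsto_0_in_probability_def)
 then have "\<forall>\<^sub>F n in sequentially. Z (e n) \<in> borel_measurable M"
  by (rule eventually_compose_filterlim[OF _ ef])
 then obtain N where N: "\<And>n. n \<ge> N ==> Z (e n) \<in> borel_measurable M" by (auto simp: eventually_sequentially)
 have lim: "(\<lambda>n. prob {w \<in> space M. \<bar>Z (e (n + N)) w\<bar> > ep}) \<longlonglongrightarrow> 0" if "ep > 0" for ep
 proof -
  have "((\<lambda>i. prob {w \<in> space M. \<bar>Z i w\<bar> > ep}) \<longlongrightarrow> 0) (at_right 0)"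
   using assms that by (simp add: tendsto_0_in_probability_def)
  from filterlim_compose[OF this ef] show ?thesis
   by (rule LIMSEQ_ignore_initial_segment)
 qed
 define u where "u = (\<lambda>n w. min 1 \<bar>Z (e (n + N)) w\<bar>)"
 have um [measurable]: "(\<lambda>w. Z (e (n + N)) w) \<in> borel_measurable M" "u n \<in> borel_measurable M" for n
  unfolding u_def using N[of "n + N"] by auto
 have ui: "integrable M (u n)" for n
  by (rule integrable_const_bound[of _ 1]) (auto simp: u_def)
 have "(\<lambda>n. \<integral>w. norm (u n w) \<partial>M) \<longlonglongrightarrow> 0"
 proof (rule LIMSEQ_I)
  fix ep :: real assume ep: "ep > 0"
  have "\<forall>\<^sub>F n in sequentially. prob {w \<in> space M. \<bar>Z (e (n + N)) w\<bar> > ep / 2} < ep / 2"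
   using order_tendstoD(2)[OF lim[of "ep / 2"], of "ep / 2"] ep by auto
  then obtain n0 where n0: "\<And>n. n \<ge> n0 ==> prob {w \<in> space M. \<bar>Z (e (n + N)) w\<bar> > ep / 2} < ep / 2"
   by (auto simp: eventually_sequentially)
  have "(\<integral>w. norm (u n w) \<partial>M) < ep" if "n \<ge> n0" for n
  proof -
   let ?A = "{w \<in> space M. \<bar>Z (e (n + N)) w\<bar> > ep / 2}"
   have A: "?A \<in> sets M" by measurable
   have "(\<integral>w. norm (u n w) \<partial>M) \<le> (\<integral>w. ep / 2 + indicator ?A w \<partial>M)"
   proof (rule integral_mono)
    show "integrable M (\<lambda>w. norm (u n w))" using ui by auto
    show "integrable M (\<lambda>w. ep / 2 + indicator ?A w)" using A by (auto intro!: integrable_real_indicator simp: emeasure_eq_measure)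
    show "norm (u n w) \<le> ep / 2 + indicator ?A w" if "w \<in> space M" for w
     using ep that by (auto simp: u_def indicator_def)
   qed
   also have "\<dots> = ep / 2 + prob ?A" using A
    by (subst Bochner_Integration.integral_add) (auto intro!: integrable_real_indicator simp: emeasure_eq_measure prob_space)
   finally show ?thesis using n0[OF that] by simp
  qed
  moreover have "(\<integral>w. norm (u n w) \<partial>M) \<ge> 0" for n by simp
  ultimately show "\<exists>no. \<forall>n\<ge>no. norm ((\<integral>w. norm (u n w) \<partial>M) - 0) < ep" by auto
 qed
 from tendsto_L1_AE_subseq[OF ui this] obtain r :: "nat => nat" where
  r: "strict_mono r" "AE w in M. (\<lambda>n. u (r n) w) \<longlonglongrightarrow> 0" by blast
 show ?thesis
 proof (rule that)
  show "e (r n + N) > 0" for n by (rule e0)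
  have "filterlim (\<lambda>n. r n + N) sequentially sequentially"
   using filterlim_compose[OF filterlim_add_const_nat_at_top filterlim_subseq[OF r(1)]] by simp
  then show "(\<lambda>n. e (r n + N)) \<longlonglongrightarrow> 0" by (rule filterlim_compose[OF e0(1)])
  show "AE w in M. (\<lambda>n. Z (e (r n + N)) w) \<longlonglongrightarrow> 0"
   using r(2)
  proof eventually_elim
   case (elim w)
   then have "\<forall>\<^sub>F n in sequentially. u (r n) w < 1" by (rule order_tendstoD) simp
   then have "\<forall>\<^sub>F n in sequentially. u (r n) w = \<bar>Z (e (r n + N)) w\<bar>"
    by eventually_elim (auto simp: u_def min_def split: if_splits)
   then have "(\<lambda>n. \<bar>Z (e (r n + N)) w\<bar>) \<longlonglongrightarrow> 0" using elim by (rule Lim_transform_eventually[rotated])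
   then show ?case by (simp add: tendsto_rabs_zero_iff)
  qed
 qed
qed

lemma (in prob_space) sobolev_limit_pairing:
 fixes \<phi> :: "'b::euclidean_space => real" and F :: "real => 'a => 'b => complex"
 assumes \<phi>: "\<phi> \<in> test_functions UNIV" "(LINT x|lborel. \<phi> x) = 1"
  and F: "\<And>dl w. dl > 0 ==> w \<in> space M ==> F dl w \<in> borel_measurable borel"
   "\<And>dl w x. dl > 0 ==> w \<in> space M ==> norm (F dl w x) \<le> B dl" "bounded U" "\<And>dl w x. x \<notin> U ==> F dl w x = 0"
  and \<mu>: "random_sobolev M (- real DIM('b)) \<mu>"
  and conv: "tendsto_0_in_probability M (\<lambda>dl w. sobolev_norm (- real DIM('b)) (\<lambda>f. (LINT x|lborel. F dl w x * complex_of_real (f x)) - \<mu> w f)) (at_right 0)"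
 obtains dl :: "nat => real" where "\<And>n. dl n > 0" "dl \<longlonglongrightarrow> 0"
  "AE w in M. \<forall>f\<in>test_functions UNIV. (\<lambda>n. LINT x|lborel. F (dl n) w x * complex_of_real (f x)) \<longlonglongrightarrow> \<mu> w f"
proof -
 obtain dl :: "nat => real" where dl: "\<And>n. dl n > 0" "dl \<longlonglongrightarrow> 0"
  "AE w in M. (\<lambda>n. sobolev_norm (- real DIM('b)) (\<lambda>f. (LINT x|lborel. F (dl n) w x * complex_of_real (f x)) - \<mu> w f)) \<longlonglongrightarrow> 0"
  by (rule tendsto_0_in_probability_AE_subseq[OF conv]) blast
 have "AE w in M. \<forall>f\<in>test_functions UNIV. (\<lambda>n. LINT x|lborel. F (dl n) w x * complex_of_real (f x)) \<longlonglongrightarrow> \<mu> w f"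
  using dl(3) AE_space
 proof eventually_elim
  case (elim w)
  show ?case
  proof
   fix f :: "'b => real" assume f: "f \<in> test_functions UNIV"
   obtain K where K: "\<And>u. \<exists>v. sobolev_fourier (- real DIM('b)) u v ==> norm (u f) \<le> K * sobolev_norm (- real DIM('b)) u"
    by (rule sobolev_norm_pairing[OF f]) blast
   define u where "u = (\<lambda>n f. (LINT x|lborel. F (dl n) w x * complex_of_real (f x)) - \<mu> w f)"
   obtain v2 where v2: "sobolev_fourier (- real DIM('b)) (\<mu> w) v2"
    using \<mu> elim(2) by (auto simp: random_sobolev_def sobolev_def)
   have "\<exists>v. sobolev_fourier (- real DIM('b)) (u n) v" for n
   proof -
    obtain v1 where "sobolev_fourier (- real DIM('b)) (\<lambda>f. LINT x|lborel. F (dl n) w x * complex_of_real (f x)) v1"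
     using sobolev_fourier_bounded_function[OF \<phi> F(1)[OF dl(1) elim(2)] F(2)[OF dl(1) elim(2)] F(3) F(4)] by blast
    from sobolev_fourier_diff[OF this v2] show ?thesis unfolding u_def by blast
   qed
   then have b: "norm (u n f) \<le> K * sobolev_norm (- real DIM('b)) (u n)" for n by (rule K)
   have "(\<lambda>n. sobolev_norm (- real DIM('b)) (u n)) \<longlonglongrightarrow> 0"
    using elim(1) unfolding u_def .
   from tendsto_mult_left[OF this, of K] have lim0: "(\<lambda>n. K * sobolev_norm (- real DIM('b)) (u n)) \<longlonglongrightarrow> 0"
    by simp
   have "(\<lambda>n. u n f) \<longlonglongrightarrow> 0"
    by (rule Lim_null_comparison[OF _ lim0]) (intro always_eventually allI b)
   then have "(\<lambda>n. (LINT x|lborel. F (dl n) w x * complex_of_real (f x)) - \<mu> w f) \<longlonglongrightarrow> 0"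
    unfolding u_def .
   then show "(\<lambda>n. LINT x|lborel. F (dl n) w x * complex_of_real (f x)) \<longlonglongrightarrow> \<mu> w f"
    by (rule LIM_zero_cancel)
  qed
 qed
 then show ?thesis by (rule that[OF dl(1,2)])
qed

section \<open>Log-correlated fields\<close>

lemma (in prob_space) centered_gaussian_moments:
 assumes "centered_gaussian M X"
 shows "X \<in> borel_measurable M" "integrable M (\<lambda>w. (X w)\<^sup>2)"
  "(LINT w|M. cis (X w)) = exp (- (complex_of_real (LINT w|M. (X w)\<^sup>2)) / 2)"
proof -
 show [measurable]: "X \<in> borel_measurable M" using assms by (simp add: centered_gaussian_def)
 have [measurable]: "cis \<in> borel_measurable borel"
  by (intro borel_measurable_continuous_onI continuous_intros)
 consider "AE w in M. X w = 0" | \<sigma> where "\<sigma> > 0" "distributed M lborel X (normal_density 0 \<sigma>)"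
  using assms by (auto simp: centered_gaussian_def)
 then have "integrable M (\<lambda>w. (X w)\<^sup>2) \<and> (LINT w|M. cis (X w)) = exp (- (complex_of_real (LINT w|M. (X w)\<^sup>2)) / 2)"
 proof cases
  case 1
  have sq: "AE w in M. (X w)\<^sup>2 = 0" using 1 by eventually_elim simp
  have "integrable M (\<lambda>w. (X w)\<^sup>2) = integrable M (\<lambda>w. 0::real)"
   by (rule integrable_cong_AE) (use sq in auto)
  moreover have "(LINT w|M. (X w)\<^sup>2) = (LINT w|M. 0)" by (rule integral_cong_AE) (use sq in auto)
  moreover have "(LINT w|M. cis (X w)) = (LINT w|M. 1)"
   by (rule integral_cong_AE) (use 1 in auto)
  ultimately show ?thesis by (simp add: prob_space)
 next
  case 2
  define Y where "Y = (\<lambda>w. X w / \<sigma>)"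
  have Y: "distributed M lborel Y std_normal_density"
   using normal_standard_normal_convert[OF 2(1), of X 0] 2(2) by (simp add: Y_def)
  have Ym [measurable]: "Y \<in> borel_measurable M" using distributed_measurable[OF Y] by simp
  have dY: "distr M lborel Y = std_normal_distribution"
   using distributed_distr_eq_density[OF Y] by simp
  have X: "X w = \<sigma> * Y w" for w using 2(1) by (simp add: Y_def)
  have Y2: "has_bochner_integral lborel (\<lambda>x. std_normal_density x * x\<^sup>2) 1"
   using std_normal_moment_even[of 1] by simp
  have Y2i: "integrable M (\<lambda>w. (Y w)\<^sup>2)"
   using distributed_integrable[OF Y, of "\<lambda>x. x\<^sup>2"] Y2 by (auto simp: has_bochner_integral_iff normal_density_nonneg)
  have Y2v: "(LINT w|M. (Y w)\<^sup>2) = 1"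
   using distributed_integral[OF Y, of "\<lambda>x. x\<^sup>2"] Y2 by (auto simp: has_bochner_integral_iff normal_density_nonneg)
  have "(LINT w|M. cis (X w)) = (LINT w|M. iexp (\<sigma> * Y w))" by (simp add: X cis_conv_exp)
  also have "\<dots> = char (distr M lborel Y) \<sigma>"
   unfolding char_def by (subst integral_distr) auto
  also have "\<dots> = exp (- (complex_of_real (\<sigma>\<^sup>2)) / 2)"
   unfolding dY char_std_normal_distribution by (simp add: exp_of_real[symmetric])
  finally show ?thesis using Y2i Y2v by (simp add: X power_mult_distrib)
 qed
 then show "integrable M (\<lambda>w. (X w)\<^sup>2)"
  "(LINT w|M. cis (X w)) = exp (- (complex_of_real (LINT w|M. (X w)\<^sup>2)) / 2)" by auto
qed

lemma borel_measurable_caratheodory: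
 fixes f :: "'w => 'a::euclidean_space => 'b::{metric_space}"
 assumes m: "\<And>x. (\<lambda>w. f w x) \<in> borel_measurable M"
  and c: "\<And>w. w \<in> space M ==> continuous_on UNIV (f w)"
 shows "(\<lambda>(w, x). f w x) \<in> borel_measurable (M \<Otimes>\<^sub>M borel)"
proof -
 obtain D :: "'a set" where D: "countable D" "\<And>X. open X ==> X \<noteq> {} ==> \<exists>d\<in>D. d \<in> X"
  using countable_dense_setE by blast
 then have "D \<noteq> {}" by (metis empty_iff open_UNIV UNIV_not_empty)
 define q where "q = from_nat_into D"
 have q: "\<exists>i. dist (q i) x < e" if e: "e > 0" for x e
 proof -
  obtain d where "d \<in> D" "d \<in> ball x e" using D(2)[of "ball x e"] e by auto
  then show ?thesis using from_nat_into_surj[OF D(1)] by (metis dist_commute mem_ball q_def)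
 qed
 define N where "N = (\<lambda>n x. LEAST i. dist (q i) x < 1 / real (Suc n))"
 have N: "dist (q (N n x)) x < 1 / real (Suc n)" for n x
  unfolding N_def by (rule LeastI_ex) (rule q, simp)
 have Nm: "N n \<in> measurable borel (count_space UNIV)" for n
  unfolding N_def by measurable
 have lim: "(\<lambda>n. q (N n x)) \<longlonglongrightarrow> x" for x
 proof (rule metric_LIMSEQ_I)
  fix r :: real assume "r > 0"
  then obtain n0 where n0: "1 / real (Suc n0) < r" using nat_approx_posE by blast
  have "dist (q (N n x)) x < r" if "n \<ge> n0" for n
  proof -
   have "1 / real (Suc n) \<le> 1 / real (Suc n0)" using that by (simp add: field_simps)
   then show ?thesis using N[of n x] n0 by linarith
  qed
  then show "\<exists>no. \<forall>n\<ge>no. dist (q (N n x)) x < r" by blast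
 qed
 show ?thesis
 proof (rule borel_measurable_LIMSEQ_metric)
  fix n
  have 1: "(\<lambda>z. N n (snd z)) \<in> measurable (M \<Otimes>\<^sub>M borel) (count_space UNIV)"
   by (rule measurable_compose[OF measurable_snd Nm])
  have 2: "(\<lambda>z. f (fst z) (q i)) \<in> borel_measurable (M \<Otimes>\<^sub>M borel)" for i
   by (rule measurable_compose[OF measurable_fst m])
  show "(\<lambda>z. f (fst z) (q (N n (snd z)))) \<in> borel_measurable (M \<Otimes>\<^sub>M borel)"
   by (rule measurable_compose_countable'[OF 2 1]) simp
 next
  fix z assume z: "z \<in> space (M \<Otimes>\<^sub>M (borel :: 'a measure))"
  then have "isCont (f (fst z)) (snd z)"
   using c by (auto simp: space_pair_measure continuous_on_eq_continuous_at)
  then show "(\<lambda>n. f (fst z) (q (N n (snd z)))) \<longlonglongrightarrow> (case z of (w, x) => f w x)"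
   using isCont_tendsto_compose[OF _ lim] by (simp add: split_beta)
 qed
qed

locale log_field = prob_space M for M :: "'w measure" +
 fixes U :: "'a::euclidean_space set" and g :: "'a \<times> 'a => real" and \<Gamma> :: "'w => ('a => real) => real"
  and \<phi> :: "'a => real" and \<beta> :: real
 assumes dim: "DIM('a) \<ge> 2" and U: "bounded U" "open U"
  and g_C2: "Ck_on 2 (U \<times> U) g" and g_int: "set_integrable lborel (U \<times> U) g"
  and field: "gaussian_field M U (\<lambda>x y. ln (1 / norm (x - y)) + g (x, y)) \<Gamma>"
  and beta: "0 < \<beta>" "\<beta>\<^sup>2 < DIM('a)" and moll: "annular_mollifier \<phi>"
begin

definition C :: "'a => 'a => real" where "C x y = ln (1 / norm (x - y)) + g (x, y)"
definition b :: real where "b = \<beta>\<^sup>2"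
definition mol :: "real => 'a => 'a => real" where "mol dl x = (\<lambda>y. rescale \<phi> dl (x - y))"
definition cov :: "('a => real) => ('a => real) => real" where "cov f h = (LINT w|M. \<Gamma> w f * \<Gamma> w h)"
definition Kd :: "real => 'a => 'a => real" where "Kd dl x y = cov (mol dl x) (mol dl y)"
definition chaos :: "real => 'w => 'a => complex" where "chaos dl = chaos_approx M U \<phi> \<beta> \<Gamma> dl"

lemma b: "0 < b" "b < DIM('a)" using beta by (auto simp: b_def)

lemma phi: "\<phi> \<in> test_functions UNIV" "\<And>x. \<phi> x \<ge> 0" "(LINT x|lborel. \<phi> x) = 1" "\<And>x. norm x \<ge> 1 ==> \<phi> x = 0"
proof -
 have 1: "\<phi> \<in> test_functions (ball 0 1 - ball 0 (1/2))" using moll by (simp add: annular_mollifier_def)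
 then show "\<phi> \<in> test_functions UNIV" by (rule test_functions_mono[rotated]) simp
 show "\<phi> x \<ge> 0" for x using moll by (simp add: annular_mollifier_def)
 show "(LINT x|lborel. \<phi> x) = 1" using moll by (simp add: annular_mollifier_def)
 have "supp \<phi> \<subseteq> ball 0 1" using 1 by (auto simp: test_functions_iff)
 then show "\<phi> x = 0" if "norm x \<ge> 1" for x using supp_superset[of x \<phi>] that by (force simp: dist_norm)
qed

lemma phi_borel [measurable]: "\<phi> \<in> borel_measurable borel" using phi(1) by (rule test_functions_borel)

lemma mol_eq: "mol dl x y = \<phi> ((1/dl) *\<^sub>R (x - y)) / dl ^ DIM('a)"
 by (simp add: mol_def rescale_def divide_inverse_commute)

lemma mol_test: "dl > 0 ==> mol dl x \<in> test_functions UNIV"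
 using test_functions_affine[OF test_functions_rescale[OF phi(1)], of dl "-1" x] by (simp add: mol_def)

lemma mol_measurable [measurable]:
 "(\<lambda>z. mol dl (fst z) (snd z)) \<in> borel_measurable (borel \<Otimes>\<^sub>M borel)" "mol dl x \<in> borel_measurable borel"
 unfolding mol_eq by measurable

lemma mol_nonneg: "dl > 0 ==> mol dl x y \<ge> 0" by (simp add: mol_eq phi(2))

lemma mol_zero: "dl > 0 ==> dist x y \<ge> dl ==> mol dl x y = 0"
 unfolding mol_eq by (subst phi(4)) (simp_all only: norm_scaleR, simp_all add: dist_norm field_simps)

lemma mol_integral: "dl > 0 ==> (LINT y|lborel. mol dl x y) = 1"
proof -
 assume dl: "dl > 0"
 have "(LINT y|lborel. \<phi> ((1/dl) *\<^sub>R x + (- 1 / dl) *\<^sub>R y)) = (1 / \<bar>- 1 / dl\<bar> ^ DIM('a)) *\<^sub>R (LINT y|lborel. \<phi> y)"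
  by (rule integral_affine) (use dl in auto)
 also have "\<dots> = dl ^ DIM('a)" using dl phi(3) by (simp add: power_one_over)
 finally show ?thesis using dl by (simp add: mol_eq scaleR_diff_right)
qed

lemma mol_integrable: "dl > 0 ==> integrable lborel (mol dl x)"
 by (rule test_functions_integrable[OF mol_test])

lemma dist_Gamma: "w \<in> space M ==> distribution (\<Gamma> w)"
proof -
 assume w: "w \<in> space M"
 have "random_sobolev M (- 1) (\<lambda>w f. complex_of_real (\<Gamma> w f))"
  using field by (simp add: gaussian_field_def)
 then have d: "distribution (\<lambda>f. complex_of_real (\<Gamma> w f))"
  using w by (simp add: random_sobolev_def sobolev_def)
 note 1 = conjunct1[OF d[unfolded distribution_def]] and 2 = conjunct2[OF d[unfolded distribution_def]]
 show ?thesis unfolding distribution_def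
 proof (intro conjI ballI allI)
  fix f h :: "'a => real" and a b :: real assume "f \<in> test_functions UNIV" "h \<in> test_functions UNIV"
  then have "complex_of_real (\<Gamma> w (\<lambda>x. a * f x + b * h x)) = complex_of_real (a * \<Gamma> w f + b * \<Gamma> w h)"
   using 1 by (simp add: scaleR_conv_of_real)
  then show "\<Gamma> w (\<lambda>x. a * f x + b * h x) = a *\<^sub>R \<Gamma> w f + b *\<^sub>R \<Gamma> w h" by (simp only: of_real_eq_iff real_scaleR_def)
 qed (use 2 in simp)
qed

lemma Gamma_lincomb:
 "w \<in> space M ==> f \<in> test_functions UNIV ==> h \<in> test_functions UNIV ==> \<Gamma> w (\<lambda>x. a * f x + c * h x) = a * \<Gamma> w f + c * \<Gamma> w h"
 using distribution_lincomb[OF dist_Gamma] by simp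

lemma Gamma_gaussian: "f \<in> test_functions UNIV ==> centered_gaussian M (\<lambda>w. \<Gamma> w f)"
 using field by (simp add: gaussian_field_def)

lemma Gamma_measurable [measurable]: "f \<in> test_functions UNIV ==> (\<lambda>w. \<Gamma> w f) \<in> borel_measurable M"
 using centered_gaussian_moments(1)[OF Gamma_gaussian] .

lemma Gamma_integrable:
 assumes "f \<in> test_functions UNIV" "h \<in> test_functions UNIV"
 shows "integrable M (\<lambda>w. \<Gamma> w f * \<Gamma> w h)" "integrable M (\<lambda>w. \<Gamma> w f)"
proof -
 have 2: "integrable M (\<lambda>w. (\<Gamma> w f)\<^sup>2)" "integrable M (\<lambda>w. (\<Gamma> w h)\<^sup>2)"
  using centered_gaussian_moments(2)[OF Gamma_gaussian] assms by auto
 have [measurable]: "(\<lambda>w. \<Gamma> w f) \<in> borel_measurable M" "(\<lambda>w. \<Gamma> w h) \<in> borel_measurable M" using assms by auto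
 have i: "integrable M (\<lambda>w. (\<Gamma> w f)\<^sup>2 + (\<Gamma> w h)\<^sup>2)" "integrable M (\<lambda>w. (\<Gamma> w f)\<^sup>2 + 1)" using 2 by auto
 have "\<bar>x * y\<bar> \<le> x\<^sup>2 + y\<^sup>2" for x y :: real
 proof -
  have "2 * \<bar>x\<bar> * \<bar>y\<bar> \<le> x\<^sup>2 + y\<^sup>2" using sum_squares_bound[of "\<bar>x\<bar>" "\<bar>y\<bar>"] by simp
  moreover have "0 \<le> \<bar>x\<bar> * \<bar>y\<bar>" by simp
  ultimately show ?thesis unfolding abs_mult by linarith
 qed
 then show "integrable M (\<lambda>w. \<Gamma> w f * \<Gamma> w h)"
  by (intro LINT_bound[OF i(1)]) (auto intro!: AE_I2)
 have "\<bar>x\<bar> \<le> \<bar>x\<^sup>2 + 1\<bar>" for x :: real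
 proof -
  have "2 * \<bar>x\<bar> \<le> x\<^sup>2 + 1" using sum_squares_bound[of "\<bar>x\<bar>" 1] by simp
  then show ?thesis by linarith
 qed
 then show "integrable M (\<lambda>w. \<Gamma> w f)"
  by (intro LINT_bound[OF i(2)]) (auto intro!: AE_I2)
qed

lemma cov_commute: "cov f h = cov h f" by (simp add: cov_def mult.commute)

lemma cov_lincomb:
 assumes "f \<in> test_functions UNIV" "f' \<in> test_functions UNIV" "h \<in> test_functions UNIV"
 shows "cov (\<lambda>x. a * f x + c * f' x) h = a * cov f h + c * cov f' h"
proof -
 have "cov (\<lambda>x. a * f x + c * f' x) h = (LINT w|M. a * (\<Gamma> w f * \<Gamma> w h) + c * (\<Gamma> w f' * \<Gamma> w h))"
  unfolding cov_def by (intro LINT_cong) (simp add: Gamma_lincomb assms algebra_simps)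
 then show ?thesis using assms by (simp add: cov_def Gamma_integrable)
qed

lemma cov_lincomb2:
 assumes "f \<in> test_functions UNIV" "f' \<in> test_functions UNIV" "h \<in> test_functions UNIV"
 shows "cov h (\<lambda>x. a * f x + c * f' x) = a * cov h f + c * cov h f'"
 using cov_lincomb[OF assms] by (simp add: cov_commute)

lemma expectation_cis: "f \<in> test_functions UNIV ==> (LINT w|M. cis (\<Gamma> w f)) = exp (- complex_of_real (cov f f) / 2)"
 using centered_gaussian_moments(3)[OF Gamma_gaussian] by (simp add: cov_def power2_eq_square)

lemma cis_measurable [measurable]: "cis \<in> borel_measurable borel"
 by (intro borel_measurable_continuous_onI continuous_intros)

lemma integrable_cis: "f \<in> test_functions UNIV ==> integrable M (\<lambda>w. cis (\<Gamma> w f))"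
 by (rule integrable_const_bound[of _ 1]) (use measurable_compose[OF Gamma_measurable cis_measurable] in auto)

lemma exp_half_of_real: "exp (- complex_of_real c / 2) = complex_of_real (exp (- c / 2))"
 using exp_of_real[of "- c / 2", where ?'a = complex] by simp

lemma expectation_cis_mult:
 assumes f: "f \<in> test_functions UNIV" and h: "h \<in> test_functions UNIV"
 shows "(LINT w|M. cis (\<Gamma> w f) * complex_of_real (\<Gamma> w h)) = \<i> * of_real (cov f h) * exp (- complex_of_real (cov f f) / 2)"
proof -
 have [measurable]: "(\<lambda>w. \<Gamma> w f) \<in> borel_measurable M" "(\<lambda>w. \<Gamma> w h) \<in> borel_measurable M" using f h by auto
 have "(\<lambda>n. LINT w|M. cis (\<Gamma> w f) * ((cis (\<Gamma> w h / Suc n) - 1) * Suc n)) \<longlonglongrightarrow> (LINT w|M. cis (\<Gamma> w f) * (\<i> * of_real (\<Gamma> w h)))"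
 proof (rule integral_dominated_convergence[where w = "\<lambda>w. \<bar>\<Gamma> w h\<bar>"])
  show "AE w in M. (\<lambda>n. cis (\<Gamma> w f) * ((cis (\<Gamma> w h / Suc n) - 1) * Suc n)) \<longlonglongrightarrow> cis (\<Gamma> w f) * (\<i> * of_real (\<Gamma> w h))"
   by (intro AE_I2 tendsto_mult_left cis_difference_LIMSEQ)
  have c1: "norm (cis t - 1) \<le> \<bar>t\<bar>" for t
   using iexp_approx1[of t 0] by (simp add: cis_conv_exp)
  have "norm (cis (t / Suc n) - 1) * Suc n \<le> \<bar>t / Suc n\<bar> * Suc n" for t n
   by (intro mult_right_mono c1) simp
  then have *: "norm (cis (t / Suc n) - 1) * Suc n \<le> \<bar>t\<bar>" for t n by (simp add: abs_divide del: of_nat_Suc)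
  show "AE w in M. norm (cis (\<Gamma> w f) * ((cis (\<Gamma> w h / Suc n) - 1) * Suc n)) \<le> \<bar>\<Gamma> w h\<bar>" for n
   using *[of _ n] by (intro AE_I2) (simp add: norm_mult del: of_nat_Suc)
 qed (use Gamma_integrable(2)[OF h h] in auto)
 moreover have "(LINT w|M. cis (\<Gamma> w f) * ((cis (\<Gamma> w h / Suc n) - 1) * Suc n)) =
   (exp (- complex_of_real (cov f f + (2 / Suc n) * cov f h + (1 / Suc n)\<^sup>2 * cov h h) / 2) - exp (- complex_of_real (cov f f) / 2)) * Suc n" for n
 proof -
  define e where "e = 1 / real (Suc n)"
  let ?k = "\<lambda>x. 1 * f x + e * h x"
  have k: "?k \<in> test_functions UNIV" by (rule test_functions_lincomb[OF f h])
  have km [measurable]: "(\<lambda>w. \<Gamma> w ?k) \<in> borel_measurable M" by (rule Gamma_measurable[OF k])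
  have ci: "integrable M (\<lambda>w. cis (\<Gamma> w ?k))" "integrable M (\<lambda>w. cis (\<Gamma> w f))"
   by (rule integrable_cis[OF k], rule integrable_cis[OF f])
  have "(LINT w|M. cis (\<Gamma> w f) * ((cis (\<Gamma> w h / Suc n) - 1) * Suc n)) = (LINT w|M. (cis (\<Gamma> w ?k) - cis (\<Gamma> w f)) * Suc n)"
  proof (intro LINT_cong)
   fix w assume "w \<in> space M"
   then have "\<Gamma> w ?k = \<Gamma> w f + \<Gamma> w h / Suc n" using Gamma_lincomb[OF _ f h, of w 1 e] by (simp add: e_def)
   then show "cis (\<Gamma> w f) * ((cis (\<Gamma> w h / Suc n) - 1) * Suc n) = (cis (\<Gamma> w ?k) - cis (\<Gamma> w f)) * Suc n"
    by (simp add: cis_mult[symmetric] algebra_simps del: of_nat_Suc)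
  qed
  also have "\<dots> = ((LINT w|M. cis (\<Gamma> w ?k)) - (LINT w|M. cis (\<Gamma> w f))) * Suc n"
   using ci by simp
  also have "\<dots> = (exp (- complex_of_real (cov ?k ?k) / 2) - exp (- complex_of_real (cov f f) / 2)) * Suc n"
   unfolding expectation_cis[OF k] expectation_cis[OF f] ..
  also have "cov ?k ?k = cov f f + (2 / Suc n) * cov f h + (1 / Suc n)\<^sup>2 * cov h h"
  proof -
   have "cov ?k ?k = 1 * (1 * cov f f + e * cov f h) + e * (1 * cov h f + e * cov h h)"
    unfolding cov_lincomb[OF f h k] cov_lincomb2[OF f h f] cov_lincomb2[OF f h h] ..
   then show ?thesis by (simp add: cov_commute[of h f] e_def[symmetric] power2_eq_square algebra_simps del: of_nat_Suc) (simp add: e_def)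
  qed
  finally show ?thesis .
 qed
 moreover have "(\<lambda>n. (exp (- complex_of_real (cov f f + (2 / Suc n) * cov f h + (1 / Suc n)\<^sup>2 * cov h h) / 2) - exp (- complex_of_real (cov f f) / 2)) * Suc n)
  \<longlonglongrightarrow> - of_real (cov f h) * exp (- complex_of_real (cov f f) / 2)"
 proof -
  define F where "F = (\<lambda>t::real. exp (- (cov f f + 2 * t * cov f h + t\<^sup>2 * cov h h) / 2))"
  have "(F has_real_derivative - cov f h * exp (- cov f f / 2)) (at 0)"
   unfolding F_def by (auto intro!: derivative_eq_intros)
  then have "((\<lambda>t. (F t - F 0) / t) \<longlongrightarrow> - cov f h * exp (- cov f f / 2)) (at 0)"
   by (simp add: has_field_derivative_iff)
  moreover have "filterlim (\<lambda>n. 1 / real (Suc n)) (at 0) sequentially"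
   using LIMSEQ_Suc[OF lim_1_over_n] by (auto simp: filterlim_at)
  ultimately have "((\<lambda>n. (F (1 / Suc n) - F 0) / (1 / Suc n)) \<longlongrightarrow> - cov f h * exp (- cov f f / 2)) sequentially"
   by (rule filterlim_compose)
  from tendsto_of_real[OF this, where ?'a = complex] show ?thesis
   by (simp add: F_def exp_of_real[symmetric] power_one_over del: of_nat_Suc)
 qed
 ultimately have "(LINT w|M. cis (\<Gamma> w f) * (\<i> * of_real (\<Gamma> w h))) = - of_real (cov f h) * exp (- complex_of_real (cov f f) / 2)"
  using LIMSEQ_unique by auto
 moreover have "(LINT w|M. cis (\<Gamma> w f) * (\<i> * of_real (\<Gamma> w h))) = \<i> * (LINT w|M. cis (\<Gamma> w f) * of_real (\<Gamma> w h))"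
  by (simp add: mult.left_commute)
 ultimately have "\<i> * (\<i> * (LINT w|M. cis (\<Gamma> w f) * of_real (\<Gamma> w h))) = \<i> * (- of_real (cov f h) * exp (- complex_of_real (cov f f) / 2))"
  by simp
 then show ?thesis by (simp add: mult.assoc[symmetric])
qed

lemma G_continuous: "w \<in> space M ==> dl > 0 ==> continuous_on UNIV (\<lambda>x. \<Gamma> w (mol dl x))"
 using distribution_convolve_continuous[OF dist_Gamma test_functions_rescale[OF phi(1)]]
 by (simp add: convolve_def mol_def)

lemma G_joint: "dl > 0 ==> (\<lambda>z. \<Gamma> (fst z) (mol dl (snd z))) \<in> borel_measurable (M \<Otimes>\<^sub>M borel)"
 using borel_measurable_caratheodory[of "\<lambda>w x. \<Gamma> w (mol dl x)" M] G_continuous Gamma_measurable mol_test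
 by (simp add: split_beta')

lemma chaos_eq: "x \<in> U ==> chaos dl w x = cis (\<beta> * \<Gamma> w (mol dl x)) * of_real (exp (b / 2 * Kd dl x x))"
 by (simp add: chaos_def chaos_approx_def convolve_def mol_def[symmetric] exp_add cis_conv_exp
   Kd_def cov_def power2_eq_square b_def exp_of_real[symmetric])

lemma chaos_outside: "x \<notin> U ==> chaos dl w x = 0"
 by (simp add: chaos_def chaos_approx_def)

lemma Kd_measurable [measurable]: "dl > 0 ==> (\<lambda>z. Kd dl (fst z) (snd z)) \<in> borel_measurable (borel \<Otimes>\<^sub>M borel)"
proof -
 assume dl: "dl > 0"
 note G_joint[OF dl, measurable]
 have "(\<lambda>(z, w). \<Gamma> w (mol dl (fst z)) * \<Gamma> w (mol dl (snd z))) \<in> borel_measurable ((borel \<Otimes>\<^sub>M borel) \<Otimes>\<^sub>M M)"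
 proof -
  have 1: "(\<lambda>z. \<Gamma> (snd z) (mol dl (fst (fst z)))) \<in> borel_measurable ((borel \<Otimes>\<^sub>M borel) \<Otimes>\<^sub>M M)"
  proof -
   have "(\<lambda>z. (snd z, fst (fst z))) \<in> measurable ((borel \<Otimes>\<^sub>M borel) \<Otimes>\<^sub>M M) (M \<Otimes>\<^sub>M borel)" by measurable
   from measurable_compose[OF this G_joint[OF dl]] show ?thesis by simp
  qed
  have 2: "(\<lambda>z. \<Gamma> (snd z) (mol dl (snd (fst z)))) \<in> borel_measurable ((borel \<Otimes>\<^sub>M borel) \<Otimes>\<^sub>M M)"
  proof -
   have "(\<lambda>z. (snd z, snd (fst z))) \<in> measurable ((borel \<Otimes>\<^sub>M borel) \<Otimes>\<^sub>M M) (M \<Otimes>\<^sub>M borel)" by measurable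
   from measurable_compose[OF this G_joint[OF dl]] show ?thesis by simp
  qed
  show ?thesis unfolding split_beta' using borel_measurable_times[OF 1 2] .
 qed
 then show ?thesis unfolding Kd_def cov_def by (rule borel_measurable_lebesgue_integral)
qed

lemma chaos_joint: "dl > 0 ==> (\<lambda>z. chaos dl (fst z) (snd z)) \<in> borel_measurable (M \<Otimes>\<^sub>M borel)"
proof -
 assume dl: "dl > 0"
 have [measurable]: "U \<in> sets borel" using U by simp
 have [measurable]: "(\<lambda>x. Kd dl x x) \<in> borel_measurable borel"
  using measurable_compose[of "\<lambda>x. (x, x)" borel "borel \<Otimes>\<^sub>M borel", OF _ Kd_measurable[OF dl]] by simp
 note G_joint[OF dl, measurable]
 have "(\<lambda>z. chaos dl (fst z) (snd z)) = (\<lambda>z. indicator U (snd z) * (cis (\<beta> * \<Gamma> (fst z) (mol dl (snd z))) * of_real (exp (b / 2 * Kd dl (snd z) (snd z)))))"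
  by (auto simp: fun_eq_iff chaos_eq chaos_outside indicator_def)
 then show ?thesis by simp
qed

definition pair_chaos :: "real => 'w => 'a \<times> 'a => complex" where
 "pair_chaos dl w z = chaos dl w (fst z) * cnj (chaos dl w (snd z))"

definition Dd :: "real => 'a \<times> 'a => 'a \<times> 'a => real" where
 "Dd dl z z' = Kd dl (fst z) (fst z') + Kd dl (snd z) (snd z') - Kd dl (fst z) (snd z') - Kd dl (snd z) (fst z')"

definition Pd :: "real => 'a \<times> 'a => real" where "Pd dl z = exp (b * Kd dl (fst z) (snd z))"

lemma pair_chaos_eq:
 assumes w: "w \<in> space M" and dl: "dl > 0" and z: "fst z \<in> U" "snd z \<in> U"
 shows "pair_chaos dl w z = cis (\<Gamma> w (\<lambda>y. \<beta> * mol dl (fst z) y + (- \<beta>) * mol dl (snd z) y)) *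
  of_real (exp (b / 2 * (Kd dl (fst z) (fst z) + Kd dl (snd z) (snd z))))"
 unfolding pair_chaos_def chaos_eq[OF z(1)] chaos_eq[OF z(2)] Gamma_lincomb[OF w mol_test[OF dl] mol_test[OF dl]]
proof -
 have 1: "cis (\<beta> * s + - \<beta> * t) = cis (\<beta> * s) * cnj (cis (\<beta> * t))" for s t by (simp add: cis_cnj cis_mult)
 have 2: "exp (b / 2 * (s + t)) = exp (b / 2 * s) * exp (b / 2 * t)" for s t by (simp add: distrib_left exp_add)
 show "cis (\<beta> * \<Gamma> w (mol dl (fst z))) * complex_of_real (exp (b / 2 * Kd dl (fst z) (fst z))) *
   cnj (cis (\<beta> * \<Gamma> w (mol dl (snd z))) * complex_of_real (exp (b / 2 * Kd dl (snd z) (snd z)))) =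
  cis (\<beta> * \<Gamma> w (mol dl (fst z)) + - \<beta> * \<Gamma> w (mol dl (snd z))) *
   complex_of_real (exp (b / 2 * (Kd dl (fst z) (fst z) + Kd dl (snd z) (snd z))))"
  unfolding 1 2 by simp
qed

lemma expectation_pair_chaos:
 assumes dl: "dl > 0" and z: "fst z \<in> U" "snd z \<in> U"
 shows "(LINT w|M. pair_chaos dl w z) = of_real (Pd dl z)"
  "h \<in> test_functions UNIV ==> (LINT w|M. pair_chaos dl w z * complex_of_real (\<Gamma> w h)) =
   \<i> * of_real (\<beta> * (cov (mol dl (fst z)) h - cov (mol dl (snd z)) h) * Pd dl z)"
proof -
 define k where "k = (\<lambda>y. \<beta> * mol dl (fst z) y + (- \<beta>) * mol dl (snd z) y)"
 note m = mol_test[OF dl]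
 have k: "k \<in> test_functions UNIV" unfolding k_def by (rule test_functions_lincomb[OF m m])
 define S where "S = exp (b / 2 * (Kd dl (fst z) (fst z) + Kd dl (snd z) (snd z)))"
 have pc: "pair_chaos dl w z = of_real S * cis (\<Gamma> w k)" if "w \<in> space M" for w
  using pair_chaos_eq[OF that dl z] by (simp add: k_def S_def)
 have kh: "cov k h = \<beta> * (cov (mol dl (fst z)) h - cov (mol dl (snd z)) h)" if "h \<in> test_functions UNIV" for h
  unfolding k_def using cov_lincomb[OF m m that, of \<beta> "fst z" "- \<beta>" "snd z"] by (simp add: algebra_simps)
 have hk: "cov (mol dl x) k = \<beta> * (cov (mol dl x) (mol dl (fst z)) - cov (mol dl x) (mol dl (snd z)))" for x
  unfolding cov_commute[of "mol dl x"] by (rule kh[OF m])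
 have "cov k k = b * (Kd dl (fst z) (fst z) + Kd dl (snd z) (snd z) - 2 * Kd dl (fst z) (snd z))"
  unfolding kh[OF k] hk cov_commute[of "mol dl (snd z)" "mol dl (fst z)"]
  by (simp add: Kd_def b_def power2_eq_square algebra_simps)
 then have "S * exp (- cov k k / 2) = Pd dl z"
  unfolding S_def Pd_def exp_add[symmetric] by (intro arg_cong[of _ _ exp]) (simp add: field_simps)
 then have SP: "complex_of_real S * exp (- complex_of_real (cov k k) / 2) = of_real (Pd dl z)"
  unfolding exp_half_of_real by (simp flip: of_real_mult)
 have "(LINT w|M. pair_chaos dl w z) = (LINT w|M. of_real S * cis (\<Gamma> w k))"
  by (intro LINT_cong pc)
 also have "\<dots> = of_real S * exp (- complex_of_real (cov k k) / 2)"
  by (simp only: integral_mult_right_zero expectation_cis[OF k])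
 finally show "(LINT w|M. pair_chaos dl w z) = of_real (Pd dl z)" unfolding SP .
 assume h: "h \<in> test_functions UNIV"
 have "(LINT w|M. pair_chaos dl w z * complex_of_real (\<Gamma> w h)) = (LINT w|M. of_real S * (cis (\<Gamma> w k) * complex_of_real (\<Gamma> w h)))"
  by (intro LINT_cong) (simp add: pc)
 also have "\<dots> = \<i> * of_real (cov k h) * (of_real S * exp (- complex_of_real (cov k k) / 2))"
  by (simp only: integral_mult_right_zero expectation_cis_mult[OF k h]) (simp add: mult_ac)
 finally show "(LINT w|M. pair_chaos dl w z * complex_of_real (\<Gamma> w h)) = \<i> * of_real (\<beta> * (cov (mol dl (fst z)) h - cov (mol dl (snd z)) h) * Pd dl z)"
  unfolding SP kh[OF h] by simp
qed

lemma expectation_pair_chaos2: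
 assumes dl: "dl > 0" and z: "fst z \<in> U" "snd z \<in> U" and z': "fst z' \<in> U" "snd z' \<in> U"
 shows "(LINT w|M. pair_chaos dl w z * cnj (pair_chaos dl w z')) = of_real (Pd dl z * Pd dl z' * exp (b * Dd dl z z'))"
proof -
 note m = mol_test[OF dl]
 define k where "k = (\<lambda>z y. \<beta> * mol dl (fst z) y + (- \<beta>) * mol dl (snd z) y)"
 have k: "k z \<in> test_functions UNIV" for z unfolding k_def by (rule test_functions_lincomb[OF m m])
 define l where "l = (\<lambda>y. 1 * k z y + (- 1) * k z' y)"
 have l: "l \<in> test_functions UNIV" unfolding l_def by (rule test_functions_lincomb[OF k k])
 define S where "S = (\<lambda>z. exp (b / 2 * (Kd dl (fst z) (fst z) + Kd dl (snd z) (snd z))))"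
 have pc: "pair_chaos dl w z * cnj (pair_chaos dl w z') = of_real (S z * S z') * cis (\<Gamma> w l)" if "w \<in> space M" for w
 proof -
  have 1: "pair_chaos dl w z = cis (\<Gamma> w (k z)) * of_real (S z)"
   unfolding k_def S_def by (rule pair_chaos_eq[OF that dl z])
  have 2: "pair_chaos dl w z' = cis (\<Gamma> w (k z')) * of_real (S z')"
   unfolding k_def S_def by (rule pair_chaos_eq[OF that dl z'])
  have "cis (1 * s + (- 1) * t) = cis s * cnj (cis t)" for s t by (simp add: cis_cnj cis_mult)
  then show ?thesis unfolding 1 2 l_def Gamma_lincomb[OF that k k] by (simp only:) simp
 qed
 have kh: "cov (k z) h = \<beta> * (cov (mol dl (fst z)) h - cov (mol dl (snd z)) h)" if "h \<in> test_functions UNIV" for h z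
  unfolding k_def using cov_lincomb[OF m m that, of \<beta> "fst z" "- \<beta>" "snd z"] by (simp add: algebra_simps)
 have kk: "cov (k z1) (k z2) = b * Dd dl z1 z2" for z1 z2
 proof -
  have hk: "cov (mol dl x) (k z2) = \<beta> * (cov (mol dl x) (mol dl (fst z2)) - cov (mol dl x) (mol dl (snd z2)))" for x
   unfolding cov_commute[of "mol dl x"] by (rule kh[OF m])
  show ?thesis unfolding kh[OF k] hk Dd_def Kd_def by (simp add: b_def power2_eq_square algebra_simps)
 qed
 have "cov l l = cov (k z) (k z) - 2 * cov (k z) (k z') + cov (k z') (k z')"
 proof -
  have 1: "cov l h = 1 * cov (k z) h + (- 1) * cov (k z') h" if "h \<in> test_functions UNIV" for h
   unfolding l_def by (rule cov_lincomb[OF k k that])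
  have 2: "cov h l = 1 * cov h (k z) + (- 1) * cov h (k z')" if "h \<in> test_functions UNIV" for h
   unfolding l_def by (rule cov_lincomb2[OF k k that])
  show ?thesis unfolding 1[OF l] 2[OF k] cov_commute[of "k z'" "k z"] by simp
 qed
 then have "S z * S z' * exp (- cov l l / 2) = Pd dl z * Pd dl z' * exp (b * Dd dl z z')"
  unfolding kk S_def Pd_def exp_add[symmetric]
  by (intro arg_cong[of _ _ exp])
   (simp add: Dd_def Kd_def cov_commute[of "mol dl (snd z)" "mol dl (fst z)"] cov_commute[of "mol dl (snd z')" "mol dl (fst z')"] field_simps)
 then have "complex_of_real (S z * S z') * exp (- complex_of_real (cov l l) / 2) = of_real (Pd dl z * Pd dl z' * exp (b * Dd dl z z'))"
  unfolding exp_half_of_real by (simp flip: of_real_mult)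
 moreover have "(LINT w|M. pair_chaos dl w z * cnj (pair_chaos dl w z')) = (LINT w|M. of_real (S z * S z') * cis (\<Gamma> w l))"
  by (intro LINT_cong pc)
 ultimately show ?thesis by (simp only: integral_mult_right_zero expectation_cis[OF l])
qed

end

lemma abs_ln_inverse_le: "\<bar>ln (1 / t)\<bar> \<le> 2 * t powr (- (1/2)) + t" if "t \<ge> 0" for t :: real
proof (cases "t = 0 \<or> t \<ge> 1")
 case True
 then show ?thesis
 proof
  assume "t \<ge> 1"
  then have "\<bar>ln (1 / t)\<bar> = ln t" by (simp add: ln_div)
  also have "\<dots> \<le> t" using ln_le_minus_one[of t] \<open>t \<ge> 1\<close> by simp
  finally show ?thesis by (simp add: add_increasing)
 qed simp
next
 case False
 then have t: "0 < t" "t < 1" using that by auto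
 have "ln (t powr (- (1/2))) \<le> t powr (- (1/2)) - 1" using t by (intro ln_le_minus_one) auto
 then have "- ln t \<le> 2 * t powr (- (1/2))" using t by (simp add: ln_powr)
 then show ?thesis using t by (simp add: ln_div)
qed

lemma integral_le_nn_integral:
 assumes "integrable M h" "\<And>x. x \<in> space M ==> ennreal (h x) \<le> f x"
 shows "ennreal (LINT x|M. h x) \<le> (\<integral>\<^sup>+ x. f x \<partial>M)"
proof -
 have i: "integrable M (\<lambda>x. max 0 (h x))" using assms by auto
 have "ennreal (LINT x|M. h x) \<le> ennreal (LINT x|M. max 0 (h x))"
  by (intro ennreal_leI integral_mono assms i) auto
 also have "\<dots> = (\<integral>\<^sup>+ x. ennreal (max 0 (h x)) \<partial>M)"
  by (rule nn_integral_eq_integral[symmetric, OF i]) auto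
 also have "\<dots> \<le> (\<integral>\<^sup>+ x. f x \<partial>M)"
  using assms(2) by (intro nn_integral_mono) (auto simp: max_def)
 finally show ?thesis .
qed

lemma compact_neighbourhood:
 fixes A :: "'a::euclidean_space set"
 assumes "compact A" "open U" "A \<subseteq> U"
 obtains e A' where "e > 0" "compact A'" "A' \<subseteq> U" "\<And>x. x \<in> A ==> cball x e \<subseteq> A'" "A \<subseteq> A'"
proof (cases "A = {}")
 case True then show ?thesis using that[of 1 "{}"] by auto
next
 case False
 have "\<exists>e>0. \<forall>x\<in>A. \<forall>y. dist x y \<le> e \<longrightarrow> y \<in> U"
 proof (cases "U = UNIV")
  case True then show ?thesis by (intro exI[of _ 1]) auto
 next
  case F: False
  have "closed (- U)" "A \<inter> - U = {}" using assms by auto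
  from separate_compact_closed[OF assms(1) this] obtain d where "d > 0" "\<forall>x\<in>A. \<forall>y\<in>- U. d \<le> dist x y" by blast
  then show ?thesis by (intro exI[of _ "d / 2"]) force
 qed
 then obtain e where e: "e > 0" "\<And>x y. x \<in> A ==> dist x y \<le> e ==> y \<in> U" by blast
 define A' where "A' = (\<lambda>(x, y). x + y) ` (A \<times> cball 0 e)"
 show ?thesis
 proof (rule that[OF e(1), of A'])
  show "compact A'" unfolding A'_def using assms
   by (intro compact_continuous_image compact_Times) (auto intro!: continuous_intros simp: split_beta)
  show "A' \<subseteq> U" unfolding A'_def using e(2) by (auto simp: dist_norm)
  show c: "cball x e \<subseteq> A'" if "x \<in> A" for x
  proof
   fix y assume "y \<in> cball x e"
   then have "(case (x, y - x) of (x, y) => x + y) \<in> A'" unfolding A'_def using that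
    by (intro imageI) (auto simp: dist_norm norm_minus_commute)
   then show "y \<in> A'" by simp
  qed
  show "A \<subseteq> A'" using c e(1) by (meson centre_in_cball less_imp_le subsetD subsetI)
 qed
qed

context log_field
begin

definition CU :: "'a \<times> 'a => real" where
 "CU z = (if fst z \<in> U \<and> snd z \<in> U then C (fst z) (snd z) else 0)"

definition pot :: "('a => real) => 'a => real" where "pot h x = (LINT y|lborel. CU (x, y) * h y)"

lemma U_borel [measurable]: "U \<in> sets borel" using U by simp

lemma g_continuous: "continuous_on (U \<times> U) g"
 using g_C2[unfolded Ck_on_def, rule_format, of "[]"] by simp

lemma CU_measurable [measurable]: "CU \<in> borel_measurable (borel \<Otimes>\<^sub>M borel)"
proof -
 have "(\<lambda>z. indicator (U \<times> U) z *\<^sub>R g z) \<in> borel_measurable borel"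
  by (rule borel_measurable_continuous_on_indicator[OF _ g_continuous]) (use U in \<open>auto intro!: borel_open open_Times\<close>)
 then have [measurable]: "(\<lambda>z. indicator (U \<times> U) z *\<^sub>R g z) \<in> borel_measurable (borel \<Otimes>\<^sub>M borel)"
  by (simp add: borel_prod)
 have "CU = (\<lambda>z. indicator U (fst z) * indicator U (snd z) * ln (1 / norm (fst z - snd z)) + indicator (U \<times> U) z *\<^sub>R g z)"
  by (auto simp: CU_def C_def indicator_def fun_eq_iff)
 moreover have "\<dots> \<in> borel_measurable (borel \<Otimes>\<^sub>M borel)"
  by (intro borel_measurable_add) measurable
 ultimately show ?thesis by simp
qed

lemma CU_measurable' [measurable]: "CU \<in> borel_measurable borel"
 using CU_measurable by (simp add: borel_prod)

lemma integrable_log_U: "integrable lborel (\<lambda>z. indicator U (fst z) * indicator U (snd z) * ln (1 / norm (fst z - snd z)))"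
proof -
 obtain R where R: "R > 0" "\<And>x. x \<in> U ==> norm x \<le> R" using U(1) by (auto simp: bounded_pos)
 obtain A where A: "A > 0" "\<And>s (w::'a). s > 0 ==>
  (\<integral>\<^sup>+ y. riesz (1/2) (y - w) * indicator (cball w s) y \<partial>lborel) \<le> ennreal (A * s powr (DIM('a) - (1/2)))"
  by (rule riesz_near[where ?'a = 'a and gm = "1/2"]) (use dim in auto)
 have m: "(\<lambda>z::'a \<times> 'a. 2 * (riesz (1/2) (snd z - fst z) * indicator {..2*R} (norm (fst z - snd z)) * indicator U (fst z)) + ennreal (2 * R) * (indicator U (fst z) * indicator U (snd z))) \<in> borel_measurable (borel \<Otimes>\<^sub>M borel)"
  by measurable
 have fin: "emeasure lborel U < \<infinity>" using emeasure_bounded_finite[OF U(1)] by (simp add: less_top)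
 have "(\<integral>\<^sup>+ z. ennreal (norm (indicator U (fst z) * indicator U (snd z) * ln (1 / norm (fst z - snd z)) :: real)) \<partial>lborel)
  \<le> (\<integral>\<^sup>+ z. 2 * (riesz (1/2) (snd z - fst z) * indicator {..2*R} (norm (fst z - snd z)) * indicator U (fst z)) + ennreal (2 * R) * (indicator U (fst z) * indicator U (snd z)) \<partial>(lborel :: ('a \<times> 'a) measure))"
 proof (intro nn_integral_mono)
  fix z :: "'a \<times> 'a"
  show "ennreal (norm (indicator U (fst z) * indicator U (snd z) * ln (1 / norm (fst z - snd z)) :: real))
   \<le> 2 * (riesz (1/2) (snd z - fst z) * indicator {..2*R} (norm (fst z - snd z)) * indicator U (fst z)) + ennreal (2 * R) * (indicator U (fst z) * indicator U (snd z))"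
  proof (cases "fst z \<in> U \<and> snd z \<in> U")
   case True
   have n: "norm (fst z - snd z) \<le> 2 * R"
    using norm_triangle_ineq4[of "fst z" "snd z"] R(2)[of "fst z"] R(2)[of "snd z"] True by linarith
   have "\<bar>ln (1 / norm (fst z - snd z))\<bar> \<le> 2 * norm (fst z - snd z) powr (- (1/2)) + 2 * R"
    using abs_ln_inverse_le[of "norm (fst z - snd z)"] n by simp
   then have "ennreal \<bar>ln (1 / norm (fst z - snd z))\<bar> \<le> ennreal (2 * norm (fst z - snd z) powr (- (1/2)) + 2 * R)"
    by (rule ennreal_leI)
   also have "\<dots> = 2 * riesz (1/2) (snd z - fst z) + ennreal (2 * R)"
    using R(1) by (simp add: riesz_def norm_minus_commute ennreal_mult)
   finally show ?thesis using True n by (simp add: abs_mult)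
  qed auto
 qed
 also have "\<dots> = (\<integral>\<^sup>+ x. \<integral>\<^sup>+ y. 2 * (riesz (1/2) (y - x) * indicator {..2*R} (norm (x - y)) * indicator U x) + ennreal (2 * R) * (indicator U x * indicator U y) \<partial>lborel \<partial>(lborel :: 'a measure))"
  using m by (subst nn_integral_lborel_pair) (simp_all add: borel_prod)
 also have "\<dots> = (\<integral>\<^sup>+ x. 2 * (\<integral>\<^sup>+ y. riesz (1/2) (y - x) * indicator (cball x (2 * R)) y \<partial>lborel) * indicator U x + ennreal (2 * R) * (indicator U x * emeasure lborel U) \<partial>(lborel :: 'a measure))"
 proof (intro nn_integral_cong)
  fix x :: 'a
  have "(\<integral>\<^sup>+ y. 2 * (riesz (1/2) (y - x) * indicator {..2*R} (norm (x - y)) * indicator U x) + ennreal (2 * R) * (indicator U x * indicator U y) \<partial>lborel)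
   = (\<integral>\<^sup>+ y. (2 * indicator U x) * (riesz (1/2) (y - x) * indicator (cball x (2 * R)) y) + (ennreal (2 * R) * indicator U x) * indicator U y \<partial>lborel)"
   by (intro nn_integral_cong) (auto simp: indicator_def dist_norm)
  also have "\<dots> = (2 * indicator U x) * (\<integral>\<^sup>+ y. riesz (1/2) (y - x) * indicator (cball x (2 * R)) y \<partial>lborel) + (ennreal (2 * R) * indicator U x) * emeasure lborel U"
   by (simp add: nn_integral_add nn_integral_cmult)
  finally show "(\<integral>\<^sup>+ y. 2 * (riesz (1/2) (y - x) * indicator {..2*R} (norm (x - y)) * indicator U x) + ennreal (2 * R) * (indicator U x * indicator U y) \<partial>lborel)
   = 2 * (\<integral>\<^sup>+ y. riesz (1/2) (y - x) * indicator (cball x (2 * R)) y \<partial>lborel) * indicator U x + ennreal (2 * R) * (indicator U x * emeasure lborel U)"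
   by (simp add: mult_ac)
 qed
 also have "\<dots> \<le> (\<integral>\<^sup>+ x. (2 * ennreal (A * (2 * R) powr (DIM('a) - 1/2)) + ennreal (2 * R) * emeasure lborel U) * indicator U x \<partial>(lborel :: 'a measure))"
  using A(2)[of "2 * R"] R(1) by (intro nn_integral_mono) (auto simp: indicator_def intro!: add_mono mult_left_mono)
 also have "\<dots> < \<infinity>" using fin by (subst nn_integral_cmult_indicator) (auto simp: ennreal_mult_less_top)
 finally show ?thesis
  by (intro integrableI_bounded) (simp add: measurable_lborel1 borel_prod[symmetric])
qed

lemma CU_integrable: "integrable lborel CU"
proof -
 have "CU = (\<lambda>z. indicator U (fst z) * indicator U (snd z) * ln (1 / norm (fst z - snd z)) + indicator (U \<times> U) z *\<^sub>R g z)"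
  by (auto simp: CU_def C_def indicator_def fun_eq_iff)
 then show ?thesis using integrable_log_U g_int by (auto simp: set_integrable_def)
qed

lemma weighted_CU_integrable:
 assumes f: "f \<in> test_functions UNIV" and h: "h \<in> test_functions UNIV"
 shows "integrable lborel (\<lambda>z. f (fst z) * h (snd z) * CU z)"
proof -
 have [measurable]: "f \<in> borel_measurable borel" "h \<in> borel_measurable borel" using f h by (auto intro: test_functions_borel)
 obtain B1 where B1: "B1 > 0" "\<And>x. \<bar>f x\<bar> \<le> B1" by (rule test_functions_bounded[OF f]) blast
 obtain B2 where B2: "B2 > 0" "\<And>x. \<bar>h x\<bar> \<le> B2" by (rule test_functions_bounded[OF h]) blast
 have "(\<lambda>z. f (fst z) * h (snd z) * CU z) \<in> borel_measurable (borel \<Otimes>\<^sub>M borel)" by measurable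
 then have m: "(\<lambda>z. f (fst z) * h (snd z) * CU z) \<in> borel_measurable lborel" by (simp add: borel_prod)
 have "norm (f (fst z) * h (snd z) * CU z) \<le> norm (B1 * B2 * CU z)" for z
  using B1 B2 by (auto simp: abs_mult intro!: mult_mono)
 then show ?thesis
  by (intro LINT_bound[OF integrable_mult_right[OF CU_integrable, of "B1 * B2"] m] AE_I2) 
qed

lemma cov_eq:
 assumes "f \<in> test_functions UNIV" "h \<in> test_functions UNIV"
 shows "cov f h = (LINT z|lborel. f (fst z) * h (snd z) * CU z)"
 using field assms unfolding gaussian_field_def cov_def CU_def C_def by auto

lemma Kd_bounded:
 assumes dl: "dl > 0" obtains B where "\<And>x y. \<bar>Kd dl x y\<bar> \<le> B"
proof -
 obtain B where B: "B > 0" "\<And>x. \<bar>\<phi> x\<bar> \<le> B" by (rule test_functions_bounded[OF phi(1)]) blast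
 define m where "m = B / dl ^ DIM('a)"
 have m: "\<bar>mol dl x y\<bar> \<le> m" for x y using B dl by (simp add: mol_eq m_def abs_divide divide_right_mono)
 have m0: "m > 0" using B dl by (simp add: m_def)
 show ?thesis
 proof (rule that)
  fix x y
  have "\<bar>Kd dl x y\<bar> \<le> (LINT z|lborel. \<bar>mol dl x (fst z) * mol dl y (snd z) * CU z\<bar>)"
   unfolding Kd_def cov_eq[OF mol_test[OF dl] mol_test[OF dl]] by (rule integral_abs_bound)
  also have "\<dots> \<le> (LINT z|lborel. m * m * \<bar>CU z\<bar>)"
  proof (rule integral_mono)
   show "integrable lborel (\<lambda>z. \<bar>mol dl x (fst z) * mol dl y (snd z) * CU z\<bar>)"
    using weighted_CU_integrable[OF mol_test[OF dl] mol_test[OF dl]] by (rule integrable_abs)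
   show "integrable lborel (\<lambda>z. m * m * \<bar>CU z\<bar>)" using CU_integrable by auto
   show "\<bar>mol dl x (fst z) * mol dl y (snd z) * CU z\<bar> \<le> m * m * \<bar>CU z\<bar>" for z
    unfolding abs_mult using m m0 by (intro mult_right_mono mult_mono) auto
  qed
  finally show "\<bar>Kd dl x y\<bar> \<le> (LINT z|lborel. m * m * \<bar>CU z\<bar>)" .
 qed
qed

lemma chaos_bounded:
 assumes "dl > 0" obtains B where "\<And>w x. norm (chaos dl w x) \<le> B"
proof -
 obtain B where B: "\<And>x y. \<bar>Kd dl x y\<bar> \<le> B" by (rule Kd_bounded[OF assms]) blast
 show ?thesis
 proof (rule that)
  fix w x
  have "b / 2 * Kd dl x x \<le> b / 2 * B" using B[of x x] b by (intro mult_left_mono) auto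
  then show "norm (chaos dl w x) \<le> exp (b / 2 * B)"
   by (cases "x \<in> U") (auto simp: chaos_eq chaos_outside norm_mult)
 qed
qed

definition mol2 :: "real => 'a \<times> 'a => 'a \<times> 'a => real" where
 "mol2 dl z zz = mol dl (fst z) (fst zz) * mol dl (snd z) (snd zz)"

lemma mol2:
 assumes dl: "dl > 0"
 shows "mol2 dl z zz \<ge> 0" "integrable lborel (mol2 dl z)" "(LINT zz|lborel. mol2 dl z zz) = 1"
  "mol2 dl z \<in> borel_measurable borel"
  "mol2 dl z zz \<noteq> 0 ==> dist (fst z) (fst zz) < dl \<and> dist (snd z) (snd zz) < dl"
proof -
 show "mol2 dl z zz \<ge> 0" using mol_nonneg[OF dl] by (simp add: mol2_def)
 have m: "(\<lambda>zz. mol2 dl z zz) \<in> borel_measurable (borel \<Otimes>\<^sub>M borel)" unfolding mol2_def by measurable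
 then show m': "mol2 dl z \<in> borel_measurable borel" by (simp add: borel_prod)
 have c: "(\<lambda>x y. mol2 dl z (x, y)) = (\<lambda>x y. mol dl (fst z) x * mol dl (snd z) y)" by (simp add: mol2_def)
 have i: "integrable (lborel \<Otimes>\<^sub>M lborel) (case_prod (\<lambda>x y. mol dl (fst z) x * mol dl (snd z) y))"
 proof (rule lborel_pair.integrable_dominated_product)
  show "case_prod (\<lambda>x y. mol dl (fst z) x * mol dl (snd z) y) \<in> borel_measurable (lborel \<Otimes>\<^sub>M lborel)" by measurable
  show "integrable lborel (mol dl (fst z))" "integrable lborel (mol dl (snd z))" using mol_integrable[OF dl] by auto
  show "norm (mol dl (fst z) x * mol dl (snd z) y) \<le> mol dl (fst z) x * mol dl (snd z) y" for x y
   using mol_nonneg[OF dl] by simp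
 qed
 have e: "case_prod (\<lambda>x y. mol dl (fst z) x * mol dl (snd z) y) = mol2 dl z" by (auto simp: mol2_def)
 show "integrable lborel (mol2 dl z)" using i unfolding e lborel_prod .
 have "(LINT zz|lborel. mol2 dl z zz) = (LINT x|lborel. LINT y|lborel. mol dl (fst z) x * mol dl (snd z) y)"
  using lborel_pair.integral_fst[OF i] unfolding e lborel_prod by simp
 then show "(LINT zz|lborel. mol2 dl z zz) = 1" by (simp add: mol_integral[OF dl])
 assume "mol2 dl z zz \<noteq> 0"
 then have "mol dl (fst z) (fst zz) \<noteq> 0" "mol dl (snd z) (snd zz) \<noteq> 0" by (auto simp: mol2_def)
 then show "dist (fst z) (fst zz) < dl \<and> dist (snd z) (snd zz) < dl"
  using mol_zero[OF dl, of "fst z" "fst zz"] mol_zero[OF dl, of "snd z" "snd zz"] by linarith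
qed

lemma Kd_eq: "dl > 0 ==> Kd dl x y = (LINT zz|lborel. mol2 dl (x, y) zz * CU zz)"
 unfolding Kd_def by (simp add: cov_eq mol_test mol2_def)

lemma mol2_CU_integrable: "dl > 0 ==> integrable lborel (\<lambda>zz. mol2 dl z zz * CU zz)"
 unfolding mol2_def by (rule weighted_CU_integrable[OF mol_test mol_test])

lemma CU_lower:
 assumes A: "compact A" "A \<subseteq> U"
 obtains c where "c \<ge> 0" "\<And>x y. x \<in> A ==> y \<in> A ==> CU (x, y) \<ge> - c" "\<And>x y. x \<in> A ==> y \<in> A ==> \<bar>g (x, y)\<bar> \<le> c"
proof -
 have "compact (g ` (A \<times> A))" using A by (intro compact_continuous_image continuous_on_subset[OF g_continuous] compact_Times) auto
 then obtain G where G: "G > 0" "\<And>z. z \<in> A \<times> A ==> \<bar>g z\<bar> \<le> G"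
  using compact_imp_bounded bounded_pos by (metis imageI real_norm_def)
 obtain R where R: "R > 0" "\<And>x. x \<in> A ==> norm x \<le> R" using A(1) compact_imp_bounded[of A] by (auto simp: bounded_pos)
 show ?thesis
 proof (rule that[of "G + 2 * R"])
  show "G + 2 * R \<ge> 0" using G R by simp
  fix x y assume xy: "x \<in> A" "y \<in> A"
  have "norm (x - y) \<le> 2 * R" using norm_triangle_ineq4[of x y] R(2)[of x] R(2)[of y] xy by linarith
  moreover have "ln (1 / norm (x - y)) \<ge> - norm (x - y)"
   using ln_le_minus_one[of "norm (x - y)"] by (cases "x = y") (auto simp: ln_div)
  ultimately have "ln (1 / norm (x - y)) \<ge> - 2 * R" by linarith
  then show "CU (x, y) \<ge> - (G + 2 * R)" using G(2)[of "(x, y)"] xy A by (auto simp: CU_def C_def)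
  show "\<bar>g (x, y)\<bar> \<le> G + 2 * R" using G(2)[of "(x, y)"] xy R by auto
 qed
qed

lemma Kd_bounds:
 assumes A: "compact A" "A \<subseteq> U"
 obtains dl0 c where "dl0 > 0" "c > 0"
  "\<And>dl x y. 0 < dl ==> dl \<le> dl0 ==> x \<in> A ==> y \<in> A ==> x \<noteq> y ==> exp (b * Kd dl x y) \<le> c * norm (x - y) powr (- b)"
  "\<And>dl x y. 0 < dl ==> dl \<le> dl0 ==> x \<in> A ==> y \<in> A ==> exp (- b * Kd dl x y) \<le> c"
proof -
 obtain e A' where e: "e > 0" "compact A'" "A' \<subseteq> U" "\<And>x. x \<in> A ==> cball x e \<subseteq> A'" "A \<subseteq> A'"
  by (rule compact_neighbourhood[OF A(1) U(2) A(2)]) blast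
 obtain c0 where c0: "c0 \<ge> 0" "\<And>x y. x \<in> A' ==> y \<in> A' ==> CU (x, y) \<ge> - c0" "\<And>x y. x \<in> A' ==> y \<in> A' ==> \<bar>g (x, y)\<bar> \<le> c0"
  by (rule CU_lower[OF e(2,3)]) blast
 obtain B where B: "B > 0" "\<And>x. \<bar>\<phi> x\<bar> \<le> B" by (rule test_functions_bounded[OF phi(1)]) blast
 obtain A1 where A1: "A1 > 0" "\<And>r (x::'a) w. r > 0 ==>
  (\<integral>\<^sup>+ y. riesz b (y - w) * indicator (cball x (2 * r)) y \<partial>lborel)
   \<le> ennreal (A1 * r ^ DIM('a) * (max r (norm (x - w))) powr (- b))"
  by (rule riesz_average[where ?'a = 'a and gm = b]) (use b in auto)
 have avg: "(\<integral>\<^sup>+ y. ennreal (mol dl x y) * riesz b (y - w) \<partial>lborel) \<le> ennreal (B * A1) * riesz b (x - w)"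
  if dl: "dl > 0" and ne: "x \<noteq> w" for dl x w
 proof -
  have "(\<integral>\<^sup>+ y. ennreal (mol dl x y) * riesz b (y - w) \<partial>lborel)
   \<le> (\<integral>\<^sup>+ y. ennreal (B / dl ^ DIM('a)) * (riesz b (y - w) * indicator (cball x (2 * dl)) y) \<partial>lborel)"
  proof (intro nn_integral_mono)
   fix y
   have "ennreal (mol dl x y) \<le> ennreal (B / dl ^ DIM('a)) * indicator (cball x (2 * dl)) y"
   proof (cases "dist x y < dl")
    case True
    have "mol dl x y \<le> B / dl ^ DIM('a)" unfolding mol_eq using B(2) dl by (intro divide_right_mono) (auto intro: order_trans[OF abs_ge_self])
    then show ?thesis using True dl by (auto intro!: ennreal_leI)
   qed (use mol_zero[OF dl] in auto)
   from mult_right_mono[OF this, of "riesz b (y - w)"]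
   show "ennreal (mol dl x y) * riesz b (y - w) \<le> ennreal (B / dl ^ DIM('a)) * (riesz b (y - w) * indicator (cball x (2 * dl)) y)"
    by (simp add: mult_ac)
  qed
  also have "\<dots> = ennreal (B / dl ^ DIM('a)) * (\<integral>\<^sup>+ y. riesz b (y - w) * indicator (cball x (2 * dl)) y \<partial>lborel)"
   by (rule nn_integral_cmult) measurable
  also have "\<dots> \<le> ennreal (B / dl ^ DIM('a)) * ennreal (A1 * dl ^ DIM('a) * (max dl (norm (x - w))) powr (- b))"
   by (intro mult_left_mono A1 dl) auto
  also have "\<dots> = ennreal (B * A1 * (max dl (norm (x - w))) powr (- b))"
   using B A1 dl by (simp add: ennreal_mult[symmetric])
  also have "\<dots> \<le> ennreal (B * A1 * norm (x - w) powr (- b))"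
   using B A1 ne b by (intro ennreal_leI mult_left_mono powr_mono2') auto
  also have "\<dots> = ennreal (B * A1) * riesz b (x - w)" using B A1 by (simp add: riesz_def ennreal_mult)
  finally show ?thesis .
 qed
 define c where "c = max (exp (b * c0) * (B * A1)\<^sup>2) (exp (b * c0))"
 show ?thesis
 proof (rule that[OF e(1)])
  show "c > 0" by (simp add: c_def less_max_iff_disj)
  fix dl x y assume dl: "0 < dl" "dl \<le> e" and xy: "x \<in> A" "y \<in> A"
  have supp: "fst zz \<in> A' \<and> snd zz \<in> A'" if "mol2 dl (x, y) zz \<noteq> 0" for zz
   using mol2(5)[OF dl(1) that] e(4)[OF xy(1)] e(4)[OF xy(2)] dl(2) by auto
  have lower: "Kd dl x y \<ge> - c0"
  proof -
   have "(LINT zz|lborel. (- c0) * mol2 dl (x, y) zz) \<le> Kd dl x y"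
    unfolding Kd_eq[OF dl(1)]
   proof (rule integral_mono)
    show "integrable lborel (\<lambda>zz. (- c0) * mol2 dl (x, y) zz)" using mol2(2)[OF dl(1)] by simp
    show "integrable lborel (\<lambda>zz. mol2 dl (x, y) zz * CU zz)" by (rule mol2_CU_integrable[OF dl(1)])
    fix zz
    show "(- c0) * mol2 dl (x, y) zz \<le> mol2 dl (x, y) zz * CU zz"
     using supp[of zz] c0(2)[of "fst zz" "snd zz"] mol2(1)[OF dl(1), of "(x, y)" zz]
     mult_right_mono[of "- c0" "CU zz" "mol2 dl (x, y) zz"]
     by (cases "mol2 dl (x, y) zz = 0") (simp_all add: mult.commute)
   qed
   then show ?thesis by (simp add: mol2(3)[OF dl(1)])
  qed
  then have "- b * Kd dl x y \<le> b * c0" using b mult_left_mono[OF lower, of b] by simp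
  then have "exp (- b * Kd dl x y) \<le> exp (b * c0)" by simp
  then show "exp (- b * Kd dl x y) \<le> c" unfolding c_def by (rule max.coboundedI2)
  assume ne: "x \<noteq> y"
  define m where "m = Kd dl x y"
  have "ennreal (LINT zz|lborel. exp (b * m) * (1 - b * m) * mol2 dl (x, y) zz + exp (b * m) * b * (mol2 dl (x, y) zz * CU zz))
   \<le> (\<integral>\<^sup>+ zz. ennreal (mol2 dl (x, y) zz * exp (b * CU zz)) \<partial>lborel)"
  proof (rule integral_le_nn_integral)
   show "integrable lborel (\<lambda>zz. exp (b * m) * (1 - b * m) * mol2 dl (x, y) zz + exp (b * m) * b * (mol2 dl (x, y) zz * CU zz))"
    using mol2(2)[OF dl(1)] mol2_CU_integrable[OF dl(1)] by auto
   fix zz :: "'a \<times> 'a"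
   have "exp (b * m) * (1 + (b * CU zz - b * m)) \<le> exp (b * m) * exp (b * CU zz - b * m)"
    by (intro mult_left_mono exp_ge_add_one_self) auto
   also have "\<dots> = exp (b * CU zz)" by (simp add: exp_add[symmetric])
   finally have "mol2 dl (x, y) zz * (exp (b * m) * (1 + (b * CU zz - b * m))) \<le> mol2 dl (x, y) zz * exp (b * CU zz)"
    by (intro mult_left_mono mol2(1) dl)
   then show "ennreal (exp (b * m) * (1 - b * m) * mol2 dl (x, y) zz + exp (b * m) * b * (mol2 dl (x, y) zz * CU zz)) \<le> ennreal (mol2 dl (x, y) zz * exp (b * CU zz))"
    by (intro ennreal_leI) (simp add: algebra_simps)
  qed
  also have "(LINT zz|lborel. exp (b * m) * (1 - b * m) * mol2 dl (x, y) zz + exp (b * m) * b * (mol2 dl (x, y) zz * CU zz)) = exp (b * m)"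
  proof -
   have "(LINT zz|lborel. exp (b * m) * (1 - b * m) * mol2 dl (x, y) zz + exp (b * m) * b * (mol2 dl (x, y) zz * CU zz))
    = exp (b * m) * (1 - b * m) * (LINT zz|lborel. mol2 dl (x, y) zz) + exp (b * m) * b * (LINT zz|lborel. mol2 dl (x, y) zz * CU zz)"
    using mol2(2)[OF dl(1)] mol2_CU_integrable[OF dl(1)]
    by (subst Bochner_Integration.integral_add) (auto intro: integrable_mult_right)
   also have "\<dots> = exp (b * m)"
    unfolding mol2(3)[OF dl(1)] Kd_eq[OF dl(1), symmetric] m_def[symmetric] by (simp add: algebra_simps)
   finally show ?thesis .
  qed
  also have "(\<integral>\<^sup>+ zz. ennreal (mol2 dl (x, y) zz * exp (b * CU zz)) \<partial>lborel)
   \<le> (\<integral>\<^sup>+ zz. ennreal (exp (b * c0)) * (ennreal (mol dl x (fst zz)) * (ennreal (mol dl y (snd zz)) * riesz b (snd zz - fst zz))) \<partial>lborel)"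
  proof (rule nn_integral_mono_AE)
   obtain b0 :: 'a where "b0 \<in> Basis" using nonempty_Basis by blast
   then have "AE zz in (lborel :: ('a \<times> 'a) measure). (b0, - b0) \<bullet> zz \<noteq> 0"
    by (intro AE_lborel_inner_neq) (auto simp: zero_prod_def)
   then have "AE zz in (lborel :: ('a \<times> 'a) measure). fst zz \<noteq> snd zz" by eventually_elim (auto simp: inner_prod_def)
   then show "AE zz in lborel. ennreal (mol2 dl (x, y) zz * exp (b * CU zz)) \<le> ennreal (exp (b * c0)) * (ennreal (mol dl x (fst zz)) * (ennreal (mol dl y (snd zz)) * riesz b (snd zz - fst zz)))"
   proof eventually_elim
    fix zz :: "'a \<times> 'a" assume z: "fst zz \<noteq> snd zz"
    show "ennreal (mol2 dl (x, y) zz * exp (b * CU zz)) \<le> ennreal (exp (b * c0)) * (ennreal (mol dl x (fst zz)) * (ennreal (mol dl y (snd zz)) * riesz b (snd zz - fst zz)))"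
    proof (cases "mol2 dl (x, y) zz = 0")
     case False
     then have A'z: "fst zz \<in> A'" "snd zz \<in> A'" using supp by auto
     have "exp (b * CU zz) = exp (b * g zz) * norm (snd zz - fst zz) powr (- b)"
      using A'z e(3) z by (auto simp: CU_def C_def powr_def ln_div norm_minus_commute exp_add[symmetric] algebra_simps)
     also have "\<dots> \<le> exp (b * c0) * norm (snd zz - fst zz) powr (- b)"
      using c0(3)[OF A'z] b by (intro mult_right_mono) (auto simp: mult_left_mono)
     finally have "mol2 dl (x, y) zz * exp (b * CU zz) \<le> mol2 dl (x, y) zz * (exp (b * c0) * norm (snd zz - fst zz) powr (- b))"
      by (intro mult_left_mono mol2(1) dl)
     then have "ennreal (mol2 dl (x, y) zz * exp (b * CU zz)) \<le> ennreal (exp (b * c0) * (mol dl x (fst zz) * (mol dl y (snd zz) * norm (snd zz - fst zz) powr (- b))))"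
      by (intro ennreal_leI) (simp add: mol2_def mult_ac)
     then show ?thesis using mol_nonneg[OF dl(1)] by (simp add: ennreal_mult riesz_def)
    qed simp
   qed
  qed
  also have "\<dots> = (\<integral>\<^sup>+ u. \<integral>\<^sup>+ v. ennreal (exp (b * c0)) * (ennreal (mol dl x u) * (ennreal (mol dl y v) * riesz b (v - u))) \<partial>lborel \<partial>lborel)"
  proof -
   have "(\<lambda>zz. ennreal (exp (b * c0)) * (ennreal (mol dl x (fst zz)) * (ennreal (mol dl y (snd zz)) * riesz b (snd zz - fst zz)))) \<in> borel_measurable (borel \<Otimes>\<^sub>M borel)"
    by measurable
   then show ?thesis by (subst nn_integral_lborel_pair) (simp_all add: borel_prod)
  qed
  also have "\<dots> = (\<integral>\<^sup>+ u. ennreal (exp (b * c0)) * (ennreal (mol dl x u) * (\<integral>\<^sup>+ v. ennreal (mol dl y v) * riesz b (v - u) \<partial>lborel)) \<partial>lborel)"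
   by (simp add: nn_integral_cmult)
  also have "\<dots> \<le> (\<integral>\<^sup>+ u. (ennreal (exp (b * c0)) * ennreal (B * A1)) * (ennreal (mol dl x u) * riesz b (u - y)) \<partial>lborel)"
  proof (intro nn_integral_mono_AE, use AE_lborel_neq[of y] in eventually_elim)
   fix u assume "u \<noteq> y"
   then have "ennreal (exp (b * c0)) * (ennreal (mol dl x u) * (\<integral>\<^sup>+ v. ennreal (mol dl y v) * riesz b (v - u) \<partial>lborel))
    \<le> ennreal (exp (b * c0)) * (ennreal (mol dl x u) * (ennreal (B * A1) * riesz b (y - u)))"
    by (intro mult_left_mono avg dl) auto
   then show "ennreal (exp (b * c0)) * (ennreal (mol dl x u) * (\<integral>\<^sup>+ v. ennreal (mol dl y v) * riesz b (v - u) \<partial>lborel))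
    \<le> (ennreal (exp (b * c0)) * ennreal (B * A1)) * (ennreal (mol dl x u) * riesz b (u - y))"
    by (simp add: mult_ac riesz_minus[of b y u])
  qed
  also have "\<dots> = (ennreal (exp (b * c0)) * ennreal (B * A1)) * (\<integral>\<^sup>+ u. ennreal (mol dl x u) * riesz b (u - y) \<partial>lborel)"
   by (rule nn_integral_cmult) measurable
  also have "\<dots> \<le> (ennreal (exp (b * c0)) * ennreal (B * A1)) * (ennreal (B * A1) * riesz b (x - y))"
   by (intro mult_left_mono avg dl ne) auto
  also have "\<dots> = ennreal (exp (b * c0) * (B * A1)\<^sup>2 * norm (x - y) powr (- b))"
   using B A1 by (simp add: riesz_def ennreal_mult[symmetric] power2_eq_square mult_ac)
  finally have "exp (b * m) \<le> exp (b * c0) * (B * A1)\<^sup>2 * norm (x - y) powr (- b)"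
   by (subst (asm) ennreal_le_iff) auto
  also have "\<dots> \<le> c * norm (x - y) powr (- b)" unfolding c_def by (intro mult_right_mono) auto
  finally show "exp (b * Kd dl x y) \<le> c * norm (x - y) powr (- b)" by (simp add: m_def)
 qed
qed

lemma CU_continuous_off_diagonal:
 assumes "x \<in> U" "y \<in> U" "x \<noteq> y" shows "isCont CU (x, y)"
proof -
 define W where "W = {z. fst z \<in> U \<and> snd z \<in> U \<and> fst z \<noteq> snd z}"
 have "W = (U \<times> U) \<inter> {z. fst z \<noteq> snd z}" by (auto simp: W_def)
 moreover have "open {z :: 'a \<times> 'a. fst z \<noteq> snd z}" by (intro open_Collect_neq continuous_intros)
 ultimately have W: "open W" "(x, y) \<in> W" using U assms by (auto simp: open_Times W_def)
 have "continuous_on W (\<lambda>z. ln (1 / norm (fst z - snd z)) + g z)"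
  by (intro continuous_intros continuous_on_subset[OF g_continuous]) (auto simp: W_def)
 then have "continuous_on W CU" by (rule continuous_on_eq) (auto simp: W_def CU_def C_def)
 then show ?thesis using W by (simp add: continuous_on_eq_continuous_at)
qed

lemma Kd_tendsto:
 assumes xy: "x \<in> U" "y \<in> U" "x \<noteq> y" and dl: "\<And>n. dl n > 0" "dl \<longlonglongrightarrow> 0"
 shows "(\<lambda>n. Kd (dl n) x y) \<longlonglongrightarrow> CU (x, y)"
proof (rule metric_LIMSEQ_I)
 fix e :: real assume e: "e > 0"
 obtain d where d: "d > 0" "\<And>zz. dist zz (x, y) < d ==> dist (CU zz) (CU (x, y)) < e / 2"
  using CU_continuous_off_diagonal[OF xy] e unfolding continuous_at_eps_delta by (metis half_gt_zero)
 have "\<forall>\<^sub>F n in sequentially. dl n < d / 2" using order_tendstoD(2)[OF dl(2), of "d / 2"] d by auto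
 then obtain n0 where n0: "\<And>n. n \<ge> n0 ==> dl n < d / 2" by (auto simp: eventually_sequentially)
 have "dist (Kd (dl n) x y) (CU (x, y)) < e" if "n \<ge> n0" for n
 proof -
  have i: "integrable lborel (\<lambda>zz. mol2 (dl n) (x, y) zz * CU zz)" "integrable lborel (mol2 (dl n) (x, y))"
   using mol2_CU_integrable[OF dl(1)] mol2(2)[OF dl(1)] by auto
  have "Kd (dl n) x y - CU (x, y) = (LINT zz|lborel. mol2 (dl n) (x, y) zz * CU zz - CU (x, y) * mol2 (dl n) (x, y) zz)"
   using i by (simp add: Kd_eq[OF dl(1)] mol2(3)[OF dl(1)])
  also have "\<bar>\<dots>\<bar> \<le> (LINT zz|lborel. \<bar>mol2 (dl n) (x, y) zz * CU zz - CU (x, y) * mol2 (dl n) (x, y) zz\<bar>)"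
   by (rule integral_abs_bound)
  also have "\<dots> \<le> (LINT zz|lborel. (e / 2) * mol2 (dl n) (x, y) zz)"
  proof (rule integral_mono)
   show "integrable lborel (\<lambda>zz. \<bar>mol2 (dl n) (x, y) zz * CU zz - CU (x, y) * mol2 (dl n) (x, y) zz\<bar>)" using i by auto
   show "integrable lborel (\<lambda>zz. (e / 2) * mol2 (dl n) (x, y) zz)" using i by auto
   fix zz :: "'a \<times> 'a"
   have eq: "mol2 (dl n) (x, y) zz * CU zz - CU (x, y) * mol2 (dl n) (x, y) zz = mol2 (dl n) (x, y) zz * (CU zz - CU (x, y))"
    by (simp add: algebra_simps)
   show "\<bar>mol2 (dl n) (x, y) zz * CU zz - CU (x, y) * mol2 (dl n) (x, y) zz\<bar> \<le> (e / 2) * mol2 (dl n) (x, y) zz"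
   proof (cases "mol2 (dl n) (x, y) zz = 0")
    case False
    from mol2(5)[OF dl(1) this] have "dist x (fst zz) < dl n" "dist y (snd zz) < dl n" by auto
    then have "dist zz (x, y) < d"
     using n0[OF that] norm_Pair_le[of "fst zz - x" "snd zz - y"] by (cases zz) (auto simp: dist_norm norm_minus_commute)
    then have "\<bar>CU zz - CU (x, y)\<bar> \<le> e / 2" using d(2)[of zz] by (simp add: dist_real_def)
    then show ?thesis unfolding eq abs_mult using mol2(1)[OF dl(1), of n "(x, y)" zz]
     mult_right_mono[of "\<bar>CU zz - CU (x, y)\<bar>" "e / 2" "mol2 (dl n) (x, y) zz"]
     by (simp add: mult.commute)
   qed simp
  qed
  also have "\<dots> = e / 2" by (simp add: mol2(3)[OF dl(1)])
  finally show ?thesis using e by (simp add: dist_real_def)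
 qed
 then show "\<exists>no. \<forall>n\<ge>no. dist (Kd (dl n) x y) (CU (x, y)) < e" by blast
qed

lemma CU_commute: "CU (x, y) = CU (y, x)"
proof (cases "x \<in> U \<and> y \<in> U \<and> x \<noteq> y")
 case True
 define dl where "dl = (\<lambda>n::nat. 1 / real (Suc n))"
 have dl: "\<And>n. dl n > 0" "dl \<longlonglongrightarrow> 0" unfolding dl_def using LIMSEQ_Suc[OF lim_1_over_n] by auto
 have "(\<lambda>n. Kd (dl n) x y) \<longlonglongrightarrow> CU (x, y)" "(\<lambda>n. Kd (dl n) y x) \<longlonglongrightarrow> CU (y, x)"
  using True by (auto intro!: Kd_tendsto dl)
 then show ?thesis using LIMSEQ_unique unfolding Kd_def cov_commute[of "mol _ x"] by blast
qed (auto simp: CU_def)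

lemma cov_pot:
 assumes "f \<in> test_functions UNIV" "h \<in> test_functions UNIV"
 shows "cov f h = (LINT x|lborel. f x * pot h x)"
proof -
 have i: "integrable (lborel \<Otimes>\<^sub>M lborel) (case_prod (\<lambda>x y. f x * (CU (x, y) * h y)))"
 proof -
  have "case_prod (\<lambda>x y. f x * (CU (x, y) * h y)) = (\<lambda>z. f (fst z) * h (snd z) * CU z)"
   by (auto simp: fun_eq_iff)
  then show ?thesis using weighted_CU_integrable[OF assms] by (simp add: lborel_prod)
 qed
 have "cov f h = (LINT z|(lborel \<Otimes>\<^sub>M lborel). case_prod (\<lambda>x y. f x * (CU (x, y) * h y)) z)"
  unfolding cov_eq[OF assms] lborel_prod by (intro LINT_cong) (auto simp: split_beta)
 also have "\<dots> = (LINT x|lborel. LINT y|lborel. f x * (CU (x, y) * h y))"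
  using lborel_pair.integral_fst[OF i] by simp
 finally show ?thesis by (simp add: pot_def)
qed

lemma integrable_log_cball: "integrable lborel (\<lambda>p::'a. ln (1 / norm p) * indicator (cball 0 R) p)"
proof (cases "R > 0")
 case True
 obtain A where A: "A > 0" "\<And>s (w::'a). s > 0 ==>
  (\<integral>\<^sup>+ y. riesz (1/2) (y - w) * indicator (cball w s) y \<partial>lborel) \<le> ennreal (A * s powr (DIM('a) - (1/2)))"
  by (rule riesz_near[where ?'a = 'a and gm = "1/2"]) (use dim in auto)
 have "(\<integral>\<^sup>+ p. ennreal (norm (ln (1 / norm p) * indicator (cball 0 R) p :: real)) \<partial>(lborel :: 'a measure))
  \<le> (\<integral>\<^sup>+ p. 2 * (riesz (1/2) (p - 0) * indicator (cball 0 R) p) + ennreal R * indicator (cball 0 R) p \<partial>(lborel :: 'a measure))"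
 proof (intro nn_integral_mono)
  fix p :: 'a
  show "ennreal (norm (ln (1 / norm p) * indicator (cball 0 R) p :: real)) \<le> 2 * (riesz (1/2) (p - 0) * indicator (cball 0 R) p) + ennreal R * indicator (cball 0 R) p"
  proof (cases "norm p \<le> R")
   case pR: True
   have "\<bar>ln (1 / norm p)\<bar> \<le> 2 * norm p powr (- (1/2)) + R"
    using abs_ln_inverse_le[of "norm p"] pR by simp
   then have "ennreal \<bar>ln (1 / norm p)\<bar> \<le> ennreal (2 * norm p powr (- (1/2)) + R)" by (rule ennreal_leI)
   also have "\<dots> = 2 * riesz (1/2) (p - 0) + ennreal R"
    using True by (simp add: riesz_def ennreal_mult)
   finally show ?thesis using pR by simp
  qed simp
 qed
 also have "\<dots> = 2 * (\<integral>\<^sup>+ p. riesz (1/2) (p - 0) * indicator (cball 0 R) p \<partial>(lborel :: 'a measure)) + ennreal R * emeasure lborel (cball (0::'a) R)"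
  by (simp add: nn_integral_add nn_integral_cmult)
 also have "\<dots> \<le> 2 * ennreal (A * R powr (DIM('a) - (1/2))) + ennreal R * emeasure lborel (cball (0::'a) R)"
  by (intro add_mono mult_left_mono A True) auto
 also have "\<dots> < \<infinity>" using emeasure_lborel_cball_finite[of "0::'a" R] by (auto simp: ennreal_mult_less_top)
 finally show ?thesis by (intro integrableI_bounded) auto
next
 case False
 then have "(\<lambda>p::'a. ln (1 / norm p) * indicator (cball 0 R) p :: real) = (\<lambda>p. 0)"
 proof (intro ext)
  fix p :: 'a
  have "norm p = 0" if "norm p \<le> R" using that False norm_ge_zero[of p] by linarith
  then show "ln (1 / norm p) * indicator (cball 0 R) p = (0::real)" by (cases "norm p \<le> R") auto
 qed
 then show ?thesis by simp
qed

lemma pot_continuous: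
 assumes \<rho>: "\<rho> \<in> test_functions U"
 shows "continuous_on U (pot \<rho>)"
 unfolding continuous_on_sequentially
proof (intro allI ballI impI, elim conjE)
 fix X a assume a: "a \<in> U" and X: "\<forall>n. X n \<in> U" and lim: "X \<longlonglongrightarrow> a"
 have \<rho>U: "\<rho> \<in> test_functions UNIV" by (rule test_functions_mono[OF _ \<rho>]) simp
 have [measurable]: "\<rho> \<in> borel_measurable borel" using \<rho> by (rule test_functions_borel)
 obtain B where B: "B > 0" "\<And>x. \<bar>\<rho> x\<bar> \<le> B" by (rule test_functions_bounded[OF \<rho>]) blast
 have S: "compact (supp \<rho>)" "supp \<rho> \<subseteq> U" using \<rho> by (auto simp: test_functions_iff)
 define T where "T = insert a (range X)"
 have T: "compact T" "T \<subseteq> U" unfolding T_def using compact_sequence_with_limit[OF lim] a X by auto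
 have "compact (T \<union> supp \<rho>)" using T S by auto
 then obtain R where R: "R > 0" "\<And>x. x \<in> T \<union> supp \<rho> ==> norm x \<le> R" using compact_imp_bounded bounded_pos by metis
 define l where "l = (\<lambda>x v. ln (1 / norm (x - v)) * \<rho> v)"
 define m where "m = (\<lambda>x v. CU (x, v) * \<rho> v - l x v)"
 have \<rho>0: "\<rho> v = 0" if "v \<notin> supp \<rho>" for v using that by (rule supp_superset)
 have l_eq: "(LINT v|lborel. l x v) = (LINT p|lborel. ln (1 / norm p) * \<rho> (x + p))" for x
 proof -
  have "l x \<in> borel_measurable borel" unfolding l_def by measurable
  from integral_translate[OF this, of x] show ?thesis by (simp add: l_def)
 qed
 have dom: "norm (ln (1 / norm p) * \<rho> (x + p)) \<le> B * norm (ln (1 / norm p) * indicator (cball 0 (2 * R)) p)" if "x \<in> T" for x p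
 proof (cases "\<rho> (x + p) = 0")
  case False
  then have "x + p \<in> supp \<rho>" using \<rho>0 by metis
  then have "norm p \<le> 2 * R" using R(2)[of x] R(2)[of "x + p"] that norm_triangle_ineq4[of "x + p" x] by simp
  then show ?thesis using B(2)[of "x + p"] by (simp add: abs_mult mult.commute[of B] mult_left_mono)
 qed (use B in simp)
 have l_int: "integrable lborel (l x)" if "x \<in> T" for x
 proof -
  have "integrable lborel (\<lambda>p. ln (1 / norm p) * \<rho> (x + p))"
   by (rule LINT_bound[OF integrable_mult_right[OF integrable_norm[OF integrable_log_cball[of "2 * R"]], of B]])
    (use dom[OF that] B in \<open>auto simp: abs_mult\<close>)
  from integrable_affine[OF this, of 1 "- x"] show ?thesis by (simp add: l_def[abs_def] norm_minus_commute)
 qed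
 have "compact (g ` (T \<times> supp \<rho>))" using T S by (intro compact_continuous_image continuous_on_subset[OF g_continuous] compact_Times) auto
 then obtain G where G: "G > 0" "\<And>z. z \<in> T \<times> supp \<rho> ==> \<bar>g z\<bar> \<le> G"
  using compact_imp_bounded bounded_pos by (metis imageI real_norm_def)
 have m_eq: "m x v = g (x, v) * \<rho> v" if "x \<in> T" "v \<in> supp \<rho>" for x v
  using that T S by (auto simp: m_def l_def CU_def C_def algebra_simps)
 have m0: "m x v = 0" if "v \<notin> supp \<rho>" for x v using \<rho>0[OF that] by (simp add: m_def l_def)
 have m_bound: "norm (m x v) \<le> G * B * indicator (supp \<rho>) v" if "x \<in> T" for x v
  using m_eq[OF that] m0 G B that by (cases "v \<in> supp \<rho>") (auto simp: abs_mult intro!: mult_mono)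
 have fin: "integrable lborel (\<lambda>v. G * B * indicator (supp \<rho>) v)"
  using S emeasure_compact_finite[OF S(1)] by (intro integrable_mult_right integrable_real_indicator) (auto simp: borel_closed compact_imp_closed)
 have mm [measurable]: "m x \<in> borel_measurable borel" for x
 proof -
  have "(\<lambda>v. CU (x, v)) \<in> borel_measurable borel" by (rule measurable_compose[OF _ CU_measurable]) measurable
  then show ?thesis unfolding m_def l_def by measurable
 qed
 have m_int: "integrable lborel (m x)" if "x \<in> T" for x
  by (rule LINT_bound[OF fin]) (use m_bound[OF that] G B in auto)
 have pot: "pot \<rho> x = (LINT p|lborel. ln (1 / norm p) * \<rho> (x + p)) + (LINT v|lborel. m x v)" if "x \<in> T" for x
 proof -
  have "pot \<rho> x = (LINT v|lborel. l x v + m x v)" by (simp add: pot_def m_def)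
  then show ?thesis using l_int[OF that] m_int[OF that] by (simp add: l_eq)
 qed
 have XT: "X n \<in> T" "a \<in> T" for n by (auto simp: T_def)
 have "(\<lambda>n. LINT p|lborel. ln (1 / norm p) * \<rho> (X n + p)) \<longlonglongrightarrow> (LINT p|lborel. ln (1 / norm p) * \<rho> (a + p))"
 proof (rule integral_dominated_convergence[where w = "\<lambda>p. B * norm (ln (1 / norm p) * indicator (cball 0 (2 * R)) p)"])
  have "isCont \<rho> y" for y using test_functions_continuous[OF \<rho>U, of UNIV] by (simp add: continuous_on_eq_continuous_at)
  then show "AE p in lborel. (\<lambda>n. ln (1 / norm p) * \<rho> (X n + p)) \<longlonglongrightarrow> ln (1 / norm p) * \<rho> (a + p)"
   using lim by (intro AE_I2 tendsto_mult_left isCont_tendsto_compose[of _ \<rho>] tendsto_add tendsto_const)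
  show "AE p in lborel. norm (ln (1 / norm p) * \<rho> (X n + p)) \<le> B * norm (ln (1 / norm p) * indicator (cball 0 (2 * R)) p)" for n
   by (intro AE_I2 dom XT)
  show "integrable lborel (\<lambda>p::'a. B * norm (ln (1 / norm p) * indicator (cball 0 (2 * R)) p :: real))"
   by (intro integrable_mult_right integrable_norm integrable_log_cball)
 qed measurable
 moreover have "(\<lambda>n. LINT v|lborel. m (X n) v) \<longlonglongrightarrow> (LINT v|lborel. m a v)"
 proof (rule integral_dominated_convergence[OF _ _ fin])
  show "AE v in lborel. (\<lambda>n. m (X n) v) \<longlonglongrightarrow> m a v"
  proof (intro AE_I2)
   fix v
   show "(\<lambda>n. m (X n) v) \<longlonglongrightarrow> m a v"
   proof (cases "v \<in> supp \<rho>")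
    case True
    have "(\<lambda>n. g (X n, v)) \<longlonglongrightarrow> g (a, v)"
     by (rule continuous_on_tendsto_compose[OF g_continuous tendsto_Pair[OF lim tendsto_const]])
      (use X a True S in auto)
    then show ?thesis using True XT by (simp add: m_eq tendsto_mult_right)
   qed (simp add: m0)
  qed
  show "AE v in lborel. norm (m (X n) v) \<le> G * B * indicator (supp \<rho>) v" for n
   by (intro AE_I2 m_bound XT)
 qed simp_all
 ultimately show "(pot \<rho> \<circ> X) \<longlonglongrightarrow> pot \<rho> a"
  unfolding o_def pot[OF XT(1)] pot[OF XT(2)] by (rule tendsto_add)
qed

lemma cov_mol_tendsto:
 assumes \<rho>: "\<rho> \<in> test_functions U" and x: "x \<in> U" and dl: "\<And>n. dl n > 0" "dl \<longlonglongrightarrow> 0"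
 shows "(\<lambda>n. cov (mol (dl n) x) \<rho>) \<longlonglongrightarrow> pot \<rho> x"
proof (rule metric_LIMSEQ_I)
 have \<rho>U: "\<rho> \<in> test_functions UNIV" by (rule test_functions_mono[OF _ \<rho>]) simp
 fix e :: real assume e: "e > 0"
 have "isCont (pot \<rho>) x" using pot_continuous[OF \<rho>] U(2) x by (simp add: continuous_on_eq_continuous_at)
 then obtain d where d: "d > 0" "\<And>y. dist y x < d ==> dist (pot \<rho> y) (pot \<rho> x) < e / 2"
  using e unfolding continuous_at_eps_delta by (metis half_gt_zero)
 have "\<forall>\<^sub>F n in sequentially. dl n < d" using order_tendstoD(2)[OF dl(2), of d] d by auto
 then obtain n0 where n0: "\<And>n. n \<ge> n0 ==> dl n < d" by (auto simp: eventually_sequentially)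
 have "dist (cov (mol (dl n) x) \<rho>) (pot \<rho> x) < e" if "n \<ge> n0" for n
 proof -
  have i: "integrable lborel (\<lambda>u. mol (dl n) x u * pot \<rho> u)" "integrable lborel (mol (dl n) x)"
  proof -
   have "integrable (lborel \<Otimes>\<^sub>M lborel) (case_prod (\<lambda>u y. mol (dl n) x u * (CU (u, y) * \<rho> y)))"
   proof -
    have "case_prod (\<lambda>u y. mol (dl n) x u * (CU (u, y) * \<rho> y)) = (\<lambda>z. mol (dl n) x (fst z) * \<rho> (snd z) * CU z)"
     by (auto simp: fun_eq_iff)
    then show ?thesis using weighted_CU_integrable[OF mol_test[OF dl(1)] \<rho>U] by (simp add: lborel_prod)
   qed
   from lborel_pair.integrable_fst[OF this] show "integrable lborel (\<lambda>u. mol (dl n) x u * pot \<rho> u)" by (simp add: pot_def)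
   show "integrable lborel (mol (dl n) x)" by (rule mol_integrable[OF dl(1)])
  qed
  have "cov (mol (dl n) x) \<rho> - pot \<rho> x = (LINT u|lborel. mol (dl n) x u * pot \<rho> u - pot \<rho> x * mol (dl n) x u)"
   using i by (simp add: cov_pot[OF mol_test[OF dl(1)] \<rho>U] mol_integral[OF dl(1)])
  also have "\<bar>\<dots>\<bar> \<le> (LINT u|lborel. \<bar>mol (dl n) x u * pot \<rho> u - pot \<rho> x * mol (dl n) x u\<bar>)"
   by (rule integral_abs_bound)
  also have "\<dots> \<le> (LINT u|lborel. (e / 2) * mol (dl n) x u)"
  proof (rule integral_mono)
   show "integrable lborel (\<lambda>u. \<bar>mol (dl n) x u * pot \<rho> u - pot \<rho> x * mol (dl n) x u\<bar>)" using i by auto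
   show "integrable lborel (\<lambda>u. (e / 2) * mol (dl n) x u)" using i by auto
   fix u
   have eq: "mol (dl n) x u * pot \<rho> u - pot \<rho> x * mol (dl n) x u = mol (dl n) x u * (pot \<rho> u - pot \<rho> x)"
    by (simp add: algebra_simps)
   show "\<bar>mol (dl n) x u * pot \<rho> u - pot \<rho> x * mol (dl n) x u\<bar> \<le> (e / 2) * mol (dl n) x u"
   proof (cases "dist x u < dl n")
    case True
    then have "\<bar>pot \<rho> u - pot \<rho> x\<bar> \<le> e / 2" using d(2)[of u] n0[OF that] by (simp add: dist_real_def dist_commute)
    from mult_right_mono[OF this mol_nonneg[OF dl(1)[of n], of x u]]
    show ?thesis unfolding eq abs_mult using mol_nonneg[OF dl(1)[of n], of x u] by (simp add: mult.commute)
   qed (simp add: mol_zero[OF dl(1)])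
  qed
  also have "\<dots> = e / 2" by (simp add: mol_integral[OF dl(1)])
  finally show ?thesis using e by (simp add: dist_real_def)
 qed
 then show "\<exists>no. \<forall>n\<ge>no. dist (cov (mol (dl n) x) \<rho>) (pot \<rho> x) < e" by blast
qed

lemma cov_mol_bounded:
 assumes \<rho>: "\<rho> \<in> test_functions U" and A: "compact A" "A \<subseteq> U"
 obtains dl0 B where "dl0 > 0" "B \<ge> 0" "\<And>dl x. 0 < dl ==> dl \<le> dl0 ==> x \<in> A ==> \<bar>cov (mol dl x) \<rho>\<bar> \<le> B"
proof -
 have \<rho>U: "\<rho> \<in> test_functions UNIV" by (rule test_functions_mono[OF _ \<rho>]) simp
 obtain e A' where e: "e > 0" "compact A'" "A' \<subseteq> U" "\<And>x. x \<in> A ==> cball x e \<subseteq> A'" "A \<subseteq> A'"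
  by (rule compact_neighbourhood[OF A(1) U(2) A(2)]) blast
 have "compact (pot \<rho> ` A')" using e by (intro compact_continuous_image continuous_on_subset[OF pot_continuous[OF \<rho>]])
 then obtain B where B: "B > 0" "\<And>z. z \<in> A' ==> \<bar>pot \<rho> z\<bar> \<le> B"
  using compact_imp_bounded bounded_pos by (metis imageI real_norm_def)
 show ?thesis
 proof (rule that[of e B])
  show "e > 0" "B \<ge> 0" using e B by auto
  fix dl x assume dl: "0 < dl" "dl \<le> e" and x: "x \<in> A"
  have le: "norm (mol dl x u * pot \<rho> u) \<le> B * mol dl x u" for u
  proof (cases "dist x u < dl")
   case True
   then have "u \<in> A'" using e(4)[OF x] dl by auto
   from mult_right_mono[OF B(2)[OF this] mol_nonneg[OF dl(1), of x u]]
   show ?thesis using mol_nonneg[OF dl(1), of x u] by (simp add: abs_mult mult.commute)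
  qed (simp add: mol_zero[OF dl(1)])
  have "\<bar>cov (mol dl x) \<rho>\<bar> \<le> (LINT u|lborel. norm (mol dl x u * pot \<rho> u))"
   unfolding cov_pot[OF mol_test[OF dl(1)] \<rho>U] using integral_norm_bound[of lborel "\<lambda>u. mol dl x u * pot \<rho> u"] by simp
  also have "\<dots> \<le> (LINT u|lborel. B * mol dl x u)"
   using mol_integrable[OF dl(1)] B mol_nonneg[OF dl(1)] le by (intro integral_mono') auto
  also have "\<dots> = B" by (simp add: mol_integral[OF dl(1)])
  finally show "\<bar>cov (mol dl x) \<rho>\<bar> \<le> B" .
 qed
qed

lemma g_lipschitz:
 assumes A: "compact A" "A \<subseteq> U" and e: "e > 0" "compact A'" "A' \<subseteq> U" "\<And>x. x \<in> A ==> cball x e \<subseteq> A'"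
 obtains L where "L \<ge> 0" "\<And>x y v. x \<in> A ==> dist x y \<le> e ==> v \<in> A' ==> \<bar>g (x, v) - g (y, v)\<bar> \<le> L * dist x y"
proof -
 have "\<exists>G\<ge>0. \<forall>z\<in>A' \<times> A'. \<bar>partials [c] g z\<bar> \<le> G" if "c \<in> Basis" for c
 proof -
  have "continuous_on (U \<times> U) (partials [c] g)"
   using g_C2[unfolded Ck_on_def, rule_format, of "[c]"] that by simp
  then have "compact (partials [c] g ` (A' \<times> A'))"
   using e by (intro compact_continuous_image compact_Times) (auto elim: continuous_on_subset)
  then obtain G where "G > 0" "\<And>z. z \<in> A' \<times> A' ==> \<bar>partials [c] g z\<bar> \<le> G"
   using compact_imp_bounded bounded_pos by (metis imageI real_norm_def)
  then show ?thesis by (intro exI[of _ G]) auto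
 qed
 then obtain G where G: "\<And>c. c \<in> Basis ==> G c \<ge> 0" "\<And>c z. c \<in> Basis ==> z \<in> A' \<times> A' ==> \<bar>partials [c] g z\<bar> \<le> G c"
  by metis
 define L where "L = (\<Sum>c\<in>Basis. G c)"
 show ?thesis
 proof (rule that)
  show "L \<ge> 0" unfolding L_def by (intro sum_nonneg G)
  fix x y v assume x: "x \<in> A" "dist x y \<le> e" and v: "v \<in> A'"
  define h where "h = (\<lambda>t. g (x + t *\<^sub>R (y - x), v))"
  define h' where "h' = (\<lambda>t. \<Sum>c\<in>Basis. ((y - x, 0) \<bullet> c) * partials [c] g (x + t *\<^sub>R (y - x), v))"
  have in_A': "(x + t *\<^sub>R (y - x), v) \<in> A' \<times> A'" if "0 \<le> t" "t \<le> 1" for t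
  proof -
   have "\<bar>t\<bar> * norm (y - x) \<le> 1 * e" using that x(2) by (intro mult_mono) (auto simp: dist_norm norm_minus_commute)
   then have "x + t *\<^sub>R (y - x) \<in> cball x e" by (simp add: dist_norm)
   then show ?thesis using e(4)[OF x(1)] v by auto
  qed
  have der: "(h has_real_derivative h' t) (at t)" if "0 \<le> t" "t \<le> 1" for t
  proof -
   have "(x + t *\<^sub>R (y - x), v) \<in> U \<times> U" using in_A'[OF that] e(3) by auto
   then have "g differentiable (at (x + t *\<^sub>R (y - x), v))"
    using g_C2[unfolded Ck_on_def, rule_format, of "[]"] by simp
   from differentiable_has_derivative[OF this]
   have 1: "(g has_derivative (\<lambda>w. \<Sum>c\<in>Basis. (w \<bullet> c) * partials [c] g (x + t *\<^sub>R (y - x), v))) (at (x + t *\<^sub>R (y - x), v))" .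
   have 2: "((\<lambda>t. (x + t *\<^sub>R (y - x), v)) has_derivative (\<lambda>s. (s *\<^sub>R (y - x), 0))) (at t)"
    by (auto intro!: derivative_eq_intros)
   have "(h has_derivative (\<lambda>s. \<Sum>c\<in>Basis. ((s *\<^sub>R (y - x), 0) \<bullet> c) * partials [c] g (x + t *\<^sub>R (y - x), v))) (at t)"
    unfolding h_def by (rule has_derivative_compose[OF 2 1])
   moreover have "(\<lambda>s. \<Sum>c\<in>Basis. ((s *\<^sub>R (y - x), 0) \<bullet> c) * partials [c] g (x + t *\<^sub>R (y - x), v)) = (*) (h' t)"
   proof
    fix s
    have "(s *\<^sub>R (y - x), 0) = s *\<^sub>R (y - x, 0 :: 'a)" by (simp add: scaleR_prod_def)
    then show "(\<Sum>c\<in>Basis. ((s *\<^sub>R (y - x), 0) \<bullet> c) * partials [c] g (x + t *\<^sub>R (y - x), v)) = h' t * s"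
     unfolding h'_def sum_distrib_right by (intro sum.cong refl) (simp only: inner_scaleR_left mult_ac)
   qed
   ultimately show ?thesis by (simp add: has_field_derivative_def)
  qed
  obtain t where t: "0 < t" "t < 1" "h 1 - h 0 = (1 - 0) * h' t"
   using MVT2[of 0 1 h h'] der by auto
  have "\<bar>h' t\<bar> \<le> (\<Sum>c\<in>Basis. norm (y - x) * G c)"
   unfolding h'_def
  proof (rule order_trans[OF sum_abs], intro sum_mono)
   fix c :: "'a \<times> 'a" assume c: "c \<in> Basis"
   have "\<bar>(y - x, 0) \<bullet> c\<bar> \<le> norm (y - x, 0 :: 'a)" using Basis_le_norm[OF c] .
   then have "\<bar>(y - x, 0) \<bullet> c\<bar> \<le> norm (y - x)" by (simp add: norm_Pair)
   moreover have "\<bar>partials [c] g (x + t *\<^sub>R (y - x), v)\<bar> \<le> G c" using t by (intro G(2)[OF c] in_A') auto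
   ultimately show "\<bar>((y - x, 0) \<bullet> c) * partials [c] g (x + t *\<^sub>R (y - x), v)\<bar> \<le> norm (y - x) * G c"
    unfolding abs_mult by (intro mult_mono) auto
  qed
  also have "\<dots> = L * dist x y" by (simp add: L_def sum_distrib_left sum_distrib_right dist_norm norm_minus_commute mult.commute)
  finally show "\<bar>g (x, v) - g (y, v)\<bar> \<le> L * dist x y" using t(3) by (simp add: h_def)
 qed
qed

end

section \<open>Second moments of bilinear functionals of the chaos\<close>

lemma integral_lborel_product:
 fixes f :: "'a::euclidean_space => 'c::{banach, real_normed_field, second_countable_topology}" and h :: "'b::euclidean_space => 'c"
 assumes f: "integrable lborel f" and h: "integrable lborel h"
 shows "integrable lborel (\<lambda>zz. f (fst zz) * h (snd zz))"
  "(LINT zz|lborel. f (fst zz) * h (snd zz)) = (LINT x|lborel. f x) * (LINT y|lborel. h y)"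
proof -
 have [measurable]: "f \<in> borel_measurable borel" "h \<in> borel_measurable borel" using f h by auto
 have i: "integrable (lborel \<Otimes>\<^sub>M lborel) (case_prod (\<lambda>x y. f x * h y))"
  by (rule lborel_pair.integrable_dominated_product[of _ "\<lambda>x. norm (f x)" "\<lambda>y. norm (h y)"])
   (use f h in \<open>auto simp: norm_mult\<close>)
 have e: "case_prod (\<lambda>x y. f x * h y) = (\<lambda>zz. f (fst zz) * h (snd zz))" by (auto simp: fun_eq_iff)
 show "integrable lborel (\<lambda>zz. f (fst zz) * h (snd zz))" using i unfolding e lborel_prod .
 show "(LINT zz|lborel. f (fst zz) * h (snd zz)) = (LINT x|lborel. f x) * (LINT y|lborel. h y)"
  using lborel_pair.integral_fst[OF i] unfolding e lborel_prod by simp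
qed

lemma riesz_pair_integrable:
 fixes A :: "'a::euclidean_space set" and gm :: real
 assumes A: "compact A" and gm: "0 < gm" "gm < DIM('a)"
 shows "integrable lborel (\<lambda>z. indicator A (fst z) * indicator A (snd z) * norm (fst z - snd z) powr (- gm))"
proof -
 have [measurable]: "A \<in> sets borel" using A by (simp add: compact_imp_closed borel_closed)
 obtain R where R: "R > 0" "\<And>x. x \<in> A ==> norm x \<le> R" using A compact_imp_bounded[of A] by (auto simp: bounded_pos)
 obtain c where c: "c > 0" "\<And>s (w::'a). s > 0 ==>
  (\<integral>\<^sup>+ y. riesz gm (y - w) * indicator (cball w s) y \<partial>lborel) \<le> ennreal (c * s powr (DIM('a) - gm))"
  by (rule riesz_near[where ?'a = 'a and gm = gm]) (use gm in auto)
 have "(\<integral>\<^sup>+ z. ennreal (norm (indicator A (fst z) * indicator A (snd z) * norm (fst z - snd z) powr (- gm))) \<partial>lborel)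
  = (\<integral>\<^sup>+ z. indicator A (fst z) * (indicator A (snd z) * riesz gm (snd z - fst z)) \<partial>(lborel :: ('a \<times> 'a) measure))"
  by (intro nn_integral_cong) (auto simp: indicator_def riesz_def norm_minus_commute)
 also have "\<dots> = (\<integral>\<^sup>+ x. \<integral>\<^sup>+ y. indicator A x * (indicator A y * riesz gm (y - x)) \<partial>lborel \<partial>lborel)"
 proof -
  have "(\<lambda>z. indicator A (fst z) * (indicator A (snd z) * riesz gm (snd z - fst z))) \<in> borel_measurable (borel \<Otimes>\<^sub>M borel)" by measurable
  then show ?thesis by (subst nn_integral_lborel_pair) (simp_all add: borel_prod)
 qed
 also have "\<dots> \<le> (\<integral>\<^sup>+ x. ennreal (c * (2 * R) powr (DIM('a) - gm)) * indicator A x \<partial>lborel)"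
 proof (intro nn_integral_mono)
  fix x :: 'a
  have "(\<integral>\<^sup>+ y. indicator A x * (indicator A y * riesz gm (y - x)) \<partial>lborel) \<le> (\<integral>\<^sup>+ y. indicator A x * (riesz gm (y - x) * indicator (cball x (2 * R)) y) \<partial>lborel)"
  proof (intro nn_integral_mono)
   fix y
   have "dist x y \<le> 2 * R" if "x \<in> A" "y \<in> A" using norm_triangle_ineq4[of x y] R(2)[OF that(1)] R(2)[OF that(2)] by (simp add: dist_norm)
   then show "indicator A x * (indicator A y * riesz gm (y - x)) \<le> indicator A x * (riesz gm (y - x) * indicator (cball x (2 * R)) y)"
    by (auto simp: indicator_def)
  qed
  also have "\<dots> = indicator A x * (\<integral>\<^sup>+ y. riesz gm (y - x) * indicator (cball x (2 * R)) y \<partial>lborel)"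
   by (rule nn_integral_cmult) measurable
  also have "\<dots> \<le> indicator A x * ennreal (c * (2 * R) powr (DIM('a) - gm))"
   using R by (intro mult_left_mono c) auto
  finally show "(\<integral>\<^sup>+ y. indicator A x * (indicator A y * riesz gm (y - x)) \<partial>lborel) \<le> ennreal (c * (2 * R) powr (DIM('a) - gm)) * indicator A x"
   by (simp add: mult.commute)
 qed
 also have "\<dots> = ennreal (c * (2 * R) powr (DIM('a) - gm)) * emeasure lborel A" by (rule nn_integral_cmult_indicator) simp
 also have "\<dots> < \<infinity>" using emeasure_compact_finite[OF A] by (auto simp: ennreal_mult_less_top)
 finally have "(\<integral>\<^sup>+ z. ennreal (norm (indicator A (fst z) * indicator A (snd z) * norm (fst z - snd z) powr (- gm))) \<partial>(lborel :: ('a \<times> 'a) measure)) < \<infinity>" .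
 moreover have "(\<lambda>z. indicator A (fst z) * indicator A (snd z) * norm (fst z - snd z) powr (- gm)) \<in> borel_measurable (borel \<Otimes>\<^sub>M borel)" by measurable
 ultimately show ?thesis by (intro integrableI_bounded) (auto simp: borel_prod)
qed

lemma (in sigma_finite_measure) nn_integral_norm_square:
 fixes f :: "'a => complex"
 assumes "integrable M (\<lambda>x. (norm (f x))\<^sup>2)"
 shows "(\<integral>\<^sup>+ x. ennreal ((norm (f x))\<^sup>2) \<partial>M) = ennreal (LINT x|M. (norm (f x))\<^sup>2)"
 by (rule nn_integral_eq_integral[OF assms]) simp

context log_field
begin

definition off_diagonal :: "('a \<times> 'a) set => bool" where
 "off_diagonal S \<longleftrightarrow> compact S \<and> (\<forall>z\<in>S. fst z \<in> U \<and> snd z \<in> U \<and> fst z \<noteq> snd z)"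

definition P :: "'a \<times> 'a => real" where "P z = exp (b * CU z)"

definition D :: "'a \<times> 'a => 'a \<times> 'a => real" where
 "D z z' = CU (fst z, fst z') + CU (snd z, snd z') - CU (fst z, snd z') - CU (snd z, fst z')"

definition Q :: "('a \<times> 'a => real) => ('a => real) => real" where
 "Q K \<rho> = (LINT zz|lborel. (K (fst zz) * P (fst zz)) * (K (snd zz) * P (snd zz)) * (exp (b * D (fst zz) (snd zz)) - 1))
  - 2 * b * (LINT z|lborel. (K z * P z) * (pot \<rho> (fst z) - pot \<rho> (snd z))) + b * cov \<rho> \<rho>"

definition Qd :: "real => ('a \<times> 'a => real) => ('a => real) => real" where
 "Qd dl K \<rho> = (LINT zz|lborel. (K (fst zz) * Pd dl (fst zz)) * (K (snd zz) * Pd dl (snd zz)) * (exp (b * Dd dl (fst zz) (snd zz)) - 1))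
  - 2 * b * (LINT z|lborel. (K z * Pd dl z) * (cov (mol dl (fst z)) \<rho> - cov (mol dl (snd z)) \<rho>)) + b * cov \<rho> \<rho>"

lemma Kd_compose_measurable [measurable (raw)]:
 "dl > 0 ==> f \<in> borel_measurable N ==> h \<in> borel_measurable N ==> (\<lambda>x. Kd dl (f x) (h x)) \<in> borel_measurable N"
 using measurable_compose[of "\<lambda>x. (f x, h x)" N "borel \<Otimes>\<^sub>M borel", OF _ Kd_measurable] by simp

lemma Pd_measurable [measurable]: "dl > 0 ==> Pd dl \<in> borel_measurable borel"
proof -
 assume "dl > 0"
 then have "Pd dl \<in> borel_measurable (borel \<Otimes>\<^sub>M borel)" unfolding Pd_def[abs_def] by measurable
 then show ?thesis by (simp add: borel_prod)
qed

lemma CU_compose_measurable [measurable (raw)]: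
 "f \<in> borel_measurable N ==> h \<in> borel_measurable N ==> (\<lambda>x. CU (f x, h x)) \<in> borel_measurable N"
 using measurable_compose[of "\<lambda>x. (f x, h x)" N "borel \<Otimes>\<^sub>M borel", OF _ CU_measurable] by simp

lemma P_measurable [measurable]: "P \<in> borel_measurable borel"
 unfolding P_def[abs_def] by measurable

lemma Dd_measurable [measurable]: "dl > 0 ==> (\<lambda>zz. Dd dl (fst zz) (snd zz)) \<in> borel_measurable borel"
proof -
 assume "dl > 0"
 then have "(\<lambda>zz. Dd dl (fst zz) (snd zz)) \<in> borel_measurable ((borel \<Otimes>\<^sub>M borel) \<Otimes>\<^sub>M (borel \<Otimes>\<^sub>M borel))" unfolding Dd_def by measurable
 then show ?thesis by (simp add: borel_quad)
qed

lemma D_measurable [measurable]: "(\<lambda>zz. D (fst zz) (snd zz)) \<in> borel_measurable borel"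
proof -
 have "(\<lambda>zz. D (fst zz) (snd zz)) \<in> borel_measurable ((borel \<Otimes>\<^sub>M borel) \<Otimes>\<^sub>M (borel \<Otimes>\<^sub>M borel))" unfolding D_def by measurable
 then show ?thesis by (simp add: borel_quad)
qed

lemma pot_measurable [measurable]:
 assumes [measurable]: "\<rho> \<in> borel_measurable borel"
 shows "pot \<rho> \<in> borel_measurable borel"
 unfolding pot_def[abs_def] by measurable

lemma cov_mol_measurable: "dl > 0 ==> \<rho> \<in> test_functions UNIV ==> (\<lambda>x. cov (mol dl x) \<rho>) \<in> borel_measurable borel"
proof -
 assume a: "dl > 0" "\<rho> \<in> test_functions UNIV"
 have [measurable]: "\<rho> \<in> borel_measurable borel" using a by (auto intro: test_functions_borel)
 have "(\<lambda>x. LINT u|lborel. mol dl (fst (x, u)) (snd (x, u)) * pot \<rho> u) \<in> borel_measurable borel" by measurable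
 then show ?thesis using a by (simp add: cov_pot mol_test)
qed

lemma off_diagonal_gap:
 assumes "off_diagonal S" shows "\<exists>\<rho>>0. \<forall>z\<in>S. \<rho> \<le> norm (fst z - snd z)"
proof (cases "S = {}")
 case False
 have cont: "continuous_on S (\<lambda>z. norm (fst z - snd z))" by (intro continuous_intros)
 have "\<exists>x\<in>S. \<forall>y\<in>S. norm (fst x - snd x) \<le> norm (fst y - snd y)"
  by (rule continuous_attains_inf[OF _ False cont]) (use assms in \<open>simp add: off_diagonal_def\<close>)
 then obtain z0 where "z0 \<in> S" "\<forall>z\<in>S. norm (fst z0 - snd z0) \<le> norm (fst z - snd z)" by blast
 then show ?thesis using assms by (intro exI[of _ "norm (fst z0 - snd z0)"]) (auto simp: off_diagonal_def)
qed (auto intro: exI[of _ 1])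

lemma off_diagonal_bounds:
 assumes S: "off_diagonal S" and \<rho>: "\<rho> \<in> test_functions U"
 obtains A dl0 c where "compact A" "dl0 > 0" "c > 0" "\<And>z. z \<in> S ==> fst z \<in> A \<and> snd z \<in> A"
  "\<And>dl z. 0 < dl ==> dl \<le> dl0 ==> z \<in> S ==> Pd dl z \<le> c"
  "\<And>dl z. 0 < dl ==> dl \<le> dl0 ==> z \<in> S ==> \<bar>cov (mol dl (fst z)) \<rho> - cov (mol dl (snd z)) \<rho>\<bar> \<le> c"
  "\<And>dl z z'. 0 < dl ==> dl \<le> dl0 ==> z \<in> S ==> z' \<in> S ==> fst z \<noteq> fst z' ==> snd z \<noteq> snd z' ==>
   exp (b * Dd dl z z') \<le> c * (norm (fst z - fst z') powr (- b) * norm (snd z - snd z') powr (- b))"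
proof -
 define A where "A = fst ` S \<union> snd ` S"
 have A: "compact A" "A \<subseteq> U" using S unfolding A_def off_diagonal_def
  by (auto intro!: compact_Un compact_continuous_image continuous_intros)
 have SA: "fst z \<in> A" "snd z \<in> A" if "z \<in> S" for z using that by (auto simp: A_def)
 obtain \<rho>0 where \<rho>0: "\<rho>0 > 0" "\<And>z. z \<in> S ==> norm (fst z - snd z) \<ge> \<rho>0" using off_diagonal_gap[OF S] by blast
 obtain dl1 c1 where 1: "dl1 > 0" "c1 > 0"
  "\<And>dl x y. 0 < dl ==> dl \<le> dl1 ==> x \<in> A ==> y \<in> A ==> x \<noteq> y ==> exp (b * Kd dl x y) \<le> c1 * norm (x - y) powr (- b)"
  "\<And>dl x y. 0 < dl ==> dl \<le> dl1 ==> x \<in> A ==> y \<in> A ==> exp (- b * Kd dl x y) \<le> c1"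
  by (rule Kd_bounds[OF A]) blast
 obtain dl2 B where 2: "dl2 > 0" "B \<ge> 0" "\<And>dl x. 0 < dl ==> dl \<le> dl2 ==> x \<in> A ==> \<bar>cov (mol dl x) \<rho>\<bar> \<le> B"
  by (rule cov_mol_bounded[OF \<rho> A]) blast
 define c where "c = max (c1 * \<rho>0 powr (- b)) (max (2 * B) (c1 * c1 * c1 * c1))"
 show ?thesis
 proof (rule that[OF A(1), of "min dl1 dl2" c])
  show "min dl1 dl2 > 0" using 1 2 by simp
  show "c > 0" using 1(2) \<rho>0(1) by (simp add: c_def less_max_iff_disj)
  show "fst z \<in> A \<and> snd z \<in> A" if "z \<in> S" for z using SA[OF that] by simp
  fix dl z assume dl: "0 < dl" "dl \<le> min dl1 dl2" and z: "z \<in> S"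
  then have dl': "dl \<le> dl1" "dl \<le> dl2" by auto
  have "Pd dl z \<le> c1 * norm (fst z - snd z) powr (- b)"
   unfolding Pd_def using z S by (intro 1 dl dl' SA) (auto simp: off_diagonal_def)
  also have "\<dots> \<le> c1 * \<rho>0 powr (- b)" using 1(2) \<rho>0 z b by (intro mult_left_mono powr_mono2') auto
  finally show "Pd dl z \<le> c" by (simp add: c_def)
  have "\<bar>cov (mol dl (fst z)) \<rho> - cov (mol dl (snd z)) \<rho>\<bar> \<le> 2 * B"
   using 2(3)[OF dl(1) dl'(2) SA(1)[OF z]] 2(3)[OF dl(1) dl'(2) SA(2)[OF z]] by linarith
  then show "\<bar>cov (mol dl (fst z)) \<rho> - cov (mol dl (snd z)) \<rho>\<bar> \<le> c" by (simp add: c_def)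
  fix z' assume z': "z' \<in> S" and ne: "fst z \<noteq> fst z'" "snd z \<noteq> snd z'"
  have "exp (b * Dd dl z z') = (exp (b * Kd dl (fst z) (fst z')) * exp (b * Kd dl (snd z) (snd z'))) * (exp (- b * Kd dl (fst z) (snd z')) * exp (- b * Kd dl (snd z) (fst z')))"
   by (simp add: Dd_def exp_add[symmetric] algebra_simps)
  also have "\<dots> \<le> ((c1 * norm (fst z - fst z') powr (- b)) * (c1 * norm (snd z - snd z') powr (- b))) * (c1 * c1)"
   using 1(2) by (intro mult_mono 1 dl dl' SA z z' ne) auto
  also have "\<dots> = (c1 * c1 * c1 * c1) * (norm (fst z - fst z') powr (- b) * norm (snd z - snd z') powr (- b))" by simp
  also have "\<dots> \<le> c * (norm (fst z - fst z') powr (- b) * norm (snd z - snd z') powr (- b))"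
   by (intro mult_right_mono) (auto simp: c_def)
  finally show "exp (b * Dd dl z z') \<le> c * (norm (fst z - fst z') powr (- b) * norm (snd z - snd z') powr (- b))" .
 qed
qed

lemma quad_dominator_integrable:
 assumes "compact (A::'a set)"
 shows "integrable lborel (\<lambda>zz::('a \<times> 'a) \<times> ('a \<times> 'a). (indicator A (fst (fst zz)) * indicator A (fst (snd zz)) * norm (fst (fst zz) - fst (snd zz)) powr (- b)) *
   (indicator A (snd (fst zz)) * indicator A (snd (snd zz)) * norm (snd (fst zz) - snd (snd zz)) powr (- b)))"
proof -
 have [measurable]: "A \<in> sets borel" using assms by (simp add: compact_imp_closed borel_closed)
 define f where "f = (\<lambda>z::'a \<times> 'a. indicator A (fst z) * indicator A (snd z) * norm (fst z - snd z) powr (- b))"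
 have fm [measurable]: "f \<in> borel_measurable (borel \<Otimes>\<^sub>M borel)" unfolding f_def by measurable
 have f: "integrable lborel f" unfolding f_def by (rule riesz_pair_integrable[OF assms b])
 have f0: "f z \<ge> 0" for z by (simp add: f_def)
 have "(\<integral>\<^sup>+ z. ennreal (f z) \<partial>lborel) < \<infinity>" using f f0 by (subst nn_integral_eq_integral) auto
 then have fin: "(\<integral>\<^sup>+ x. \<integral>\<^sup>+ x'. ennreal (f (x, x')) \<partial>lborel \<partial>lborel) < \<infinity>"
  using f by (subst (asm) nn_integral_lborel_pair) auto
 have m: "(\<lambda>zz. f (fst (fst zz), fst (snd zz)) * f (snd (fst zz), snd (snd zz))) \<in> borel_measurable ((borel \<Otimes>\<^sub>M borel) \<Otimes>\<^sub>M (borel \<Otimes>\<^sub>M borel))"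
  by measurable
 then have m': "(\<lambda>zz::('a \<times> 'a) \<times> ('a \<times> 'a). f (fst (fst zz), fst (snd zz)) * f (snd (fst zz), snd (snd zz))) \<in> borel_measurable borel" by (simp add: borel_quad)
 then have m'': "(\<lambda>zz::('a \<times> 'a) \<times> ('a \<times> 'a). ennreal (f (fst (fst zz), fst (snd zz)) * f (snd (fst zz), snd (snd zz)))) \<in> borel_measurable borel" by simp
 have "(\<integral>\<^sup>+ zz. ennreal (f (fst (fst zz), fst (snd zz)) * f (snd (fst zz), snd (snd zz))) \<partial>lborel)
  = (\<integral>\<^sup>+ x. \<integral>\<^sup>+ x'. \<integral>\<^sup>+ y. \<integral>\<^sup>+ y'. ennreal (f (x, x')) * ennreal (f (y, y')) \<partial>lborel \<partial>lborel \<partial>lborel \<partial>lborel)"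
  by (subst nn_integral_quad[OF m'']) (simp add: ennreal_mult f0)
 also have "\<dots> = (\<integral>\<^sup>+ x. \<integral>\<^sup>+ x'. ennreal (f (x, x')) \<partial>lborel \<partial>lborel) * (\<integral>\<^sup>+ y. \<integral>\<^sup>+ y'. ennreal (f (y, y')) \<partial>lborel \<partial>lborel)"
  by (simp add: nn_integral_cmult nn_integral_multc)
 also have "\<dots> < \<infinity>" using fin by (simp add: ennreal_mult_less_top)
 finally have "integrable lborel (\<lambda>zz::('a \<times> 'a) \<times> ('a \<times> 'a). f (fst (fst zz), fst (snd zz)) * f (snd (fst zz), snd (snd zz)))"
  using m' f0 by (intro integrableI_bounded) (auto simp: abs_of_nonneg)
 then show ?thesis by (simp add: f_def)
qed

lemma off_diagonal_integrable:
 assumes S: "off_diagonal S" shows "integrable lborel (\<lambda>z. c * indicator S z :: real)"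
 using S emeasure_compact_finite[of S]
 by (intro integrable_mult_right integrable_real_indicator) (auto simp: off_diagonal_def borel_closed compact_imp_closed)

lemma Qd_tendsto:
 assumes S: "off_diagonal S" and \<rho>: "\<rho> \<in> test_functions U"
  and Hm: "\<And>n. H n \<in> borel_measurable borel" and Hb: "\<And>n z. \<bar>H n z\<bar> \<le> kp" and H0: "\<And>n z. z \<notin> S ==> H n z = 0"
  and Hl: "\<And>z. (\<lambda>n. H n z) \<longlonglongrightarrow> K z"
  and dl: "\<And>n. dl n > 0" "dl \<longlonglongrightarrow> 0"
 shows "(\<lambda>n. Qd (dl n) (H n) \<rho>) \<longlonglongrightarrow> Q K \<rho>"
  "(\<lambda>n. LINT z|lborel. H n z * Pd (dl n) z) \<longlonglongrightarrow> (LINT z|lborel. K z * P z)"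
proof -
 have \<rho>U: "\<rho> \<in> test_functions UNIV" by (rule test_functions_mono[OF _ \<rho>]) simp
 have \<rho>m [measurable]: "\<rho> \<in> borel_measurable borel" using \<rho> by (rule test_functions_borel)
 obtain A dl0 c where A: "compact A" "dl0 > 0" "c > 0" "\<And>z. z \<in> S ==> fst z \<in> A \<and> snd z \<in> A"
  "\<And>dl z. 0 < dl ==> dl \<le> dl0 ==> z \<in> S ==> Pd dl z \<le> c"
  "\<And>dl z. 0 < dl ==> dl \<le> dl0 ==> z \<in> S ==> \<bar>cov (mol dl (fst z)) \<rho> - cov (mol dl (snd z)) \<rho>\<bar> \<le> c"
  "\<And>dl z z'. 0 < dl ==> dl \<le> dl0 ==> z \<in> S ==> z' \<in> S ==> fst z \<noteq> fst z' ==> snd z \<noteq> snd z' ==>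
   exp (b * Dd dl z z') \<le> c * (norm (fst z - fst z') powr (- b) * norm (snd z - snd z') powr (- b))"
  by (rule off_diagonal_bounds[OF S \<rho>]) blast
 have kp: "kp \<ge> 0" using Hb[of undefined undefined] by linarith
 have K [measurable]: "K \<in> borel_measurable borel" by (rule borel_measurable_LIMSEQ_real[OF Hl Hm])
 have K0: "K z = 0" if "z \<notin> S" for z
  using LIMSEQ_unique[OF Hl[of z]] H0[OF that] by (simp add: tendsto_const)
 have "\<forall>\<^sub>F n in sequentially. dl n < dl0" using order_tendstoD(2)[OF dl(2)] A(2) by auto
 then obtain N where "\<forall>n\<ge>N. dl n < dl0" by (auto simp: eventually_sequentially)
 then have N: "\<And>n. n \<ge> N ==> dl n \<le> dl0" by (auto intro: less_imp_le)
 define ep where "ep = (\<lambda>n. dl (n + N))"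
 define J where "J = (\<lambda>n. H (n + N))"
 have J [measurable]: "J n \<in> borel_measurable borel" and Jb: "\<bar>J n z\<bar> \<le> kp" and J0: "z \<notin> S ==> J n z = 0"
  and Jl: "(\<lambda>n. J n z) \<longlonglongrightarrow> K z" for n z
  using Hm Hb H0 LIMSEQ_ignore_initial_segment[OF Hl] by (auto simp: J_def)
 have ep: "ep n > 0" "ep n \<le> dl0" "ep \<longlonglongrightarrow> 0" for n
  using dl N by (auto simp: ep_def LIMSEQ_ignore_initial_segment)
 have Plim: "(\<lambda>n. Pd (ep n) z) \<longlonglongrightarrow> P z" if "z \<in> S" for z
  unfolding Pd_def P_def using Kd_tendsto[of "fst z" "snd z", OF _ _ _ ep(1,3)] that S
  by (intro tendsto_exp tendsto_mult_left) (auto simp: off_diagonal_def)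
 have P0: "Pd dl z \<ge> 0" for dl z by (simp add: Pd_def)
 have KP: "\<bar>J n z * Pd (ep n) z\<bar> \<le> kp * c * indicator S z" for n z
  using Jb[of n z] A(5)[OF ep(1)[of n] ep(2)[of n], of z] J0[of z n] P0[of "ep n" z] kp
  by (cases "z \<in> S") (auto simp: abs_mult intro!: mult_mono)
 have KPlim: "(\<lambda>n. J n z * Pd (ep n) z) \<longlonglongrightarrow> K z * P z" for z
  by (cases "z \<in> S") (auto intro!: tendsto_mult Jl Plim simp: K0 J0)
 have em: "Pd (ep n) \<in> borel_measurable borel" "(\<lambda>zz. Dd (ep n) (fst zz) (snd zz)) \<in> borel_measurable borel" for n
  using ep(1) by measurable
 note em [measurable]
 have L0: "(\<lambda>n. LINT z|lborel. J n z * Pd (ep n) z) \<longlonglongrightarrow> (LINT z|lborel. K z * P z)"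
  by (rule integral_dominated_convergence[OF _ _ off_diagonal_integrable[OF S, of "kp * c"]])
   (use KP KPlim in auto)
 have L1: "(\<lambda>n. LINT z|lborel. (J n z * Pd (ep n) z) * (cov (mol (ep n) (fst z)) \<rho> - cov (mol (ep n) (snd z)) \<rho>))
  \<longlonglongrightarrow> (LINT z|lborel. (K z * P z) * (pot \<rho> (fst z) - pot \<rho> (snd z)))"
 proof (rule integral_dominated_convergence[OF _ _ off_diagonal_integrable[OF S, of "kp * c * c"]])
  have [measurable]: "(\<lambda>x. cov (mol (ep n) x) \<rho>) \<in> borel_measurable borel" for n by (rule cov_mol_measurable[OF ep(1) \<rho>U])
  show "(\<lambda>z. (K z * P z) * (pot \<rho> (fst z) - pot \<rho> (snd z))) \<in> borel_measurable lborel"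
  proof -
   have "(\<lambda>z. pot \<rho> (fst z) - pot \<rho> (snd z)) \<in> borel_measurable (borel \<Otimes>\<^sub>M borel)" by measurable
   then have [measurable]: "(\<lambda>z. pot \<rho> (fst z) - pot \<rho> (snd z)) \<in> borel_measurable borel" by (simp add: borel_prod)
   show ?thesis by measurable
  qed
  show "(\<lambda>z. (J n z * Pd (ep n) z) * (cov (mol (ep n) (fst z)) \<rho> - cov (mol (ep n) (snd z)) \<rho>)) \<in> borel_measurable lborel" for n
  proof -
   have "(\<lambda>z. cov (mol (ep n) (fst z)) \<rho> - cov (mol (ep n) (snd z)) \<rho>) \<in> borel_measurable (borel \<Otimes>\<^sub>M borel)" by measurable
   then have [measurable]: "(\<lambda>z. cov (mol (ep n) (fst z)) \<rho> - cov (mol (ep n) (snd z)) \<rho>) \<in> borel_measurable borel" by (simp add: borel_prod)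
   show ?thesis by measurable
  qed
  show "AE z in lborel. (\<lambda>n. (J n z * Pd (ep n) z) * (cov (mol (ep n) (fst z)) \<rho> - cov (mol (ep n) (snd z)) \<rho>)) \<longlonglongrightarrow> (K z * P z) * (pot \<rho> (fst z) - pot \<rho> (snd z))"
  proof (intro AE_I2)
   fix z
   show "(\<lambda>n. (J n z * Pd (ep n) z) * (cov (mol (ep n) (fst z)) \<rho> - cov (mol (ep n) (snd z)) \<rho>)) \<longlonglongrightarrow> (K z * P z) * (pot \<rho> (fst z) - pot \<rho> (snd z))"
   proof (cases "z \<in> S")
    case True
    then have "fst z \<in> U" "snd z \<in> U" using S by (auto simp: off_diagonal_def)
    then show ?thesis by (intro tendsto_mult KPlim tendsto_diff cov_mol_tendsto[OF \<rho>] ep)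
   qed (simp add: K0 J0)
  qed
  show "AE z in lborel. norm ((J n z * Pd (ep n) z) * (cov (mol (ep n) (fst z)) \<rho> - cov (mol (ep n) (snd z)) \<rho>)) \<le> kp * c * c * indicator S z" for n
  proof (intro AE_I2)
   fix z
   show "norm ((J n z * Pd (ep n) z) * (cov (mol (ep n) (fst z)) \<rho> - cov (mol (ep n) (snd z)) \<rho>)) \<le> kp * c * c * indicator S z"
   proof (cases "z \<in> S")
    case True
    then have "\<bar>(J n z * Pd (ep n) z) * (cov (mol (ep n) (fst z)) \<rho> - cov (mol (ep n) (snd z)) \<rho>)\<bar> \<le> (kp * c) * c"
     unfolding abs_mult[of "J n z * Pd (ep n) z"]
     using KP[of n z] A(6)[OF ep(1)[of n] ep(2)[of n] True] kp A(3) by (intro mult_mono) auto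
    then show ?thesis using True by simp
   qed (simp add: K0 J0)
  qed
 qed
 let ?w = "\<lambda>zz::('a \<times> 'a) \<times> ('a \<times> 'a). (indicator A (fst (fst zz)) * indicator A (fst (snd zz)) * norm (fst (fst zz) - fst (snd zz)) powr (- b)) *
   (indicator A (snd (fst zz)) * indicator A (snd (snd zz)) * norm (snd (fst zz) - snd (snd zz)) powr (- b))"
 have L2: "(\<lambda>n. LINT zz|lborel. (J n (fst zz) * Pd (ep n) (fst zz)) * (J n (snd zz) * Pd (ep n) (snd zz)) * (exp (b * Dd (ep n) (fst zz) (snd zz)) - 1))
  \<longlonglongrightarrow> (LINT zz|lborel. (K (fst zz) * P (fst zz)) * (K (snd zz) * P (snd zz)) * (exp (b * D (fst zz) (snd zz)) - 1))"
 proof (rule integral_dominated_convergence[where w = "\<lambda>zz. (kp * c)\<^sup>2 * (c * ?w zz) + (kp * c * indicator S (fst zz)) * (kp * c * indicator S (snd zz))"])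
  have [measurable]: "S \<in> sets borel" using S by (auto simp: off_diagonal_def borel_closed compact_imp_closed)
  have fs: "(\<lambda>zz::('a \<times> 'a) \<times> ('a \<times> 'a). h (fst zz)) \<in> borel_measurable borel" "(\<lambda>zz::('a \<times> 'a) \<times> ('a \<times> 'a). h (snd zz)) \<in> borel_measurable borel"
   if "h \<in> borel_measurable borel" for h :: "'a \<times> 'a => real"
   using measurable_compose[OF _ that, of fst "borel :: (('a \<times> 'a) \<times> ('a \<times> 'a)) measure"] measurable_compose[OF _ that, of snd "borel :: (('a \<times> 'a) \<times> ('a \<times> 'a)) measure"]
   using borel_measurable_continuous_onI[OF continuous_on_fst[OF continuous_on_id]] borel_measurable_continuous_onI[OF continuous_on_snd[OF continuous_on_id]] by auto
  note fs[OF K, measurable] fs[OF J, measurable] fs[OF P_measurable, measurable] fs[OF em(1), measurable]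
  show "(\<lambda>zz. (K (fst zz) * P (fst zz)) * (K (snd zz) * P (snd zz)) * (exp (b * D (fst zz) (snd zz)) - 1)) \<in> borel_measurable lborel"
   by measurable
  show "(\<lambda>zz. (J n (fst zz) * Pd (ep n) (fst zz)) * (J n (snd zz) * Pd (ep n) (snd zz)) * (exp (b * Dd (ep n) (fst zz) (snd zz)) - 1)) \<in> borel_measurable lborel" for n
   by measurable
  show "integrable lborel (\<lambda>zz. (kp * c)\<^sup>2 * (c * ?w zz) + (kp * c * indicator S (fst zz)) * (kp * c * indicator S (snd zz)))"
   using quad_dominator_integrable[OF A(1)] integral_lborel_product(1)[OF off_diagonal_integrable[OF S, of "kp * c"] off_diagonal_integrable[OF S, of "kp * c"]]
   by (intro Bochner_Integration.integrable_add integrable_mult_right) auto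
  show "AE zz in lborel. (\<lambda>n. (J n (fst zz) * Pd (ep n) (fst zz)) * (J n (snd zz) * Pd (ep n) (snd zz)) * (exp (b * Dd (ep n) (fst zz) (snd zz)) - 1))
   \<longlonglongrightarrow> (K (fst zz) * P (fst zz)) * (K (snd zz) * P (snd zz)) * (exp (b * D (fst zz) (snd zz)) - 1)"
   using AE_quad_neq[where ?'a = 'a]
  proof eventually_elim
   fix zz :: "('a \<times> 'a) \<times> ('a \<times> 'a)"
   assume ne: "fst (fst zz) \<noteq> fst (snd zz) \<and> snd (fst zz) \<noteq> snd (snd zz) \<and> fst (fst zz) \<noteq> snd (snd zz) \<and> snd (fst zz) \<noteq> fst (snd zz)"
   show "(\<lambda>n. (J n (fst zz) * Pd (ep n) (fst zz)) * (J n (snd zz) * Pd (ep n) (snd zz)) * (exp (b * Dd (ep n) (fst zz) (snd zz)) - 1))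
    \<longlonglongrightarrow> (K (fst zz) * P (fst zz)) * (K (snd zz) * P (snd zz)) * (exp (b * D (fst zz) (snd zz)) - 1)"
   proof (cases "fst zz \<in> S \<and> snd zz \<in> S")
    case True
    then have "fst (fst zz) \<in> U" "snd (fst zz) \<in> U" "fst (snd zz) \<in> U" "snd (snd zz) \<in> U" using S by (auto simp: off_diagonal_def)
    then have "(\<lambda>n. Dd (ep n) (fst zz) (snd zz)) \<longlonglongrightarrow> D (fst zz) (snd zz)"
     unfolding Dd_def D_def using ne by (intro tendsto_intros Kd_tendsto ep) auto
    then show ?thesis by (intro tendsto_mult KPlim tendsto_diff tendsto_exp tendsto_const)
   qed (auto simp: K0 J0)
  qed
  show "AE zz in lborel. norm ((J n (fst zz) * Pd (ep n) (fst zz)) * (J n (snd zz) * Pd (ep n) (snd zz)) * (exp (b * Dd (ep n) (fst zz) (snd zz)) - 1))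
   \<le> (kp * c)\<^sup>2 * (c * ?w zz) + (kp * c * indicator S (fst zz)) * (kp * c * indicator S (snd zz))" for n
   using AE_quad_neq[where ?'a = 'a]
  proof eventually_elim
   fix zz :: "('a \<times> 'a) \<times> ('a \<times> 'a)"
   assume ne: "fst (fst zz) \<noteq> fst (snd zz) \<and> snd (fst zz) \<noteq> snd (snd zz) \<and> fst (fst zz) \<noteq> snd (snd zz) \<and> snd (fst zz) \<noteq> fst (snd zz)"
   show "norm ((J n (fst zz) * Pd (ep n) (fst zz)) * (J n (snd zz) * Pd (ep n) (snd zz)) * (exp (b * Dd (ep n) (fst zz) (snd zz)) - 1))
    \<le> (kp * c)\<^sup>2 * (c * ?w zz) + (kp * c * indicator S (fst zz)) * (kp * c * indicator S (snd zz))"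
   proof (cases "fst zz \<in> S \<and> snd zz \<in> S")
    case True
    have e: "exp (b * Dd (ep n) (fst zz) (snd zz)) \<le> c * ?w zz"
     using A(7)[OF ep(1)[of n] ep(2)[of n], of "fst zz" "snd zz"] True ne A(4)[of "fst zz"] A(4)[of "snd zz"] by simp
    have "\<bar>exp (b * Dd (ep n) (fst zz) (snd zz)) - 1\<bar> \<le> exp (b * Dd (ep n) (fst zz) (snd zz)) + 1"
     using exp_gt_zero[of "b * Dd (ep n) (fst zz) (snd zz)"] by linarith
    also have "\<dots> \<le> c * ?w zz + 1" using e by simp
    finally have e1: "\<bar>exp (b * Dd (ep n) (fst zz) (snd zz)) - 1\<bar> \<le> c * ?w zz + 1" .
    have "norm ((J n (fst zz) * Pd (ep n) (fst zz)) * (J n (snd zz) * Pd (ep n) (snd zz)) * (exp (b * Dd (ep n) (fst zz) (snd zz)) - 1))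
     \<le> ((kp * c) * (kp * c)) * (c * ?w zz + 1)"
     unfolding norm_mult real_norm_def abs_mult[symmetric]
     unfolding abs_mult[of "J n (fst zz) * Pd (ep n) (fst zz) * (J n (snd zz) * Pd (ep n) (snd zz))"] abs_mult[of "J n (fst zz) * Pd (ep n) (fst zz)"]
     using KP[of n "fst zz"] KP[of n "snd zz"] True kp A(3) e1 by (intro mult_mono) auto
    then show ?thesis using True by (simp add: power2_eq_square algebra_simps)
   next
    case False
    then have "J n (fst zz) = 0 \<or> J n (snd zz) = 0" using J0[of "fst zz" n] J0[of "snd zz" n] by blast
    then show ?thesis using A(3) kp by auto
   qed
  qed
 qed
 have "(\<lambda>n. Qd (ep n) (J n) \<rho>) \<longlonglongrightarrow> Q K \<rho>"
  unfolding Qd_def Q_def by (intro tendsto_add tendsto_diff tendsto_mult_left tendsto_const L1 L2)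
 then show "(\<lambda>n. Qd (dl n) (H n) \<rho>) \<longlonglongrightarrow> Q K \<rho>"
  unfolding ep_def J_def by (rule LIMSEQ_offset)
 show "(\<lambda>n. LINT z|lborel. H n z * Pd (dl n) z) \<longlonglongrightarrow> (LINT z|lborel. K z * P z)"
  using L0 unfolding ep_def J_def by (rule LIMSEQ_offset)
qed

lemma Q_tendsto:
 assumes S: "off_diagonal S" and \<rho>: "\<rho> \<in> test_functions U"
  and H: "\<And>n. H n \<in> borel_measurable borel" "\<And>n z. \<bar>H n z\<bar> \<le> kp" "\<And>n z. z \<notin> S ==> H n z = 0"
   "\<And>z. (\<lambda>n. H n z) \<longlonglongrightarrow> K z"
 shows "(\<lambda>n. Q (H n) \<rho>) \<longlonglongrightarrow> Q K \<rho>"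
proof -
 define ep where "ep = (\<lambda>n. 1 / real (Suc n))"
 have ep: "ep n > 0" "ep \<longlonglongrightarrow> 0" for n using LIMSEQ_inverse_real_of_nat by (auto simp: ep_def inverse_eq_divide)
 have "\<exists>dl. 0 < dl \<and> dl < ep n \<and> \<bar>Qd dl (H n) \<rho> - Q (H n) \<rho>\<bar> < ep n" for n
 proof -
  have "(\<lambda>j. Qd (ep j) (H n) \<rho>) \<longlonglongrightarrow> Q (H n) \<rho>"
   by (rule Qd_tendsto(1)[OF S \<rho> H(1)[of n] H(2)[of n] H(3)[of _ n] tendsto_const ep])
  then have "\<forall>\<^sub>F j in sequentially. dist (Qd (ep j) (H n) \<rho>) (Q (H n) \<rho>) < ep n" by (rule tendstoD) (rule ep)
  moreover have "\<forall>\<^sub>F j in sequentially. ep j < ep n" by (rule order_tendstoD(2)[OF ep(2) ep(1)])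
  ultimately have "\<forall>\<^sub>F j in sequentially. dist (Qd (ep j) (H n) \<rho>) (Q (H n) \<rho>) < ep n \<and> ep j < ep n" by eventually_elim simp
  then obtain j where "dist (Qd (ep j) (H n) \<rho>) (Q (H n) \<rho>) < ep n \<and> ep j < ep n"
   unfolding eventually_sequentially by blast
  then show ?thesis using ep(1)[of j] by (auto simp: dist_real_def)
 qed
 then obtain dl where dl: "\<And>n. 0 < dl n" "\<And>n. dl n < ep n" "\<And>n. \<bar>Qd (dl n) (H n) \<rho> - Q (H n) \<rho>\<bar> < ep n" by metis
 have "dl \<longlonglongrightarrow> 0" by (rule tendsto_sandwich[OF _ _ tendsto_const ep(2)]) (use dl in \<open>auto intro!: always_eventually less_imp_le\<close>)
 from Qd_tendsto(1)[OF S \<rho> H dl(1) this] have "(\<lambda>n. Qd (dl n) (H n) \<rho>) \<longlonglongrightarrow> Q K \<rho>" by simp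
 moreover have "(\<lambda>n. Qd (dl n) (H n) \<rho> - Q (H n) \<rho>) \<longlonglongrightarrow> 0"
  by (rule Lim_null_comparison[OF _ ep(2)]) (use dl(3) in \<open>auto intro!: always_eventually less_imp_le\<close>)
 ultimately have "(\<lambda>n. Qd (dl n) (H n) \<rho> - (Qd (dl n) (H n) \<rho> - Q (H n) \<rho>)) \<longlonglongrightarrow> Q K \<rho> - 0" by (rule tendsto_diff)
 then show ?thesis by simp
qed

end

lemma cnj_measurable [measurable (raw)]: "f \<in> borel_measurable N ==> (\<lambda>x. cnj (f x)) \<in> borel_measurable N"
 by (rule borel_measurable_continuous_on[OF linear_continuous_on[OF bounded_linear_cnj]])

context log_field
begin

lemma pair_chaos_joint: "dl > 0 ==> (\<lambda>z. pair_chaos dl (fst z) (snd z)) \<in> borel_measurable (M \<Otimes>\<^sub>M borel)"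
proof -
 assume dl: "dl > 0"
 have p: "(\<lambda>z. (fst z, fst (snd z))) \<in> measurable (M \<Otimes>\<^sub>M (borel \<Otimes>\<^sub>M borel)) (M \<Otimes>\<^sub>M borel)"
  "(\<lambda>z. (fst z, snd (snd z))) \<in> measurable (M \<Otimes>\<^sub>M (borel \<Otimes>\<^sub>M borel)) (M \<Otimes>\<^sub>M borel)" by measurable
 have [measurable]: "(\<lambda>z. chaos dl (fst z) (fst (snd z))) \<in> borel_measurable (M \<Otimes>\<^sub>M (borel \<Otimes>\<^sub>M borel))"
  "(\<lambda>z. chaos dl (fst z) (snd (snd z))) \<in> borel_measurable (M \<Otimes>\<^sub>M (borel \<Otimes>\<^sub>M borel))"
  using measurable_compose[OF p(1) chaos_joint[OF dl]] measurable_compose[OF p(2) chaos_joint[OF dl]] by simp_all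
 have "(\<lambda>z. pair_chaos dl (fst z) (snd z)) \<in> borel_measurable (M \<Otimes>\<^sub>M (borel \<Otimes>\<^sub>M borel))"
  unfolding pair_chaos_def by measurable
 then show ?thesis by (simp add: borel_prod)
qed

lemma chaos_section: "dl > 0 ==> w \<in> space M ==> chaos dl w \<in> borel_measurable borel"
 using measurable_compose[OF _ chaos_joint, of "\<lambda>x. (w, x)"] by simp

lemma pair_chaos_section: "dl > 0 ==> w \<in> space M ==> pair_chaos dl w \<in> borel_measurable borel"
 using measurable_compose[OF _ pair_chaos_joint, of "\<lambda>x. (w, x)"] by simp

definition Y :: "real => ('a \<times> 'a => real) => 'w => complex" where
 "Y dl K w = (LINT z|lborel. of_real (K z) * pair_chaos dl w z)"

lemma second_moment:
 assumes S: "off_diagonal S" and \<rho>U: "\<rho> \<in> test_functions UNIV" and dl: "dl > 0"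
  and K [measurable]: "K \<in> borel_measurable borel" and Kb: "\<And>z. \<bar>K z\<bar> \<le> kp" and K0: "\<And>z. z \<notin> S ==> K z = 0"
 shows "(\<integral>\<^sup>+ w. ennreal ((norm (Y dl K w - of_real (LINT z|lborel. K z * Pd dl z) - \<i> * of_real (\<beta> * \<Gamma> w \<rho>)))\<^sup>2) \<partial>M) = ennreal (Qd dl K \<rho>)"
  "Y dl K \<in> borel_measurable M"
proof -
 interpret pair: pair_sigma_finite M "lborel :: ('a \<times> 'a) measure" ..
 interpret quad: pair_sigma_finite M "lborel :: (('a \<times> 'a) \<times> ('a \<times> 'a)) measure" ..
 have [measurable]: "S \<in> sets borel" using S by (auto simp: off_diagonal_def borel_closed compact_imp_closed)
 have kp: "kp \<ge> 0" using Kb[of undefined] by linarith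
 obtain B where B: "\<And>w x. norm (chaos dl w x) \<le> B" by (rule chaos_bounded[OF dl]) blast
 have B0: "B \<ge> 0" using B[of undefined undefined] norm_ge_zero order_trans by blast
 have pB: "norm (pair_chaos dl w z) \<le> B * B" for w z
  unfolding pair_chaos_def norm_mult using B B0 by (intro mult_mono) auto
 define F where "F = (\<lambda>w z. of_real (K z) * pair_chaos dl w z)"
 define d where "d = (\<lambda>z. kp * (B * B) * indicator S z :: real)"
 have Fd: "norm (F w z) \<le> d z" for w z
  unfolding F_def d_def norm_mult using Kb[of z] K0[of z] pB[of w z] kp B0
  by (cases "z \<in> S") (auto intro!: mult_mono)
 have di: "integrable lborel d" unfolding d_def by (rule off_diagonal_integrable[OF S])
 have Fm: "(\<lambda>x. F (fst x) (snd x)) \<in> borel_measurable (M \<Otimes>\<^sub>M borel)"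
 proof -
  note pair_chaos_joint[OF dl, measurable]
  show ?thesis unfolding F_def by measurable
 qed
 have lb: "sets (M \<Otimes>\<^sub>M (lborel :: 'b::euclidean_space measure)) = sets (M \<Otimes>\<^sub>M (borel :: 'b measure))"
  by (rule sets_pair_measure_cong) auto
 have Fm': "case_prod F \<in> borel_measurable (M \<Otimes>\<^sub>M lborel)"
  using Fm by (simp add: split_beta' cong: measurable_cong_sets lb)
 have one: "integrable M (\<lambda>w. 1 :: real)" by simp
 have Fi: "integrable (M \<Otimes>\<^sub>M lborel) (case_prod F)"
  by (rule pair.integrable_dominated_product[OF Fm' one di]) (use Fd in auto)
 have FwI: "integrable lborel (F w)" if "w \<in> space M" for w
 proof (rule LINT_bound[OF di])
  show "F w \<in> borel_measurable lborel" unfolding F_def using pair_chaos_section[OF dl that] by simp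
  show "AE z in lborel. norm (F w z) \<le> norm (d z)" by (intro AE_I2 order_trans[OF Fd]) simp
 qed
 have Yeq: "Y dl K w = (LINT z|lborel. F w z)" for w by (simp add: Y_def F_def)
 show Ym [measurable]: "Y dl K \<in> borel_measurable M"
  unfolding Yeq[abs_def] by (rule lborel.borel_measurable_lebesgue_integral[OF Fm'])
 define Dm where "Dm = (LINT z|lborel. d z)"
 have Yb: "norm (Y dl K w) \<le> Dm" for w
 proof -
  have "norm (Y dl K w) \<le> (LINT z|lborel. norm (F w z))" unfolding Yeq by (rule integral_norm_bound)
  also have "\<dots> \<le> Dm" unfolding Dm_def using Fd kp B0 by (intro integral_mono' di) (auto simp: d_def)
  finally show ?thesis .
 qed
 let ?X = "\<lambda>w. \<Gamma> w \<rho>"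
 have Xm [measurable]: "?X \<in> borel_measurable M" by (rule Gamma_measurable[OF \<rho>U])
 have Xi: "integrable M ?X" "integrable M (\<lambda>w. ?X w * ?X w)" using Gamma_integrable[OF \<rho>U \<rho>U] by auto
 have zU: "fst z \<in> U" "snd z \<in> U" if "z \<in> S" for z using that S by (auto simp: off_diagonal_def)
 define m where "m = (LINT z|lborel. K z * Pd dl z)"
 have EY: "(LINT w|M. Y dl K w) = of_real m"
 proof -
  have "(LINT w|M. Y dl K w) = (LINT z|lborel. LINT w|M. F w z)"
   unfolding Yeq by (rule pair.Fubini_integral[OF Fi, symmetric])
  also have "\<dots> = (LINT z|lborel. complex_of_real (K z * Pd dl z))"
  proof (intro LINT_cong)
   fix z show "(LINT w|M. F w z) = complex_of_real (K z * Pd dl z)"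
    by (cases "z \<in> S") (simp_all add: F_def expectation_pair_chaos(1)[OF dl zU] K0)
  qed
  finally show ?thesis by (simp only: m_def integral_complex_of_real)
 qed
 define u where "u = (LINT z|lborel. (K z * Pd dl z) * (cov (mol dl (fst z)) \<rho> - cov (mol dl (snd z)) \<rho>))"
 have EYX: "(LINT w|M. Y dl K w * of_real (?X w)) = \<i> * of_real (\<beta> * u)"
 proof -
  have Gm: "case_prod (\<lambda>w z. F w z * of_real (?X w)) \<in> borel_measurable (M \<Otimes>\<^sub>M lborel)"
   using Fm' by (simp add: split_beta')
  have i: "integrable (M \<Otimes>\<^sub>M lborel) (case_prod (\<lambda>w z. F w z * of_real (?X w)))"
   by (rule pair.integrable_dominated_product[OF Gm integrable_norm[OF Xi(1)] di])
    (use Fd in \<open>auto simp: norm_mult mult.commute intro!: mult_left_mono\<close>)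
  have "(LINT w|M. Y dl K w * of_real (?X w)) = (LINT w|M. LINT z|lborel. F w z * of_real (?X w))"
   unfolding Yeq by simp
  also have "\<dots> = (LINT z|lborel. LINT w|M. F w z * of_real (?X w))"
   by (rule pair.Fubini_integral[OF i, symmetric])
  also have "\<dots> = (LINT z|lborel. \<i> * complex_of_real (\<beta> * ((K z * Pd dl z) * (cov (mol dl (fst z)) \<rho> - cov (mol dl (snd z)) \<rho>))))"
  proof (intro LINT_cong)
   fix z
   show "(LINT w|M. F w z * of_real (?X w)) = \<i> * complex_of_real (\<beta> * ((K z * Pd dl z) * (cov (mol dl (fst z)) \<rho> - cov (mol dl (snd z)) \<rho>)))"
   proof (cases "z \<in> S")
    case True
    have "(LINT w|M. F w z * of_real (?X w)) = of_real (K z) * (LINT w|M. pair_chaos dl w z * of_real (?X w))"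
     by (simp add: F_def mult.assoc)
    then show ?thesis unfolding expectation_pair_chaos(2)[OF dl zU[OF True] \<rho>U] by simp
   qed (simp add: F_def K0)
  qed
  also have "\<dots> = \<i> * of_real (\<beta> * u)"
   unfolding u_def by (simp only: integral_mult_right_zero integral_complex_of_real)
  finally show ?thesis .
 qed
 define T where "T = (LINT zz|lborel. (K (fst zz) * Pd dl (fst zz)) * (K (snd zz) * Pd dl (snd zz)) * exp (b * Dd dl (fst zz) (snd zz)))"
 define dd where "dd = (\<lambda>zz. d (fst zz) * d (snd zz))"
 have ddi: "integrable lborel dd" unfolding dd_def by (rule integral_lborel_product(1)[OF di di])
 define G where "G = (\<lambda>w zz. F w (fst zz) * cnj (F w (snd zz)))"
 have Gd: "norm (G w zz) \<le> dd zz" for w zz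
  unfolding G_def dd_def norm_mult using Fd by (intro mult_mono) (auto intro: order_trans[OF norm_ge_zero Fd])
 have Gm: "case_prod G \<in> borel_measurable (M \<Otimes>\<^sub>M lborel)"
 proof -
  have p: "(\<lambda>z. (fst z, fst (snd z))) \<in> measurable (M \<Otimes>\<^sub>M (borel \<Otimes>\<^sub>M borel)) (M \<Otimes>\<^sub>M (borel :: ('a \<times> 'a) measure))"
   "(\<lambda>z. (fst z, snd (snd z))) \<in> measurable (M \<Otimes>\<^sub>M (borel \<Otimes>\<^sub>M borel)) (M \<Otimes>\<^sub>M (borel :: ('a \<times> 'a) measure))" by measurable
  have [measurable]: "(\<lambda>z. F (fst z) (fst (snd z))) \<in> borel_measurable (M \<Otimes>\<^sub>M (borel \<Otimes>\<^sub>M borel))"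
   "(\<lambda>z. F (fst z) (snd (snd z))) \<in> borel_measurable (M \<Otimes>\<^sub>M (borel \<Otimes>\<^sub>M borel))"
   using measurable_compose[OF p(1) Fm] measurable_compose[OF p(2) Fm] by simp_all
  have "(\<lambda>z. G (fst z) (snd z)) \<in> borel_measurable (M \<Otimes>\<^sub>M (borel \<Otimes>\<^sub>M borel))"
   unfolding G_def by measurable
  then show ?thesis by (simp add: split_beta' borel_prod cong: measurable_cong_sets lb)
 qed
 have EYY: "(LINT w|M. Y dl K w * cnj (Y dl K w)) = of_real T"
 proof -
  have i: "integrable (M \<Otimes>\<^sub>M lborel) (case_prod G)"
   by (rule quad.integrable_dominated_product[OF Gm one ddi]) (use Gd in auto)
  have "(LINT w|M. Y dl K w * cnj (Y dl K w)) = (LINT w|M. LINT zz|lborel. G w zz)"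
  proof (intro LINT_cong)
   fix w assume w: "w \<in> space M"
   have c: "integrable lborel (\<lambda>z. cnj (F w z))" using FwI[OF w] by simp
   show "Y dl K w * cnj (Y dl K w) = (LINT zz|lborel. G w zz)"
    unfolding G_def integral_lborel_product(2)[OF FwI[OF w] c] Yeq by simp
  qed
  also have "\<dots> = (LINT zz|lborel. LINT w|M. G w zz)"
   by (rule quad.Fubini_integral[OF i, symmetric])
  also have "\<dots> = (LINT zz|lborel. complex_of_real ((K (fst zz) * Pd dl (fst zz)) * (K (snd zz) * Pd dl (snd zz)) * exp (b * Dd dl (fst zz) (snd zz))))"
  proof (intro LINT_cong)
   fix zz :: "('a \<times> 'a) \<times> ('a \<times> 'a)"
   show "(LINT w|M. G w zz) = complex_of_real ((K (fst zz) * Pd dl (fst zz)) * (K (snd zz) * Pd dl (snd zz)) * exp (b * Dd dl (fst zz) (snd zz)))"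
   proof (cases "fst zz \<in> S \<and> snd zz \<in> S")
    case True
    have "(LINT w|M. G w zz) = (LINT w|M. of_real (K (fst zz) * K (snd zz)) * (pair_chaos dl w (fst zz) * cnj (pair_chaos dl w (snd zz))))"
     unfolding G_def F_def by (intro LINT_cong) (simp add: mult_ac)
    also have "\<dots> = of_real (K (fst zz) * K (snd zz)) * of_real (Pd dl (fst zz) * Pd dl (snd zz) * exp (b * Dd dl (fst zz) (snd zz)))"
     using True by (simp only: integral_mult_right_zero expectation_pair_chaos2[OF dl zU zU])
    finally show ?thesis by (simp add: mult_ac)
   qed (auto simp: G_def F_def K0)
  qed
  also have "\<dots> = of_real T" unfolding T_def by (simp only: integral_complex_of_real)
  finally show ?thesis .
 qed
 define f where "f = (\<lambda>w. Y dl K w - of_real m - \<i> * of_real (\<beta> * ?X w))"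
 have exp_eq: "complex_of_real ((norm (f w))\<^sup>2) = Y dl K w * cnj (Y dl K w) - of_real (2 * m * Re (Y dl K w)) + of_real (m * m) - of_real (2 * \<beta> * Im (Y dl K w * of_real (?X w))) + of_real (b * (?X w * ?X w))" for w
  unfolding complex_norm_square
  by (simp add: f_def complex_eq_iff b_def power2_eq_square algebra_simps)
 have sq: "(norm (f w))\<^sup>2 = (norm (Y dl K w))\<^sup>2 - 2 * m * Re (Y dl K w) + m * m - 2 * \<beta> * Im (Y dl K w * of_real (?X w)) + b * (?X w * ?X w)" for w
 proof -
  have "complex_of_real ((norm (f w))\<^sup>2) = complex_of_real ((norm (Y dl K w))\<^sup>2 - 2 * m * Re (Y dl K w) + m * m - 2 * \<beta> * Im (Y dl K w * of_real (?X w)) + b * (?X w * ?X w))"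
   unfolding exp_eq by (simp only: of_real_add of_real_diff complex_norm_square)
  then show ?thesis by (simp only: of_real_eq_iff)
 qed
 have YI: "integrable M (Y dl K)" by (rule integrable_const_bound[of _ Dm]) (use Yb in auto)
 have YXI: "integrable M (\<lambda>w. Y dl K w * of_real (?X w))"
  by (rule LINT_bound[OF integrable_mult_right[OF Xi(1), of Dm]])
   (use Yb in \<open>auto simp: norm_mult abs_mult intro!: AE_I2 mult_right_mono order_trans[OF Yb abs_ge_self]\<close>)
 have YYI: "integrable M (\<lambda>w. (norm (Y dl K w))\<^sup>2)"
  by (rule integrable_const_bound[of _ "Dm\<^sup>2"]) (use Yb in \<open>auto intro!: power_mono\<close>)
 have EYYr: "(LINT w|M. (norm (Y dl K w))\<^sup>2) = T"
 proof -
  have "complex_of_real (LINT w|M. (norm (Y dl K w))\<^sup>2) = (LINT w|M. complex_of_real ((norm (Y dl K w))\<^sup>2))"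
   by (simp only: integral_complex_of_real)
  also have "\<dots> = (LINT w|M. Y dl K w * cnj (Y dl K w))" unfolding complex_norm_square ..
  finally show ?thesis unfolding EYY by (simp only: of_real_eq_iff)
 qed
 have ReI: "integrable M (\<lambda>w. Re (Y dl K w))" "integrable M (\<lambda>w. Im (Y dl K w * of_real (?X w)))"
  by (rule integrable_Re[OF YI], rule integrable_Im[OF YXI])
 have ReE: "(LINT w|M. Re (Y dl K w)) = m" "(LINT w|M. Im (Y dl K w * of_real (?X w))) = \<beta> * u"
  using integral_Re[OF YI] integral_Im[OF YXI] unfolding EY EYX by simp_all
 have fI: "integrable M (\<lambda>w. (norm (f w))\<^sup>2)"
  unfolding sq using YYI ReI Xi by (intro Bochner_Integration.integrable_add Bochner_Integration.integrable_diff integrable_mult_right) auto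
 have "(LINT w|M. (norm (f w))\<^sup>2) = (LINT w|M. (norm (Y dl K w))\<^sup>2) - 2 * m * (LINT w|M. Re (Y dl K w)) + m * m - 2 * \<beta> * (LINT w|M. Im (Y dl K w * of_real (?X w))) + b * (LINT w|M. ?X w * ?X w)"
  unfolding sq using YYI ReI Xi by (simp add: prob_space)
 also have "\<dots> = T - m * m - 2 * b * u + b * cov \<rho> \<rho>"
  unfolding EYYr ReE by (simp add: cov_def b_def power2_eq_square algebra_simps)
 also have "T - m * m = (LINT zz|lborel. (K (fst zz) * Pd dl (fst zz)) * (K (snd zz) * Pd dl (snd zz)) * (exp (b * Dd dl (fst zz) (snd zz)) - 1))"
 proof -
  obtain BK where BK: "\<And>x y. \<bar>Kd dl x y\<bar> \<le> BK" by (rule Kd_bounded[OF dl]) blast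
  have PdB: "Pd dl z \<le> exp (b * BK)" "Pd dl z \<ge> 0" for z
   unfolding Pd_def using BK[of "fst z" "snd z"] b by (auto intro!: mult_left_mono)
  have KPi: "integrable lborel (\<lambda>z. K z * Pd dl z)"
  proof (rule LINT_bound[OF off_diagonal_integrable[OF S, of "kp * exp (b * BK)"]])
   show "(\<lambda>z. K z * Pd dl z) \<in> borel_measurable lborel" using Pd_measurable[OF dl] K by simp
   have "\<bar>K z * Pd dl z\<bar> \<le> kp * exp (b * BK)" for z
    unfolding abs_mult using Kb[of z] PdB[of z] kp by (intro mult_mono) auto
   then show "AE z in lborel. norm (K z * Pd dl z) \<le> norm (kp * exp (b * BK) * indicator S z :: real)"
    using K0 kp by (intro AE_I2) (auto simp: indicator_def)
  qed
  note pr = integral_lborel_product[OF KPi KPi]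
  have Ti: "integrable lborel (\<lambda>zz. (K (fst zz) * Pd dl (fst zz)) * (K (snd zz) * Pd dl (snd zz)) * exp (b * Dd dl (fst zz) (snd zz)))"
  proof (rule LINT_bound[OF integrable_mult_right[OF pr(1), of "exp (b * (4 * BK))"]])
   show "(\<lambda>zz. (K (fst zz) * Pd dl (fst zz)) * (K (snd zz) * Pd dl (snd zz)) * exp (b * Dd dl (fst zz) (snd zz))) \<in> borel_measurable lborel"
    by (rule borel_measurable_times[OF borel_measurable_integrable[OF pr(1)]]) (use Dd_measurable[OF dl] in simp)
   have "exp (b * Dd dl z z') \<le> exp (b * (4 * BK))" for z z'
   proof -
    have "Dd dl z z' \<le> 4 * BK" unfolding Dd_def
     using BK[of "fst z" "fst z'"] BK[of "snd z" "snd z'"] BK[of "fst z" "snd z'"] BK[of "snd z" "fst z'"] by linarith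
    then show ?thesis using b by (simp add: mult_left_mono)
   qed
   then show "AE zz in lborel. norm ((K (fst zz) * Pd dl (fst zz)) * (K (snd zz) * Pd dl (snd zz)) * exp (b * Dd dl (fst zz) (snd zz)))
    \<le> norm (exp (b * (4 * BK)) * ((K (fst zz) * Pd dl (fst zz)) * (K (snd zz) * Pd dl (snd zz))))"
    by (intro AE_I2) (simp add: abs_mult mult.commute[of "exp (b * (4 * BK))"] mult_left_mono)
  qed
  have "m * m = (LINT zz|lborel. (K (fst zz) * Pd dl (fst zz)) * (K (snd zz) * Pd dl (snd zz)))"
   unfolding pr(2) m_def ..
  then have "T - m * m = (LINT zz|lborel. (K (fst zz) * Pd dl (fst zz)) * (K (snd zz) * Pd dl (snd zz)) * exp (b * Dd dl (fst zz) (snd zz)) - (K (fst zz) * Pd dl (fst zz)) * (K (snd zz) * Pd dl (snd zz)))"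
   unfolding T_def using Bochner_Integration.integral_diff[OF Ti pr(1)] by simp
  then show ?thesis by (simp only: right_diff_distrib mult_1_right)
 qed
 finally have "(LINT w|M. (norm (f w))\<^sup>2) = Qd dl K \<rho>" by (simp add: Qd_def u_def)
 then show "(\<integral>\<^sup>+ w. ennreal ((norm (Y dl K w - of_real (LINT z|lborel. K z * Pd dl z) - \<i> * of_real (\<beta> * \<Gamma> w \<rho>)))\<^sup>2) \<partial>M) = ennreal (Qd dl K \<rho>)"
  using nn_integral_norm_square[OF fI] by (simp add: f_def m_def)
qed

definition tensor :: "'a set => ('a \<times> 'a => real) => bool" where
 "tensor V K \<longleftrightarrow> (\<exists>I::('a \<times> 'a) set. finite I \<and> (\<exists>c f h. (\<forall>i\<in>I. f i \<in> test_functions V \<and> h i \<in> test_functions V) \<and>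
  K = (\<lambda>z. \<Sum>i\<in>I. c i * (f i (fst z) * h i (snd z)))))"

lemma tensor_continuous: "tensor V K ==> continuous_on UNIV K"
 unfolding tensor_def
proof (elim exE conjE)
 fix I :: "('a \<times> 'a) set" and c f h
 assume I: "\<forall>i\<in>I. f i \<in> test_functions V \<and> h i \<in> test_functions V" and K: "K = (\<lambda>z. \<Sum>i\<in>I. c i * (f i (fst z) * h i (snd z)))"
 show "continuous_on UNIV K"
  unfolding K
  by (intro continuous_on_sum continuous_on_mult continuous_on_const)
   (auto intro!: continuous_on_compose2[OF test_functions_continuous[OF I[rule_format, THEN conjunct1]]]
     continuous_on_compose2[OF test_functions_continuous[OF I[rule_format, THEN conjunct2]]] continuous_intros)
qed

lemma chaos_approximation:
 fixes \<mu> :: "'w => ('a => real) => complex"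
 assumes S: "off_diagonal S" and \<rho>: "\<rho> \<in> test_functions U" and \<mu>: "imaginary_chaos M U \<phi> \<beta> \<Gamma> \<mu>"
  and K: "tensor V K" and K0: "\<And>z. z \<notin> S ==> K z = 0"
 shows "\<exists>Z. Z \<in> borel_measurable (restriction_algebra M V \<mu>) \<and>
  (\<integral>\<^sup>+ w. ennreal ((norm (Z w - \<i> * of_real (\<beta> * \<Gamma> w \<rho>)))\<^sup>2) \<partial>M) \<le> ennreal (Q K \<rho>)"
proof -
 have \<rho>U: "\<rho> \<in> test_functions UNIV" by (rule test_functions_mono[OF _ \<rho>]) simp
 obtain I :: "('a \<times> 'a) set" and c f h where I: "finite I" "\<And>i. i \<in> I ==> f i \<in> test_functions V" "\<And>i. i \<in> I ==> h i \<in> test_functions V"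
  and Keq: "K = (\<lambda>z. \<Sum>i\<in>I. c i * (f i (fst z) * h i (snd z)))"
  using K unfolding tensor_def by blast
 have fU: "f i \<in> test_functions UNIV" "h i \<in> test_functions UNIV" if "i \<in> I" for i
  using I(2,3)[OF that] test_functions_mono[OF subset_UNIV] by blast+
 have Kc: "continuous_on UNIV K" by (rule tensor_continuous[OF K])
 then have Km: "K \<in> borel_measurable borel" by (rule borel_measurable_continuous_onI)
 obtain kp where Kb: "\<And>z. norm (K z) \<le> kp"
  by (rule continuous_compact_support_bounded[OF Kc, of S]) (use S K0 in \<open>auto simp: off_diagonal_def\<close>)
 have neg: "- real DIM('a) < - real DIM('a) / 2" by simp
 have rs: "random_sobolev M (- real DIM('a)) \<mu>"
  and conv: "tendsto_0_in_probability M (\<lambda>dl w. sobolev_norm (- real DIM('a)) (\<lambda>f. (LINT x|lborel. chaos dl w x * complex_of_real (f x)) - \<mu> w f)) (at_right 0)"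
  using \<mu> neg unfolding imaginary_chaos_def chaos_def by blast+
 have "\<exists>B. \<forall>w x. norm (chaos dl w x) \<le> B" if "dl > 0" for dl
  using chaos_bounded[OF that] by metis
 then obtain B where B: "\<And>dl w x. dl > 0 ==> norm (chaos dl w x) \<le> B dl" by metis
 have "\<exists>dl::nat => real. (\<forall>n. dl n > 0) \<and> dl \<longlonglongrightarrow> 0 \<and>
  (AE w in M. \<forall>f\<in>test_functions UNIV. (\<lambda>n. LINT x|lborel. chaos (dl n) w x * complex_of_real (f x)) \<longlonglongrightarrow> \<mu> w f)"
 proof (rule sobolev_limit_pairing[of \<phi> chaos B U \<mu>, OF phi(1,3) chaos_section B U(1) chaos_outside rs conv])
  fix dl :: "nat => real"
  assume "\<And>n. dl n > 0" "dl \<longlonglongrightarrow> 0"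
   "AE w in M. \<forall>f\<in>test_functions UNIV. (\<lambda>n. LINT x|lborel. chaos (dl n) w x * complex_of_real (f x)) \<longlonglongrightarrow> \<mu> w f"
  then show ?thesis by (intro exI[of _ dl] conjI allI)
 qed
 then obtain dl :: "nat => real" where dl: "\<And>n. dl n > 0" "dl \<longlonglongrightarrow> 0"
  "AE w in M. \<forall>f\<in>test_functions UNIV. (\<lambda>n. LINT x|lborel. chaos (dl n) w x * complex_of_real (f x)) \<longlonglongrightarrow> \<mu> w f"
  by blast
 define m where "m = (LINT z|lborel. K z * P z)"
 define Z where "Z = (\<lambda>w. (\<Sum>i\<in>I. of_real (c i) * (\<mu> w (f i) * cnj (\<mu> w (h i)))) - of_real m)"
 define R where "R = restriction_algebra M V \<mu>"
 have spR: "space R = space M" unfolding R_def restriction_algebra_def by (rule space_measure_of) (auto dest: null_setsD2 sets.sets_into_space)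
 have \<mu>R: "(\<lambda>w. \<mu> w k) \<in> borel_measurable R" if "k \<in> test_functions V" for k
 proof (rule measurableI)
  fix A :: "complex set" assume A: "A \<in> sets borel"
  have sub: "{(\<lambda>w. \<mu> w h) -` B \<inter> space M | h B. h \<in> test_functions V \<and> B \<in> sets borel} \<union> null_sets M \<subseteq> Pow (space M)"
   by (auto dest: null_setsD2 sets.sets_into_space)
  show "(\<lambda>w. \<mu> w k) -` A \<inter> space R \<in> sets R"
   unfolding spR unfolding R_def restriction_algebra_def sets_measure_of[OF sub]
   using that A by (intro sigma_sets.Basic) blast
 qed simp
 have Zm: "Z \<in> borel_measurable R"
  unfolding Z_def using \<mu>R I by (intro borel_measurable_diff borel_measurable_sum borel_measurable_times borel_measurable_const cnj_measurable) auto
 define \<mu>d where "\<mu>d = (\<lambda>n w k. LINT x|lborel. chaos (dl n) w x * complex_of_real (k x))"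
 have Yeq: "Y (dl n) K w = (\<Sum>i\<in>I. of_real (c i) * (\<mu>d n w (f i) * cnj (\<mu>d n w (h i))))" if w: "w \<in> space M" for n w
 proof -
  have ci: "integrable lborel (\<lambda>x. chaos (dl n) w x * complex_of_real (k x))" if k: "k \<in> test_functions UNIV" for k
   by (rule LINT_bound[OF integrable_mult_right[OF test_functions_integrable[OF k], of "B (dl n)"]])
    (use B[OF dl(1)] chaos_section[OF dl(1) w] test_functions_borel[OF k] in \<open>auto simp: norm_mult abs_mult intro!: AE_I2 mult_right_mono order_trans[OF B[OF dl(1)] abs_ge_self]\<close>)
  have ci': "integrable lborel (\<lambda>x. cnj (chaos (dl n) w x * complex_of_real (k x)))" if "k \<in> test_functions UNIV" for k
   by (rule integrable_bounded_linear[OF bounded_linear_cnj ci[OF that]])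
  have "Y (dl n) K w = (LINT z|lborel. (\<Sum>i\<in>I. of_real (c i) * ((chaos (dl n) w (fst z) * complex_of_real (f i (fst z))) * cnj (chaos (dl n) w (snd z) * complex_of_real (h i (snd z))))))"
   unfolding Y_def Keq pair_chaos_def
   by (intro LINT_cong) (simp add: sum_distrib_right sum_distrib_left mult_ac)
  also have "\<dots> = (\<Sum>i\<in>I. (LINT z|lborel. of_real (c i) * ((chaos (dl n) w (fst z) * complex_of_real (f i (fst z))) * cnj (chaos (dl n) w (snd z) * complex_of_real (h i (snd z))))))"
   by (rule Bochner_Integration.integral_sum) (intro integrable_mult_right integral_lborel_product(1) ci ci' fU)
  also have "\<dots> = (\<Sum>i\<in>I. of_real (c i) * (\<mu>d n w (f i) * cnj (\<mu>d n w (h i))))"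
   unfolding \<mu>d_def
   by (intro sum.cong refl) (simp only: integral_mult_right_zero integral_lborel_product(2)[OF ci[OF fU(1)] ci'[OF fU(2)]] Bochner_Integration.integral_cnj)
  finally show ?thesis .
 qed
 define W where "W = (\<lambda>n w. Y (dl n) K w - of_real (LINT z|lborel. K z * Pd (dl n) z) - \<i> * of_real (\<beta> * \<Gamma> w \<rho>))"
 have sm: "(\<integral>\<^sup>+ w. ennreal ((norm (W n w))\<^sup>2) \<partial>M) = ennreal (Qd (dl n) K \<rho>)" "Y (dl n) K \<in> borel_measurable M" for n
  unfolding W_def using second_moment[OF S \<rho>U dl(1) Km _ K0, of kp] Kb by auto
 have [measurable]: "(\<lambda>w. \<Gamma> w \<rho>) \<in> borel_measurable M" by (rule Gamma_measurable[OF \<rho>U])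
 have Wm [measurable]: "W n \<in> borel_measurable M" for n unfolding W_def using sm(2) by measurable
 have mlim: "(\<lambda>n. LINT z|lborel. K z * Pd (dl n) z) \<longlonglongrightarrow> m" and Qlim: "(\<lambda>n. Qd (dl n) K \<rho>) \<longlonglongrightarrow> Q K \<rho>"
  unfolding m_def using Qd_tendsto[where H = "\<lambda>n. K" and K = K and kp = kp, OF S \<rho> Km _ K0 tendsto_const dl(1,2)] Kb by auto
 have "AE w in M. (\<lambda>n. W n w) \<longlonglongrightarrow> Z w - \<i> * of_real (\<beta> * \<Gamma> w \<rho>)"
  using dl(3) AE_space
 proof eventually_elim
  case (elim w)
  have l: "(\<lambda>n. \<mu>d n w k) \<longlonglongrightarrow> \<mu> w k" if "k \<in> test_functions UNIV" for k
   using elim(1) that unfolding \<mu>d_def by blast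
  show ?case
   unfolding W_def Yeq[OF elim(2)] Z_def
   by (intro tendsto_diff tendsto_sum tendsto_mult tendsto_const tendsto_cnj l fU tendsto_of_real mlim)
 qed
 then have "AE w in M. ennreal ((norm (Z w - \<i> * of_real (\<beta> * \<Gamma> w \<rho>)))\<^sup>2) \<le> liminf (\<lambda>n. ennreal ((norm (W n w))\<^sup>2))"
 proof eventually_elim
  case (elim w)
  have "(\<lambda>n. ennreal ((norm (W n w))\<^sup>2)) \<longlonglongrightarrow> ennreal ((norm (Z w - \<i> * of_real (\<beta> * \<Gamma> w \<rho>)))\<^sup>2)"
   by (intro tendsto_ennrealI tendsto_power tendsto_norm elim)
  from lim_imp_Liminf[OF sequentially_bot this] show ?case by simp
 qed
 then have "(\<integral>\<^sup>+ w. ennreal ((norm (Z w - \<i> * of_real (\<beta> * \<Gamma> w \<rho>)))\<^sup>2) \<partial>M) \<le> (\<integral>\<^sup>+ w. liminf (\<lambda>n. ennreal ((norm (W n w))\<^sup>2)) \<partial>M)"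
  by (rule nn_integral_mono_AE)
 also have "\<dots> \<le> liminf (\<lambda>n. \<integral>\<^sup>+ w. ennreal ((norm (W n w))\<^sup>2) \<partial>M)"
  by (intro nn_integral_liminf) measurable
 also have "\<dots> = ennreal (Q K \<rho>)"
  unfolding sm(1) by (rule lim_imp_Liminf[OF sequentially_bot tendsto_ennrealI[OF Qlim]])
 finally show ?thesis using Zm unfolding R_def by blast
qed

end

section \<open>Tensor products\<close>

lemma riemann_weights:
 fixes T :: "'a::euclidean_space set"
 assumes "finite I" "T \<in> sets borel" "emeasure lborel T < \<infinity>" "T \<subseteq> (\<Union>u\<in>I. ball u d)"
 shows "\<exists>m. (\<forall>u. 0 \<le> m u) \<and> (\<forall>(h :: 'a => real) \<omega>. integrable lborel h \<longrightarrow> (\<forall>u v. dist u v < d \<longrightarrow> \<bar>h u - h v\<bar> \<le> \<omega>) \<longrightarrow>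
  \<bar>(\<Sum>u\<in>I. m u * h u) - (LINT v|lborel. indicator T v * h v)\<bar> \<le> \<omega> * measure lborel T)"
 using assms
proof (induction I arbitrary: T)
 case empty
 then have "T = {}" by auto
 then show ?case by (intro exI[of _ "\<lambda>u. 0"]) auto
next
 case (insert u0 I)
 define T1 T2 where "T1 = T \<inter> ball u0 d" and "T2 = T - ball u0 d"
 have [measurable]: "T \<in> sets borel" "T1 \<in> sets borel" "T2 \<in> sets borel" using insert.prems(1) by (auto simp: T1_def T2_def)
 have fin: "emeasure lborel T1 < \<infinity>" "emeasure lborel T2 < \<infinity>"
  using insert.prems(2) emeasure_mono[of T1 T lborel] emeasure_mono[of T2 T lborel] by (auto simp: T1_def T2_def less_top[symmetric] top_unique)
 have "T2 \<subseteq> (\<Union>u\<in>I. ball u d)" using insert.prems(3) by (auto simp: T2_def)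
 from insert.IH[OF \<open>T2 \<in> sets borel\<close> fin(2) this]
 obtain m where m0: "\<forall>u. 0 \<le> m u" and m1: "\<forall>(h :: 'a => real) \<omega>. integrable lborel h \<longrightarrow> (\<forall>u v. dist u v < d \<longrightarrow> \<bar>h u - h v\<bar> \<le> \<omega>) \<longrightarrow>
  \<bar>(\<Sum>u\<in>I. m u * h u) - (LINT v|lborel. indicator T2 v * h v)\<bar> \<le> \<omega> * measure lborel T2"
  by (elim exE conjE)
 have T12: "measure lborel T = measure lborel T1 + measure lborel T2"
  using measure_Union[of lborel T1 T2] fin by (auto simp: T1_def T2_def Int_Diff_Un Int_Diff_disjoint)
 have one: "integrable lborel (indicator T1 :: 'a => real)" using fin(1) by simp
 show ?case
 proof (intro exI[of _ "m(u0 := measure lborel T1)"] conjI allI impI)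
  show "0 \<le> (m(u0 := measure lborel T1)) u" for u using m0 by simp
  fix h :: "'a => real" and \<omega> assume h: "integrable lborel h" and \<omega>: "\<forall>u v. dist u v < d \<longrightarrow> \<bar>h u - h v\<bar> \<le> \<omega>"
  have hi: "integrable lborel (\<lambda>v. indicator S v * h v)" if "S \<in> sets borel" for S
   using integrable_mult_indicator[OF _ h, of S] that by simp
  have "(LINT v|lborel. indicator T v * h v) = (LINT v|lborel. indicator T1 v * h v + indicator T2 v * h v)"
   by (intro Bochner_Integration.integral_cong) (auto simp: T1_def T2_def indicator_def)
  also have "\<dots> = (LINT v|lborel. indicator T1 v * h v) + (LINT v|lborel. indicator T2 v * h v)"
   by (intro Bochner_Integration.integral_add hi) auto
  finally have split: "(LINT v|lborel. indicator T v * h v) = (LINT v|lborel. indicator T1 v * h v) + (LINT v|lborel. indicator T2 v * h v)" .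
  have "measure lborel T1 * h u0 - (LINT v|lborel. indicator T1 v * h v) = (LINT v|lborel. indicator T1 v * h u0 - indicator T1 v * h v)"
   using one by (subst Bochner_Integration.integral_diff) (auto intro: hi)
  also have "\<bar>\<dots>\<bar> \<le> (LINT v|lborel. \<omega> * indicator T1 v)"
  proof -
   have "norm (LINT v|lborel. indicator T1 v * h u0 - indicator T1 v * h v) \<le> (LINT v|lborel. norm (indicator T1 v * h u0 - indicator T1 v * h v))"
    by (rule integral_norm_bound)
   also have "\<dots> \<le> (LINT v|lborel. \<omega> * indicator T1 v)"
   proof (intro integral_mono' integrable_mult_right one)
    fix v
    have o: "\<bar>h u0 - h v\<bar> \<le> \<omega>" if "v \<in> T1" using \<omega> that by (auto simp: T1_def)
    show "norm (indicator T1 v * h u0 - indicator T1 v * h v) \<le> \<omega> * indicator T1 v" by (cases "v \<in> T1") (use o in auto)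
    show "0 \<le> \<omega> * indicator T1 v" using o order_trans[OF abs_ge_zero o] by (cases "v \<in> T1") auto
   qed
   finally show ?thesis by simp
  qed
  finally have 1: "\<bar>measure lborel T1 * h u0 - (LINT v|lborel. indicator T1 v * h v)\<bar> \<le> \<omega> * measure lborel T1"
   using one by simp
  have "(\<Sum>u\<in>I. (m(u0 := measure lborel T1)) u * h u) = (\<Sum>u\<in>I. m u * h u)"
   using insert.hyps(2) by (intro sum.cong) auto
  then have s: "(\<Sum>u\<in>insert u0 I. (m(u0 := measure lborel T1)) u * h u) = measure lborel T1 * h u0 + (\<Sum>u\<in>I. m u * h u)"
   using insert.hyps by simp
  show "\<bar>(\<Sum>u\<in>insert u0 I. (m(u0 := measure lborel T1)) u * h u) - (LINT v|lborel. indicator T v * h v)\<bar> \<le> \<omega> * measure lborel T"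
   using 1 m1[rule_format, OF h \<omega>[rule_format]] unfolding s split T12 distrib_left by linarith
 qed
qed

context log_field
begin

lemma approximate_partition_of_unity:
 assumes A: "compact A" and et: "et > 0"
 shows "\<exists>(I :: 'a set) w. finite I \<and> (\<forall>u. w u \<in> test_functions (cball u et)) \<and> (\<forall>u x. 0 \<le> w u x) \<and>
  (\<forall>x\<in>A. \<bar>(\<Sum>u\<in>I. w u x) - 1\<bar> \<le> et) \<and> (\<forall>x. (\<Sum>u\<in>I. w u x) \<le> 2)"
proof -
 obtain R where R: "\<And>x. x \<in> A ==> norm x \<le> R" using compact_imp_bounded[OF A] by (auto simp: bounded_iff)
 define T where "T = cball (0::'a) (R + et)"
 have T: "compact T" "T \<in> sets borel" by (auto simp: T_def)
 define \<psi> where "\<psi> = mol et 0"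
 have \<psi>t: "\<psi> \<in> test_functions UNIV" unfolding \<psi>_def by (rule mol_test[OF et])
 have molx: "mol et x u = \<psi> (u - x)" for x u by (simp add: \<psi>_def mol_eq algebra_simps)
 have ms: "mol et x u = 0" if "dist x u > et" for x u
 proof -
  have "norm ((1/et) *\<^sub>R (x - u)) \<ge> 1" unfolding norm_scaleR using that et by (simp add: dist_norm field_simps)
  then show ?thesis by (simp only: mol_eq phi(4) div_0)
 qed
 define e where "e = min et 1 / (1 + measure lborel T)"
 have e: "e > 0" "e * measure lborel T \<le> min et 1"
 proof -
  show "e > 0" using et by (simp add: e_def add_pos_nonneg)
  have "min et 1 * (measure lborel T / (1 + measure lborel T)) \<le> min et 1 * 1"
   using et by (intro mult_left_mono) (auto simp: divide_simps add_pos_nonneg)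
  then show "e * measure lborel T \<le> min et 1" by (simp add: e_def)
 qed
 obtain d where d: "d > 0" "\<And>x y. dist x y < d ==> dist (\<psi> x) (\<psi> y) < e"
  using continuous_compact_support_uniform[OF test_functions_continuous[OF \<psi>t] compact_cball[of 0 et] _ e(1)] ms[of 0]
  by (auto simp: \<psi>_def)
 obtain I where I: "finite I" "T \<subseteq> (\<Union>u\<in>I. ball u d)" using T(1) d(1) unfolding compact_eq_totally_bounded by blast
 from riemann_weights[OF I(1) T(2) emeasure_compact_finite[OF T(1)] I(2)]
 obtain m where m0: "\<forall>u. 0 \<le> m u" and m1: "\<forall>(h :: 'a => real) \<omega>. integrable lborel h \<longrightarrow> (\<forall>u v. dist u v < d \<longrightarrow> \<bar>h u - h v\<bar> \<le> \<omega>) \<longrightarrow>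
  \<bar>(\<Sum>u\<in>I. m u * h u) - (LINT v|lborel. indicator T v * h v)\<bar> \<le> \<omega> * measure lborel T"
  by (elim exE conjE)
 define w where "w = (\<lambda>u x. m u * mol et x u)"
 have "(\<lambda>x. mol et x u) \<in> test_functions (cball u et)" for u
 proof (rule test_functionsI[where S = "cball u et"])
  have "(\<lambda>x. rescale \<phi> et (- u + 1 *\<^sub>R x)) \<in> test_functions UNIV"
   by (rule test_functions_affine[OF test_functions_rescale[OF phi(1) et]]) simp
  then show "smooth (\<lambda>x. mol et x u)" by (intro test_functions_smooth[where V = UNIV]) (simp add: mol_def)
 qed (use ms in \<open>auto simp: dist_commute\<close>)
 then have wt: "w u \<in> test_functions (cball u et)" for u
  unfolding w_def by (rule test_functions_cmult)
 have main: "\<bar>(\<Sum>u\<in>I. w u x) - (LINT v|lborel. indicator T v * mol et x v)\<bar> \<le> min et 1" for x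
 proof -
  have "\<forall>u v. dist u v < d \<longrightarrow> \<bar>mol et x u - mol et x v\<bar> \<le> e"
   using d(2)[of "u - x" "v - x" for u v] by (force simp: molx dist_norm dist_real_def intro: less_imp_le)
  from m1[rule_format, OF mol_integrable[OF et] this[rule_format]] show ?thesis using e(2) by (simp add: w_def)
 qed
 have le1: "(LINT v|lborel. indicator T v * mol et x v) \<le> 1" for x
 proof -
  have "(LINT v|lborel. indicator T v * mol et x v) \<le> (LINT v|lborel. mol et x v)"
   using mol_nonneg[OF et] by (intro integral_mono' mol_integrable[OF et]) (auto simp: indicator_def)
  then show ?thesis using mol_integral[OF et] by simp
 qed
 have eq1: "(LINT v|lborel. indicator T v * mol et x v) = 1" if x: "x \<in> A" for x
 proof -
  have "indicator T v * mol et x v = mol et x v" for v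
  proof (cases "dist x v > et")
   case False
   then have "norm v \<le> R + et" using R[OF x] norm_triangle_ineq2[of v x] by (simp add: dist_norm norm_minus_commute)
   then show ?thesis by (simp add: T_def)
  qed (simp add: ms)
  then show ?thesis by (simp only: mol_integral[OF et])
 qed
 show ?thesis
 proof (intro exI[of _ I] exI[of _ w] conjI allI ballI)
  show "0 \<le> w u x" for u x using m0 mol_nonneg[OF et] by (simp add: w_def)
  show "\<bar>(\<Sum>u\<in>I. w u x) - 1\<bar> \<le> et" if "x \<in> A" for x using main[of x] eq1[OF that] by simp
  show "(\<Sum>u\<in>I. w u x) \<le> 2" for x using main[of x] le1[of x] by linarith
 qed (use I wt in auto)
qed

lemma tensor_approximation:
 assumes S0: "off_diagonal S0" and V: "open V" "V \<subseteq> U" "fst ` S0 \<union> snd ` S0 \<subseteq> V"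
  and K: "continuous_on UNIV K" and K0: "\<And>z. z \<notin> S0 ==> K z = (0::real)"
 obtains S H kp where "off_diagonal S" "\<And>n::nat. tensor V (H n)" "\<And>n z. \<bar>H n z\<bar> \<le> kp" "\<And>n z. z \<notin> S ==> H n z = 0"
  "\<And>z. (\<lambda>n. H n z) \<longlonglongrightarrow> K z"
proof -
 have cS0: "compact S0" using S0 by (simp add: off_diagonal_def)
 define A where "A = fst ` S0 \<union> snd ` S0"
 have A: "compact A" "A \<subseteq> V" using V(3) cS0 unfolding A_def
  by (auto intro!: compact_Un compact_continuous_image continuous_intros)
 obtain e A' where e: "e > 0" "A' \<subseteq> V" "\<And>x. x \<in> A ==> cball x e \<subseteq> A'"
  by (rule compact_neighbourhood[OF A(1) V(1) A(2)]) blast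
 obtain \<rho>0 where \<rho>0: "\<rho>0 > 0" "\<And>z. z \<in> S0 ==> \<rho>0 \<le> norm (fst z - snd z)" using off_diagonal_gap[OF S0] by blast
 define et0 where "et0 = min e (\<rho>0 / 4)"
 have et0: "et0 > 0" "et0 \<le> e" "et0 \<le> \<rho>0 / 4" using e(1) \<rho>0(1) by (auto simp: et0_def)
 define et where "et = (\<lambda>n. et0 / real (Suc n))"
 have et: "et n > 0" "et n \<le> et0" "et \<longlonglongrightarrow> 0" for n
  using et0(1) lim_const_over_n[of et0, THEN LIMSEQ_Suc] by (auto simp: et_def field_simps)
 obtain kp0 where kp0: "kp0 > 0" "\<And>z. norm (K z) \<le> kp0" by (rule continuous_compact_support_bounded[OF K cS0 K0]) auto
 have "\<exists>I w. finite (I :: 'a set) \<and> (\<forall>u. w u \<in> test_functions (cball u (et n))) \<and> (\<forall>u x. 0 \<le> w u x) \<and>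
  (\<forall>x\<in>A. \<bar>(\<Sum>u\<in>I. w u x) - 1\<bar> \<le> et n) \<and> (\<forall>x. (\<Sum>u\<in>I. w u x) \<le> 2)" for n
  by (rule approximate_partition_of_unity[OF A(1) et(1)])
 then obtain I w where I: "\<And>n. finite (I n :: 'a set)" and wt: "\<And>n u. w n u \<in> test_functions (cball u (et n))"
  and w0: "\<And>n u x. 0 \<le> w n u x" and w1: "\<And>n x. x \<in> A ==> \<bar>(\<Sum>u\<in>I n. w n u x) - 1\<bar> \<le> et n" and w2: "\<And>n x. (\<Sum>u\<in>I n. w n u x) \<le> 2"
  by metis
 define s where "s = (\<lambda>n x. \<Sum>u\<in>I n. w n u x)"
 have s0: "0 \<le> s n x" "s n x \<le> 2" for n x using w2 by (auto simp: s_def intro: sum_nonneg w0)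
 have wz: "dist u x \<le> et n" if "w n u x \<noteq> 0" for n u x
 proof -
  have "x \<in> supp (w n u)" using that supp_superset[of x "w n u"] by blast
  then have "x \<in> cball u (et n)" using wt[of n u] by (auto simp only: test_functions_iff)
  then show ?thesis by simp
 qed
 define J where "J = (\<lambda>n. {p \<in> I n \<times> I n. K p \<noteq> 0})"
 have J: "finite (J n)" "p \<in> J n ==> p \<in> S0" for n p using I K0 by (auto simp: J_def)
 define H where "H = (\<lambda>n z. \<Sum>p\<in>J n. K p * (w n (fst p) (fst z) * w n (snd p) (snd z)))"
 have Heq: "H n z = (\<Sum>p\<in>I n \<times> I n. K p * (w n (fst p) (fst z) * w n (snd p) (snd z)))" for n z
  unfolding H_def J_def using I[of n] by (intro sum.mono_neutral_left) auto
 have ss: "(\<Sum>p\<in>I n \<times> I n. w n (fst p) (fst z) * w n (snd p) (snd z)) = s n (fst z) * s n (snd z)" for n z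
  unfolding s_def sum_product sum.cartesian_product by (simp add: split_beta')
 define S where "S = (\<lambda>q. fst q + snd q) ` (S0 \<times> (cball 0 et0 \<times> cball 0 et0))"
 have Sc: "compact S" unfolding S_def
  by (intro compact_continuous_image compact_Times cS0 compact_cball continuous_intros)
 have SI: "z \<in> S" if "p \<in> S0" "dist (fst p) (fst z) \<le> et0" "dist (snd p) (snd z) \<le> et0" for p z
  unfolding S_def using that
  by (intro image_eqI[of _ _ "(p, z - p)"]) (auto simp: dist_norm norm_minus_commute mem_Times_iff)
 have SE: "\<exists>p\<in>S0. dist (fst p) (fst z) \<le> et0 \<and> dist (snd p) (snd z) \<le> et0" if "z \<in> S" for z
  using that unfolding S_def by (auto simp: dist_norm) (metis add_diff_cancel_left' fst_conv snd_conv norm_minus_commute)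
 have Sod: "off_diagonal S"
  unfolding off_diagonal_def
 proof (intro conjI ballI Sc)
  fix z assume "z \<in> S"
  then obtain p where p: "p \<in> S0" "dist (fst p) (fst z) \<le> et0" "dist (snd p) (snd z) \<le> et0" using SE by blast
  have "fst p \<in> A" "snd p \<in> A" using p(1) by (auto simp: A_def)
  then have "fst z \<in> A'" "snd z \<in> A'" using e(3)[of "fst p"] e(3)[of "snd p"] p et0(2) by auto
  then show "fst z \<in> U" "snd z \<in> U" using e(2) V(2) by auto
  have "\<rho>0 \<le> norm (fst p - snd p)" by (rule \<rho>0(2)[OF p(1)])
  also have "\<dots> \<le> norm (fst z - snd z) + dist (fst p) (fst z) + dist (snd p) (snd z)" by norm
  finally show "fst z \<noteq> snd z" using p et0(3) \<rho>0(1) by auto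
 qed
 have Hb: "\<bar>H n z\<bar> \<le> 4 * kp0" for n z
 proof -
  have "\<bar>H n z\<bar> \<le> (\<Sum>p\<in>I n \<times> I n. \<bar>K p * (w n (fst p) (fst z) * w n (snd p) (snd z))\<bar>)" unfolding Heq by (rule sum_abs)
  also have "\<dots> \<le> (\<Sum>p\<in>I n \<times> I n. kp0 * (w n (fst p) (fst z) * w n (snd p) (snd z)))"
   using kp0 w0 by (intro sum_mono) (auto simp: abs_mult intro!: mult_right_mono)
  also have "\<dots> = kp0 * (s n (fst z) * s n (snd z))" by (simp only: sum_distrib_left[symmetric] ss)
  also have "\<dots> \<le> kp0 * (2 * 2)" using kp0(1) s0 by (intro mult_left_mono mult_mono) auto
  finally show ?thesis by simp
 qed
 have HS: "H n z = 0" if "z \<notin> S" for n z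
  unfolding H_def
 proof (intro sum.neutral ballI)
  fix p assume p: "p \<in> J n"
  show "K p * (w n (fst p) (fst z) * w n (snd p) (snd z)) = 0"
  proof (rule ccontr)
   assume "K p * (w n (fst p) (fst z) * w n (snd p) (snd z)) \<noteq> 0"
   then have "dist (fst p) (fst z) \<le> et n" "dist (snd p) (snd z) \<le> et n" by (auto intro: wz)
   then show False using SI[OF J(2)[OF p], of z] et(2)[of n] that by auto
  qed
 qed
 have Ht: "tensor V (H n)" for n
  unfolding tensor_def
 proof (rule exI[of _ "J n"], rule conjI[OF J(1)], rule exI[of _ K], rule exI[of _ "\<lambda>p. w n (fst p)"], rule exI[of _ "\<lambda>p. w n (snd p)"], intro conjI ballI)
  fix p assume "p \<in> J n"
  then have "fst p \<in> A" "snd p \<in> A" using J(2) by (auto simp: A_def)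
  then have "cball (fst p) (et n) \<subseteq> V" "cball (snd p) (et n) \<subseteq> V"
   using e(2,3) et(2)[of n] et0(2) subset_cball[of "et n" e] by (meson order_trans)+
  then show "w n (fst p) \<in> test_functions V" "w n (snd p) \<in> test_functions V"
   using test_functions_mono[OF _ wt] by blast+
 qed (simp add: H_def)
 have Hl: "(\<lambda>n. H n z) \<longlonglongrightarrow> K z" for z
 proof (rule tendstoI)
  fix ep :: real assume ep: "ep > 0"
  obtain d where d: "d > 0" "\<And>x y. dist x y < d ==> dist (K x) (K y) < ep / 8"
   using continuous_compact_support_uniform[OF K cS0 K0, of "ep / 8"] ep by auto
  have "\<forall>\<^sub>F n in sequentially. et n < d / 2" "\<forall>\<^sub>F n in sequentially. et n < ep / (6 * kp0)"
   using order_tendstoD(2)[OF et(3), of "d / 2"] order_tendstoD(2)[OF et(3), of "ep / (6 * kp0)"] d(1) ep kp0(1) by simp_all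
  then show "\<forall>\<^sub>F n in sequentially. dist (H n z) (K z) < ep"
  proof eventually_elim
   case (elim n)
   define W where "W = (\<lambda>p. w n (fst p) (fst z) * w n (snd p) (snd z))"
   have W0: "W p \<ge> 0" for p using w0 by (simp add: W_def)
   have sW: "(\<Sum>p\<in>I n \<times> I n. W p) = s n (fst z) * s n (snd z)" unfolding W_def by (rule ss)
   have t: "\<bar>K p * W p - K z * W p\<bar> \<le> ep / 8 * W p" for p
   proof (cases "W p = 0")
    case False
    then have "dist (fst p) (fst z) \<le> et n" "dist (snd p) (snd z) \<le> et n" by (auto simp: W_def intro: wz)
    moreover have "dist p z \<le> dist (fst p) (fst z) + dist (snd p) (snd z)"
     unfolding dist_prod_def by (rule sqrt_sum_squares_le_sum) auto
    ultimately have "dist p z < d" using elim(1) by linarith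
    then have "\<bar>K p - K z\<bar> \<le> ep / 8" using d(2)[of p z] by (simp add: dist_real_def)
    from mult_right_mono[OF this W0[of p]] show ?thesis
     using W0[of p] by (simp only: left_diff_distrib[symmetric] abs_mult abs_of_nonneg)
   qed simp
   have "\<bar>H n z - K z * (s n (fst z) * s n (snd z))\<bar> = \<bar>\<Sum>p\<in>I n \<times> I n. K p * W p - K z * W p\<bar>"
    unfolding Heq sum_subtractf sum_distrib_left[symmetric] sW by (simp add: W_def)
   also have "\<dots> \<le> (\<Sum>p\<in>I n \<times> I n. \<bar>K p * W p - K z * W p\<bar>)" by (rule sum_abs)
   also have "\<dots> \<le> (\<Sum>p\<in>I n \<times> I n. ep / 8 * W p)" by (intro sum_mono t)
   also have "\<dots> = ep / 8 * (s n (fst z) * s n (snd z))" unfolding sum_distrib_left[symmetric] sW ..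
   also have "\<dots> \<le> ep / 8 * (2 * 2)" using ep s0 by (intro mult_left_mono mult_mono) auto
   finally have 1: "\<bar>H n z - K z * (s n (fst z) * s n (snd z))\<bar> \<le> ep / 2" by simp
   have 2: "\<bar>K z * (s n (fst z) * s n (snd z)) - K z\<bar> < ep / 2"
   proof (cases "z \<in> S0")
    case True
    then have "fst z \<in> A" "snd z \<in> A" by (auto simp: A_def)
    then have d1: "\<bar>s n (fst z) - 1\<bar> \<le> et n" "\<bar>s n (snd z) - 1\<bar> \<le> et n" using w1 by (auto simp: s_def)
    have "s n (fst z) * s n (snd z) - 1 = (s n (fst z) - 1) * s n (snd z) + (s n (snd z) - 1)" by (simp add: algebra_simps)
    also have "\<bar>\<dots>\<bar> \<le> \<bar>s n (fst z) - 1\<bar> * s n (snd z) + \<bar>s n (snd z) - 1\<bar>"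
     using s0(1)[of n "snd z"] by (metis abs_mult abs_of_nonneg abs_triangle_ineq)
    also have "\<dots> \<le> et n * 2 + et n" using d1 s0[of n] by (intro add_mono mult_mono) auto
    finally have 3: "\<bar>s n (fst z) * s n (snd z) - 1\<bar> \<le> 3 * et n" by simp
    have "\<bar>K z * (s n (fst z) * s n (snd z)) - K z\<bar> = \<bar>K z\<bar> * \<bar>s n (fst z) * s n (snd z) - 1\<bar>"
     by (simp add: abs_mult[symmetric] algebra_simps)
    also have "\<dots> \<le> kp0 * (3 * et n)" using kp0 3 by (intro mult_mono) auto
    also have "\<dots> < ep / 2" using elim(2) kp0(1) by (simp add: field_simps)
    finally show ?thesis .
   qed (use ep in \<open>simp add: K0\<close>)
   show "dist (H n z) (K z) < ep" using 1 2 unfolding dist_real_def by linarith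
  qed
 qed
 show ?thesis by (rule that[OF Sod Ht Hb HS Hl])
qed

end

lemma AE_lborel_pair:
 assumes "AE x in lborel. P x"
 shows "AE z in (lborel :: ('a::euclidean_space \<times> 'b::euclidean_space) measure). P (fst z)"
  "AE z in (lborel :: ('b \<times> 'a) measure). P (snd z)"
proof -
 obtain N where N: "{x. \<not> P x} \<subseteq> N" "N \<in> null_sets lborel" using assms by (auto simp: eventually_ae_filter)
 have n: "N \<times> UNIV \<in> null_sets (lborel :: ('a \<times> 'b) measure)" "UNIV \<times> N \<in> null_sets (lborel :: ('b \<times> 'a) measure)"
  using N(2) unfolding lborel_prod[symmetric] null_sets_def by (auto simp: lborel.emeasure_pair_measure_Times)
 show "AE z in (lborel :: ('a \<times> 'b) measure). P (fst z)" by (rule AE_I'[OF n(1)]) (use N(1) in auto)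
 show "AE z in (lborel :: ('b \<times> 'a) measure). P (snd z)" by (rule AE_I'[OF n(2)]) (use N(1) in auto)
qed

lemma nn_integral_box_coordinate:
 fixes G :: "'a::euclidean_space => ennreal" and a :: "'a \<times> 'a => 'a"
 assumes [measurable]: "B \<in> sets borel" "G \<in> borel_measurable borel" and a: "a = fst \<or> a = snd"
 shows "(\<integral>\<^sup>+ z. indicator (B \<times> B) z * G (a z) \<partial>lborel) \<le> emeasure lborel B * (\<integral>\<^sup>+ u. G u \<partial>lborel)"
proof -
 have BB: "indicator (B \<times> B) z = (indicator B (fst z) * indicator B (snd z) :: ennreal)" for z
  by (auto simp: indicator_def mem_Times_iff)
 have m: "(\<lambda>z. indicator B (fst z) * indicator B (snd z) * G (a z)) \<in> borel_measurable borel"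
 proof -
  have "(\<lambda>z. indicator B (fst z) * indicator B (snd z) * G (a z)) \<in> borel_measurable (borel \<Otimes>\<^sub>M borel)"
   using a by (elim disjE; simp)
  then show ?thesis by (simp add: borel_prod)
 qed
 have le: "(\<integral>\<^sup>+ u. indicator B u * G u \<partial>lborel) \<le> (\<integral>\<^sup>+ u. G u \<partial>lborel)"
  by (intro nn_integral_mono) (auto simp: indicator_def)
 have "(\<integral>\<^sup>+ z. indicator (B \<times> B) z * G (a z) \<partial>lborel) = emeasure lborel B * (\<integral>\<^sup>+ u. indicator B u * G u \<partial>lborel)"
  unfolding BB nn_integral_lborel_pair[OF m]
  using a
 proof
  assume a: "a = fst"
  have "(\<integral>\<^sup>+ y. indicator B x * indicator B y * G x \<partial>lborel) = emeasure lborel B * (indicator B x * G x)" for x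
   by (subst mult.assoc, subst mult.left_commute) (simp add: nn_integral_multc)
  then show "(\<integral>\<^sup>+ x. \<integral>\<^sup>+ y. indicator B (fst (x, y)) * indicator B (snd (x, y)) * G (a (x, y)) \<partial>lborel \<partial>lborel) = emeasure lborel B * (\<integral>\<^sup>+ u. indicator B u * G u \<partial>lborel)"
   unfolding a by (simp add: nn_integral_cmult)
 next
  assume a: "a = snd"
  show "(\<integral>\<^sup>+ x. \<integral>\<^sup>+ y. indicator B (fst (x, y)) * indicator B (snd (x, y)) * G (a (x, y)) \<partial>lborel \<partial>lborel) = emeasure lborel B * (\<integral>\<^sup>+ u. indicator B u * G u \<partial>lborel)"
   unfolding a by (simp add: mult.assoc nn_integral_cmult nn_integral_multc)
 qed
 also have "\<dots> \<le> emeasure lborel B * (\<integral>\<^sup>+ u. G u \<partial>lborel)" by (intro mult_left_mono le) auto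
 finally show ?thesis .
qed

lemma quad_coordinates_integrable:
 fixes W :: "'a::euclidean_space \<times> 'a => real" and a a' :: "'a \<times> 'a => 'a"
 assumes W: "integrable lborel W" and B: "compact B" and a: "a = fst \<or> a = snd" "a' = fst \<or> a' = snd"
  and k: "k \<in> borel_measurable borel" "\<And>z. \<bar>k z\<bar> \<le> kp * indicator (B \<times> B) z"
 shows "integrable lborel (\<lambda>zz. k (fst zz) * k (snd zz) * W (a (fst zz), a' (snd zz)))"
proof -
 have Wm0: "W \<in> borel_measurable borel" using W by auto
 have [measurable]: "B \<in> sets borel" using B by (simp add: compact_imp_closed borel_closed)
 have am: "a \<in> borel_measurable borel" "a' \<in> borel_measurable borel"
  using a by (auto intro!: borel_measurable_continuous_onI continuous_intros simp: continuous_on_fst continuous_on_snd continuous_on_id)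
 have fs: "(fst :: ('a \<times> 'a) \<times> ('a \<times> 'a) => _) \<in> borel_measurable borel" "(snd :: ('a \<times> 'a) \<times> ('a \<times> 'a) => _) \<in> borel_measurable borel"
  using borel_measurable_continuous_onI[OF continuous_on_fst[OF continuous_on_id]] borel_measurable_continuous_onI[OF continuous_on_snd[OF continuous_on_id]] by auto
 have pm: "(\<lambda>zz. (a (fst zz), a' (snd zz))) \<in> borel_measurable borel"
  using measurable_compose[OF fs(1) am(1)] measurable_compose[OF fs(2) am(2)] unfolding borel_prod[symmetric, where ?'a = 'a and ?'b = 'a] by (intro measurable_Pair) (simp_all add: borel_prod)
 note Wm = measurable_compose[OF pm Wm0]
 have km: "(\<lambda>zz::('a \<times> 'a) \<times> ('a \<times> 'a). k (fst zz)) \<in> borel_measurable borel" "(\<lambda>zz::('a \<times> 'a) \<times> ('a \<times> 'a). k (snd zz)) \<in> borel_measurable borel"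
  using measurable_compose[OF fs(1) k(1)] measurable_compose[OF fs(2) k(1)] by simp_all
 define F where "F = (\<lambda>z. ennreal \<bar>W z\<bar>)"
 have Fm0: "F \<in> borel_measurable borel" using Wm0 by (simp add: F_def)
 have Fm: "F \<in> borel_measurable (borel \<Otimes>\<^sub>M borel)" using Fm0 by (simp add: borel_prod)
 have Fs: "(\<lambda>v. F (u, v)) \<in> borel_measurable borel" for u using measurable_compose[OF _ Fm, of "\<lambda>v. (u, v)"] by simp
 define G where "G = (\<lambda>u. \<integral>\<^sup>+ v. F (u, v) \<partial>lborel)"
 have Gm: "G \<in> borel_measurable borel"
  unfolding G_def using lborel.borel_measurable_nn_integral_fst[of F borel] Fm by (simp add: measurable_lborel1 cong: measurable_cong_sets sets_pair_measure_cong)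
 have fin: "(\<integral>\<^sup>+ u. G u \<partial>lborel) < \<infinity>"
  using W unfolding G_def by (subst nn_integral_lborel_pair[symmetric]) (auto simp: Fm0 F_def integrable_iff_bounded)
 let ?I = "indicator (B \<times> B) :: 'a \<times> 'a => ennreal"
 let ?E = "emeasure lborel B"
 have BBm: "B \<times> B \<in> sets borel" using B by (simp add: compact_Times compact_imp_closed borel_closed)
 have Im: "?I \<in> borel_measurable borel" using BBm by simp
 have kp0: "0 \<le> kp \<or> (\<forall>z. k z = 0)"
 proof (cases "kp \<ge> 0")
  case False
  then have "kp * indicator (B \<times> B) z \<le> 0" for z by (simp add: mult_nonpos_nonneg)
  from order_trans[OF k(2) this] show ?thesis by simp
 qed simp
 show ?thesis
  using kp0
 proof
  assume kp: "0 \<le> kp"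
  have m1: "(\<lambda>zz. ?I (fst zz) * (?I (snd zz) * F (a (fst zz), a' (snd zz)))) \<in> borel_measurable borel"
   using measurable_compose[OF fs(1) Im] measurable_compose[OF fs(2) Im] measurable_compose[OF pm Fm0] by simp
  have "(\<integral>\<^sup>+ zz. ennreal (norm (k (fst zz) * k (snd zz) * W (a (fst zz), a' (snd zz)))) \<partial>lborel)
   \<le> (\<integral>\<^sup>+ zz. ennreal (kp * kp) * (?I (fst zz) * (?I (snd zz) * F (a (fst zz), a' (snd zz)))) \<partial>lborel)"
  proof (intro nn_integral_mono)
   fix zz :: "('a \<times> 'a) \<times> ('a \<times> 'a)"
   have "norm (k (fst zz) * k (snd zz) * W (a (fst zz), a' (snd zz))) \<le> (kp * indicator (B \<times> B) (fst zz)) * (kp * indicator (B \<times> B) (snd zz)) * \<bar>W (a (fst zz), a' (snd zz))\<bar>"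
    unfolding real_norm_def abs_mult using k(2) kp by (intro mult_mono mult_nonneg_nonneg) auto
   then have "ennreal (norm (k (fst zz) * k (snd zz) * W (a (fst zz), a' (snd zz)))) \<le> ennreal ((kp * indicator (B \<times> B) (fst zz)) * (kp * indicator (B \<times> B) (snd zz)) * \<bar>W (a (fst zz), a' (snd zz))\<bar>)"
    by (rule ennreal_leI)
   also have "\<dots> = ennreal (kp * kp) * (?I (fst zz) * (?I (snd zz) * F (a (fst zz), a' (snd zz))))"
    using kp by (auto simp: F_def indicator_def ennreal_mult)
   finally show "ennreal (norm (k (fst zz) * k (snd zz) * W (a (fst zz), a' (snd zz)))) \<le> ennreal (kp * kp) * (?I (fst zz) * (?I (snd zz) * F (a (fst zz), a' (snd zz))))" .
  qed
  also have "\<dots> = ennreal (kp * kp) * (\<integral>\<^sup>+ zz. ?I (fst zz) * (?I (snd zz) * F (a (fst zz), a' (snd zz))) \<partial>lborel)"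
   using m1 by (intro nn_integral_cmult) simp
  also have "(\<integral>\<^sup>+ zz. ?I (fst zz) * (?I (snd zz) * F (a (fst zz), a' (snd zz))) \<partial>lborel)
   = (\<integral>\<^sup>+ z. \<integral>\<^sup>+ z'. ?I z * (?I z' * F (a z, a' z')) \<partial>lborel \<partial>lborel)"
   by (subst nn_integral_lborel_pair[OF m1]) simp
  also have "\<dots> = (\<integral>\<^sup>+ z. ?I z * (\<integral>\<^sup>+ z'. ?I z' * F (a z, a' z') \<partial>lborel) \<partial>lborel)"
   using measurable_compose[OF am(2) Fs] Im by (intro nn_integral_cong nn_integral_cmult) simp
  also have "\<dots> \<le> (\<integral>\<^sup>+ z. ?E * (?I z * G (a z)) \<partial>lborel)"
  proof (intro nn_integral_mono)
   fix z
   have "?I z * (\<integral>\<^sup>+ z'. ?I z' * F (a z, a' z') \<partial>lborel) \<le> ?I z * (?E * G (a z))"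
    unfolding G_def by (intro mult_left_mono nn_integral_box_coordinate Fs a) auto
   then show "?I z * (\<integral>\<^sup>+ z'. ?I z' * F (a z, a' z') \<partial>lborel) \<le> ?E * (?I z * G (a z))" by (simp only: mult.left_commute)
  qed
  also have "\<dots> = ?E * (\<integral>\<^sup>+ z. ?I z * G (a z) \<partial>lborel)"
   using measurable_compose[OF am(1) Gm] Im by (intro nn_integral_cmult) simp
  also have "\<dots> \<le> ?E * (?E * (\<integral>\<^sup>+ u. G u \<partial>lborel))"
   by (intro mult_left_mono nn_integral_box_coordinate Gm a) auto
  finally have bound: "(\<integral>\<^sup>+ zz. ennreal (norm (k (fst zz) * k (snd zz) * W (a (fst zz), a' (snd zz)))) \<partial>lborel) \<le> ennreal (kp * kp) * (?E * (?E * (\<integral>\<^sup>+ u. G u \<partial>lborel)))"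
   by (simp add: mult_left_mono)
  also have "\<dots> < \<infinity>" using fin emeasure_compact_finite[OF B] by (simp add: ennreal_mult_less_top)
  finally show ?thesis using km Wm by (intro integrableI_bounded) auto
 next
  assume "\<forall>z. k z = 0"
  then have z: "k z = 0" for z by blast
  show ?thesis unfolding z by simp
 qed
qed

definition marginal_difference :: "('a::euclidean_space \<times> 'a => real) => 'a => real" where
 "marginal_difference k x = (LINT y|lborel. k (x, y)) - (LINT y|lborel. k (y, x))"

lemma integral_marginal_difference:
 fixes k :: "'a::euclidean_space \<times> 'a => real"
 assumes h: "integrable lborel h" and B: "compact B" and k: "k \<in> borel_measurable borel" "\<And>z. \<bar>k z\<bar> \<le> kp * indicator (B \<times> B) z"
 shows "(LINT z|lborel. k z * (h (fst z) - h (snd z))) = (LINT x|lborel. marginal_difference k x * h x)"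
  "integrable lborel (\<lambda>z. k z * (h (fst z) - h (snd z)))"
proof -
 have [measurable]: "B \<in> sets borel" using B by (simp add: compact_imp_closed borel_closed)
 have hm [measurable]: "h \<in> borel_measurable borel" using h by auto
 have km [measurable]: "k \<in> borel_measurable (borel \<Otimes>\<^sub>M borel)" using k(1) by (simp add: borel_prod)
 have kb: "\<bar>k z\<bar> \<le> \<bar>kp\<bar> * indicator B (fst z)" "\<bar>k z\<bar> \<le> \<bar>kp\<bar> * indicator B (snd z)" for z
  using k(2)[of z] by (cases "z \<in> B \<times> B"; auto simp: mem_Times_iff)+
 have iB1: "integrable lborel (indicator B :: 'a => real)" using emeasure_compact_finite[OF B] by simp
 have "integrable (lborel \<Otimes>\<^sub>M lborel) (case_prod (\<lambda>x y. \<bar>h x\<bar> * (\<bar>kp\<bar> * indicator B y)))"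
  by (rule lborel_pair.integrable_dominated_product[of _ "\<lambda>x. \<bar>h x\<bar>" "\<lambda>y. \<bar>kp\<bar> * indicator B y"]) (use h iB1 in auto)
 then have d1: "integrable lborel (\<lambda>z. \<bar>h (fst z)\<bar> * (\<bar>kp\<bar> * indicator B (snd z)))" by (simp add: lborel_prod split_beta')
 have "integrable (lborel \<Otimes>\<^sub>M lborel) (case_prod (\<lambda>x y. (\<bar>kp\<bar> * indicator B x) * \<bar>h y\<bar>))"
  by (rule lborel_pair.integrable_dominated_product[of _ "\<lambda>y. \<bar>kp\<bar> * indicator B y" "\<lambda>x. \<bar>h x\<bar>"]) (use h iB1 in auto)
 then have d2: "integrable lborel (\<lambda>z. (\<bar>kp\<bar> * indicator B (fst z)) * \<bar>h (snd z)\<bar>)" by (simp add: lborel_prod split_beta')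
 have hfs: "(\<lambda>z. k z * h (fst z)) \<in> borel_measurable borel" "(\<lambda>z. k z * h (snd z)) \<in> borel_measurable borel"
 proof -
  have "(\<lambda>z. k z * h (fst z)) \<in> borel_measurable (borel \<Otimes>\<^sub>M borel)" "(\<lambda>z. k z * h (snd z)) \<in> borel_measurable (borel \<Otimes>\<^sub>M borel)" by measurable
  then show "(\<lambda>z. k z * h (fst z)) \<in> borel_measurable borel" "(\<lambda>z. k z * h (snd z)) \<in> borel_measurable borel" by (simp_all add: borel_prod)
 qed
 have i1: "integrable lborel (\<lambda>z. k z * h (fst z))"
 proof (rule LINT_bound[OF d1])
  have "\<bar>k z\<bar> * \<bar>h (fst z)\<bar> \<le> (\<bar>kp\<bar> * indicator B (snd z)) * \<bar>h (fst z)\<bar>" for z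
   by (intro mult_right_mono kb) auto
  then show "AE z in lborel. norm (k z * h (fst z)) \<le> norm (\<bar>h (fst z)\<bar> * (\<bar>kp\<bar> * indicator B (snd z)))" by (intro AE_I2) (simp add: abs_mult mult.commute)
 qed (use hfs in simp)
 have i2: "integrable lborel (\<lambda>z. k z * h (snd z))"
 proof (rule LINT_bound[OF d2])
  have "\<bar>k z\<bar> * \<bar>h (snd z)\<bar> \<le> (\<bar>kp\<bar> * indicator B (fst z)) * \<bar>h (snd z)\<bar>" for z
   by (intro mult_right_mono kb) auto
  then show "AE z in lborel. norm (k z * h (snd z)) \<le> norm ((\<bar>kp\<bar> * indicator B (fst z)) * \<bar>h (snd z)\<bar>)" by (intro AE_I2) (simp add: abs_mult mult.commute)
 qed (use hfs in simp)
 have c1: "integrable (lborel \<Otimes>\<^sub>M lborel) (case_prod (\<lambda>x y. k (x, y) * h x))" and c2: "integrable (lborel \<Otimes>\<^sub>M lborel) (case_prod (\<lambda>x y. k (x, y) * h y))"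
  using i1 i2 by (simp_all add: lborel_prod split_beta')
 have e1: "(LINT z|lborel. k z * h (fst z)) = (LINT x|lborel. (LINT y|lborel. k (x, y)) * h x)"
  using lborel_pair.integral_fst[OF c1] by (simp add: lborel_prod split_beta')
 have e2: "(LINT z|lborel. k z * h (snd z)) = (LINT y|lborel. (LINT x|lborel. k (x, y)) * h y)"
  using lborel_pair.integral_snd[OF c2] by (simp add: lborel_prod split_beta')
 have f1: "integrable lborel (\<lambda>x. (LINT y|lborel. k (x, y)) * h x)" using lborel_pair.integrable_fst[OF c1] by simp
 have f2: "integrable lborel (\<lambda>y. (LINT x|lborel. k (x, y)) * h y)" using lborel_pair.integrable_snd[OF c2] by simp
 show "integrable lborel (\<lambda>z. k z * (h (fst z) - h (snd z)))"
  unfolding right_diff_distrib by (intro Bochner_Integration.integrable_diff i1 i2)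
 show "(LINT z|lborel. k z * (h (fst z) - h (snd z))) = (LINT x|lborel. marginal_difference k x * h x)"
  unfolding right_diff_distrib marginal_difference_def left_diff_distrib
  by (simp only: Bochner_Integration.integral_diff[OF i1 i2] Bochner_Integration.integral_diff[OF f1 f2] e1 e2)
qed

context log_field
begin

lemma energy:
 fixes p q :: "'a => real"
 assumes p: "p \<in> borel_measurable borel" "\<And>x. \<bar>p x\<bar> \<le> Mp" and q: "q \<in> borel_measurable borel" "\<And>x. \<bar>q x\<bar> \<le> Mq"
 shows "integrable lborel (pot q)" "(LINT x|lborel. p x * pot q x) = (LINT z|lborel. p (fst z) * q (snd z) * CU z)"
  "integrable lborel (\<lambda>z. p (fst z) * q (snd z) * CU z)" "\<bar>LINT x|lborel. p x * pot q x\<bar> \<le> Mp * Mq * (LINT z|lborel. \<bar>CU z\<bar>)"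
proof -
 have gen: "integrable lborel (\<lambda>z. p (fst z) * q (snd z) * CU z)"
  if [measurable]: "p \<in> borel_measurable borel" and pb: "\<And>x. \<bar>p x\<bar> \<le> Mp" for p :: "'a => real" and Mp
 proof (rule LINT_bound[OF integrable_mult_right[OF CU_integrable, of "Mp * Mq"]])
  note q(1)[measurable]
  have "(\<lambda>z. p (fst z) * q (snd z) * CU z) \<in> borel_measurable (borel \<Otimes>\<^sub>M borel)" by measurable
  then show "(\<lambda>z. p (fst z) * q (snd z) * CU z) \<in> borel_measurable lborel" by (simp add: borel_prod)
  have "\<bar>p (fst z) * q (snd z) * CU z\<bar> \<le> (Mp * Mq) * \<bar>CU z\<bar>" for z
   unfolding abs_mult using pb[of "fst z"] q(2)[of "snd z"] by (intro mult_mono mult_nonneg_nonneg) (auto intro: order_trans[OF abs_ge_zero])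
  also have "(Mp * Mq) * \<bar>CU z\<bar> \<le> \<bar>(Mp * Mq) * CU z\<bar>" for z
   unfolding abs_mult[of "Mp * Mq"] by (intro mult_right_mono) auto
  finally show "AE z in lborel. norm (p (fst z) * q (snd z) * CU z) \<le> norm ((Mp * Mq) * CU z)"
   by (intro AE_I2) simp
 qed
 show i: "integrable lborel (\<lambda>z. p (fst z) * q (snd z) * CU z)" by (rule gen[OF p])
 have c: "integrable (lborel \<Otimes>\<^sub>M lborel) (case_prod (\<lambda>x y. p x * (CU (x, y) * q y)))"
  using i by (simp add: lborel_prod split_beta' mult_ac)
 show e: "(LINT x|lborel. p x * pot q x) = (LINT z|lborel. p (fst z) * q (snd z) * CU z)"
  using lborel_pair.integral_fst[OF c] by (simp add: lborel_prod split_beta' mult_ac pot_def)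
 have c1: "integrable (lborel \<Otimes>\<^sub>M lborel) (case_prod (\<lambda>x y. CU (x, y) * q y))"
  using gen[of "\<lambda>x. 1" 1] by (simp add: lborel_prod split_beta' mult_ac)
 show "integrable lborel (pot q)" using lborel_pair.integrable_fst[OF c1] by (simp add: pot_def[abs_def])
 have "norm (LINT z|lborel. p (fst z) * q (snd z) * CU z) \<le> (LINT z|lborel. norm (p (fst z) * q (snd z) * CU z))" by (rule integral_norm_bound)
 also have "\<dots> \<le> (LINT z|lborel. (Mp * Mq) * \<bar>CU z\<bar>)"
 proof (rule integral_mono[OF integrable_norm[OF i]])
  show "integrable lborel (\<lambda>z. (Mp * Mq) * \<bar>CU z\<bar>)" using CU_integrable by simp
  show "norm (p (fst z) * q (snd z) * CU z) \<le> (Mp * Mq) * \<bar>CU z\<bar>" for z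
   unfolding real_norm_def abs_mult using p(2)[of "fst z"] q(2)[of "snd z"] by (intro mult_mono mult_nonneg_nonneg) (auto intro: order_trans[OF abs_ge_zero])
 qed
 finally show "\<bar>LINT x|lborel. p x * pot q x\<bar> \<le> Mp * Mq * (LINT z|lborel. \<bar>CU z\<bar>)" by (simp add: e)
qed

lemma Q_split:
 assumes S: "off_diagonal S" and k: "continuous_on UNIV k" "\<And>z. z \<notin> S ==> k z = 0" and \<rho>: "\<rho> \<in> test_functions U" "\<And>x. \<bar>\<rho> x\<bar> \<le> m"
  and R: "(\<integral>\<^sup>+ zz. ennreal (\<bar>k (fst zz)\<bar> * \<bar>k (snd zz)\<bar> * expr2 (b * D (fst zz) (snd zz))) \<partial>lborel) \<le> ennreal R" "R \<ge> 0"
  and close: "\<And>x. \<bar>marginal_difference k x - \<rho> x\<bar> \<le> ep"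
 shows "Q (\<lambda>z. k z / P z) \<rho> \<le> R + b * ((2 * m + ep) * ep * (LINT z|lborel. \<bar>CU z\<bar>))"
proof -
 have \<rho>U: "\<rho> \<in> test_functions UNIV" by (rule test_functions_mono[OF _ \<rho>(1)]) simp
 have \<rho>m: "\<rho> \<in> borel_measurable borel" using \<rho>(1) by (rule test_functions_borel)
 have cS: "compact S" using S by (simp add: off_diagonal_def)
 have km: "k \<in> borel_measurable borel" by (rule borel_measurable_continuous_onI[OF k(1)])
 obtain kp where kp: "kp > 0" "\<And>z. norm (k z) \<le> kp" by (rule continuous_compact_support_bounded[OF k(1) cS k(2)]) auto
 define B where "B = fst ` S \<union> snd ` S"
 have B: "compact B" using cS unfolding B_def by (auto intro!: compact_Un compact_continuous_image continuous_intros)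
 have kb: "\<bar>k z\<bar> \<le> kp * indicator (B \<times> B) z" for z
  using kp(2)[of z] k(2)[of z] by (cases "z \<in> S") (auto simp: B_def indicator_def mem_Times_iff)
 define p where "p = marginal_difference k"
 have pm: "p \<in> borel_measurable borel"
 proof -
  have km': "k \<in> borel_measurable (borel \<Otimes>\<^sub>M borel)" using km by (simp add: borel_prod)
  have "(\<lambda>z. k (snd z, fst z)) \<in> borel_measurable (borel \<Otimes>\<^sub>M borel)"
   by (rule measurable_compose[OF _ km']) measurable
  then have "(\<lambda>x. LINT y|lborel. k (y, x)) \<in> borel_measurable borel"
   using lborel.borel_measurable_lebesgue_integral[of "\<lambda>x y. k (y, x)" borel] by (simp add: split_beta' cong: measurable_cong_sets sets_pair_measure_cong)
  moreover have "(\<lambda>x. LINT y|lborel. k (x, y)) \<in> borel_measurable borel"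
   using km' lborel.borel_measurable_lebesgue_integral[of "\<lambda>x y. k (x, y)" borel] by (simp add: split_beta' cong: measurable_cong_sets sets_pair_measure_cong)
  ultimately show ?thesis unfolding p_def marginal_difference_def by simp
 qed
 have pb: "\<bar>p x\<bar> \<le> m + ep" "\<bar>p x - \<rho> x\<bar> \<le> ep" for x using close[of x] \<rho>(2)[of x] by (auto simp: p_def)
 have KP: "k z / P z * P z = k z" for z by (simp add: P_def)
 have 1: "(LINT z|lborel. k z * (pot \<rho> (fst z) - pot \<rho> (snd z))) = (LINT x|lborel. p x * pot \<rho> x)"
  unfolding p_def by (rule integral_marginal_difference(1)[OF energy(1)[OF pm pb(1) \<rho>m \<rho>(2)] B km kb])
 have Di: "integrable lborel (\<lambda>zz. k (fst zz) * k (snd zz) * D (fst zz) (snd zz))"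
  unfolding D_def right_diff_distrib distrib_left
  by (intro Bochner_Integration.integrable_diff Bochner_Integration.integrable_add quad_coordinates_integrable[OF CU_integrable B _ _ km kb]) auto
 have sec: "AE x in lborel. integrable lborel (\<lambda>y. CU (x, y))"
  using lborel_pair.AE_integrable_fst[of "\<lambda>x y. CU (x, y)"] CU_integrable by (simp add: lborel_prod split_beta')
 have inner: "AE z in lborel. (LINT z'|lborel. k z * k z' * D z z') = k z * (pot p (fst z) - pot p (snd z))"
  using AE_lborel_pair[OF sec, where ?'b = 'a]
 proof eventually_elim
  case (elim z)
  have h: "integrable lborel (\<lambda>u. CU (fst z, u) - CU (snd z, u))" using elim by (intro Bochner_Integration.integrable_diff)
  have "(LINT z'|lborel. k z * k z' * D z z') = k z * (LINT z'|lborel. k z' * ((CU (fst z, fst z') - CU (snd z, fst z')) - (CU (fst z, snd z') - CU (snd z, snd z'))))"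
   unfolding integral_mult_right_zero[symmetric] by (intro LINT_cong) (simp add: D_def algebra_simps)
  also have "(LINT z'|lborel. k z' * ((CU (fst z, fst z') - CU (snd z, fst z')) - (CU (fst z, snd z') - CU (snd z, snd z')))) = (LINT u|lborel. p u * (CU (fst z, u) - CU (snd z, u)))"
   unfolding p_def by (rule integral_marginal_difference(1)[OF h B km kb])
  also have "\<dots> = (LINT u|lborel. CU (fst z, u) * p u - CU (snd z, u) * p u)" by (simp add: algebra_simps)
  also have "\<dots> = pot p (fst z) - pot p (snd z)"
   unfolding pot_def
  proof (rule Bochner_Integration.integral_diff)
   have i: "integrable lborel (\<lambda>u. CU (x, u) * p u)" if x: "integrable lborel (\<lambda>u. CU (x, u))" for x
   proof (rule LINT_bound[OF integrable_mult_right[OF x, of "m + ep"]])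
    show "(\<lambda>u. CU (x, u) * p u) \<in> borel_measurable lborel" using borel_measurable_integrable[OF x] pm by simp
    have "\<bar>CU (x, u) * p u\<bar> \<le> \<bar>(m + ep) * CU (x, u)\<bar>" for u
     unfolding abs_mult using pb(1)[of u] by (subst mult.commute) (intro mult_right_mono, auto)
    then show "AE u in lborel. norm (CU (x, u) * p u) \<le> norm ((m + ep) * CU (x, u))" by simp
   qed
   show "integrable lborel (\<lambda>u. CU (fst z, u) * p u)" "integrable lborel (\<lambda>u. CU (snd z, u) * p u)" using elim by (auto intro: i)
  qed
  finally show ?case .
 qed
 have 2: "(LINT zz|lborel. k (fst zz) * k (snd zz) * D (fst zz) (snd zz)) = (LINT x|lborel. p x * pot p x)"
 proof -
  have c: "integrable (lborel \<Otimes>\<^sub>M lborel) (case_prod (\<lambda>z z'. k z * k z' * D z z'))" using Di by (simp add: lborel_prod split_beta')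
  have "(LINT zz|lborel. k (fst zz) * k (snd zz) * D (fst zz) (snd zz)) = (LINT z|lborel. LINT z'|lborel. k z * k z' * D z z')"
   using lborel_pair.integral_fst[OF c] by (simp add: lborel_prod split_beta')
  also have "\<dots> = (LINT z|lborel. k z * (pot p (fst z) - pot p (snd z)))"
   using lborel_pair.integrable_fst[OF c] integral_marginal_difference(2)[OF energy(1)[OF pm pb(1) pm pb(1)] B km kb] inner
   by (intro integral_cong_AE) (auto simp del: integrable_fst)
  also have "\<dots> = (LINT x|lborel. p x * pot p x)"
   unfolding p_def[symmetric] by (subst integral_marginal_difference(1)[OF energy(1)[OF pm pb(1) pm pb(1)] B km kb]) (simp add: p_def)
  finally show ?thesis .
 qed
 let ?r = "\<lambda>zz. k (fst zz) * k (snd zz) * expr2 (b * D (fst zz) (snd zz))"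
 have km2: "(\<lambda>zz::('a \<times> 'a) \<times> ('a \<times> 'a). k (fst zz)) \<in> borel_measurable borel" "(\<lambda>zz::('a \<times> 'a) \<times> ('a \<times> 'a). k (snd zz)) \<in> borel_measurable borel"
  by (intro borel_measurable_continuous_onI continuous_on_compose2[OF k(1)] continuous_intros; simp)+
 have rm: "?r \<in> borel_measurable borel" using km2 D_measurable unfolding expr2_def by simp
 have rn: "(\<integral>\<^sup>+ zz. ennreal (norm (?r zz)) \<partial>lborel) \<le> ennreal R" using R(1) by (simp add: abs_mult expr2_nonneg)
 have ri: "integrable lborel ?r"
  using rm order_le_less_trans[OF rn] by (intro integrableI_bounded) auto
 have rR: "(LINT zz|lborel. ?r zz) \<le> R"
 proof -
  have "ennreal (LINT zz|lborel. ?r zz) \<le> (\<integral>\<^sup>+ zz. ennreal (norm (?r zz)) \<partial>lborel)"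
   by (rule integral_le_nn_integral[OF ri]) (auto intro!: ennreal_leI)
  then show ?thesis using rn R(2) by (meson ennreal_le_iff order_trans)
 qed
 have "(LINT zz|lborel. k (fst zz) * k (snd zz) * (exp (b * D (fst zz) (snd zz)) - 1))
  = (LINT zz|lborel. ?r zz + b * (k (fst zz) * k (snd zz) * D (fst zz) (snd zz)))"
  by (intro LINT_cong) (simp add: expr2_def algebra_simps)
 also have "\<dots> = (LINT zz|lborel. ?r zz) + b * (LINT x|lborel. p x * pot p x)"
  using Bochner_Integration.integral_add[OF ri integrable_mult_right[OF Di, of b]] by (simp add: 2)
 finally have "Q (\<lambda>z. k z / P z) \<rho> = (LINT zz|lborel. ?r zz) + b * ((LINT x|lborel. p x * pot p x) - 2 * (LINT x|lborel. p x * pot \<rho> x) + (LINT x|lborel. \<rho> x * pot \<rho> x))"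
  unfolding Q_def KP 1 cov_pot[OF \<rho>U \<rho>U] by (simp add: algebra_simps)
 moreover have "(LINT x|lborel. p x * pot p x) - 2 * (LINT x|lborel. p x * pot \<rho> x) + (LINT x|lborel. \<rho> x * pot \<rho> x) \<le> (2 * m + ep) * ep * (LINT z|lborel. \<bar>CU z\<bar>)"
 proof -
  have dm: "(\<lambda>x. p x - \<rho> x) \<in> borel_measurable borel" using pm \<rho>m by simp
  note pp = energy(2,3)[OF pm pb(1) pm pb(1)] and pr = energy(2,3)[OF pm pb(1) \<rho>m \<rho>(2)] and rr = energy(2,3)[OF \<rho>m \<rho>(2) \<rho>m \<rho>(2)]
  note pd = energy(2-4)[OF pm pb(1) dm pb(2)] and dr = energy(2-4)[OF dm pb(2) \<rho>m \<rho>(2)]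
  have a: "(LINT x|lborel. p x * pot p x) - (LINT x|lborel. p x * pot \<rho> x) = (LINT x|lborel. p x * pot (\<lambda>x. p x - \<rho> x) x)"
   unfolding pp(1) pr(1) pd(1) Bochner_Integration.integral_diff[OF pp(2) pr(2), symmetric] by (simp add: algebra_simps)
  have c: "(LINT x|lborel. p x * pot \<rho> x) - (LINT x|lborel. \<rho> x * pot \<rho> x) = (LINT x|lborel. (p x - \<rho> x) * pot \<rho> x)"
   unfolding pr(1) rr(1) dr(1) Bochner_Integration.integral_diff[OF pr(2) rr(2), symmetric] by (simp add: algebra_simps)
  have "(LINT x|lborel. p x * pot (\<lambda>x. p x - \<rho> x) x) - (LINT x|lborel. (p x - \<rho> x) * pot \<rho> x) \<le> (m + ep) * ep * (LINT z|lborel. \<bar>CU z\<bar>) + ep * m * (LINT z|lborel. \<bar>CU z\<bar>)"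
   using pd(3) dr(3) by linarith
  also have "\<dots> = (2 * m + ep) * ep * (LINT z|lborel. \<bar>CU z\<bar>)" by (simp add: algebra_simps)
  finally show ?thesis using a c by linarith
 qed
 ultimately show ?thesis using rR b(1) by (simp add: add_mono mult_left_mono)
qed

end

section \<open>Kernels approximating a derivative\<close>

definition gradient :: "('a::euclidean_space => real) => 'a => 'a" where
 "gradient f x = (\<Sum>b\<in>Basis. partials [b] f x *\<^sub>R b)"

lemma inner_gradient: "v \<bullet> gradient f x = (\<Sum>b\<in>Basis. (v \<bullet> b) * partials [b] f x)"
 by (simp add: gradient_def inner_sum_right mult.commute)

lemma uniformly_differentiable:
 fixes f :: "'a::euclidean_space => real"
 assumes f: "f \<in> test_functions V" and e: "e > 0"
 shows "\<exists>d>0. \<forall>x h. norm h < d \<longrightarrow> \<bar>f (x + h) - f x - h \<bullet> gradient f x\<bar> \<le> e * norm h"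
proof -
 have "continuous_on UNIV (partials [b] f)" if "b \<in> Basis" for b
  by (rule test_functions_continuous[OF test_functions_partials[OF f]]) (use that in simp)
 then have c: "continuous_on UNIV (gradient f)"
  unfolding gradient_def by (intro continuous_intros) auto
 have z: "gradient f x = 0" if "x \<notin> supp f" for x
 proof -
  have "partials [b] f x = 0" if "b \<in> Basis" for b
   using partials_eq_0_outside[where bs = "[b]", OF closed_supp supp_superset \<open>x \<notin> supp f\<close>] by simp
  then show ?thesis by (simp add: gradient_def)
 qed
 have cs: "compact (supp f)" using f by (simp add: test_functions_iff)
 from continuous_compact_support_uniform[OF c cs z e]
 obtain d where d: "d > 0" "\<And>x y. dist x y < d ==> dist (gradient f x) (gradient f y) < e" by blast
 have der: "(f has_derivative (\<lambda>v. v \<bullet> gradient f x)) (at x within S)" for x S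
  using smooth_has_derivative[OF test_functions_smooth[OF f], of x] unfolding inner_gradient by (rule has_derivative_at_withinI)
 show ?thesis
 proof (intro exI[of _ d] conjI allI impI d)
  fix x h :: 'a assume h: "norm h < d"
  have "norm (f (x + h) - f x - (x + h - x) \<bullet> gradient f x) \<le> norm (x + h - x) * e"
  proof (rule differentiable_bound_linearization[where S = "ball x d" and f' = "\<lambda>x v. v \<bullet> gradient f x"])
   show "x + t *\<^sub>R (x + h - x) \<in> ball x d" if "t \<in> {0..1}" for t
   proof -
    have "\<bar>t\<bar> * norm h \<le> 1 * norm h" using that by (intro mult_right_mono) auto
    then show ?thesis using h by (simp add: dist_norm)
   qed
   show "onorm ((\<lambda>v. v \<bullet> gradient f y) - (\<lambda>v. v \<bullet> gradient f x)) \<le> e" if "y \<in> ball x d" for y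
   proof (rule onorm_le)
    fix v
    have "norm (v \<bullet> (gradient f y - gradient f x)) \<le> norm v * norm (gradient f y - gradient f x)"
     unfolding real_norm_def by (rule Cauchy_Schwarz_ineq2)
    also have "\<dots> \<le> norm v * e" using d(2)[of y x] that by (intro mult_left_mono) (auto simp: dist_norm norm_minus_commute)
    finally show "norm (((\<lambda>v. v \<bullet> gradient f y) - (\<lambda>v. v \<bullet> gradient f x)) v) \<le> e * norm v"
     by (simp add: inner_diff_right mult.commute)
   qed
  qed (use d(1) in \<open>auto intro: der\<close>)
  then show "\<bar>f (x + h) - f x - h \<bullet> gradient f x\<bar> \<le> e * norm h" by (simp add: mult.commute)
 qed
qed

context log_field
begin

definition center :: 'a where "center = (LINT w|lborel. \<phi> w *\<^sub>R w)"

definition ker :: "('a => real) => 'a => real => 'a \<times> 'a => real" where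
 "ker f e r z = f (fst z) * (4 / r) ^ DIM('a) * \<phi> ((4 / r) *\<^sub>R (fst z - snd z) - 4 *\<^sub>R e + center) / r"

lemma phi_continuous: "continuous_on UNIV \<phi>" using test_functions_continuous[OF phi(1)] .

lemma phi_integrable: "integrable lborel \<phi>" using test_functions_integrable[OF phi(1)] .

lemma phi_weighted_integrable:
 fixes h :: "'a => 'b::{banach, second_countable_topology}"
 assumes "continuous_on UNIV h" shows "integrable lborel (\<lambda>w. \<phi> w *\<^sub>R h w)"
 by (rule integrable_continuous_compact_support[where S = "cball 0 1"])
  (auto intro!: continuous_on_scaleR phi_continuous assms simp: phi(4))

lemma norm_center: "norm center \<le> 1"
proof -
 have "norm center \<le> (LINT w|lborel. norm (\<phi> w *\<^sub>R w))" unfolding center_def by (rule integral_norm_bound)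
 also have "\<dots> \<le> (LINT w|lborel. \<phi> w)"
 proof (rule integral_mono'[OF phi_integrable])
  fix w
  show "norm (\<phi> w *\<^sub>R w) \<le> \<phi> w"
   using phi(4)[of w] phi(2)[of w] mult_left_mono[of "norm w" 1 "\<phi> w"] by (cases "norm w \<ge> 1") auto
 qed (rule phi(2))
 finally show ?thesis using phi(3) by simp
qed

lemma ker_support:
 assumes r: "r > 0" and e: "norm e = 1" and nz: "ker f e r z \<noteq> 0"
 shows "f (fst z) \<noteq> 0" "r / 2 \<le> norm (fst z - snd z)" "norm (fst z - snd z) \<le> 3 / 2 * r"
proof -
 define w where "w = (4 / r) *\<^sub>R (fst z - snd z) - 4 *\<^sub>R e + center"
 show "f (fst z) \<noteq> 0" using nz by (auto simp: ker_def)
 have "\<phi> w \<noteq> 0" using nz by (auto simp: ker_def w_def)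
 then have w: "norm w < 1" using phi(4)[of w] by force
 have e4: "norm (4 *\<^sub>R e) = 4" using e by simp
 have n: "norm ((4 / r) *\<^sub>R (fst z - snd z)) = 4 / r * norm (fst z - snd z)" using r by simp
 have tri: "norm a \<le> norm (a - p + q) + norm p + norm q" "norm p \<le> norm a + norm (a - p + q) + norm q" for a p q :: 'a by norm+
 have "norm ((4 / r) *\<^sub>R (fst z - snd z)) \<le> norm w + norm (4 *\<^sub>R e) + norm center" unfolding w_def by (rule tri)
 then have "4 / r * norm (fst z - snd z) \<le> 6" using w norm_center e4 n by linarith
 then show "norm (fst z - snd z) \<le> 3 / 2 * r" using r by (simp add: field_simps)
 have "norm (4 *\<^sub>R e) \<le> norm ((4 / r) *\<^sub>R (fst z - snd z)) + norm w + norm center" unfolding w_def by (rule tri)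
 then have "2 \<le> 4 / r * norm (fst z - snd z)" using w norm_center e4 n by linarith
 then show "r / 2 \<le> norm (fst z - snd z)" using r by (simp add: field_simps)
qed

lemma ker_continuous:
 assumes "continuous_on UNIV f" "r > 0" shows "continuous_on UNIV (ker f e r)"
 unfolding ker_def[abs_def]
 using assms(2) by (intro continuous_intros continuous_on_compose2[OF assms(1)] continuous_on_compose2[OF phi_continuous]) auto

lemma ker_section_integrable:
 assumes f: "continuous_on UNIV f" and r: "r > 0" and e: "norm e = 1"
 shows "integrable lborel (\<lambda>y. ker f e r (x, y))" "integrable lborel (\<lambda>y. ker f e r (y, x))"
proof -
 have z: "ker f e r (x, y) = 0" "ker f e r (y, x) = 0" if "y \<notin> cball x (3 / 2 * r)" for y
  using ker_support(3)[OF r e, of f "(x, y)"] ker_support(3)[OF r e, of f "(y, x)"] that by (auto simp: dist_norm norm_minus_commute)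
 show "integrable lborel (\<lambda>y. ker f e r (x, y))" "integrable lborel (\<lambda>y. ker f e r (y, x))"
  by (rule integrable_continuous_compact_support[where S = "cball x (3 / 2 * r)"];
    auto intro!: continuous_on_compose2[OF ker_continuous[OF f r]] continuous_intros z)+
qed

lemma marginal_difference_ker:
 assumes f: "continuous_on UNIV f" and r: "r > 0"
 shows "marginal_difference (ker f e r) x = (f x - (LINT w|lborel. f (x + r *\<^sub>R (e + (1/4) *\<^sub>R (w - center))) * \<phi> w)) / r"
proof -
 have [measurable]: "f \<in> borel_measurable borel" by (rule borel_measurable_continuous_onI[OF f])
 have [measurable]: "ker f e r \<in> borel_measurable borel" by (rule borel_measurable_continuous_onI[OF ker_continuous[OF f r]])
 let ?d = "DIM('a)"
 have "(LINT y|lborel. ker f e r (x, y)) = (LINT y|lborel. f x * (4 / r) ^ ?d / r * \<phi> (((4 / r) *\<^sub>R x - 4 *\<^sub>R e + center) + (- (4 / r)) *\<^sub>R y))"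
  by (intro LINT_cong) (simp add: ker_def algebra_simps)
 also have "\<dots> = f x * (4 / r) ^ ?d / r * (1 / \<bar>- (4 / r)\<bar> ^ ?d)"
  using r by (subst integral_mult_right_zero, subst integral_affine) (auto simp: phi(3))
 also have "\<dots> = f x / r" using r by (simp add: field_simps)
 finally have 1: "(LINT y|lborel. ker f e r (x, y)) = f x / r" .
 define t where "t = x + r *\<^sub>R e - (r / 4) *\<^sub>R center"
 have tw: "t + (r / 4) *\<^sub>R w = x + r *\<^sub>R (e + (1/4) *\<^sub>R (w - center))" for w by (simp add: t_def algebra_simps)
 have arg: "(4 / r) *\<^sub>R ((t + (r / 4) *\<^sub>R w) - x) - 4 *\<^sub>R e + center = w" for w
  using r by (simp add: t_def scaleR_add_right scaleR_diff_right)
 have "(\<lambda>y. ker f e r (y, x)) \<in> borel_measurable borel"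
  by (intro borel_measurable_continuous_onI continuous_on_compose2[OF ker_continuous[OF f r]] continuous_intros) auto
 from integral_affine[OF this, of "r / 4" t] have "(LINT w|lborel. ker f e r (t + (r / 4) *\<^sub>R w, x)) = (4 / r) ^ ?d * (LINT y|lborel. ker f e r (y, x))"
  using r by (simp add: power_divide)
 moreover have "ker f e r (t + (r / 4) *\<^sub>R w, x) = (4 / r) ^ ?d * ((f (x + r *\<^sub>R (e + (1/4) *\<^sub>R (w - center))) * \<phi> w) / r)" for w
  unfolding ker_def fst_conv snd_conv arg unfolding tw by simp
 ultimately have "(4 / r) ^ ?d * (LINT y|lborel. ker f e r (y, x)) = (4 / r) ^ ?d * ((LINT w|lborel. f (x + r *\<^sub>R (e + (1/4) *\<^sub>R (w - center))) * \<phi> w) / r)"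
  by (simp only: integral_mult_right_zero integral_divide_zero)
 then have 2: "(LINT y|lborel. ker f e r (y, x)) = (LINT w|lborel. f (x + r *\<^sub>R (e + (1/4) *\<^sub>R (w - center))) * \<phi> w) / r"
  unfolding mult_cancel_left using r by (elim disjE) simp_all
 show ?thesis unfolding marginal_difference_def 1 2 by (simp add: diff_divide_distrib)
qed

lemma marginal_difference_ker_uniform:
 assumes f: "f \<in> test_functions V" and e: "e \<in> Basis" and ep: "ep > 0"
 shows "\<exists>d>0. \<forall>r x. 0 < r \<longrightarrow> r \<le> d \<longrightarrow> \<bar>marginal_difference (ker f e r) x + partials [e] f x\<bar> \<le> ep"
proof -
 have "ep / 2 > 0" using ep by simp
 from uniformly_differentiable[OF f this]
 obtain d where d: "d > 0" "\<And>x h. norm h < d ==> \<bar>f (x + h) - f x - h \<bullet> gradient f x\<bar> \<le> ep / 2 * norm h" by blast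
 have fc: "continuous_on UNIV f" by (rule test_functions_continuous[OF f])
 have "\<bar>marginal_difference (ker f e r) x + partials [e] f x\<bar> \<le> ep" if r: "0 < r" "r \<le> d / 2" for r x
 proof -
  define v where "v = (\<lambda>w. e + (1/4) *\<^sub>R (w - center))"
  have vc: "continuous_on UNIV v" unfolding v_def by (intro continuous_intros)
  have vn: "norm (v w) \<le> 3 / 2" if "norm w \<le> 1" for w
  proof -
   have "norm (w - center) \<le> 2" using norm_triangle_ineq4[of w center] norm_center that by linarith
   then have h: "norm ((1/4) *\<^sub>R (w - center)) \<le> 1 / 2" by simp
   have "norm (v w) \<le> 1 + 1 / 2"
    unfolding v_def by (rule order_trans[OF norm_triangle_ineq add_mono[OF _ h]]) (simp add: e)
   then show ?thesis by simp
  qed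
  let ?G = "gradient f x"
  have i1: "integrable lborel (\<lambda>w. f (x + r *\<^sub>R v w) * \<phi> w)"
  proof -
   have "continuous_on UNIV (\<lambda>w. f (x + r *\<^sub>R v w))"
    by (rule continuous_on_compose2[OF fc]) (auto intro!: continuous_intros vc)
   from phi_weighted_integrable[OF this] show ?thesis by (simp add: mult.commute)
  qed
  have i3: "integrable lborel (\<lambda>w. \<phi> w *\<^sub>R w)" by (intro phi_weighted_integrable continuous_intros)
  have "(LINT w|lborel. (v w \<bullet> ?G) * \<phi> w) = (LINT w|lborel. (e \<bullet> ?G - (1/4) * (center \<bullet> ?G)) * \<phi> w + (1/4) * ((\<phi> w *\<^sub>R w) \<bullet> ?G))"
   by (intro LINT_cong) (simp add: v_def inner_add_left inner_diff_left algebra_simps)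
  also have "\<dots> = (e \<bullet> ?G - (1/4) * (center \<bullet> ?G)) * (LINT w|lborel. \<phi> w) + (1/4) * ((LINT w|lborel. \<phi> w *\<^sub>R w) \<bullet> ?G)"
  proof -
   have i4: "integrable lborel (\<lambda>w. (\<phi> w *\<^sub>R w) \<bullet> ?G)" and e4: "(LINT w|lborel. (\<phi> w *\<^sub>R w) \<bullet> ?G) = (LINT w|lborel. \<phi> w *\<^sub>R w) \<bullet> ?G"
    by (rule integrable_inner_left[OF i3], rule integral_inner_left[OF i3])
   show ?thesis
    by (subst Bochner_Integration.integral_add[OF integrable_mult_right[OF phi_integrable] integrable_mult_right[OF i4]])
     (simp only: integral_mult_right_zero e4)
  qed
  also have "\<dots> = partials [e] f x" using e by (simp add: phi(3) center_def[symmetric] inner_gradient sum_Basis_inner del: partials.simps)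
  finally have mean: "(LINT w|lborel. (v w \<bullet> ?G) * \<phi> w) = partials [e] f x" .
  have i2: "integrable lborel (\<lambda>w. (v w \<bullet> ?G) * \<phi> w)"
  proof -
   have "continuous_on UNIV (\<lambda>w. v w \<bullet> ?G)" by (intro continuous_intros vc)
   from phi_weighted_integrable[OF this] show ?thesis by (simp add: mult.commute)
  qed
  let ?F = "\<lambda>w. (f (x + r *\<^sub>R v w) - f x - (r *\<^sub>R v w) \<bullet> ?G) * \<phi> w"
  have "(LINT w|lborel. ?F w) = (LINT w|lborel. f (x + r *\<^sub>R v w) * \<phi> w - f x * \<phi> w - r * ((v w \<bullet> ?G) * \<phi> w))"
   by (intro LINT_cong) (simp add: algebra_simps)
  also have "\<dots> = (LINT w|lborel. f (x + r *\<^sub>R v w) * \<phi> w) - f x - r * partials [e] f x"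
   using i1 i2 phi_integrable by (simp add: phi(3) mean del: partials.simps)
  finally have F: "(LINT w|lborel. ?F w) = (LINT w|lborel. f (x + r *\<^sub>R v w) * \<phi> w) - f x - r * partials [e] f x" .
  have md: "marginal_difference (ker f e r) x + partials [e] f x = - (LINT w|lborel. ?F w) / r"
   unfolding F marginal_difference_ker[OF fc r(1)] using r by (simp add: v_def field_simps del: partials.simps)
  have "\<bar>LINT w|lborel. ?F w\<bar> \<le> (LINT w|lborel. \<bar>?F w\<bar>)" by (rule integral_abs_bound)
  also have "\<dots> \<le> (LINT w|lborel. (ep * r) * \<phi> w)"
  proof (rule integral_mono')
   show "integrable lborel (\<lambda>w. (ep * r) * \<phi> w)" using phi_integrable by simp
   show "0 \<le> (ep * r) * \<phi> w" for w using ep r phi(2) by simp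
   fix w
   show "\<bar>?F w\<bar> \<le> (ep * r) * \<phi> w"
   proof (cases "norm w \<ge> 1")
    case False
    have nv: "norm (r *\<^sub>R v w) \<le> r * (3 / 2)" using vn[of w] False r by simp
    also have "\<dots> < d" using r d(1) by simp
    finally have "\<bar>f (x + r *\<^sub>R v w) - f x - (r *\<^sub>R v w) \<bullet> ?G\<bar> \<le> ep / 2 * norm (r *\<^sub>R v w)" by (rule d(2))
    also have "\<dots> \<le> ep / 2 * (r * (3 / 2))" using ep nv by (intro mult_left_mono) auto
    also have "\<dots> \<le> ep * r" using ep r by simp
    finally show ?thesis unfolding abs_mult using phi(2)[of w] by (simp add: mult_right_mono)
   qed (simp add: phi(4))
  qed
  also have "\<dots> = ep * r" using phi(3) by simp
  finally show ?thesis unfolding md using r by (simp add: field_simps)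
 qed
 then show ?thesis using d(1) by (intro exI[of _ "d / 2"]) auto
qed

end

lemma nn_integral_lborel_swap:
 fixes H :: "'b::euclidean_space \<times> 'b => ennreal"
 assumes H: "H \<in> borel_measurable borel"
 shows "(\<integral>\<^sup>+ zz. H (snd zz, fst zz) \<partial>lborel) = (\<integral>\<^sup>+ zz. H zz \<partial>lborel)"
proof -
 have Hm: "H \<in> borel_measurable (borel \<Otimes>\<^sub>M borel)" using H by (simp add: borel_prod)
 have "(\<lambda>zz. H (snd zz, fst zz)) \<in> borel_measurable (borel \<Otimes>\<^sub>M borel)"
  by (rule measurable_compose[OF _ Hm]) measurable
 then have Hs: "(\<lambda>zz. H (snd zz, fst zz)) \<in> borel_measurable borel" by (simp add: borel_prod)
 have c: "case_prod (\<lambda>x y. H (x, y)) \<in> borel_measurable (lborel \<Otimes>\<^sub>M lborel)" using H by (simp add: lborel_prod split_beta')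
 show ?thesis
  unfolding nn_integral_lborel_pair[OF Hs] nn_integral_lborel_pair[OF H] fst_conv snd_conv by (rule lborel_pair.Fubini'[OF c])
qed

context log_field
begin

lemma D_commute: "D z z' = D z' z"
 unfolding D_def using CU_commute[of "fst z" "fst z'"] CU_commute[of "snd z" "snd z'"] CU_commute[of "fst z" "snd z'"] CU_commute[of "snd z" "fst z'"] by simp

lemma ker_interaction:
 assumes f: "f \<in> test_functions U" and e: "e \<in> Basis"
 obtains A R0 where "A \<ge> 0" "R0 > 0" "\<And>x y. x \<in> supp f ==> dist x y \<le> 2 * R0 ==> y \<in> U"
  "\<And>r s. 0 < r ==> r \<le> s ==> s \<le> R0 ==>
   (\<integral>\<^sup>+ zz. ennreal (\<bar>ker f e r (fst zz)\<bar> * \<bar>ker f e s (snd zz)\<bar> * expr2 (b * D (fst zz) (snd zz))) \<partial>lborel) \<le> ennreal (A * sqrt (r / s))"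
  "\<And>r s. 0 < r ==> r \<le> s ==> s \<le> R0 ==>
   (\<integral>\<^sup>+ zz. ennreal (\<bar>ker f e s (fst zz)\<bar> * \<bar>ker f e r (snd zz)\<bar> * expr2 (b * D (fst zz) (snd zz))) \<partial>lborel) \<le> ennreal (A * sqrt (r / s))"
proof -
 have F: "compact (supp f)" "supp f \<subseteq> U" using f by (auto simp: test_functions_iff)
 obtain e0 A' where A': "e0 > 0" "compact A'" "A' \<subseteq> U" "\<And>x. x \<in> supp f ==> cball x e0 \<subseteq> A'" "supp f \<subseteq> A'"
  by (rule compact_neighbourhood[OF F(1) U(2) F(2)]) blast
 have "\<exists>L\<ge>0. \<forall>x y v. x \<in> supp f \<longrightarrow> dist x y \<le> e0 \<longrightarrow> v \<in> A' \<longrightarrow> \<bar>g (x, v) - g (y, v)\<bar> \<le> L * dist x y"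
 proof (rule g_lipschitz[OF F A'(1-4)])
  fix L assume "0 \<le> L" and L: "\<And>x y v. x \<in> supp f ==> dist x y \<le> e0 ==> v \<in> A' ==> \<bar>g (x, v) - g (y, v)\<bar> \<le> L * dist x y"
  then show ?thesis by (intro exI[of _ L] conjI allI impI L)
 qed
 then obtain L where L0: "L \<ge> 0" and L1: "\<forall>x y v. x \<in> supp f \<longrightarrow> dist x y \<le> e0 \<longrightarrow> v \<in> A' \<longrightarrow> \<bar>g (x, v) - g (y, v)\<bar> \<le> L * dist x y" by blast
 note L = L0 L1[rule_format]
 obtain Bf where Bf: "Bf > 0" "\<And>x. \<bar>f x\<bar> \<le> Bf" by (rule test_functions_bounded[OF f]) blast
 obtain B\<phi> where B\<phi>: "B\<phi> > 0" "\<And>x. \<bar>\<phi> x\<bar> \<le> B\<phi>" by (rule test_functions_bounded[OF phi(1)]) blast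
 define R0 where "R0 = e0 / 2"
 have R0: "R0 > 0" using A'(1) by (simp add: R0_def)
 define K where "K = Bf * 4 ^ DIM('a) * B\<phi>"
 obtain A where A: "A \<ge> 0" "\<And>r s (k :: 'a \<times> 'a => real) k' \<Phi>. 0 < r ==> r \<le> s ==> s \<le> R0 ==>
  (\<And>x y. \<bar>k (x, y)\<bar> \<le> (if x \<in> supp f \<and> norm (x - y) \<le> 2 * r then K / r ^ Suc (DIM('a)) else 0)) ==>
  (\<And>x y. \<bar>k' (x, y)\<bar> \<le> (if x \<in> supp f \<and> norm (x - y) \<le> 2 * s then K / s ^ Suc (DIM('a)) else 0)) ==>
  (\<And>x y x' y'. x \<in> supp f ==> x' \<in> supp f ==> norm (x - y) \<le> 2 * r ==> norm (x' - y') \<le> 2 * s ==>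
    x \<noteq> x' ==> y \<noteq> y' ==> x \<noteq> y' ==> y \<noteq> x' ==>
    \<exists>h. \<bar>h\<bar> \<le> (4 * L) * r \<and> \<Phi> ((x, y), (x', y')) =
     expr2 (b * (ln ((norm (x - y') * norm (y - x')) / (norm (x - x') * norm (y - y'))) + h))) ==>
  (\<integral>\<^sup>+ zz. ennreal (\<bar>k (fst zz)\<bar> * \<bar>k' (snd zz)\<bar> * \<Phi> zz) \<partial>lborel) \<le> ennreal (A * sqrt (r / s))"
  by (rule kernel_pair_bound[OF b dim F(1), of "4 * L" R0 K]) (use L(1) R0 in auto)
 have kb: "\<bar>ker f e r (x, y)\<bar> \<le> (if x \<in> supp f \<and> norm (x - y) \<le> 2 * r then K / r ^ Suc (DIM('a)) else 0)" if r: "r > 0" for r x y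
 proof (cases "ker f e r (x, y) = 0")
  case True
  have "0 \<le> K / r ^ Suc (DIM('a))" using Bf(1) B\<phi>(1) r by (simp add: K_def)
  then show ?thesis using True by (simp del: power_Suc)
 next
  case False
  note s = ker_support[OF r norm_Basis[OF e] False]
  have "x \<in> supp f" using s(1) supp_superset[of x f] by auto
  moreover have "norm (x - y) \<le> 2 * r" using s(3) r by simp
  moreover have "\<bar>ker f e r (x, y)\<bar> \<le> K / r ^ Suc (DIM('a))"
  proof -
   have "\<bar>ker f e r (x, y)\<bar> = \<bar>f x\<bar> * \<bar>\<phi> ((4 / r) *\<^sub>R (x - y) - 4 *\<^sub>R e + center)\<bar> * ((4 / r) ^ DIM('a) / r)"
    using r by (simp add: ker_def abs_mult)
   also have "\<dots> \<le> Bf * B\<phi> * ((4 / r) ^ DIM('a) / r)"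
    using r Bf B\<phi> by (intro mult_right_mono mult_mono) auto
   also have "\<dots> = K / r ^ Suc (DIM('a))" using r by (simp add: K_def power_divide field_simps)
   finally show ?thesis .
  qed
  ultimately show ?thesis by simp
 qed
 have \<Phi>: "\<exists>h. \<bar>h\<bar> \<le> (4 * L) * r \<and> expr2 (b * D (x, y) (x', y')) =
     expr2 (b * (ln ((norm (x - y') * norm (y - x')) / (norm (x - x') * norm (y - y'))) + h))"
  if rs: "0 < r" "r \<le> s" "s \<le> R0" and x: "x \<in> supp f" "x' \<in> supp f" and y: "norm (x - y) \<le> 2 * r" "norm (x' - y') \<le> 2 * s"
   and ne: "x \<noteq> x'" "y \<noteq> y'" "x \<noteq> y'" "y \<noteq> x'" for r s x y x' y'
 proof -
  have d: "dist x y \<le> e0" "dist x' y' \<le> e0" "dist x y \<le> 2 * r" using y rs by (auto simp: dist_norm R0_def)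
  have m: "x \<in> A'" "x' \<in> A'" "y \<in> A'" "y' \<in> A'" using A'(4)[OF x(1)] A'(4)[OF x(2)] A'(5) x d by auto
  then have u: "x \<in> U" "x' \<in> U" "y \<in> U" "y' \<in> U" using A'(3) by auto
  define h where "h = (g (x, x') - g (y, x')) - (g (x, y') - g (y, y'))"
  have "\<bar>h\<bar> \<le> L * dist x y + L * dist x y"
   unfolding h_def using L(2)[OF x(1) d(1) m(2)] L(2)[OF x(1) d(1) m(4)] by linarith
  also have "\<dots> \<le> L * (2 * r) + L * (2 * r)" using L(1) d(3) by (intro add_mono mult_left_mono) auto
  finally have hb: "\<bar>h\<bar> \<le> (4 * L) * r" by simp
  have "D (x, y) (x', y') = ln (1 / norm (x - x')) + ln (1 / norm (y - y')) - ln (1 / norm (x - y')) - ln (1 / norm (y - x')) + h"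
   using u by (simp add: D_def CU_def C_def h_def)
  also have "\<dots> = ln ((norm (x - y') * norm (y - x')) / (norm (x - x') * norm (y - y'))) + h"
   using ne by (simp add: ln_div ln_mult)
  finally show ?thesis using hb by (intro exI[of _ h]) simp
 qed
 have main: "(\<integral>\<^sup>+ zz. ennreal (\<bar>ker f e r (fst zz)\<bar> * \<bar>ker f e s (snd zz)\<bar> * expr2 (b * D (fst zz) (snd zz))) \<partial>lborel) \<le> ennreal (A * sqrt (r / s))"
  if rs: "0 < r" "r \<le> s" "s \<le> R0" for r s
 proof (rule A(2)[OF rs])
  fix x y x' y' :: 'a
  show "\<bar>ker f e r (x, y)\<bar> \<le> (if x \<in> supp f \<and> norm (x - y) \<le> 2 * r then K / r ^ Suc (DIM('a)) else 0)"
   "\<bar>ker f e s (x, y)\<bar> \<le> (if x \<in> supp f \<and> norm (x - y) \<le> 2 * s then K / s ^ Suc (DIM('a)) else 0)"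
   using rs by (intro kb; simp)+
  assume a: "x \<in> supp f" "x' \<in> supp f" "norm (x - y) \<le> 2 * r" "norm (x' - y') \<le> 2 * s" "x \<noteq> x'" "y \<noteq> y'" "x \<noteq> y'" "y \<noteq> x'"
  show "\<exists>h. \<bar>h\<bar> \<le> (4 * L) * r \<and> expr2 (b * D (fst ((x, y), (x', y'))) (snd ((x, y), (x', y')))) =
     expr2 (b * (ln ((norm (x - y') * norm (y - x')) / (norm (x - x') * norm (y - y'))) + h))"
   unfolding fst_conv snd_conv by (rule \<Phi>[OF rs a])
 qed
 have swap: "(\<integral>\<^sup>+ zz. ennreal (\<bar>ker f e s (fst zz)\<bar> * \<bar>ker f e r (snd zz)\<bar> * expr2 (b * D (fst zz) (snd zz))) \<partial>lborel)
  = (\<integral>\<^sup>+ zz. ennreal (\<bar>ker f e r (fst zz)\<bar> * \<bar>ker f e s (snd zz)\<bar> * expr2 (b * D (fst zz) (snd zz))) \<partial>lborel)"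
  if rs: "0 < r" "0 < s" for r s
 proof -
  have kc: "continuous_on UNIV (ker f e r)" "continuous_on UNIV (ker f e s)" using rs by (auto intro!: ker_continuous test_functions_continuous[OF f])
  have km: "(\<lambda>zz::('a \<times> 'a) \<times> ('a \<times> 'a). ker f e r (fst zz)) \<in> borel_measurable borel" "(\<lambda>zz::('a \<times> 'a) \<times> ('a \<times> 'a). ker f e s (snd zz)) \<in> borel_measurable borel"
   by (intro borel_measurable_continuous_onI continuous_on_compose2[OF kc(1)] continuous_on_compose2[OF kc(2)] continuous_intros; simp)+
  have "(\<lambda>zz. ennreal (\<bar>ker f e r (fst zz)\<bar> * \<bar>ker f e s (snd zz)\<bar> * expr2 (b * D (fst zz) (snd zz)))) \<in> borel_measurable borel"
   using km D_measurable unfolding expr2_def by simp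
  from nn_integral_lborel_swap[OF this] show ?thesis
   by (simp only: fst_conv snd_conv D_commute[of "snd _" "fst _"] mult.commute[of "\<bar>ker f e r (snd _)\<bar>"])
 qed
 show ?thesis
 proof (rule that[OF A(1) R0])
  show "y \<in> U" if "x \<in> supp f" "dist x y \<le> 2 * R0" for x y
   using A'(3) A'(4)[OF that(1)] that(2) by (auto simp: R0_def)
  fix r s :: real assume rs: "0 < r" "r \<le> s" "s \<le> R0"
  show "(\<integral>\<^sup>+ zz. ennreal (\<bar>ker f e r (fst zz)\<bar> * \<bar>ker f e s (snd zz)\<bar> * expr2 (b * D (fst zz) (snd zz))) \<partial>lborel) \<le> ennreal (A * sqrt (r / s))"
   by (rule main[OF rs])
  show "(\<integral>\<^sup>+ zz. ennreal (\<bar>ker f e s (fst zz)\<bar> * \<bar>ker f e r (snd zz)\<bar> * expr2 (b * D (fst zz) (snd zz))) \<partial>lborel) \<le> ennreal (A * sqrt (r / s))"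
   unfolding swap[OF rs(1) less_le_trans[OF rs(1,2)]] by (rule main[OF rs])
 qed
qed

end

lemma sum_diagonal_dominant: "(\<Sum>m<N. \<Sum>n<N. if m = n then 1 else 1 / real (Suc N)) \<le> 2 * real N"
proof -
 have "(\<Sum>n<N. if m = n then 1 else 1 / real (Suc N)) \<le> 2" for m :: nat
 proof -
  have "(\<Sum>n<N. if m = n then 1 else 1 / real (Suc N)) \<le> (\<Sum>n<N. (if m = n then 1 else 0) + 1 / real (Suc N))"
   by (intro sum_mono) auto
  also have "\<dots> = (\<Sum>n<N. if m = n then 1 else (0::real)) + real N / real (Suc N)" by (simp add: sum.distrib del: of_nat_Suc)
  also have "\<dots> \<le> 1 + 1" by (intro add_mono) (simp_all add: divide_simps)
  finally show ?thesis by simp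
 qed
 then have "(\<Sum>m<N. \<Sum>n<N. if m = n then 1 else 1 / real (Suc N)) \<le> (\<Sum>m<N. 2)" by (intro sum_mono)
 then show ?thesis by simp
qed

context log_field
begin

text \<open>Kernels at well separated scales hardly interact, so averaging them makes the remainder
 small while the marginal difference stays close to \<open>\<rho>\<close>.\<close>

lemma Q_small:
 assumes f: "f \<in> test_functions V" and V: "open V" "V \<subseteq> U" and e: "e \<in> Basis" and ep: "ep > 0"
 shows "\<exists>S k. off_diagonal S \<and> fst ` S \<union> snd ` S \<subseteq> V \<and> continuous_on UNIV k \<and> (\<forall>z. z \<notin> S \<longrightarrow> k z = 0) \<and>
  Q (\<lambda>z. k z / P z) (\<lambda>x. - partials [e] f x) < ep"
proof -
 have fU: "f \<in> test_functions U" by (rule test_functions_mono[OF V(2) f])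
 have fc: "continuous_on UNIV f" by (rule test_functions_continuous[OF f])
 have e1: "norm e = 1" using e by simp
 define \<rho> where "\<rho> = (\<lambda>x. - partials [e] f x)"
 have "(\<lambda>x. (- 1) * partials [e] f x) \<in> test_functions U"
  by (rule test_functions_cmult[OF test_functions_partials[OF fU]]) (use e in simp)
 then have \<rho>: "\<rho> \<in> test_functions U" by (simp add: \<rho>_def del: partials.simps)
 obtain m where m: "m > 0" "\<And>x. \<bar>\<rho> x\<bar> \<le> m" by (rule test_functions_bounded[OF \<rho>]) blast
 have F: "compact (supp f)" "supp f \<subseteq> V" using f by (auto simp: test_functions_iff)
 obtain e0 A' where A': "e0 > 0" "A' \<subseteq> V" "\<And>x. x \<in> supp f ==> cball x e0 \<subseteq> A'" "supp f \<subseteq> A'"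
  by (rule compact_neighbourhood[OF F(1) V(1) F(2)]) blast
 define I where "I = (\<lambda>r s. \<integral>\<^sup>+ zz. ennreal (\<bar>ker f e r (fst zz)\<bar> * \<bar>ker f e s (snd zz)\<bar> * expr2 (b * D (fst zz) (snd zz))) \<partial>lborel)"
 have "\<exists>A R0. A \<ge> 0 \<and> R0 > 0 \<and> (\<forall>r s. 0 < r \<longrightarrow> r \<le> s \<longrightarrow> s \<le> R0 \<longrightarrow> I r s \<le> ennreal (A * sqrt (r / s)) \<and> I s r \<le> ennreal (A * sqrt (r / s)))"
  by (rule ker_interaction[OF fU e]) (unfold I_def, blast)
 then obtain A R0 where A: "A \<ge> 0" "R0 > 0"
  "\<And>r s. 0 < r ==> r \<le> s ==> s \<le> R0 ==> I r s \<le> ennreal (A * sqrt (r / s)) \<and> I s r \<le> ennreal (A * sqrt (r / s))" by blast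
 define c where "c = (LINT z|lborel. \<bar>CU z\<bar>)"
 have c: "c \<ge> 0" unfolding c_def by simp
 define T where "T = b * (2 * m + 1) * c"
 have T: "T \<ge> 0" using b(1) m(1) c by (simp add: T_def)
 define ep1 where "ep1 = min 1 (ep / (4 * (T + 1)))"
 have ep1: "ep1 > 0" "ep1 \<le> 1" "T * ep1 \<le> ep / 4"
 proof -
  show "ep1 > 0" "ep1 \<le> 1" using ep T by (auto simp: ep1_def)
  have "T * ep1 \<le> (T + 1) * (ep / (4 * (T + 1)))" using T ep by (intro mult_mono) (auto simp: ep1_def)
  also have "\<dots> = ep / 4" using T by (simp add: field_simps)
  finally show "T * ep1 \<le> ep / 4" .
 qed
 obtain d where d: "d > 0" "\<And>r x. 0 < r ==> r \<le> d ==> \<bar>marginal_difference (ker f e r) x + partials [e] f x\<bar> \<le> ep1"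
  using marginal_difference_ker_uniform[OF f e ep1(1)] by blast
 define r0 where "r0 = min (min R0 d) (e0 / 2)"
 have r0: "r0 > 0" "r0 \<le> R0" "r0 \<le> d" "2 * r0 \<le> e0" using A(2) d(1) A'(1) by (auto simp: r0_def)
 obtain N :: nat where N: "real N > 8 * A / ep" "N > 0"
 proof -
  obtain n :: nat where "real n > 8 * A / ep" using reals_Archimedean2 by blast
  then show ?thesis by (intro that[of "Suc n"]) auto
 qed
 define t where "t = 1 / (real (Suc N))\<^sup>2"
 have t: "0 < t" "t \<le> 1" "sqrt t = 1 / real (Suc N)" by (auto simp: t_def real_sqrt_divide simp del: of_nat_Suc)
 define r where "r = (\<lambda>n. r0 * t ^ n)"
 have r: "0 < r n" "r n \<le> r0" for n
  using r0(1) t power_le_one[of t n] by (auto simp: r_def mult_left_le)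
 have r_mono: "r n \<le> r m'" if "m' \<le> n" for m' n
  using r0(1) t that by (auto simp: r_def intro!: power_decreasing)
 have ratio: "sqrt (r n / r m') \<le> 1 / real (Suc N)" if "m' < n" for m' n
 proof -
  have "r n / r m' = t ^ (n - m')" using that t(1) r0(1) by (simp add: r_def power_diff)
  also have "\<dots> \<le> t ^ 1" using that t by (intro power_decreasing) auto
  finally show ?thesis using t(3) real_sqrt_le_mono[of "r n / r m'" t] by simp
 qed
 define cc where "cc = (\<lambda>i j :: nat. if i = j then 1 else 1 / real (Suc N))"
 have I_bound: "I (r i) (r j) \<le> ennreal (A * cc i j)" for i j
 proof -
  consider "i = j" | "j < i" | "i < j" by linarith
  then show ?thesis
  proof cases
   case 1
   then show ?thesis using A(3)[of "r i" "r i"] r[of i] r0(2) by (simp add: cc_def)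
  next
   case 2
   have "I (r i) (r j) \<le> ennreal (A * sqrt (r i / r j))"
    using A(3)[of "r i" "r j"] r[of i] r[of j] r0(2) r_mono[of j i] 2 by auto
   also have "\<dots> \<le> ennreal (A * cc i j)" using 2 ratio[OF 2] A(1) unfolding cc_def by (intro ennreal_leI mult_left_mono) auto
   finally show ?thesis .
  next
   case 3
   have "I (r i) (r j) \<le> ennreal (A * sqrt (r j / r i))"
    using A(3)[of "r j" "r i"] r[of i] r[of j] r0(2) r_mono[of i j] 3 by auto
   also have "\<dots> \<le> ennreal (A * cc i j)" using 3 ratio[OF 3] A(1) unfolding cc_def by (intro ennreal_leI mult_left_mono) auto
   finally show ?thesis .
  qed
 qed
 define k where "k = (\<lambda>z. (\<Sum>n<N. ker f e (r n) z) / real N)"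
 have kerc: "continuous_on UNIV (ker f e (r n))" for n by (rule ker_continuous[OF fc r(1)])
 have kc: "continuous_on UNIV k" unfolding k_def by (intro continuous_intros kerc) (use N(2) in simp)
 define S where "S = (\<lambda>q. (fst q, fst q - snd q)) ` (supp f \<times> (cball 0 (3 / 2 * r0) - ball 0 (r N / 2)))"
 have Sc: "compact S" unfolding S_def
  by (intro compact_continuous_image compact_Times F(1) compact_diff compact_cball open_ball continuous_intros)
 have SA: "fst z \<in> supp f \<and> snd z \<in> A' \<and> fst z \<noteq> snd z" if zS: "z \<in> S" for z
 proof -
  obtain x v where xv: "x \<in> supp f" "norm v \<le> 3 / 2 * r0" "\<not> norm v < r N / 2" "z = (x, x - v)"
   using zS unfolding S_def by auto
  have "x - v \<in> cball x e0" using xv(2) r0 by (simp add: dist_norm)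
  moreover have "v \<noteq> 0" using xv(3) r(1)[of N] by auto
  ultimately show ?thesis using xv A'(3)[OF xv(1)] by auto
 qed
 have SV: "fst ` S \<union> snd ` S \<subseteq> V" using SA A'(2,4) by blast
 have So: "off_diagonal S" unfolding off_diagonal_def using Sc SA SV V(2) by blast
 have k0: "k z = 0" if z: "z \<notin> S" for z
 proof -
  have "ker f e (r n) z = 0" if n: "n < N" for n
  proof (rule ccontr)
   assume "ker f e (r n) z \<noteq> 0"
   note s = ker_support[OF r(1) e1 this]
   have "fst z \<in> supp f" using s(1) supp_superset[of "fst z" f] by auto
   moreover have "norm (fst z - snd z) \<le> 3 / 2 * r0" using s(3) r(2)[of n] by linarith
   moreover have "r N / 2 \<le> norm (fst z - snd z)" using s(2) r_mono[of n N] n by linarith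
   ultimately have "z \<in> S" unfolding S_def by (intro image_eqI[of _ _ "(fst z, fst z - snd z)"]) auto
   then show False using z by simp
  qed
  then show ?thesis by (simp add: k_def)
 qed
 have close: "\<bar>marginal_difference k x - \<rho> x\<bar> \<le> ep1" for x
 proof -
  note si = ker_section_integrable[OF fc r(1) e1, of _ x]
  have "marginal_difference k x = (\<Sum>n<N. marginal_difference (ker f e (r n)) x) / real N"
   unfolding marginal_difference_def k_def
   by (simp add: Bochner_Integration.integral_sum[OF si(1)] Bochner_Integration.integral_sum[OF si(2)] sum_subtractf diff_divide_distrib)
  then have "marginal_difference k x - \<rho> x = (\<Sum>n<N. marginal_difference (ker f e (r n)) x + partials [e] f x) / real N"
   using N(2) by (simp add: \<rho>_def sum.distrib add_divide_distrib del: partials.simps)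
  also have "\<bar>\<dots>\<bar> \<le> (\<Sum>n<N. ep1) / real N"
  proof -
   have "\<bar>\<Sum>n<N. marginal_difference (ker f e (r n)) x + partials [e] f x\<bar> \<le> (\<Sum>n<N. \<bar>marginal_difference (ker f e (r n)) x + partials [e] f x\<bar>)" by (rule sum_abs)
   also have "\<dots> \<le> (\<Sum>n<N. ep1)" using r r0(3) by (intro sum_mono d(2)) (auto intro: order_trans)
   finally show ?thesis by (simp add: divide_right_mono del: partials.simps sum_constant)
  qed
  finally show ?thesis using N(2) by simp
 qed
 let ?\<Phi> = "\<lambda>zz. expr2 (b * D (fst zz) (snd zz))"
 have Rem: "(\<integral>\<^sup>+ zz. ennreal (\<bar>k (fst zz)\<bar> * \<bar>k (snd zz)\<bar> * ?\<Phi> zz) \<partial>lborel) \<le> ennreal (2 * A / real N)"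
 proof -
  let ?G = "\<lambda>i j zz. \<bar>ker f e (r i) (fst zz)\<bar> * \<bar>ker f e (r j) (snd zz)\<bar> * ?\<Phi> zz"
  have G0: "0 \<le> ?G i j zz" for i j zz by (intro mult_nonneg_nonneg expr2_nonneg) auto
  have km: "(\<lambda>zz::('a \<times> 'a) \<times> ('a \<times> 'a). ker f e (r n) (fst zz)) \<in> borel_measurable borel" "(\<lambda>zz::('a \<times> 'a) \<times> ('a \<times> 'a). ker f e (r n) (snd zz)) \<in> borel_measurable borel" for n
   by (intro borel_measurable_continuous_onI continuous_on_compose2[OF kerc] continuous_intros; simp)+
  have Gm: "(\<lambda>zz. ennreal (?G i j zz)) \<in> borel_measurable lborel" for i j using km D_measurable unfolding expr2_def by simp
  have "\<bar>k (fst zz)\<bar> * \<bar>k (snd zz)\<bar> * ?\<Phi> zz \<le> (\<Sum>i<N. \<Sum>j<N. ?G i j zz / (real N)\<^sup>2)" for zz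
  proof -
   have kz: "\<bar>k z\<bar> \<le> (\<Sum>n<N. \<bar>ker f e (r n) z\<bar>) / real N" for z
    unfolding k_def by (simp add: divide_right_mono)
   have "\<bar>k (fst zz)\<bar> * \<bar>k (snd zz)\<bar> * ?\<Phi> zz \<le> ((\<Sum>n<N. \<bar>ker f e (r n) (fst zz)\<bar>) / real N) * ((\<Sum>n<N. \<bar>ker f e (r n) (snd zz)\<bar>) / real N) * ?\<Phi> zz"
    by (intro mult_right_mono mult_mono kz expr2_nonneg) (auto intro!: divide_nonneg_nonneg sum_nonneg)
   also have "\<dots> = ((\<Sum>n<N. \<bar>ker f e (r n) (fst zz)\<bar>) * (\<Sum>n<N. \<bar>ker f e (r n) (snd zz)\<bar>)) * (?\<Phi> zz / (real N)\<^sup>2)"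
    by (simp add: power2_eq_square)
   also have "\<dots> = (\<Sum>i<N. \<Sum>j<N. ?G i j zz / (real N)\<^sup>2)"
    unfolding sum_product sum_distrib_right by (intro sum.cong refl) (simp add: sum_distrib_left sum_distrib_right sum_divide_distrib)
   finally show ?thesis .
  qed
  then have "(\<integral>\<^sup>+ zz. ennreal (\<bar>k (fst zz)\<bar> * \<bar>k (snd zz)\<bar> * ?\<Phi> zz) \<partial>lborel)
   \<le> (\<integral>\<^sup>+ zz. ennreal (\<Sum>i<N. \<Sum>j<N. ?G i j zz / (real N)\<^sup>2) \<partial>lborel)"
   by (intro nn_integral_mono ennreal_leI)
  also have "\<dots> = (\<integral>\<^sup>+ zz. (\<Sum>i<N. \<Sum>j<N. ennreal (1 / (real N)\<^sup>2) * ennreal (?G i j zz)) \<partial>lborel)"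
  proof (intro nn_integral_cong)
   fix zz :: "('a \<times> 'a) \<times> ('a \<times> 'a)"
   have "ennreal (1 / (real N)\<^sup>2) * ennreal (?G i j zz) = ennreal (?G i j zz / (real N)\<^sup>2)" for i j
    by (subst ennreal_mult[symmetric]) (use G0[of i zz j] in auto)
   then have "(\<Sum>i<N. \<Sum>j<N. ennreal (1 / (real N)\<^sup>2) * ennreal (?G i j zz)) = (\<Sum>i<N. \<Sum>j<N. ennreal (?G i j zz / (real N)\<^sup>2))" by simp
   also have "\<dots> = ennreal (\<Sum>i<N. \<Sum>j<N. ?G i j zz / (real N)\<^sup>2)"
    by (subst sum_ennreal[symmetric], (intro sum_nonneg divide_nonneg_nonneg G0; simp), intro sum.cong refl sum_ennreal divide_nonneg_nonneg G0) auto
   finally show "ennreal (\<Sum>i<N. \<Sum>j<N. ?G i j zz / (real N)\<^sup>2) = (\<Sum>i<N. \<Sum>j<N. ennreal (1 / (real N)\<^sup>2) * ennreal (?G i j zz))" by simp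
  qed
  also have "\<dots> = (\<Sum>i<N. \<Sum>j<N. ennreal (1 / (real N)\<^sup>2) * I (r i) (r j))"
   unfolding I_def using Gm by (simp add: nn_integral_sum nn_integral_cmult)
  also have "\<dots> \<le> (\<Sum>i<N. \<Sum>j<N. ennreal (1 / (real N)\<^sup>2) * ennreal (A * cc i j))"
   by (intro sum_mono mult_left_mono I_bound) auto
  also have "\<dots> = ennreal (\<Sum>i<N. \<Sum>j<N. 1 / (real N)\<^sup>2 * (A * cc i j))"
  proof -
   have 0: "0 \<le> 1 / (real N)\<^sup>2 * (A * cc i j)" for i j using A(1) by (simp add: cc_def)
   have "(\<Sum>i<N. \<Sum>j<N. ennreal (1 / (real N)\<^sup>2) * ennreal (A * cc i j)) = (\<Sum>i<N. \<Sum>j<N. ennreal (1 / (real N)\<^sup>2 * (A * cc i j)))"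
    using A(1) by (intro sum.cong refl ennreal_mult[symmetric]) (auto simp: cc_def)
   also have "\<dots> = (\<Sum>i<N. ennreal (\<Sum>j<N. 1 / (real N)\<^sup>2 * (A * cc i j)))" by (intro sum.cong refl sum_ennreal 0)
   also have "\<dots> = ennreal (\<Sum>i<N. \<Sum>j<N. 1 / (real N)\<^sup>2 * (A * cc i j))" by (intro sum_ennreal sum_nonneg 0)
   finally show ?thesis .
  qed
  also have "\<dots> \<le> ennreal (2 * A / real N)"
  proof (rule ennreal_leI)
   have "(\<Sum>i<N. \<Sum>j<N. 1 / (real N)\<^sup>2 * (A * cc i j)) = A / (real N)\<^sup>2 * (\<Sum>i<N. \<Sum>j<N. cc i j)"
    by (simp add: sum_distrib_left)
   also have "\<dots> \<le> A / (real N)\<^sup>2 * (2 * real N)"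
    using A(1) sum_diagonal_dominant[of N] unfolding cc_def by (intro mult_left_mono) auto
   also have "\<dots> = 2 * A / real N" by (simp add: power2_eq_square)
   finally show "(\<Sum>i<N. \<Sum>j<N. 1 / (real N)\<^sup>2 * (A * cc i j)) \<le> 2 * A / real N" .
  qed
  finally show ?thesis .
 qed
 have "Q (\<lambda>z. k z / P z) \<rho> \<le> 2 * A / real N + b * ((2 * m + ep1) * ep1 * c)"
  unfolding c_def using A(1) by (intro Q_split[OF So kc k0 \<rho> m(2) Rem _ close]) auto
 also have "\<dots> \<le> 2 * A / real N + T * ep1"
 proof -
  have "b * ((2 * m + ep1) * ep1 * c) = b * c * ep1 * (2 * m + ep1)" by simp
  also have "\<dots> \<le> b * c * ep1 * (2 * m + 1)" using b(1) c ep1 by (intro mult_left_mono) auto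
  also have "\<dots> = T * ep1" by (simp add: T_def)
  finally show ?thesis by simp
 qed
 also have "\<dots> < ep"
 proof -
  have "2 * A / real N \<le> ep / 4" using N ep by (simp add: field_simps)
  then show ?thesis using ep1(3) ep by linarith
 qed
 finally show ?thesis unfolding \<rho>_def using So SV kc k0 by blast
qed

lemma quotient_continuous:
 assumes S: "off_diagonal S" and k: "continuous_on UNIV k" "\<And>z. z \<notin> S ==> k z = 0"
 shows "continuous_on UNIV (\<lambda>z. k z / P z)"
proof -
 define W where "W = (U \<times> U) \<inter> {z. fst z \<noteq> snd z}"
 have W: "open W" unfolding W_def by (intro open_Int open_Times U open_Collect_neq continuous_intros)
 have oS: "open (- S)" using S by (intro open_Compl compact_imp_closed) (simp add: off_diagonal_def)
 have "continuous_on W (\<lambda>z. k z / P z)"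
 proof (intro continuous_at_imp_continuous_on ballI)
  fix z assume "z \<in> W"
  then have "isCont CU z" using CU_continuous_off_diagonal[of "fst z" "snd z"] by (auto simp: W_def)
  moreover have "isCont k z" using k(1) continuous_on_eq_continuous_at[OF open_UNIV, of k] by blast
  ultimately show "isCont (\<lambda>z. k z / P z) z" unfolding P_def by (intro continuous_intros) auto
 qed
 moreover have "continuous_on (- S) (\<lambda>z. k z / P z)"
  by (rule continuous_on_eq[of _ "\<lambda>z. 0"]) (auto simp: k(2))
 ultimately have "continuous_on (W \<union> - S) (\<lambda>z. k z / P z)" by (intro continuous_on_open_Un W oS)
 moreover have "W \<union> - S = UNIV" using S by (force simp: W_def off_diagonal_def mem_Times_iff)
 ultimately show ?thesis by simp
qed

lemma derivative_approximation:
 fixes \<mu> :: "'w => ('a => real) => complex"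
 assumes f: "f \<in> test_functions V" and V: "open V" "V \<subseteq> U" and e: "e \<in> Basis" and \<mu>: "imaginary_chaos M U \<phi> \<beta> \<Gamma> \<mu>" and ep: "ep > 0"
 shows "\<exists>Z. Z \<in> borel_measurable (restriction_algebra M V \<mu>) \<and>
  (\<integral>\<^sup>+ w. ennreal ((norm (Z w - \<i> * of_real (\<beta> * \<Gamma> w (\<lambda>x. - partials [e] f x))))\<^sup>2) \<partial>M) \<le> ennreal ep"
proof -
 define \<rho> where "\<rho> = (\<lambda>x. - partials [e] f x)"
 have "(\<lambda>x. (- 1) * partials [e] f x) \<in> test_functions V"
  by (rule test_functions_cmult[OF test_functions_partials[OF f]]) (use e in simp)
 then have \<rho>: "\<rho> \<in> test_functions U" using test_functions_mono[OF V(2)] by (simp add: \<rho>_def del: partials.simps)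
 obtain S0 k where S0: "off_diagonal S0" "fst ` S0 \<union> snd ` S0 \<subseteq> V" and k: "continuous_on UNIV k" "\<And>z. z \<notin> S0 ==> k z = 0"
  and Qk: "Q (\<lambda>z. k z / P z) \<rho> < ep"
  using Q_small[OF f V e ep] unfolding \<rho>_def by blast
 have c: "continuous_on UNIV (\<lambda>z. k z / P z)" by (rule quotient_continuous[OF S0(1) k])
 have z: "k z / P z = 0" if "z \<notin> S0" for z using k(2)[OF that] by simp
 show ?thesis
 proof (rule tensor_approximation[OF S0(1) V S0(2) c z])
  fix S H kp assume S: "off_diagonal S" and H: "\<And>n::nat. tensor V (H n)" "\<And>n z. \<bar>H n z\<bar> \<le> kp" "\<And>n z. z \<notin> S ==> H n z = 0"
   "\<And>z. (\<lambda>n. H n z) \<longlonglongrightarrow> k z / P z"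
  have Hm: "H n \<in> borel_measurable borel" for n by (rule borel_measurable_continuous_onI[OF tensor_continuous[OF H(1)]])
  have "(\<lambda>n. Q (H n) \<rho>) \<longlonglongrightarrow> Q (\<lambda>z. k z / P z) \<rho>" by (rule Q_tendsto[OF S \<rho> Hm H(2-4)])
  from order_tendstoD(2)[OF this Qk] obtain n where n: "Q (H n) \<rho> < ep" by (auto simp: eventually_sequentially)
  obtain Z where Z: "Z \<in> borel_measurable (restriction_algebra M V \<mu>)"
   "(\<integral>\<^sup>+ w. ennreal ((norm (Z w - \<i> * of_real (\<beta> * \<Gamma> w \<rho>)))\<^sup>2) \<partial>M) \<le> ennreal (Q (H n) \<rho>)"
   using chaos_approximation[OF S \<rho> \<mu> H(1)[of n] H(3)] by blast
  have "ennreal (Q (H n) \<rho>) \<le> ennreal ep" using n by (intro ennreal_leI) simp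
  from order_trans[OF Z(2) this] Z(1) show ?thesis unfolding \<rho>_def by blast
 qed
qed

lemma derivative_measurable:
 fixes \<mu> :: "'w => ('a => real) => complex"
 assumes f: "f \<in> test_functions V" and V: "open V" "V \<subseteq> U" and e: "e \<in> Basis" and \<mu>: "imaginary_chaos M U \<phi> \<beta> \<Gamma> \<mu>"
 shows "(\<lambda>w. \<Gamma> w (\<lambda>x. - partials [e] f x)) \<in> borel_measurable (restriction_algebra M V \<mu>)"
proof -
 define \<rho> where "\<rho> = (\<lambda>x. - partials [e] f x)"
 have "(\<lambda>x. (- 1) * partials [e] f x) \<in> test_functions V"
  by (rule test_functions_cmult[OF test_functions_partials[OF f]]) (use e in simp)
 then have \<rho>: "\<rho> \<in> test_functions UNIV" using test_functions_mono[OF subset_UNIV] by (simp add: \<rho>_def del: partials.simps)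
 define X where "X = (\<lambda>w. \<Gamma> w \<rho>)"
 have XM [measurable]: "X \<in> borel_measurable M" unfolding X_def by (rule Gamma_measurable[OF \<rho>])
 define R where "R = restriction_algebra M V \<mu>"
 define G where "G = {(\<lambda>w. \<mu> w h) -` B \<inter> space M | h B. h \<in> test_functions V \<and> B \<in> sets borel} \<union> null_sets M"
 have Gsub: "G \<subseteq> Pow (space M)" unfolding G_def by (auto dest: null_setsD2 sets.sets_into_space)
 have spR: "space R = space M" and setsR: "sets R = sigma_sets (space M) G"
  unfolding R_def restriction_algebra_def G_def[symmetric] using Gsub by (simp_all add: space_measure_of sets_measure_of)
 have nullR: "B \<in> sets R" if "B \<in> null_sets M" for B
  unfolding setsR using that by (intro sigma_sets.Basic) (simp add: G_def)
 have neg: "- real DIM('a) < - real DIM('a) / 2" by simp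
 have rs: "random_sobolev M (- real DIM('a)) \<mu>" using \<mu> neg unfolding imaginary_chaos_def by blast
 have "G \<subseteq> sets M"
 proof
  fix B assume "B \<in> G"
  then consider "B \<in> null_sets M" | h C where "h \<in> test_functions V" "C \<in> sets borel" "B = (\<lambda>w. \<mu> w h) -` C \<inter> space M"
   unfolding G_def by blast
  then show "B \<in> sets M"
  proof cases
   case 2
   have "h \<in> test_functions UNIV" by (rule test_functions_mono[OF _ 2(1)]) simp
   then have "(\<lambda>w. \<mu> w h) \<in> borel_measurable M" using rs by (simp add: random_sobolev_def)
   then show ?thesis unfolding 2(3) using 2(2) by (rule measurable_sets)
  qed auto
 qed
 then have RM: "sets R \<subseteq> sets M" unfolding setsR by (rule sets.sigma_sets_subset)
 have pos: "(1 / 2 :: real) ^ n > 0" for n :: nat by simp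
 have "\<forall>n. \<exists>Z. Z \<in> borel_measurable R \<and> (\<integral>\<^sup>+ w. ennreal ((norm (Z w - \<i> * of_real (\<beta> * X w)))\<^sup>2) \<partial>M) \<le> ennreal ((1 / 2) ^ n)"
  using derivative_approximation[OF f V e \<mu> pos] unfolding R_def X_def \<rho>_def by blast
 then obtain Z where Z: "\<And>n. Z n \<in> borel_measurable R"
  "\<And>n::nat. (\<integral>\<^sup>+ w. ennreal ((norm (Z n w - \<i> * of_real (\<beta> * X w)))\<^sup>2) \<partial>M) \<le> ennreal ((1 / 2) ^ n)" by metis
 have ZM [measurable]: "Z n \<in> borel_measurable M" for n
  using Z(1)[of n] measurable_mono[of borel borel R M] RM spR by auto
 define Df where "Df = (\<lambda>n w. (norm (Z n w - \<i> * of_real (\<beta> * X w)))\<^sup>2)"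
 have Dm: "(\<lambda>w. ennreal (Df n w)) \<in> borel_measurable M" for n unfolding Df_def by measurable
 have "(\<integral>\<^sup>+ w. (\<Sum>n. ennreal (Df n w)) \<partial>M) = (\<Sum>n. \<integral>\<^sup>+ w. ennreal (Df n w) \<partial>M)" by (rule nn_integral_suminf[OF Dm])
 also have "\<dots> \<le> (\<Sum>n. ennreal ((1 / 2) ^ n))" using Z(2) by (intro suminf_le) (auto simp: Df_def)
 also have "\<dots> = ennreal (\<Sum>n. (1 / 2) ^ n)" by (intro suminf_ennreal2) (auto intro: summable_geometric)
 also have "\<dots> < \<infinity>" by simp
 finally have fin: "(\<integral>\<^sup>+ w. (\<Sum>n. ennreal (Df n w)) \<partial>M) \<noteq> \<infinity>" by simp
 have "AE w in M. (\<Sum>n. ennreal (Df n w)) \<noteq> \<infinity>"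
  using Dm fin by (intro nn_integral_PInf_AE borel_measurable_suminf) auto
 then have "AE w in M. (\<lambda>n. Z n w) \<longlonglongrightarrow> \<i> * of_real (\<beta> * X w)"
 proof eventually_elim
  case (elim w)
  have "summable (\<lambda>n. Df n w)" using elim by (intro summable_suminf_not_top) (auto simp: Df_def)
  then have "(\<lambda>n. sqrt (Df n w)) \<longlonglongrightarrow> sqrt 0" by (intro tendsto_real_sqrt summable_LIMSEQ_zero)
  then show ?case by (simp add: Df_def tendsto_norm_zero_iff LIM_zero_iff)
 qed
 then obtain N where N: "{w \<in> space M. \<not> (\<lambda>n. Z n w) \<longlonglongrightarrow> \<i> * of_real (\<beta> * X w)} \<subseteq> N" "N \<in> null_sets M"
  by (rule AE_E) (auto simp: null_sets_def)
 have NR: "N \<in> sets R" by (rule nullR[OF N(2)])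
 define h where "h = (\<lambda>w. indicator (- N) w *\<^sub>R (\<i> * of_real (\<beta> * X w)))"
 have "h \<in> borel_measurable R"
 proof (rule borel_measurable_LIMSEQ_metric)
  have "(\<lambda>w. indicator (space R - N) w :: real) \<in> borel_measurable R" using NR by (intro borel_measurable_indicator) auto
  then have i: "(\<lambda>w. indicator (- N) w :: real) \<in> borel_measurable R"
   by (rule measurable_cong[THEN iffD1, rotated]) (auto simp: indicator_def)
  show "(\<lambda>w. indicator (- N) w *\<^sub>R Z n w) \<in> borel_measurable R" for n by (rule borel_measurable_scaleR[OF i Z(1)])
  show "(\<lambda>n. indicator (- N) w *\<^sub>R Z n w) \<longlonglongrightarrow> h w" if "w \<in> space R" for w
  proof (cases "w \<in> N")
   case False
   then have "(\<lambda>n. Z n w) \<longlonglongrightarrow> \<i> * of_real (\<beta> * X w)" using N(1) that spR by auto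
   then show ?thesis unfolding h_def by (intro tendsto_scaleR tendsto_const)
  qed (simp add: h_def)
 qed
 from borel_measurable_continuous_on[OF linear_continuous_on[OF bounded_linear_Im] this]
 have X': "(\<lambda>w. Im (h w) / \<beta>) \<in> borel_measurable R" by simp
 have hX: "Im (h w) / \<beta> = X w" if "w \<notin> N" for w using that beta(1) by (simp add: h_def)
 have "X \<in> borel_measurable R"
 proof (rule measurableI)
  fix B :: "real set" assume B: "B \<in> sets borel"
  have "X -` B \<inter> N \<in> null_sets M"
  proof (rule null_sets_subset[OF N(2)])
   have "X -` B \<inter> N = (X -` B \<inter> space M) \<inter> N" using sets.sets_into_space[OF null_setsD2[OF N(2)]] by auto
   then show "X -` B \<inter> N \<in> sets M" using measurable_sets[OF XM B] null_setsD2[OF N(2)] by simp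
  qed auto
  then have "X -` B \<inter> N \<in> sets R" by (rule nullR)
  moreover have "(\<lambda>w. Im (h w) / \<beta>) -` B \<inter> space R \<in> sets R" by (rule measurable_sets[OF X' B])
  moreover have "X -` B \<inter> space R = (((\<lambda>w. Im (h w) / \<beta>) -` B \<inter> space R) - N) \<union> (X -` B \<inter> N)"
   using hX sets.sets_into_space[OF NR] by auto
  ultimately show "X -` B \<inter> space R \<in> sets R" using NR by auto
 qed simp
 then show ?thesis unfolding X_def \<rho>_def R_def .
qed

end

theorem theorem1:
  fixes M :: "'w measure"
    and U :: "(real ^ 'n) set"
    and g :: "(real ^ 'n) \<times> (real ^ 'n) \<Rightarrow> real"
    and \<Gamma> :: "'w \<Rightarrow> (real ^ 'n \<Rightarrow> real) \<Rightarrow> real"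
    and \<mu> :: "'w \<Rightarrow> (real ^ 'n \<Rightarrow> real) \<Rightarrow> complex"
    and \<phi> :: "real ^ 'n \<Rightarrow> real"
    and \<beta> :: real
  assumes "prob_space M"
    and "CARD('n) \<ge> 2"
    and "bounded U" and "open U" and "simply_connected U"
    and "Ck_on 2 (U \<times> U) g"
    and "set_integrable lborel (U \<times> U) g"
    and "\<exists>B. \<forall>z \<in> U \<times> U. g z \<le> B"
    and "gaussian_field M U (\<lambda>x y. ln (1 / norm (x - y)) + g (x, y)) \<Gamma>"
    and "0 < \<beta>" and "\<beta> < sqrt (real CARD('n))"
    and "annular_mollifier \<phi>"
    and "imaginary_chaos M U \<phi> \<beta> \<Gamma> \<mu>"
  shows "\<forall>f \<in> test_functions U. \<forall>k. \<forall>V. open V \<and> V \<subseteq> U \<and> supp f \<subseteq> V \<longrightarrow>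
           (\<lambda>w. distr_deriv (axis k 1) (\<Gamma> w) f) \<in> borel_measurable (restriction_algebra M V \<mu>)"
proof (intro ballI allI impI)
  fix f :: "real ^ 'n \<Rightarrow> real" and k :: 'n and V
  assume f: "f \<in> test_functions U" and V: "open V \<and> V \<subseteq> U \<and> supp f \<subseteq> V"
  have "\<beta>\<^sup>2 < (sqrt (real CARD('n)))\<^sup>2" using assms(10,11) by (intro power_strict_mono) auto
  then have \<beta>: "\<beta>\<^sup>2 < real CARD('n)" by simp
  interpret log_field M U g \<Gamma> \<phi> \<beta>
    using assms \<beta> by (intro log_field.intro log_field_axioms.intro) auto
  let ?e = "axis k 1 :: real ^ 'n"
  have e: "?e \<in> Basis" by (simp add: axis_in_Basis_iff)
  have fV: "f \<in> test_functions V" using f V by (simp add: test_functions_iff)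
  have p: "partials [?e] f \<in> test_functions UNIV"
    by (rule test_functions_mono[OF subset_UNIV test_functions_partials[OF f]]) (use e in simp)
  have "distr_deriv ?e (\<Gamma> w) f = \<Gamma> w (\<lambda>x. - partials [?e] f x)" if "w \<in> space (restriction_algebra M V \<mu>)" for w
  proof -
    have "w \<in> space M" using that by (auto simp: restriction_algebra_def space_measure_of_conv)
    from Gamma_lincomb[OF this p p, of "- 1" 0] show ?thesis by (simp add: distr_deriv_def)
  qed
  then show "(\<lambda>w. distr_deriv ?e (\<Gamma> w) f) \<in> borel_measurable (restriction_algebra M V \<mu>)"
    using derivative_measurable[OF fV _ _ e assms(13)] V by (subst measurable_cong) auto
qed

end
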